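(* Let $(k,l)$ be an exponent pair such that $4k-2l+1>0$, and let $\gamma\in(0,1)$ and $\delta$ with $0\le\delta\le1-\gamma$ satisfy $$ \frac{12k-2l+13}{-2l+3}(1-\gamma)+\frac{20k-4l+16}{-2l+3}\delta<1 \quad\text{and}\quad \frac{15}{2}(1-\gamma)+9\delta<1. $$ Then for every sufficiently small $\varepsilon>0$ the following holds: for all sufficiently large $x$, all $H$ with $1\le H\le x^{1-\gamma+\delta+\varepsilon}$, all $0\le u\le1$ and all $\alpha\in\mathbb{R}$, $$ \min\Big\{1,\frac{x^{1-\gamma}}{H}\Big\}\sum_{h\sim H}\Big|\sum_{n\sim x}\Lambda(n)\,\mathbf{e}\big(\alpha n+h(n+u)^\gamma\big)\Big|\ll x^{1-\delta-\varepsilon}. $$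
   Context: $\Lambda$ is the von Mangoldt function and $\mathbf{e}(t)=e^{2\pi i t}$. The notation $n\sim X$ means $n$ runs over integers in a subinterval of $(X,2X]$. An exponent pair $(k,l)$ (with $0\le k\le\frac12\le l\le1$) is in the sense of van der Corput's method (Graham–Kolesnik, "Van der Corput's Method of Exponential Sums", p. 30): roughly, for $I\subset(N,2N]$ and smooth $f$ with $|f^{(r)}(t)|\asymp FN^{-r}$ (in the precise form of that definition), $\sum_{n\in I}\mathbf{e}(f(n))\ll (F/N)^kN^l+N/F$. Implied constants may depend on $\gamma,\delta,\varepsilon,k,l$ but not on $\alpha,u,H$. *)

theory Defs
  imports "HOL-Analysis.Analysis" "HOL-Number_Theory.Prime_Powers"
begin

definition expi :: "real \<Rightarrow> complex" where
  "expi t = exp (2 * of_real pi * \<i> * of_real t)"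

text \<open>
  The class \<open>F(N, P, s, y, \<epsilon>)\<close> of Graham and Kolesnik, for functions on \<open>[a, b] \<subseteq> [N, 2N]\<close>:
  up to relative error \<open>\<epsilon>\<close>, the derivatives of \<open>f\<close> of orders 1 to \<open>P\<close> are those of a
  primitive of \<open>t \<mapsto> y t\<^sup>-\<^sup>s\<close>. Here \<open>D p\<close> is the \<open>p\<close>-th derivative of \<open>f\<close> on \<open>[a, b]\<close>,
  one-sided at the end points; it is unique there since \<open>a < b\<close>.
\<close>
definition phase_class ::
  "real \<Rightarrow> nat \<Rightarrow> real \<Rightarrow> real \<Rightarrow> real \<Rightarrow> real \<Rightarrow> real \<Rightarrow> (real \<Rightarrow> real) \<Rightarrow> bool" where
  "phase_class N P s y \<epsilon> a b f \<longleftrightarrow>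
     N \<le> a \<and> a < b \<and> b \<le> 2 * N \<and>
     (\<exists>D. D 0 = f \<and>
       (\<forall>p<P. \<forall>t\<in>{a..b}. (D p has_real_derivative D (Suc p) t) (at t within {a..b})) \<and>
       continuous_on {a..b} (D P) \<and>
       (\<forall>p<P. \<forall>t\<in>{a..b}.
         \<bar>D (Suc p) t - (-1) ^ p * pochhammer s p * y * t powr (- s - real p)\<bar>
           < \<epsilon> * pochhammer s p * y * t powr (- s - real p)))"

text \<open>
  With \<open>F = y N\<^sup>1\<^sup>-\<^sup>s\<close>, the bound reads \<open>(F/N)\<^sup>k N\<^sup>l + N/F\<close>. The parameters \<open>P\<close>, \<open>\<epsilon>\<close> and the
  implied constant \<open>C\<close> depend only on \<open>k\<close>, \<open>l\<close> and \<open>s\<close>.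
\<close>
definition exponent_pair :: "real \<Rightarrow> real \<Rightarrow> bool" where
  "exponent_pair k l \<longleftrightarrow>
     0 \<le> k \<and> k \<le> 1/2 \<and> 1/2 \<le> l \<and> l \<le> 1 \<and>
     (\<forall>s>0. \<exists>P \<epsilon> C. 0 < \<epsilon> \<and> \<epsilon> < 1/2 \<and>
       (\<forall>N>0. \<forall>y>0. \<forall>a b f. phase_class N P s y \<epsilon> a b f \<longrightarrow>
         norm (\<Sum>n::nat | a < real n \<and> real n \<le> b. expi (f (real n)))
           \<le> C * ((y * N powr (- s)) powr k * N powr l + N powr s / y)))"

text \<open>
  A sum over \<open>n \<sim> X\<close> ranges over the integers in some interval \<open>I\<close> with \<open>dyadic_subinterval X I\<close>;
  a bound for such a sum is meant uniformly in \<open>I\<close>. The interval may be open, closed, half-open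
  or empty.
\<close>
definition dyadic_subinterval :: "real \<Rightarrow> real set \<Rightarrow> bool" where
  "dyadic_subinterval X I \<longleftrightarrow> is_interval I \<and> I \<subseteq> {X<..2 * X}"

end

theory Submission
  imports Defs "HOL-Complex_Analysis.Complex_Analysis" "HOL-Real_Asymp.Real_Asymp" "HOL-Computational_Algebra.Squarefree"
begin

text \<open>
  Heath-Brown's identity, a divisor bound and a dyadic decomposition reduce the sum over primes to sums over
  products of at most six variables. If some subproduct has size \<open>N\<close> with \<open>a + 2\<delta> \<le> log\<^sub>x N \<le> 1 - 5a - 6\<delta>\<close>, where
  \<open>a = 1 - \<gamma>\<close>, then Cauchy's inequality, counting near-coincidences of \<open>h n\<^sup>\<gamma>\<close>, and the second derivative test
  suffice. By \<open>15a/2 + 9\<delta> < 1\<close>, otherwise one smooth variable exceeds roughly \<open>x\<^bsup>(1 - a - 2\<delta>)/2\<^esup>\<close>. If the product of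
  the others is short, the second derivative test applies. If not, differencing in the smooth variable with step
  \<open>q\<close> leaves double sums with phase \<open>h m\<^sup>\<gamma> ((n + q)\<^sup>\<gamma> - n\<^sup>\<gamma>)\<close>; Poisson summation in \<open>m\<close> turns them
  into integrals over \<open>w\<close> of sums over \<open>n\<close> with phase \<open>G n * \<phi> w\<close>, where the exponent pair is used.
\<close>

section \<open>Exponential sums\<close>

text \<open>Since min {1, x^a / H} H = min {H, x^a}, each range has to save a factor min {H, x^a}
  x^\<delta> over the trivial bound, up to powers of x^\<epsilon>. In the bilinear estimate this
  saving costs x^(a + 2\<delta>) in one variable (enough pairs (h, n) to fill the classes of
  Cauchy's inequality) and x^(5a + 6\<delta>) in the other (enough terms for the second derivative
  test). The condition 15a/2 + 9\<delta> < 1 is 1 - 5a - 6\<delta> > 1/3 in disguise: the Moebius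
  variables of Heath-Brown's identity of order three, of size about x^(1/3), then stay below the
  upper end of the window. The first hypothesis is, up to a factor four, the inequality between
  exponents that the exponent pair estimate requires at the shortest smooth variable; 4k - 2l + 1 >
  0 makes that the worst case. Rescaling t = G n * w avoids asymptotic stationary phase expansions:
  the sum over n stays inside the integral, and exponent pairs act for fixed w. All bounds are
  uniform in \<alpha>, so the additive characters that detect n in I can be absorbed into
  \<alpha>.\<close>

lemma expi_cis: "expi t = cis (2 * pi * t)" by (simp add: expi_def cis_conv_exp mult_ac)

lemma norm_expi [simp]: "norm (expi t) = 1" by (simp add: expi_cis)

lemma expi_add: "expi (s + t) = expi s * expi t" by (simp add: expi_cis cis_mult distrib_left)

lemma expi_minus: "expi (- t) = cnj (expi t)" by (simp add: expi_cis cis_cnj)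

lemma expi_0 [simp]: "expi 0 = 1" by (simp add: expi_cis)

lemma expi_of_int [simp]: "expi (of_int k) = 1" using cis_multiple_2pi[of "of_int k"] by (simp add: expi_cis)

lemma expi_diff: "expi (s - t) = expi s * cnj (expi t)" using expi_add[of s "- t"] by (simp add: expi_minus)

lemma norm_expi_minus_1: "norm (expi t - 1) = 2 * \<bar>sin (pi * t)\<bar>" using dist_exp_i_1[of "2 * pi * t"] by (simp add: expi_def mult_ac)

lemma norm_expi_diff_le: "norm (expi s - expi t) \<le> 2 * pi * \<bar>s - t\<bar>"
proof -
  have "expi s - expi t = expi t * (expi (s - t) - 1)" using expi_add[of t "s - t"] by (simp add: algebra_simps)
  then have "norm (expi s - expi t) = 2 * \<bar>sin (pi * (s - t))\<bar>" by (simp only: norm_mult norm_expi norm_expi_minus_1 mult_1)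
  also have "\<dots> \<le> 2 * \<bar>pi * (s - t)\<bar>" using abs_sin_x_le_abs_x[of "pi * (s - t)"] by linarith
  finally show ?thesis by (simp add: abs_mult)
qed

lemma norm_sum_expi_minus: "norm (\<Sum>n\<in>A. expi (- f n)) = norm (\<Sum>n\<in>A. expi (f n))"
proof -
  have "(\<Sum>n\<in>A. expi (- f n)) = cnj (\<Sum>n\<in>A. expi (f n))" by (simp add: expi_minus)
  then show ?thesis by (metis complex_mod_cnj)
qed

lemma norm_sum_expi_le: "norm (\<Sum>n\<in>A. expi (f n)) \<le> card A" using sum_norm_le[of A "\<lambda>n. expi (f n)" "\<lambda>_. 1"] by simp

text \<open>A weak form of Jordan's inequality. Up to pi/3 the mean value theorem gives slope at
  least 1/2; beyond, monotonicity gives \<open>sin y\<close> at least sqrt 3 / 2 > 0.85 - 0.01, in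
  fact at least 0.85, while y / 2 is at most 0.85.\<close>

lemma sin_ge_half:
  assumes "0 \<le> y" "y \<le> pi / 2"
  shows "y / 2 \<le> sin y"
proof (cases "y \<le> pi / 3")
  case True
  show ?thesis
  proof (cases "y = 0")
    case False
    with assms have "0 < y" by simp
    then obtain z where z: "0 < z" "z < y" "sin y - sin 0 = (y - 0) * cos z" using MVT2[of 0 y sin cos] by (auto intro: DERIV_sin)
    have "cos (pi / 3) \<le> cos z" using z True by (intro cos_monotone_0_pi_le) auto
    then have "1 / 2 \<le> cos z" by (simp add: cos_60)
    then have "y * (1 / 2) \<le> y * cos z" using \<open>0 < y\<close> by (intro mult_left_mono) auto
    then show ?thesis using z by simp
  qed simp
next
  case False
  have "sin (pi / 3) \<le> sin y" using False assms by (intro sin_monotone_2pi_le) auto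
  then have "sqrt 3 / 2 \<le> sin y" by (simp add: sin_60)
  moreover have "1.7 \<le> sqrt 3" by (rule real_le_rsqrt) (simp add: power2_eq_square)
  moreover have "pi \<le> 3.3" using pi_approx(2) by simp
  then have "y \<le> 1.7" using assms by simp
  ultimately show ?thesis by linarith
qed

text \<open>The sine dominates the distance from \<open>d\<close> to the nearest integer; the
  reflection of \<open>d\<close> to \<open>1 - d\<close> reduces to \<open>d\<close> at most 1/2,
  where \<open>sin_ge_half\<close> and pi > 2 suffice.\<close>

lemma sin_pi_ge:
  assumes "0 < \<theta>" "\<theta> \<le> d" "d \<le> 1 - \<theta>"
  shows "\<theta> \<le> sin (pi * d)"
proof -
  have "\<theta> \<le> sin (pi * d)" if "\<theta> \<le> d" "d \<le> 1 / 2" for d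
  proof -
    have "pi * d / 2 \<le> sin (pi * d)" using that assms by (intro sin_ge_half) auto
    moreover have "2 * d \<le> pi * d" using that assms pi_gt3 by (intro mult_right_mono) auto
    ultimately show ?thesis using that by linarith
  qed
  from this[of d] this[of "1 - d"] assms show ?thesis by (cases "d \<le> 1 / 2") (auto simp: sin_diff right_diff_distrib)
qed

section \<open>Integer intervals and partial summation\<close>

lemma convex_nat_set:
  fixes S :: "nat set"
  assumes "finite S" "\<And>a b c. \<lbrakk>a \<in> S; b \<in> S; a \<le> c; c \<le> b\<rbrakk> \<Longrightarrow> c \<in> S"
  shows "\<exists>p q. p \<le> q \<and> S = {p..<q}"
proof (cases "S = {}")
  case True
  then show ?thesis by (intro exI[of _ 0]) auto
next
  case False
  have "S = {Min S..<Suc (Max S)}"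
  proof (intro equalityI subsetI)
    fix x assume "x \<in> S"
    then show "x \<in> {Min S..<Suc (Max S)}" using assms(1) by (simp add: less_Suc_eq_le)
  next
    fix x assume "x \<in> {Min S..<Suc (Max S)}"
    then show "x \<in> S" using assms(2)[OF Min_in[OF assms(1) False] Max_in[OF assms(1) False]] by simp
  qed
  moreover have "Min S \<le> Suc (Max S)" using False assms(1) Min_le Max_in by (metis le_SucI)
  ultimately show ?thesis by blast
qed

text \<open>Level sets of monotone sequences are order-convex, so this turns them into ranges of
  summation. The bound \<open>max p q\<close>, together with r = s = p for an empty set, keeps the
  conclusion valid when p > q.\<close>

lemma convex_nat_subset:
  fixes S :: "nat set"
  assumes "S \<subseteq> {p..<q}" "\<And>a b c. \<lbrakk>a \<in> S; b \<in> S; a \<le> c; c \<le> b\<rbrakk> \<Longrightarrow> c \<in> S"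
  shows "\<exists>r s. p \<le> r \<and> r \<le> s \<and> s \<le> max p q \<and> S = {r..<s}"
proof -
  have "finite S" using assms(1) finite_subset by blast
  then obtain r s where rs: "r \<le> s" "S = {r..<s}" using convex_nat_set assms(2) by metis
  show ?thesis
  proof (cases "r = s")
    case True then show ?thesis using rs by (intro exI[of _ p]) auto
  next
    case False
    then have "r \<in> S" "s - 1 \<in> S" using rs by auto
    then have "p \<le> r" "s \<le> q" using assms(1) by force+
    then show ?thesis using rs by (intro exI[of _ r] exI[of _ s]) auto
  qed
qed

lemma summation_by_parts:
  fixes z :: "nat \<Rightarrow> complex" and c :: "nat \<Rightarrow> real"
  assumes "p \<le> q"
  shows "(\<Sum>n\<in>{p..<q}. c n * z n)
    = c q * sum z {p..<q} + (\<Sum>n\<in>{p..<q}. (c n - c (Suc n)) * sum z {p..<Suc n})" using assms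
proof (induction q rule: dec_induct)
  case (step q)
  then show ?case by (simp add: algebra_simps)
qed simp

lemma abel_antimono:
  fixes z :: "nat \<Rightarrow> complex" and c :: "nat \<Rightarrow> real"
  assumes mono: "\<And>m n. \<lbrakk>p \<le> m; m \<le> n; n < q\<rbrakk> \<Longrightarrow> c n \<le> c m"
    and c: "\<And>n. p \<le> n \<Longrightarrow> n < q \<Longrightarrow> 0 \<le> c n \<and> c n \<le> V"
    and B: "\<And>r. p \<le> r \<Longrightarrow> r \<le> q \<Longrightarrow> norm (sum z {p..<r}) \<le> B" and "0 \<le> V" "0 \<le> B"
  shows "norm (\<Sum>n\<in>{p..<q}. c n * z n) \<le> V * B"
proof (cases "p < q")
  case True
  \<comment> \<open>Cutting \<open>c\<close> off to 0 at \<open>q\<close> removes the boundary term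
    of the summation by parts; the differences are nonnegative and telescope to
    \<open>c p\<close>.\<close>
  define d where "d n = (if n < q then c n else 0)" for n
  have "norm (\<Sum>n\<in>{p..<q}. c n * z n) = norm (\<Sum>n\<in>{p..<q}. (d n - d (Suc n)) * sum z {p..<Suc n})" using summation_by_parts[of p q d z] True by (simp add: d_def)
  also have "\<dots> \<le> (\<Sum>n\<in>{p..<q}. (d n - d (Suc n)) * B)"
  proof (rule sum_norm_le)
    fix n assume n: "n \<in> {p..<q}"
    then have *: "0 \<le> d n - d (Suc n)" using mono[of n "Suc n"] c[of n] by (auto simp: d_def)
    have "norm ((complex_of_real (d n) - d (Suc n)) * sum z {p..<Suc n})
        = (d n - d (Suc n)) * norm (sum z {p..<Suc n})" unfolding norm_mult of_real_diff[symmetric] norm_of_real using * by simp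
    also have "\<dots> \<le> (d n - d (Suc n)) * B" using n B[of "Suc n"] * by (intro mult_left_mono) auto
    finally show "norm ((d n - d (Suc n)) * sum z {p..<Suc n}) \<le> (d n - d (Suc n)) * B" unfolding of_real_diff .
  qed
  also have "\<dots> = (d p - d q) * B"
  proof -
    have "(\<Sum>n\<in>{p..<q}. d n - d (Suc n)) = - (\<Sum>n\<in>{p..<q}. d (Suc n) - d n)" by (simp add: sum_negf[symmetric])
    then show ?thesis using sum_Suc_diff'[of p q d] True by (simp add: sum_distrib_right[symmetric])
  qed
  also have "\<dots> \<le> V * B" using c[of p] True B[of p] by (intro mult_right_mono) (auto simp: d_def)
  finally show ?thesis .
next
  case False
  then show ?thesis using assms by simp
qed

text \<open>Either direction of monotonicity reduces to the nonnegative decreasing case by passing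
  to \<open>s * c n + V\<close> with s = 1 or s = -1, which lies in [0, 2V]. Taking the constant off
  again costs one more \<open>V * B\<close>, whence the factor 3.\<close>

lemma abel_bound:
  fixes z :: "nat \<Rightarrow> complex" and c :: "nat \<Rightarrow> real"
  assumes mono: "(\<forall>m n. p \<le> m \<longrightarrow> m \<le> n \<longrightarrow> n < q \<longrightarrow> c n \<le> c m)
      \<or> (\<forall>m n. p \<le> m \<longrightarrow> m \<le> n \<longrightarrow> n < q \<longrightarrow> c m \<le> c n)"
    and c: "\<And>n. p \<le> n \<Longrightarrow> n < q \<Longrightarrow> \<bar>c n\<bar> \<le> V"
    and B: "\<And>r. p \<le> r \<Longrightarrow> r \<le> q \<Longrightarrow> norm (sum z {p..<r}) \<le> B" and "0 \<le> V"
    and "0 \<le> B"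
  shows "norm (\<Sum>n\<in>{p..<q}. c n * z n) \<le> 3 * V * B"
proof (cases "p \<le> q")
  case True
  define s :: real where "s = (if \<forall>m n. p \<le> m \<longrightarrow> m \<le> n \<longrightarrow> n < q \<longrightarrow> c n \<le> c m then 1 else -1)"
  define d where "d n = s * c n + V" for n
  have 1: "norm (\<Sum>n\<in>{p..<q}. d n * z n) \<le> (2 * V) * B"
  proof (rule abel_antimono)
    show "0 \<le> d n \<and> d n \<le> 2 * V" if "p \<le> n" "n < q" for n using c[OF that] by (auto simp: d_def s_def)
    show "d n \<le> d m" if "p \<le> m" "m \<le> n" "n < q" for m n using mono that by (auto simp: d_def s_def)
  qed (use B assms in auto)
  have "s = 1 \<or> s = -1" by (simp add: s_def)
  then have eq: "complex_of_real (c n) = complex_of_real s * complex_of_real (d n) - complex_of_real s * complex_of_real V" for n by (auto simp: d_def)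
  have "(\<Sum>n\<in>{p..<q}. c n * z n) = s * (\<Sum>n\<in>{p..<q}. d n * z n) - s * V * sum z {p..<q}"
    unfolding eq by (simp add: sum_distrib_left left_diff_distrib sum_subtractf mult.assoc)
  then have "norm (\<Sum>n\<in>{p..<q}. c n * z n)
     \<le> norm (s * (\<Sum>n\<in>{p..<q}. d n * z n)) + norm (s * V * sum z {p..<q})" by (metis norm_triangle_ineq4)
  also have "norm (complex_of_real s) = 1" by (simp add: s_def)
  then have "norm (s * (\<Sum>n\<in>{p..<q}. d n * z n)) + norm (s * V * sum z {p..<q})
     = norm (\<Sum>n\<in>{p..<q}. d n * z n) + V * norm (sum z {p..<q})" using assms by (simp add: norm_mult)
  also have "\<dots> \<le> 2 * V * B + V * B" using 1 B[of q] assms True by (intro add_mono mult_left_mono) auto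
  finally show ?thesis by (simp add: algebra_simps)
qed (use assms in auto)

section \<open>The Kusmin-Landau inequality and van der Corput's second derivative test\<close>

lemma cot_antimono:
  assumes "0 < x" "x \<le> y" "y < pi"
  shows "cot y \<le> cot x"
proof -
  have "sin x > 0" "sin y > 0" using assms by (auto intro!: sin_gt_zero)
  moreover have "0 \<le> sin (y - x)" using assms by (intro sin_ge_zero) auto
  ultimately show ?thesis by (simp add: cot_def divide_simps sin_diff algebra_simps)
qed

text \<open>The increments avoid the integers by \<open>\<theta>\<close>, so 1 / (expi d - 1) exists
  and equals -1/2 - (\<i>/2) cot (pi d). Multiplied by a difference of consecutive terms this
  recovers the term itself: the constant part telescopes, while the cotangent is monotone along the
  sequence and at most 1/\<theta>, so that partial summation applies.\<close>

lemma kusmin_landau: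
  fixes f :: "nat \<Rightarrow> real" and k :: int and \<theta> :: real
  assumes "0 < \<theta>" "\<theta> \<le> 1/2"
    and \<Delta>: "\<And>n. p \<le> n \<Longrightarrow> n < q \<Longrightarrow> k + \<theta> \<le> f (Suc n) - f n \<and> f (Suc n) - f n \<le> k + 1 - \<theta>"
    and mono: "\<And>m n. \<lbrakk>p \<le> m; m \<le> n; n < q\<rbrakk> \<Longrightarrow> f (Suc m) - f m \<le> f (Suc n) - f n"
  shows "norm (\<Sum>n\<in>{p..<q}. expi (f n)) \<le> 7 / \<theta>"
proof (cases "p \<le> q")
  case True
  \<comment> \<open>Subtracting k * n from the phase leaves every term unchanged, since it is an
    integer, and moves the increments into [\<theta>, 1 - \<theta>].\<close>
  define d where "d n = f (Suc n) - f n - k" for n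
  define E where "E n = expi (f n - k * n)" for n
  have E: "expi (f n) = E n" for n
  proof -
    have "expi (f n) = expi (of_int (k * int n) + (f n - k * n))" by simp
    also have "\<dots> = expi (of_int (k * int n)) * E n" unfolding expi_add E_def ..
    finally show ?thesis by (simp only: expi_of_int mult_1)
  qed
  have d: "\<theta> \<le> d n" "d n \<le> 1 - \<theta>" if "p \<le> n" "n < q" for n using \<Delta>[OF that] by (auto simp: d_def)
  have step: "E n = - (1/2) * (E (Suc n) - E n) - \<i>/2 * (cot (pi * d n) * (E (Suc n) - E n))"
    if n: "p \<le> n" "n < q" for n
  proof -
    have s: "sin (pi * d n) > 0" using sin_pi_ge[OF assms(1) d[OF n]] assms(1) by linarith
    have "E (Suc n) = E n * expi (d n)" unfolding E_def d_def expi_add[symmetric] by (simp add: algebra_simps)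
    then have "E (Suc n) - E n = E n * (expi (d n) - 1)" by (simp add: algebra_simps)
    also have "expi (d n) = cis (2 * (pi * d n))" by (simp add: expi_cis mult_ac)
    also have "\<dots> = Complex (1 - 2 * (sin (pi * d n))\<^sup>2) (2 * sin (pi * d n) * cos (pi * d n))" unfolding cis.ctr cos_double_sin sin_double ..
    finally have 1: "E (Suc n) - E n
       = E n * (Complex (1 - 2 * (sin (pi * d n))\<^sup>2) (2 * sin (pi * d n) * cos (pi * d n)) - 1)" .
    have 2: "(- (1/2) - \<i>/2 * cot (pi * d n)) *
        (Complex (1 - 2 * (sin (pi * d n))\<^sup>2) (2 * sin (pi * d n) * cos (pi * d n)) - 1) = 1"
    proof -
      define a b where "a = sin (pi * d n)" and "b = cos (pi * d n)"
      have "a > 0" "2 * a = 2 * a * (a * a + b * b)" using s sin_cos_squared_add[of "pi * d n"] by (simp_all add: a_def b_def power2_eq_square)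
      then show ?thesis unfolding cot_def a_def[symmetric] b_def[symmetric] by (simp add: complex_eq_iff field_simps power2_eq_square)
    qed
    have "- (1/2) * (E (Suc n) - E n) - \<i>/2 * (cot (pi * d n) * (E (Suc n) - E n))
      = (- (1/2) - \<i>/2 * cot (pi * d n)) * (E (Suc n) - E n)" by (simp only: left_diff_distrib mult.assoc)
    also have "\<dots> = E n * ((- (1/2) - \<i>/2 * cot (pi * d n)) *
        (Complex (1 - 2 * (sin (pi * d n))\<^sup>2) (2 * sin (pi * d n) * cos (pi * d n)) - 1))" unfolding 1 by (simp only: mult_ac)
    finally show ?thesis using 2 by simp
  qed
  have tele: "norm (\<Sum>n\<in>{p..<r}. E (Suc n) - E n) \<le> 2" if "p \<le> r" for r
  proof -
    have "(\<Sum>n\<in>{p..<r}. E (Suc n) - E n) = E r - E p" using sum_Suc_diff'[OF that] .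
    also have "norm \<dots> \<le> norm (E r) + norm (E p)" by (rule norm_triangle_ineq4)
    finally show ?thesis by (simp add: E_def)
  qed
  have ab: "norm (\<Sum>n\<in>{p..<q}. cot (pi * d n) * (E (Suc n) - E n)) \<le> 3 * (1 / \<theta>) * 2"
  proof (rule abel_bound)
    have "cot (pi * d n) \<le> cot (pi * d m)" if "p \<le> m" "m \<le> n" "n < q" for m n
    proof (rule cot_antimono)
      show "0 < pi * d m" using d(1)[of m] that assms(1) by simp
      show "pi * d m \<le> pi * d n" using mono[OF that] by (simp add: d_def)
      show "pi * d n < pi" using d(2)[of n] that assms(1) by simp
    qed
    then show "(\<forall>m n. p \<le> m \<longrightarrow> m \<le> n \<longrightarrow> n < q \<longrightarrow> cot (pi * d n) \<le> cot (pi * d m))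
      \<or> (\<forall>m n. p \<le> m \<longrightarrow> m \<le> n \<longrightarrow> n < q \<longrightarrow> cot (pi * d m) \<le> cot (pi * d n))" by blast
    show "\<bar>cot (pi * d n)\<bar> \<le> 1 / \<theta>" if "p \<le> n" "n < q" for n
    proof -
      have s: "\<theta> \<le> sin (pi * d n)" using sin_pi_ge[OF assms(1) d[OF that]] .
      have "\<bar>cot (pi * d n)\<bar> = \<bar>cos (pi * d n)\<bar> / sin (pi * d n)" using s assms(1) by (simp add: cot_def)
      also have "\<dots> \<le> 1 / \<theta>" using s assms(1) by (intro frac_le) auto
      finally show ?thesis .
    qed
  qed (use assms tele in auto)
  have "(\<Sum>n\<in>{p..<q}. expi (f n)) = (\<Sum>n\<in>{p..<q}. - (1/2) * (E (Suc n) - E n)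
     - \<i>/2 * (cot (pi * d n) * (E (Suc n) - E n)))" unfolding E by (intro sum.cong step) auto
  also have "\<dots> = - (1/2) * (\<Sum>n\<in>{p..<q}. E (Suc n) - E n)
     - \<i>/2 * (\<Sum>n\<in>{p..<q}. cot (pi * d n) * (E (Suc n) - E n))" by (subst sum_subtractf) (simp only: sum_distrib_left)
  also have "norm \<dots> \<le> norm (- (1/2) * (\<Sum>n\<in>{p..<q}. E (Suc n) - E n))
     + norm (\<i>/2 * (\<Sum>n\<in>{p..<q}. cot (pi * d n) * (E (Suc n) - E n)))" by (rule norm_triangle_ineq4)
  also have "\<dots> \<le> 1 + 3 / \<theta>" using tele[OF True] ab by (simp add: norm_mult)
  also have "\<dots> \<le> 7 / \<theta>" using assms by (simp add: field_simps)
  finally show ?thesis .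
qed (use assms in auto)

text \<open>The second derivative test for sequences. The increments of \<open>f\<close> grow by at
  least \<open>\<mu>\<close> per step, so few of them are close to a given integer; away from the
  integers \<open>kusmin_landau\<close> applies. The increments meet at most C * \<mu> * (q - p) + 2
  unit intervals, and each contributes a multiple of 1 / sqrt \<mu>.\<close>

lemma second_difference_test:
  fixes f :: "nat \<Rightarrow> real"
  assumes "0 < \<mu>" "1 \<le> C" "p \<le> q"
    and D: "\<And>n. p \<le> n \<Longrightarrow> n < q \<Longrightarrow> \<mu> \<le> f (n + 2) - 2 * f (n + 1) + f n
        \<and> f (n + 2) - 2 * f (n + 1) + f n \<le> C * \<mu>"
  shows "norm (\<Sum>n\<in>{p..<q}. expi (f n)) \<le> 13 * C * (real q - real p) * sqrt \<mu> + 26 / sqrt \<mu>"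
proof (cases "\<mu> > 1/4")
  case True
  then have "sqrt (1/4) \<le> sqrt \<mu>" by (subst real_sqrt_le_iff) simp
  then have "1/2 \<le> sqrt \<mu>" by (simp add: real_sqrt_divide)
  then have "1 * 1 \<le> (13 * C) * sqrt \<mu>" using mult_mono[of 2 "13 * C" "1/2" "sqrt \<mu>"] assms by simp
  then have "(real q - real p) * 1 \<le> (real q - real p) * ((13 * C) * sqrt \<mu>)" using assms by (intro mult_left_mono) auto
  then have "real q - real p \<le> 13 * C * (real q - real p) * sqrt \<mu>" by (simp only: mult_1_right mult_1_left mult_ac)
  moreover have "norm (\<Sum>n\<in>{p..<q}. expi (f n)) \<le> real q - real p" using norm_sum_expi_le[of f "{p..<q}"] assms by (simp add: of_nat_diff)
  moreover have "0 \<le> 26 / sqrt \<mu>" using assms by simp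
  ultimately show ?thesis by linarith
next
  case False
  \<comment> \<open>The threshold balances the trivial bound near an integer, about \<theta> / \<mu>
    terms, against the bound 7 / \<theta> away from integers. The case \<mu> > 1/4, where the
    trivial estimate wins, has been excluded so that \<theta> is at most 1/2.\<close>
  define \<theta> where "\<theta> = sqrt \<mu>"
  have \<theta>: "0 < \<theta>" "\<theta> * \<theta> = \<mu>" using assms by (auto simp: \<theta>_def)
  have "\<theta> \<le> sqrt (1/4)" unfolding \<theta>_def using False by (subst real_sqrt_le_iff) simp
  then have \<theta>h: "\<theta> \<le> 1/2" by (simp add: real_sqrt_divide)
  define d where "d n = f (Suc n) - f n" for n
  have incr: "\<mu> * (real n - real m) \<le> d n - d m \<and> d n - d m \<le> C * \<mu> * (real n - real m)"
    if "p \<le> m" "m \<le> n" "n \<le> q" for m n using that(2,3)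
  proof (induction n rule: dec_induct)
    case (step n)
    have "\<mu> \<le> d (Suc n) - d n \<and> d (Suc n) - d n \<le> C * \<mu>" using D[of n] step that(1) by (simp add: d_def algebra_simps)
    with step show ?case by (simp add: algebra_simps)
  qed simp
  have mono: "d m \<le> d n" if "p \<le> m" "m \<le> n" "n \<le> q" for m n
  proof -
    have "0 \<le> \<mu> * (real n - real m)" using that assms by (intro mult_nonneg_nonneg) auto
    then show ?thesis using incr[OF that] by linarith
  qed
  have mono': "real_of_int k \<le> x" if "real_of_int k \<le> y" "y \<le> x" for k x y using that by linarith
  \<comment> \<open>Inside a window of length \<theta> the increments are spaced by at least \<mu> =
    \<theta>^2, which leaves at most 1/\<theta> + 1 indices.\<close>
  have short: "norm (\<Sum>n\<in>S. expi (f n)) \<le> 2 / \<theta>"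
    if S: "S = {n\<in>{p..<q}. y \<le> d n \<and> d n \<le> y + \<theta>}" for y S
  proof -
    have "\<exists>r s. p \<le> r \<and> r \<le> s \<and> s \<le> max p q \<and> S = {r..<s}"
    proof (rule convex_nat_subset)
      fix a b c assume "a \<in> S" "b \<in> S" "a \<le> c" "c \<le> b"
      then show "c \<in> S" using mono[of a c] mono[of c b] unfolding S by auto
    qed (auto simp: S)
    then obtain r s where rs: "p \<le> r" "r \<le> s" "s \<le> q" "S = {r..<s}" using assms by auto
    have "real s - real r \<le> 1 / \<theta> + 1"
    proof (cases "r = s")
      case False
      then have rs': "r \<in> S" "s - 1 \<in> S" using rs by auto
      then have "\<mu> * (real (s - 1) - real r) \<le> d (s - 1) - d r" using incr[of r "s - 1"] rs False by auto
      also have "\<dots> \<le> \<theta>" using rs' unfolding S by auto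
      finally have "\<theta> * (\<theta> * (real (s - 1) - real r)) \<le> \<theta> * 1" using \<theta> by (simp add: mult.assoc[symmetric])
      then have "\<theta> * (real (s - 1) - real r) \<le> 1" using \<theta> by (subst (asm) mult_le_cancel_left_pos) auto
      then show ?thesis using \<theta> False rs by (simp add: field_simps of_nat_diff)
    qed (use \<theta> in auto)
    moreover have "norm (\<Sum>n\<in>S. expi (f n)) \<le> real s - real r" using norm_sum_expi_le[of f S] rs by (simp add: of_nat_diff)
    moreover have "1 \<le> 1 / \<theta>" using \<theta> \<theta>h by simp
    ultimately show ?thesis by (simp add: field_simps)
  qed
  \<comment> \<open>Increments with integer part \<open>k\<close> are split into those within
    \<theta> above \<open>k\<close>, a middle stretch, and those within \<theta> below
    \<open>k + 1\<close>. The three pieces cost 2/\<theta>, 7/\<theta> and 2/\<theta>.\<close>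
  have part: "norm (\<Sum>n\<in>{n\<in>{p..<q}. \<lfloor>d n\<rfloor> = k}. expi (f n)) \<le> 13 / \<theta>" for k
  proof -
    define S1 where "S1 = {n\<in>{p..<q}. k \<le> d n \<and> d n \<le> k + \<theta>}"
    define S2 where "S2 = {n\<in>{p..<q}. k + \<theta> < d n \<and> d n < k + 1 - \<theta>}"
    define S3 where "S3 = {n\<in>{p..<q}. k + 1 - \<theta> \<le> d n \<and> d n \<le> k + 1 - \<theta> + \<theta>}"
    define S4 where "S4 = {n\<in>{p..<q}. k + \<theta> \<le> d n \<and> d n \<le> k + \<theta>}"
    have "\<exists>r s. p \<le> r \<and> r \<le> s \<and> s \<le> max p q \<and> S2 = {r..<s}"
    proof (rule convex_nat_subset)
      fix a b c assume "a \<in> S2" "b \<in> S2" "a \<le> c" "c \<le> b"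
      then show "c \<in> S2" using mono[of a c] mono[of c b] unfolding S2_def by auto
    qed (auto simp: S2_def)
    then obtain r s where rs: "p \<le> r" "r \<le> s" "s \<le> q" "S2 = {r..<s}" using assms by auto
    have 2: "norm (\<Sum>n\<in>S2. expi (f n)) \<le> 7 / \<theta>" unfolding rs(4)
    proof (rule kusmin_landau)
      show "real_of_int k + \<theta> \<le> f (Suc n) - f n \<and> f (Suc n) - f n \<le> k + 1 - \<theta>"
        if "r \<le> n" "n < s" for n
      proof -
        have "n \<in> S2" using that rs by auto
        then show ?thesis by (auto simp: S2_def d_def)
      qed
      show "f (Suc m) - f m \<le> f (Suc n) - f n" if "r \<le> m" "m \<le> n" "n < s" for m n using mono[of m n] that rs by (auto simp: d_def)
    qed (use \<theta> \<theta>h in auto)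
    define S where "S = {n\<in>{p..<q}. \<lfloor>d n\<rfloor> = k}"
    have 1: "norm (\<Sum>n\<in>S \<inter> S1. expi (f n)) \<le> 2 / \<theta>"
    proof (rule short[of _ k])
      show "S \<inter> S1 = {n \<in> {p..<q}. real_of_int k \<le> d n \<and> d n \<le> real_of_int k + \<theta>}"
        unfolding S_def S1_def using \<theta>h by (auto simp: floor_eq_iff)
    qed
    have S: "S = S1 \<union> S2 \<union> (S - S1 - S2)" "S1 \<inter> S2 = {}" unfolding S_def S1_def S2_def using \<theta> \<theta>h by (auto simp: floor_eq_iff)
    have 3: "norm (\<Sum>n\<in>S - S1 - S2. expi (f n)) \<le> 2 / \<theta> + 0"
    proof -
      have eq: "S - S1 - S2 = {n\<in>{p..<q}. k + 1 - \<theta> \<le> d n \<and> d n < k + 1 \<and> k + \<theta> < d n}"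
        unfolding S_def S1_def S2_def using \<theta> \<theta>h by (auto simp: floor_eq_iff)
      have "\<exists>r s. p \<le> r \<and> r \<le> s \<and> s \<le> max p q \<and> S - S1 - S2 = {r..<s}"
      proof (rule convex_nat_subset)
        fix a b c assume "a \<in> S - S1 - S2" "b \<in> S - S1 - S2" "a \<le> c" "c \<le> b"
        then show "c \<in> S - S1 - S2" using mono[of a c] mono[of c b] unfolding eq by auto
      qed (auto simp: S_def)
      then obtain r s where rs: "p \<le> r" "r \<le> s" "s \<le> q" "S - S1 - S2 = {r..<s}" using assms by auto
      have "S3 \<supseteq> S - S1 - S2" unfolding eq S3_def by auto
      moreover have "\<exists>r s. p \<le> r \<and> r \<le> s \<and> s \<le> max p q \<and> S3 = {r..<s}"
      proof (rule convex_nat_subset)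
        fix a b c assume "a \<in> S3" "b \<in> S3" "a \<le> c" "c \<le> b"
        then show "c \<in> S3" using mono[of a c] mono[of c b] unfolding S3_def by auto
      qed (auto simp: S3_def)
      ultimately have "card (S - S1 - S2) \<le> card S3" by (intro card_mono) (auto simp: S3_def)
      moreover have "real (card S3) \<le> 2 / \<theta>"
      proof -
        obtain r s where rs: "p \<le> r" "r \<le> s" "s \<le> q" "S3 = {r..<s}"
          using \<open>\<exists>r s. p \<le> r \<and> r \<le> s \<and> s \<le> max p q \<and> S3 = {r..<s}\<close> assms by auto
        show ?thesis
        proof (cases "r = s")
          case False
          then have rs': "r \<in> S3" "s - 1 \<in> S3" using rs by auto
          then have "\<mu> * (real (s - 1) - real r) \<le> d (s - 1) - d r" using incr[of r "s - 1"] rs False by auto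
          also have "\<dots> \<le> \<theta>" using rs' unfolding S3_def by auto
          finally have "\<theta> * (\<theta> * (real (s - 1) - real r)) \<le> \<theta> * 1" using \<theta> by (simp add: mult.assoc[symmetric])
          then have "\<theta> * (real (s - 1) - real r) \<le> 1" using \<theta> by (subst (asm) mult_le_cancel_left_pos) auto
          then have "real (s - 1) - real r \<le> 1 / \<theta>" using \<theta> by (simp add: field_simps)
          moreover have "1 \<le> 1 / \<theta>" using \<theta> \<theta>h by simp
          moreover have "real (card S3) = real (s - 1) - real r + 1" using rs False by (simp add: of_nat_diff)
          moreover have "2 / \<theta> = 1 / \<theta> + 1 / \<theta>" by simp
          ultimately show ?thesis by linarith
        qed (use \<theta> rs in auto)
      qed
      ultimately show ?thesis using norm_sum_expi_le[of f "S - S1 - S2"] by linarith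
    qed
    have fin: "finite S" "finite S1" "finite S2" by (auto simp: S_def S1_def S2_def)
    have "S1 \<subseteq> S" using S(1) by blast
    then have "S \<inter> S1 = S1" by blast
    have "(\<Sum>n\<in>S. expi (f n)) = (\<Sum>n\<in>S1. expi (f n)) + (\<Sum>n\<in>S2. expi (f n)) + (\<Sum>n\<in>S - S1 - S2. expi (f n))"
    proof -
      have "sum (\<lambda>n. expi (f n)) S = sum (\<lambda>n. expi (f n)) (S1 \<union> S2 \<union> (S - S1 - S2))" using S(1) by simp
      also have "\<dots> = sum (\<lambda>n. expi (f n)) (S1 \<union> S2) + sum (\<lambda>n. expi (f n)) (S - S1 - S2)" using fin by (intro sum.union_disjoint) auto
      also have "sum (\<lambda>n. expi (f n)) (S1 \<union> S2) = sum (\<lambda>n. expi (f n)) S1 + sum (\<lambda>n. expi (f n)) S2"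
        using fin S(2) by (intro sum.union_disjoint) auto
      finally show ?thesis .
    qed
    then have "norm (\<Sum>n\<in>S. expi (f n)) \<le> norm (\<Sum>n\<in>S1. expi (f n)) + norm (\<Sum>n\<in>S2. expi (f n))
        + norm (\<Sum>n\<in>S - S1 - S2. expi (f n))" by (simp only:) (rule norm_triangle_le, simp add: norm_triangle_ineq)
    also have "\<dots> \<le> 2 / \<theta> + 7 / \<theta> + (2 / \<theta> + 0)" using 1 2 3 unfolding \<open>S \<inter> S1 = S1\<close> by linarith
    also have "\<dots> \<le> 13 / \<theta>" using \<theta> by (simp add: field_simps)
    finally show ?thesis unfolding S_def .
  qed
  show ?thesis
  proof (cases "p = q")
    case True then show ?thesis using \<theta> by (simp add: \<theta>_def[symmetric])
  next
    case False
    define T where "T = {\<lfloor>d p\<rfloor>..\<lfloor>d q\<rfloor>}"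
    have "(\<Sum>n\<in>{p..<q}. expi (f n)) = (\<Sum>k\<in>T. \<Sum>n\<in>{n\<in>{p..<q}. \<lfloor>d n\<rfloor> = k}. expi (f n))"
      by (rule sum.group[symmetric]) (use mono in \<open>auto simp: T_def intro!: floor_mono\<close>)
    also have "norm \<dots> \<le> (\<Sum>k\<in>T. 13 / \<theta>)" by (intro sum_norm_le part)
    also have "\<dots> = real (card T) * (13 / \<theta>)" by simp
    also have "\<dots> \<le> (C * \<mu> * (real q - real p) + 2) * (13 / \<theta>)"
    proof (rule mult_right_mono)
      have "\<lfloor>d p\<rfloor> \<le> \<lfloor>d q\<rfloor>" using mono[of p q] assms by (intro floor_mono) auto
      then have "real (card T) = real_of_int \<lfloor>d q\<rfloor> - \<lfloor>d p\<rfloor> + 1" by (simp add: T_def)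
      also have "\<dots> \<le> d q - d p + 2" by linarith
      finally show "real (card T) \<le> C * \<mu> * (real q - real p) + 2" using incr[of p q] assms by linarith
    qed (use \<theta> in auto)
    also have "\<dots> = 13 * C * (real q - real p) * \<theta> + 26 / \<theta>" unfolding \<theta>(2)[symmetric] using \<theta>(1) by (simp add: field_simps)
    finally show ?thesis by (simp add: \<theta>_def)
  qed
qed

section \<open>Counting close ratios\<close>

lemma abs_ln_diff_ge:
  fixes a b :: nat
  assumes "0 < a" "0 < b" "a \<noteq> b" "a \<le> Z" "b \<le> Z"
  shows "1 / Z \<le> \<bar>ln (real a) - ln b\<bar>"
proof -
  have *: "1 / Z \<le> ln (real b) - ln (real a)" if "0 < a" "a < b" "b \<le> Z" for a b :: nat
  proof -
    have "ln (real a / b) \<le> real a / b - 1" using that by (intro ln_le_minus_one) auto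
    then have "1 - real a / b \<le> ln (real b) - ln (real a)" using that by (simp add: ln_div)
    moreover have "1 - real a / b = (real b - real a) / b" using that by (simp add: field_simps)
    moreover have "1 / real Z \<le> (real b - real a) / b" using that by (intro frac_le) auto
    ultimately show ?thesis by linarith
  qed
  from *[of a b] *[of b a] assms show ?thesis by (cases "a < b") auto
qed

text \<open>Pigeonhole with cells of length \<open>\<eta>\<close>: separated values have different
  cell numbers, and a window of length 2\<theta> meets at most 1 + 2\<theta>/\<eta> cells.\<close>

lemma card_close_le:
  fixes f :: "'a \<Rightarrow> real"
  assumes "finite S" "0 < \<eta>" "0 \<le> \<theta>"
    and sep: "\<And>p q. \<lbrakk>p \<in> S; q \<in> S; p \<noteq> q\<rbrakk> \<Longrightarrow> \<eta> \<le> \<bar>f p - f q\<bar>"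
  shows "card {p\<in>S. \<bar>f p - c\<bar> \<le> \<theta>} \<le> 1 + 2 * \<theta> / \<eta>"
proof -
  define g where "g p = \<lfloor>(f p - c + \<theta>) / \<eta>\<rfloor>" for p
  define T where "T = {p\<in>S. \<bar>f p - c\<bar> \<le> \<theta>}"
  have lt: "g q < g p" if "f q + \<eta> \<le> f p" for p q
  proof -
    have "(f q - c + \<theta>) / \<eta> + 1 = (f q + \<eta> - c + \<theta>) / \<eta>" using assms by (simp add: field_simps)
    also have "\<dots> \<le> (f p - c + \<theta>) / \<eta>" using that assms by (intro divide_right_mono) auto
    finally show ?thesis unfolding g_def by linarith
  qed
  have "inj_on g T"
  proof (rule inj_onI, rule ccontr)
    fix p q assume pq: "p \<in> T" "q \<in> T" "g p = g q" "p \<noteq> q"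
    then have "\<eta> \<le> \<bar>f p - f q\<bar>" using sep by (auto simp: T_def)
    then have "f q + \<eta> \<le> f p \<or> f p + \<eta> \<le> f q" by linarith
    then show False using lt[of q p] lt[of p q] pq by auto
  qed
  moreover have "g ` T \<subseteq> {0..\<lfloor>2 * \<theta> / \<eta>\<rfloor>}" using assms by (auto simp: T_def g_def intro!: floor_mono divide_right_mono)
  ultimately have "card T \<le> card {0..\<lfloor>2 * \<theta> / \<eta>\<rfloor>}" by (intro card_inj_on_le) auto
  moreover have "real (card {0..\<lfloor>2 * \<theta> / \<eta>\<rfloor>}) \<le> 1 + 2 * \<theta> / \<eta>"
  proof -
    have "0 \<le> 2 * \<theta> / \<eta>" using assms by simp
    then show ?thesis by (simp add: nat_add_distrib)
  qed
  ultimately show ?thesis unfolding T_def[symmetric] by linarith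
qed

definition coprime_pairs :: "nat \<Rightarrow> (nat \<times> nat) set" where
  "coprime_pairs Z = {(a, b). a \<in> {1..Z} \<and> b \<in> {1..Z} \<and> coprime a b}"

definition log_ratio :: "nat \<times> nat \<Rightarrow> real" where
  "log_ratio p = ln (fst p) - ln (snd p)"

lemma finite_coprime_pairs: "finite (coprime_pairs Z)" by (rule finite_subset[of _ "{1..Z} \<times> {1..Z}"]) (auto simp: coprime_pairs_def)

lemma card_coprime_pairs_le: "card (coprime_pairs Z) \<le> Z\<^sup>2"
proof -
  have "card (coprime_pairs Z) \<le> card ({1..Z} \<times> {1..Z})" by (rule card_mono) (auto simp: coprime_pairs_def)
  then show ?thesis by (simp add: power2_eq_square)
qed

text \<open>Distinct reduced fractions a/b and c/d satisfy a * d \<noteq> c * b. These are two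
  integers up to Z^2, and logarithms of distinct positive integers up to Z^2 are at least 1/Z^2
  apart.\<close>

lemma log_ratio_sep:
  assumes "p \<in> coprime_pairs Z" "q \<in> coprime_pairs Z" "p \<noteq> q"
  shows "1 / (real Z)\<^sup>2 \<le> \<bar>log_ratio p - log_ratio q\<bar>"
proof -
  obtain a b c d where pq: "p = (a, b)" "q = (c, d)" by (cases p, cases q)
  have *: "0 < a" "0 < b" "0 < c" "0 < d" "a \<le> Z" "b \<le> Z" "c \<le> Z" "d \<le> Z" "coprime a b" "coprime c d" using assms by (auto simp: pq coprime_pairs_def)
  have "a * d \<noteq> c * b" using assms(3) * coprime_crossproduct_nat[of a b c d] by (auto simp: pq coprime_commute)
  then have "1 / real (Z * Z) \<le> \<bar>ln (real (a * d)) - ln (real (c * b))\<bar>" using * by (intro abs_ln_diff_ge) (auto intro: mult_mono)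
  also have "\<dots> = \<bar>log_ratio p - log_ratio q\<bar>" using * by (simp add: pq log_ratio_def ln_mult algebra_simps)
  finally show ?thesis by (simp add: power2_eq_square)
qed

lemma card_close_log_ratios:
  assumes "0 < \<gamma>" "0 \<le> \<theta>" "0 < P" "0 < Q"
  shows "card {(p, q) \<in> coprime_pairs P \<times> coprime_pairs Q. \<bar>\<gamma> * log_ratio q + log_ratio p\<bar> \<le> \<theta>}
    \<le> (real P)\<^sup>2 * (1 + 2 * \<theta> / \<gamma> * (real Q)\<^sup>2)"
proof -
  have "{(p, q) \<in> coprime_pairs P \<times> coprime_pairs Q. \<bar>\<gamma> * log_ratio q + log_ratio p\<bar> \<le> \<theta>}
     = (SIGMA p : coprime_pairs P. {q\<in>coprime_pairs Q. \<bar>\<gamma> * log_ratio q - (- log_ratio p)\<bar> \<le> \<theta>})" by auto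
  then have "real (card {(p, q) \<in> coprime_pairs P \<times> coprime_pairs Q. \<bar>\<gamma> * log_ratio q + log_ratio p\<bar> \<le> \<theta>})
    = (\<Sum>p\<in>coprime_pairs P. real (card {q\<in>coprime_pairs Q. \<bar>\<gamma> * log_ratio q - (- log_ratio p)\<bar> \<le> \<theta>}))"
    by (simp add: finite_coprime_pairs card_SigmaI)
  also have "\<dots> \<le> (\<Sum>p\<in>coprime_pairs P. 1 + 2 * \<theta> / (\<gamma> * (1 / (real Q)\<^sup>2)))"
  proof (intro sum_mono card_close_le)
    fix p q q' assume "q \<in> coprime_pairs Q" "q' \<in> coprime_pairs Q" "q \<noteq> q'"
    then have "\<gamma> * (1 / (real Q)\<^sup>2) \<le> \<gamma> * \<bar>log_ratio q - log_ratio q'\<bar>" using assms by (intro mult_left_mono log_ratio_sep) auto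
    also have "\<dots> = \<bar>\<gamma> * log_ratio q - \<gamma> * log_ratio q'\<bar>" using assms(1) by (simp add: right_diff_distrib[symmetric] abs_mult)
    finally show "\<gamma> * (1 / (real Q)\<^sup>2) \<le> \<bar>\<gamma> * log_ratio q - \<gamma> * log_ratio q'\<bar>" .
  qed (use assms in \<open>auto simp: finite_coprime_pairs\<close>)
  also have "\<dots> = real (card (coprime_pairs P)) * (1 + 2 * \<theta> / \<gamma> * (real Q)\<^sup>2)" using assms by simp
  also have "\<dots> \<le> (real P)\<^sup>2 * (1 + 2 * \<theta> / \<gamma> * (real Q)\<^sup>2)"
    using assms card_coprime_pairs_le[of P] by (intro mult_right_mono) (auto simp: of_nat_power[symmetric] simp del: of_nat_power)
  finally show ?thesis .
qed

text \<open>Counting with \<open>p\<close> fixed has the diagonal term P^2; fixing \<open>q\<close>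
  instead, after dividing the condition by \<open>\<gamma>\<close>, gives Q^2. The smaller of the
  two is at most P * Q, and only a term linear in P * Q is affordable in the bilinear
  estimate.\<close>

lemma card_close_log_ratios':
  assumes "0 < \<gamma>" "\<gamma> \<le> 1" "0 \<le> \<theta>" "0 < P" "0 < Q"
  shows "card {(p, q) \<in> coprime_pairs P \<times> coprime_pairs Q. \<bar>\<gamma> * log_ratio q + log_ratio p\<bar> \<le> \<theta>}
    \<le> real P * Q + 2 / \<gamma> * \<theta> * (real P * Q)\<^sup>2"
proof -
  let ?S = "{(p, q) \<in> coprime_pairs P \<times> coprime_pairs Q. \<bar>\<gamma> * log_ratio q + log_ratio p\<bar> \<le> \<theta>}"
  have "{(q, p) \<in> coprime_pairs Q \<times> coprime_pairs P. \<bar>1 / \<gamma> * log_ratio p + log_ratio q\<bar> \<le> \<theta> / \<gamma>}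
      = prod.swap ` ?S"
  proof -
    have "\<bar>1 / \<gamma> * log_ratio p + log_ratio q\<bar> \<le> \<theta> / \<gamma> \<longleftrightarrow> \<bar>\<gamma> * log_ratio q + log_ratio p\<bar> \<le> \<theta>" for p q
    proof -
      have "1 / \<gamma> * log_ratio p + log_ratio q = (\<gamma> * log_ratio q + log_ratio p) / \<gamma>" using assms by (simp add: field_simps)
      then show ?thesis using assms by (simp add: divide_le_cancel)
    qed
    then have "{(q, p) \<in> coprime_pairs Q \<times> coprime_pairs P. \<bar>1 / \<gamma> * log_ratio p + log_ratio q\<bar> \<le> \<theta> / \<gamma>}
      = {(q, p) \<in> coprime_pairs Q \<times> coprime_pairs P. \<bar>\<gamma> * log_ratio q + log_ratio p\<bar> \<le> \<theta>}" by (simp only:)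
    also have "\<dots> = prod.swap ` ?S" by force
    finally show ?thesis .
  qed
  then have eq: "card {(q, p) \<in> coprime_pairs Q \<times> coprime_pairs P. \<bar>1 / \<gamma> * log_ratio p + log_ratio q\<bar> \<le> \<theta> / \<gamma>} = card ?S"
    by (simp only: card_image[OF inj_on_subset[OF inj_swap subset_UNIV]])
  have 1: "card ?S \<le> (real P)\<^sup>2 * (1 + 2 * \<theta> / \<gamma> * (real Q)\<^sup>2)" using assms by (intro card_close_log_ratios) auto
  have "card ?S \<le> (real Q)\<^sup>2 * (1 + 2 * (\<theta> / \<gamma>) / (1 / \<gamma>) * (real P)\<^sup>2)"
    unfolding eq[symmetric] using assms by (intro card_close_log_ratios) auto
  also have "2 * (\<theta> / \<gamma>) / (1 / \<gamma>) \<le> 2 * \<theta> / \<gamma>" using assms mult_right_mono[of \<gamma> 1 "2 * \<theta>"] by (simp add: field_simps)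
  then have "(real Q)\<^sup>2 * (1 + 2 * (\<theta> / \<gamma>) / (1 / \<gamma>) * (real P)\<^sup>2) \<le> (real Q)\<^sup>2 * (1 + 2 * \<theta> / \<gamma> * (real P)\<^sup>2)"
    by (intro mult_left_mono add_left_mono mult_right_mono) auto
  finally have 2: "card ?S \<le> (real Q)\<^sup>2 * (1 + 2 * \<theta> / \<gamma> * (real P)\<^sup>2)" .
  have "card ?S \<le> min ((real P)\<^sup>2) ((real Q)\<^sup>2) + 2 / \<gamma> * \<theta> * (real P * Q)\<^sup>2" using 1 2 by (simp add: min_def algebra_simps power2_eq_square)
  also have "min ((real P)\<^sup>2) ((real Q)\<^sup>2) \<le> real P * real Q"
  proof (cases "P \<le> Q")
    case True
    then have "(real P)\<^sup>2 \<le> real P * real Q" unfolding power2_eq_square by (intro mult_left_mono) auto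
    then show ?thesis by (rule min.coboundedI1)
  next
    case False
    then have "(real Q)\<^sup>2 \<le> real P * real Q" unfolding power2_eq_square by (intro mult_right_mono) auto
    then show ?thesis by (rule min.coboundedI2)
  qed
  finally show ?thesis by simp
qed

text \<open>Each new term 1/(n + 1) is at most the gap between the logarithms of two consecutive
  integers.\<close>

lemma harmonic_sum_le:
  assumes "0 < P"
  shows "(\<Sum>d\<in>{1..P}. 1 / real d) \<le> 1 + ln P" using assms
proof (induction P rule: nat_induct_non_zero)
  case (Suc n)
  have "1 / real (Suc n) \<le> \<bar>ln (real (Suc n)) - ln n\<bar>" using Suc by (intro abs_ln_diff_ge) auto
  also have "\<dots> = ln (real (Suc n)) - ln n" using Suc by (subst abs_of_nonneg) auto
  finally show ?case using Suc by (simp add: sum.atLeast_Suc_atMost[symmetric])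
qed simp

text \<open>Dividing each pair by its greatest common divisor preserves the log ratio and leaves
  coprime pairs up to P div e and Q div d. Summing the bound for coprime pairs over e and d produces
  two harmonic sums, hence the logarithms.\<close>

lemma card_close_quadruples:
  fixes P Q :: nat and \<gamma> \<theta> :: real
  assumes "0 < \<gamma>" "\<gamma> \<le> 1" "0 \<le> \<theta>" "0 < P" "0 < Q"
  shows "card {((h, h'), (n, n')). h \<in> {1..P} \<and> h' \<in> {1..P} \<and> n \<in> {1..Q} \<and> n' \<in> {1..Q} \<and>
       \<bar>\<gamma> * log_ratio (n, n') + log_ratio (h, h')\<bar> \<le> \<theta>}
    \<le> (real P * Q + 2 / \<gamma> * \<theta> * (real P * Q)\<^sup>2) * ((1 + ln P) * (1 + ln Q))"
proof -
  let ?A = "{((h, h'), (n, n')). h \<in> {1..P} \<and> h' \<in> {1..P} \<and> n \<in> {1..Q} \<and> n' \<in> {1..Q} \<and>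
       \<bar>\<gamma> * log_ratio (n, n') + log_ratio (h, h')\<bar> \<le> \<theta>}"
  define X where "X = real P * Q + 2 / \<gamma> * \<theta> * (real P * Q)\<^sup>2"
  define S where "S = (\<lambda>(e, d). {(p, q) \<in> coprime_pairs (P div e) \<times> coprime_pairs (Q div d). \<bar>\<gamma> * log_ratio q + log_ratio p\<bar> \<le> \<theta>})"
  define r where "r = (\<lambda>((h, h'), (n, n')). ((gcd h h', gcd n n'),
     ((h div gcd h h', h' div gcd h h'), (n div gcd n n', n' div gcd n n'))))" for h h' n n' :: nat
  have finS: "finite (S i)" for i by (rule finite_subset[of _ "coprime_pairs (P div fst i) \<times> coprime_pairs (Q div snd i)"])
      (auto simp: S_def finite_coprime_pairs)
  define r where "r = (\<lambda>((h, h'), (n, n')). ((gcd h h', gcd n n'),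
     ((h div gcd h h', h' div gcd h h'), (n div gcd n n', n' div gcd n n') :: nat \<times> nat)) :: (nat \<times> nat) \<times> ((nat \<times> nat) \<times> (nat \<times> nat)))"
  have lr: "log_ratio (a div gcd a b, b div gcd a b) = log_ratio (a, b)" if "0 < a" "0 < b" for a b
  proof -
    have "real (a div gcd a b) = real a / gcd a b" "real (b div gcd a b) = real b / gcd a b" by (simp_all add: real_of_nat_div)
    then show ?thesis using that by (simp add: log_ratio_def ln_div)
  qed
  have cp: "(a div gcd a b, b div gcd a b) \<in> coprime_pairs (Z div gcd a b)"
    if "a \<in> {1..Z}" "b \<in> {1..Z}" for a b Z
  proof -
    have "a \<noteq> 0" using that by auto
    then have "coprime (a div gcd a b) (b div gcd a b)" by (intro div_gcd_coprime) auto
    moreover have "gcd a b \<le> a" "gcd a b \<le> b" "0 < gcd a b" using that by (auto intro: gcd_le1_nat gcd_le2_nat)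
    then have "0 < a div gcd a b" "0 < b div gcd a b" by (auto simp: div_greater_zero_iff)
    ultimately show ?thesis using that by (auto simp: coprime_pairs_def Suc_le_eq div_le_mono)
  qed
  have "card ?A \<le> card (SIGMA i : {1..P} \<times> {1..Q}. S i)"
  proof (rule card_inj_on_le)
    show "inj_on r ?A"
    proof (rule inj_onI)
      fix x y assume xy: "x \<in> ?A" "y \<in> ?A" "r x = r y"
      obtain h h' n n' k k' m m' where [simp]: "x = ((h, h'), (n, n'))" "y = ((k, k'), (m, m'))" by (metis surj_pair)
      have "gcd h h' = gcd k k'" "gcd n n' = gcd m m'" "h div gcd h h' = k div gcd k k'"
         "h' div gcd h h' = k' div gcd k k'" "n div gcd n n' = m div gcd m m'" "n' div gcd n n' = m' div gcd m m'" using xy(3) by (auto simp: r_def)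
      then show "x = y" by (metis \<open>x = ((h, h'), (n, n'))\<close> \<open>y = ((k, k'), (m, m'))\<close> dvd_div_mult_self gcd_dvd1 gcd_dvd2)
    qed
    show "r ` ?A \<subseteq> (SIGMA i : {1..P} \<times> {1..Q}. S i)"
    proof
      fix z assume "z \<in> r ` ?A"
      then obtain h h' n n' where z: "z = r ((h, h'), (n, n'))" and
        *: "h \<in> {1..P}" "h' \<in> {1..P}" "n \<in> {1..Q}" "n' \<in> {1..Q}"
           "\<bar>\<gamma> * log_ratio (n, n') + log_ratio (h, h')\<bar> \<le> \<theta>" by auto
      have "gcd h h' \<in> {1..P}" "gcd n n' \<in> {1..Q}" using * le_trans[OF gcd_le1_nat[of h h'], of P] le_trans[OF gcd_le1_nat[of n n'], of Q] by (auto simp: Suc_le_eq)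
      then show "z \<in> (SIGMA i : {1..P} \<times> {1..Q}. S i)" using * cp[OF *(1,2)] cp[OF *(3,4)] lr[of h h'] lr[of n n'] unfolding z r_def S_def by simp
    qed
    show "finite (SIGMA i : {1..P} \<times> {1..Q}. S i)" using finS by auto
  qed
  also have "\<dots> = (\<Sum>i\<in>{1..P} \<times> {1..Q}. card (S i))" using finS by (intro card_SigmaI) auto
  finally have "real (card ?A) \<le> (\<Sum>i\<in>{1..P} \<times> {1..Q}. real (card (S i)))" by (simp only: of_nat_sum[symmetric] of_nat_le_iff)
  also have "\<dots> \<le> (\<Sum>i\<in>{1..P} \<times> {1..Q}. X * ((1 / fst i) * (1 / snd i)))"
  proof (rule sum_mono)
    fix i assume "i \<in> {1..P} \<times> {1..Q}"
    then obtain e d where i: "i = (e, d)" "0 < e" "e \<le> P" "0 < d" "d \<le> Q" by auto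
    define u v where "u = real (P div e)" and "v = real (Q div d)"
    have uv: "0 \<le> u" "0 \<le> v" "u \<le> P / e" "v \<le> Q / d" unfolding u_def v_def by (auto intro: of_nat_div_le_of_nat)
    have p: "u * v \<le> real P * Q * (1 / e * (1 / d))" using mult_mono[OF uv(3,4)] uv by simp
    have le1: "1 / e * (1 / d) \<le> (1::real)" using i by (intro mult_le_one) auto
    \<comment> \<open>The quadratic term decreases even like 1/(e * d)^2; weakening this to 1/(e *
      d) lets both terms share the common factor \<open>X\<close>.\<close>
    have "(u * v)\<^sup>2 \<le> (real P * Q * (1 / e * (1 / d)))\<^sup>2" using p uv by (intro power_mono) auto
    also have "\<dots> = (real P * Q)\<^sup>2 * ((1 / e * (1 / d)) * (1 / e * (1 / d)))" by (simp add: power2_eq_square mult_ac)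
    also have "\<dots> \<le> (real P * Q)\<^sup>2 * ((1 / e * (1 / d)) * 1)" by (intro mult_left_mono le1) auto
    finally have "2 / \<gamma> * \<theta> * (u * v)\<^sup>2 \<le> 2 / \<gamma> * \<theta> * ((real P * Q)\<^sup>2 * ((1 / e * (1 / d)) * 1))"
      using assms by (intro mult_left_mono) auto
    then have "u * v + 2 / \<gamma> * \<theta> * (u * v)\<^sup>2 \<le> X * (1 / e * (1 / d))" using p unfolding X_def by (simp add: algebra_simps)
    moreover have "real (card (S i)) \<le> u * v + 2 / \<gamma> * \<theta> * (u * v)\<^sup>2" unfolding i S_def split u_def v_def using i assms
      by (intro card_close_log_ratios') (auto simp: div_greater_zero_iff)
    ultimately show "real (card (S i)) \<le> X * ((1 / fst i) * (1 / snd i))" by (simp add: i)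
  qed
  also have "\<dots> = X * (\<Sum>i\<in>{1..P} \<times> {1..Q}. (1 / real (fst i)) * (1 / real (snd i)))" by (simp only: sum_distrib_left)
  also have "(\<Sum>i\<in>{1..P} \<times> {1..Q}. (1 / real (fst i)) * (1 / real (snd i)))
     = (\<Sum>e\<in>{1..P}. 1 / real e) * (\<Sum>d\<in>{1..Q}. 1 / real d)" by (simp only: sum_product sum.cartesian_product split_def)
  also have "X * ((\<Sum>e\<in>{1..P}. 1 / real e) * (\<Sum>d\<in>{1..Q}. 1 / real d)) \<le> X * ((1 + ln P) * (1 + ln Q))"
    using assms by (intro mult_left_mono mult_mono harmonic_sum_le sum_nonneg) (auto simp: X_def Suc_le_eq)
  finally show ?thesis unfolding X_def .
qed

section \<open>Second differences and sums with two shifted powers\<close>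

lemma second_difference_mvt:
  fixes f f' f'' :: "real \<Rightarrow> real"
  assumes 1: "\<And>t. a \<le> t \<Longrightarrow> t \<le> a + 2 \<Longrightarrow> (f has_real_derivative f' t) (at t)"
    and 2: "\<And>t. a \<le> t \<Longrightarrow> t \<le> a + 2 \<Longrightarrow> (f' has_real_derivative f'' t) (at t)"
  obtains \<xi> where "a \<le> \<xi>" "\<xi> \<le> a + 2" "f (a + 2) - 2 * f (a + 1) + f a = f'' \<xi>"
proof -
  \<comment> \<open>A second difference of f is a first difference of t \<mapsto> f (t + 1) - f t,
    so the mean value theorem applies twice.\<close>
  have "((\<lambda>t. f (t + 1) - f t) has_real_derivative (f' (t + 1) - f' t)) (at t)"
    if "a \<le> t" "t \<le> a + 1" for t using that 1[of "t + 1"] by (intro DERIV_diff 1) (auto simp: DERIV_shift)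
  then obtain y where y: "a < y" "y < a + 1"
    "(f (a + 1 + 1) - f (a + 1)) - (f (a + 1) - f a) = (a + 1 - a) * (f' (y + 1) - f' y)"
    using MVT2[of a "a + 1" "\<lambda>t. f (t + 1) - f t" "\<lambda>t. f' (t + 1) - f' t"] by auto
  have "(f' has_real_derivative f'' t) (at t)" if "y \<le> t" "t \<le> y + 1" for t using that y by (intro 2) auto
  then obtain z where z: "y < z" "z < y + 1" "f' (y + 1) - f' y = (y + 1 - y) * f'' z" using MVT2[of y "y + 1" f' f''] by auto
  show ?thesis using y z by (intro that[of z]) (auto simp: algebra_simps)
qed

lemma has_real_derivative_powr_shift:
  assumes "0 < t + c"
  shows "((\<lambda>t. (t + c) powr b) has_real_derivative b * (t + c) powr (b - 1)) (at t)" using assms by (auto intro!: derivative_eq_intros)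

text \<open>The linear lower bound holds because the derivative of (t + x)^(\<gamma> - 2) in x is at
  least -2 t^(\<gamma> - 3): the factor 2 - \<gamma> is at most 2 and the power decreases.\<close>

lemma powr_shift_bounds:
  fixes t r \<gamma> :: real
  assumes "0 < \<gamma>" "\<gamma> < 1" "0 < t" "0 \<le> r"
  shows "(t + r) powr (\<gamma> - 2) \<le> t powr (\<gamma> - 2)"
    and "t powr (\<gamma> - 2) * (1 - 2 * r / t) \<le> (t + r) powr (\<gamma> - 2)"
proof -
  show "(t + r) powr (\<gamma> - 2) \<le> t powr (\<gamma> - 2)" using assms by (intro powr_mono2') auto
  have "((\<lambda>x. (t + x) powr (\<gamma> - 2) - t powr (\<gamma> - 2) * (1 - 2 * x / t)) has_real_derivative
      ((\<gamma> - 2) * (t + x) powr (\<gamma> - 3) + 2 * t powr (\<gamma> - 2) / t)) (at x)" if "0 \<le> x" for x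
  proof -
    have "((\<lambda>x. (t + x) powr (\<gamma> - 2)) has_real_derivative (\<gamma> - 2) * (t + x) powr (\<gamma> - 3)) (at x)"
      using has_real_derivative_powr_shift[of x t "\<gamma> - 2"] assms that by (simp add: add.commute)
    moreover have "((\<lambda>x. t powr (\<gamma> - 2) * (1 - 2 * x / t)) has_real_derivative - (2 * t powr (\<gamma> - 2) / t)) (at x)"
      using assms by (auto intro!: derivative_eq_intros)
    ultimately show ?thesis using DERIV_diff by fastforce
  qed
  moreover have "0 \<le> (\<gamma> - 2) * (t + x) powr (\<gamma> - 3) + 2 * t powr (\<gamma> - 2) / t" if "0 \<le> x" for x
  proof -
    have "(t + x) powr (\<gamma> - 3) \<le> t powr (\<gamma> - 3)" using assms that by (intro powr_mono2') auto
    then have "(2 - \<gamma>) * (t + x) powr (\<gamma> - 3) \<le> 2 * t powr (\<gamma> - 3)" using assms by (intro mult_mono) auto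
    moreover have "t powr (\<gamma> - 2) / t = t powr (\<gamma> - 3)" using assms powr_diff[of t "\<gamma> - 2" 1] by simp
    ultimately show ?thesis by (simp add: algebra_simps)
  qed
  ultimately have "(t + 0) powr (\<gamma> - 2) - t powr (\<gamma> - 2) * (1 - 2 * 0 / t)
     \<le> (t + r) powr (\<gamma> - 2) - t powr (\<gamma> - 2) * (1 - 2 * r / t)"
    using assms by (intro DERIV_nonneg_imp_nondecreasing[of 0 r "\<lambda>x. (t + x) powr (\<gamma> - 2) - t powr (\<gamma> - 2) * (1 - 2 * x / t)"]) blast+
  then show "t powr (\<gamma> - 2) * (1 - 2 * r / t) \<le> (t + r) powr (\<gamma> - 2)" using assms by simp
qed

text \<open>The shifts change each power by a relative amount of at most 2\<sigma>/t, and the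
  hypothesis on \<open>\<sigma>\<close> keeps this below half of the main difference
  \<open>A - B\<close>. The factor 1/18 is half of 1/9, the loss from t \<le> 3M in a power with
  exponent above -2.\<close>

lemma two_powers_diff_bounds:
  fixes A B M r s \<sigma> \<gamma> t :: real
  assumes "0 < \<gamma>" "\<gamma> < 1" "1 \<le> M" "M \<le> t" "t \<le> 3 * M" "0 \<le> r" "r \<le> \<sigma>" "0 \<le> s" "s \<le> \<sigma>"
    and "0 \<le> B" "B < A" "4 * \<sigma> * A \<le> M * (A - B)"
  shows "(A - B) * M powr (\<gamma> - 2) / 18 \<le> A * (t + r) powr (\<gamma> - 2) - B * (t + s) powr (\<gamma> - 2)"
    and "A * (t + r) powr (\<gamma> - 2) - B * (t + s) powr (\<gamma> - 2) \<le> 2 * ((A - B) * M powr (\<gamma> - 2))"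
proof -
  define P where "P = t powr (\<gamma> - 2)"
  have P: "0 < P" "P \<le> M powr (\<gamma> - 2)" using assms by (auto simp: P_def intro!: powr_mono2')
  have "3 powr (-2) * M powr (\<gamma> - 2) \<le> 3 powr (\<gamma> - 2) * M powr (\<gamma> - 2)" using assms by (intro mult_right_mono powr_mono) auto
  also have "\<dots> = (3 * M) powr (\<gamma> - 2)" using assms by (simp add: powr_mult)
  also have "\<dots> \<le> P" unfolding P_def using assms by (intro powr_mono2') auto
  finally have P9: "M powr (\<gamma> - 2) / 9 \<le> P" by (simp add: powr_minus divide_simps)
  have "2 * \<sigma> / t * A \<le> 2 * \<sigma> / M * A" using assms by (intro mult_right_mono divide_left_mono) auto
  also have "\<dots> \<le> (A - B) / 2" using assms by (simp add: field_simps)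
  finally have sA: "2 * \<sigma> / t * A \<le> (A - B) / 2" .
  have "2 * \<sigma> / t * B \<le> 2 * \<sigma> / t * A" using assms by (intro mult_left_mono) auto
  with sA have sB: "2 * \<sigma> / t * B \<le> (A - B) / 2" by linarith
  have 1: "P * (1 - 2 * x / t) \<le> (t + x) powr (\<gamma> - 2)" "(t + x) powr (\<gamma> - 2) \<le> P"
     "P * (1 - 2 * \<sigma> / t) \<le> P * (1 - 2 * x / t)" if "0 \<le> x" "x \<le> \<sigma>" for x
    using powr_shift_bounds[of \<gamma> t x] assms that P by (auto simp: P_def intro!: mult_left_mono divide_right_mono)
  have "A * (P * (1 - 2 * \<sigma> / t)) - B * P \<le> A * (t + r) powr (\<gamma> - 2) - B * (t + s) powr (\<gamma> - 2)"
    using 1(1,3)[of r] 1(2)[of s] assms by (intro diff_mono mult_left_mono) auto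
  moreover have "A * (P * (1 - 2 * \<sigma> / t)) - B * P = P * ((A - B) - 2 * \<sigma> / t * A)" by (simp add: algebra_simps)
  moreover have "(M powr (\<gamma> - 2) / 9) * ((A - B) / 2) \<le> P * ((A - B) - 2 * \<sigma> / t * A)" using P P9 sA assms by (intro mult_mono) auto
  moreover have "(A - B) * M powr (\<gamma> - 2) / 18 = (M powr (\<gamma> - 2) / 9) * ((A - B) / 2)" by simp
  ultimately show "(A - B) * M powr (\<gamma> - 2) / 18 \<le> A * (t + r) powr (\<gamma> - 2) - B * (t + s) powr (\<gamma> - 2)" by linarith
  have "A * (t + r) powr (\<gamma> - 2) - B * (t + s) powr (\<gamma> - 2) \<le> A * P - B * (P * (1 - 2 * \<sigma> / t))"
    using 1(2)[of r] 1(1,3)[of s] assms by (intro diff_mono mult_left_mono) auto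
  also have "\<dots> = P * ((A - B) + 2 * \<sigma> / t * B)" by (simp add: algebra_simps)
  also have "\<dots> \<le> M powr (\<gamma> - 2) * (2 * (A - B))" using P sB assms by (intro mult_mono) auto
  finally show "A * (t + r) powr (\<gamma> - 2) - B * (t + s) powr (\<gamma> - 2) \<le> 2 * ((A - B) * M powr (\<gamma> - 2))" by (simp add: algebra_simps)
qed

text \<open>468 = 13 * 36 and 26 come from \<open>second_difference_test\<close>. Here 36 is the
  ratio of the upper to the lower bound in \<open>two_powers_diff_bounds\<close>, and \<gamma>(1 -
  \<gamma>)/18 is the factor in the lower bound for the second derivative.\<close>

definition two_powers_const :: "real \<Rightarrow> real" where
  "two_powers_const \<gamma> = 468 + 26 / sqrt (\<gamma> * (1 - \<gamma>) / 18)"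

lemma two_powers_sum_bound_aux:
  fixes A B M r s \<sigma> \<gamma> \<alpha> :: real and p q :: nat
  assumes "0 < \<gamma>" "\<gamma> < 1" "1 \<le> M" "0 \<le> r" "r \<le> \<sigma>" "0 \<le> s" "s \<le> \<sigma>"
    and "0 \<le> B" "B < A" "4 * \<sigma> * A \<le> M * (A - B)" "M \<le> p" "p \<le> q" "q \<le> 2 * M"
  shows "norm (\<Sum>n\<in>{p..<q}. expi (\<alpha> * n + A * (n + r) powr \<gamma> - B * (n + s) powr \<gamma>))
    \<le> two_powers_const \<gamma> * (sqrt ((A - B) * M powr \<gamma>) + M / sqrt ((A - B) * M powr \<gamma>))"
proof -
  define \<kappa> where "\<kappa> = \<gamma> * (1 - \<gamma>) / 18"
  have "\<gamma> * (1 - \<gamma>) \<le> 1 * 1" using assms by (intro mult_mono) auto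
  then have \<kappa>: "0 < \<kappa>" "\<kappa> \<le> 1" using assms by (auto simp: \<kappa>_def)
  define D where "D = A - B"
  have D: "0 < D" using assms by (simp add: D_def)
  define \<mu> where "\<mu> = \<kappa> * (D * M powr (\<gamma> - 2))"
  have \<mu>: "0 < \<mu>" using \<kappa> D assms by (simp add: \<mu>_def)
  define f where "f t = \<alpha> * t + A * (t + r) powr \<gamma> - B * (t + s) powr \<gamma>" for t
  define f1 where "f1 t = \<alpha> + A * (\<gamma> * (t + r) powr (\<gamma> - 1)) - B * (\<gamma> * (t + s) powr (\<gamma> - 1))" for t
  define f2 where "f2 t = A * (\<gamma> * ((\<gamma> - 1) * (t + r) powr (\<gamma> - 2))) - B * (\<gamma> * ((\<gamma> - 1) * (t + s) powr (\<gamma> - 2)))" for t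
  have pw: "((\<lambda>t. (t + c) powr b) has_real_derivative b * (t + c) powr (b - 1)) (at t)" if "0 < t" "0 \<le> c" for t c b
    using that by (intro has_real_derivative_powr_shift) auto
  have d1: "(f has_real_derivative f1 t) (at t)" if "0 < t" for t unfolding f_def f1_def using that assms by (intro DERIV_diff DERIV_add DERIV_cmult pw DERIV_cmult_Id)
  have d2: "(f1 has_real_derivative f2 t) (at t)" if "0 < t" for t
  proof -
    have "(f1 has_real_derivative (0 + A * (\<gamma> * ((\<gamma> - 1) * (t + r) powr (\<gamma> - 1 - 1))) - B * (\<gamma> * ((\<gamma> - 1) * (t + s) powr (\<gamma> - 1 - 1))))) (at t)"
      unfolding f1_def using that assms by (intro DERIV_diff DERIV_add DERIV_cmult pw DERIV_const)
    then show ?thesis by (simp add: f2_def)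
  qed
  \<comment> \<open>The second derivative of the phase carries the negative factor \<gamma> - 1,
    whereas the test wants positive second differences; hence the negated phase.\<close>
  have "norm (\<Sum>n\<in>{p..<q}. expi (- f n)) \<le> 13 * 36 * (real q - real p) * sqrt \<mu> + 26 / sqrt \<mu>"
  proof (rule second_difference_test)
    fix n assume n: "p \<le> n" "n < q"
    obtain \<xi> where \<xi>: "real n \<le> \<xi>" "\<xi> \<le> n + 2" "f (real n + 2) - 2 * f (real n + 1) + f (real n) = f2 \<xi>"
      using n assms by (rule_tac second_difference_mvt[of "real n" f f1 f2]) (auto intro!: d1 d2)
    \<comment> \<open>The point n + 2 may exceed q by one, so \<xi> may exceed 2M; it stays below 3M
      because M is at least 1.\<close>
    have \<xi>M: "M \<le> \<xi>" "\<xi> \<le> 3 * M" using \<xi> n assms by linarith+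
    define W where "W = A * (\<xi> + r) powr (\<gamma> - 2) - B * (\<xi> + s) powr (\<gamma> - 2)"
    have W: "D * M powr (\<gamma> - 2) / 18 \<le> W" "W \<le> 2 * (D * M powr (\<gamma> - 2))"
      using two_powers_diff_bounds[of \<gamma> M \<xi> r \<sigma> s B A] assms \<xi>M by (auto simp: W_def D_def)
    have "- f2 \<xi> = \<gamma> * (1 - \<gamma>) * W" by (simp add: f2_def W_def algebra_simps)
    moreover have "\<gamma> * (1 - \<gamma>) * (D * M powr (\<gamma> - 2) / 18) \<le> \<gamma> * (1 - \<gamma>) * W" using W assms by (intro mult_left_mono) auto
    moreover have "\<gamma> * (1 - \<gamma>) * W \<le> \<gamma> * (1 - \<gamma>) * (2 * (D * M powr (\<gamma> - 2)))" using W assms by (intro mult_left_mono) auto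
    ultimately have "\<mu> \<le> - f2 \<xi>" "- f2 \<xi> \<le> 36 * \<mu>" by (simp_all add: \<mu>_def \<kappa>_def mult_ac)
    moreover have "- f2 \<xi> = - f (real (n + 2)) - 2 * - f (real (n + 1)) + - f (real n)" using \<xi>(3) by (simp add: add_ac)
    ultimately show "\<mu> \<le> - f (real (n + 2)) - 2 * - f (real (n + 1)) + - f (real n) \<and>
         - f (real (n + 2)) - 2 * - f (real (n + 1)) + - f (real n) \<le> 36 * \<mu>" by simp
  qed (use \<mu> assms in auto)
  also have "(\<Sum>n\<in>{p..<q}. expi (- f n)) = (\<Sum>n\<in>{p..<q}. expi (- (\<alpha> * n + A * (n + r) powr \<gamma> - B * (n + s) powr \<gamma>)))" by (simp add: f_def)
  also have "norm \<dots> = norm (\<Sum>n\<in>{p..<q}. expi (\<alpha> * n + A * (n + r) powr \<gamma> - B * (n + s) powr \<gamma>))" by (rule norm_sum_expi_minus)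
  finally have 1: "norm (\<Sum>n\<in>{p..<q}. expi (\<alpha> * n + A * (n + r) powr \<gamma> - B * (n + s) powr \<gamma>))
    \<le> 13 * 36 * (real q - real p) * sqrt \<mu> + 26 / sqrt \<mu>" .
  define R where "R = sqrt (D * M powr \<gamma>)"
  have R: "0 < R" using D assms by (simp add: R_def)
  have "\<mu> = \<kappa> * (D * M powr \<gamma>) / M\<^sup>2" using assms by (simp add: \<mu>_def powr_diff)
  then have sq: "sqrt \<mu> = sqrt \<kappa> * R / M" using assms by (simp add: R_def real_sqrt_mult real_sqrt_divide)
  have "sqrt \<kappa> \<le> 1" using \<kappa> by simp
  have "13 * 36 * (real q - real p) * sqrt \<mu> \<le> 13 * 36 * M * sqrt \<mu>" using assms \<mu> by (intro mult_right_mono) auto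
  also have "\<dots> = 468 * (sqrt \<kappa> * R)" using assms by (simp add: sq)
  also have "\<dots> \<le> 468 * (1 * R)" using \<open>sqrt \<kappa> \<le> 1\<close> R by (intro mult_left_mono mult_right_mono) auto
  finally have 2: "13 * 36 * (real q - real p) * sqrt \<mu> \<le> 468 * R" by simp
  have 3: "26 / sqrt \<mu> = 26 / sqrt \<kappa> * (M / R)" using assms R \<kappa> by (simp add: sq)
  have "(468 + 26 / sqrt \<kappa>) * (R + M / R) = 468 * R + 26 / sqrt \<kappa> * (M / R) + (468 * (M / R) + 26 / sqrt \<kappa> * R)"
    by (simp only: distrib_left distrib_right add_ac)
  moreover have "0 \<le> 468 * (M / R) + 26 / sqrt \<kappa> * R" using R assms \<kappa> by simp
  ultimately have "468 * R + 26 / sqrt \<kappa> * (M / R) \<le> (468 + 26 / sqrt \<kappa>) * (R + M / R)" by linarith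
  with 1 2 3 show ?thesis unfolding two_powers_const_def \<kappa>_def R_def D_def by linarith
qed

lemma two_powers_sum_bound:
  fixes A B M r s \<sigma> \<gamma> \<alpha> :: real and p q :: nat
  assumes "0 < \<gamma>" "\<gamma> < 1" "1 \<le> M" "0 \<le> r" "r \<le> \<sigma>" "0 \<le> s" "s \<le> \<sigma>"
    and "0 \<le> B" "0 \<le> A" "A \<noteq> B" "4 * \<sigma> * A \<le> M * \<bar>A - B\<bar>" "4 * \<sigma> * B \<le> M * \<bar>A - B\<bar>" "M \<le> p" "p \<le> q" "q \<le> 2 * M"
  shows "norm (\<Sum>n\<in>{p..<q}. expi (\<alpha> * n + A * (n + r) powr \<gamma> - B * (n + s) powr \<gamma>))
    \<le> two_powers_const \<gamma> * (sqrt (\<bar>A - B\<bar> * M powr \<gamma>) + M / sqrt (\<bar>A - B\<bar> * M powr \<gamma>))"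
proof (cases "B < A")
  case True
  then show ?thesis using two_powers_sum_bound_aux[of \<gamma> M r \<sigma> s B A p q \<alpha>] assms by simp
next
  case False
  have "norm (\<Sum>n\<in>{p..<q}. expi (\<alpha> * n + A * (n + r) powr \<gamma> - B * (n + s) powr \<gamma>))
     = norm (\<Sum>n\<in>{p..<q}. expi (- ((- \<alpha>) * n + B * (n + s) powr \<gamma> - A * (n + r) powr \<gamma>)))" by (simp add: algebra_simps)
  also have "\<dots> = norm (\<Sum>n\<in>{p..<q}. expi ((- \<alpha>) * n + B * (n + s) powr \<gamma> - A * (n + r) powr \<gamma>))" by (rule norm_sum_expi_minus)
  also have "\<dots> \<le> two_powers_const \<gamma> * (sqrt ((B - A) * M powr \<gamma>) + M / sqrt ((B - A) * M powr \<gamma>))"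
    using False assms by (intro two_powers_sum_bound_aux[of \<gamma> M s \<sigma> r A B p q "- \<alpha>"]) auto
  finally show ?thesis using False by simp
qed

section \<open>The bilinear estimate\<close>

lemma unimodular_weight:
  fixes z :: complex
  obtains w where "norm w \<le> 1" "of_real (norm z) = w * z"
proof (cases "z = 0")
  case True
  then show ?thesis by (intro that[of 0]) auto
next
  case False
  have "of_real (norm z) = cnj z / of_real (norm z) * z" using False complex_norm_square[of z] by (simp add: field_simps power2_eq_square)
  then show ?thesis using False by (intro that[of "cnj z / norm z"]) (auto simp: norm_divide)
qed

text \<open>Cauchy's inequality over \<open>m\<close> and over the classes of
  \<open>\<kappa>\<close> at once. Splitting \<open>S\<close> into classes before squaring costs the
  factor \<open>card T\<close>, but then only correlations of pairs from a common class survive, and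
  the coefficients disappear.\<close>

lemma sum_norm_sq_classes:
  fixes c :: "'p \<Rightarrow> complex" and E :: "nat \<Rightarrow> 'p \<Rightarrow> complex" and \<kappa> :: "'p \<Rightarrow> int"
  assumes fin: "finite U" "finite S" "finite T" and \<kappa>: "\<kappa> ` S \<subseteq> T" and c: "\<And>p. p \<in> S \<Longrightarrow> norm (c p) \<le> 1"
  shows "(\<Sum>m\<in>U. norm (\<Sum>p\<in>S. c p * E m p))\<^sup>2 \<le> real (card U) * real (card T) *
     (\<Sum>(p, p')\<in>{(p, p') \<in> S \<times> S. \<kappa> p = \<kappa> p'}. norm (\<Sum>m\<in>U. E m p * cnj (E m p')))"
proof -
  let ?SS = "{(p, p') \<in> S \<times> S. \<kappa> p = \<kappa> p'}"
  define Z where "Z m k = (\<Sum>p\<in>{p\<in>S. \<kappa> p = k}. c p * E m p)" for m k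
  have "(\<Sum>m\<in>U. norm (\<Sum>p\<in>S. c p * E m p)) = (\<Sum>m\<in>U. norm (\<Sum>k\<in>T. Z m k))" unfolding Z_def by (simp only: sum.group[OF fin(2,3) \<kappa>])
  also have "\<dots> \<le> (\<Sum>m\<in>U. \<Sum>k\<in>T. norm (Z m k))" by (intro sum_mono norm_sum)
  also have "\<dots> = (\<Sum>i\<in>U\<times>T. norm (Z (fst i) (snd i)))" by (simp add: sum.cartesian_product split_def)
  finally have "(\<Sum>m\<in>U. norm (\<Sum>p\<in>S. c p * E m p))\<^sup>2 \<le> (\<Sum>i\<in>U\<times>T. norm (Z (fst i) (snd i)))\<^sup>2" by (intro power_mono sum_nonneg) auto
  also have "\<dots> \<le> (\<Sum>i\<in>U\<times>T. (norm (Z (fst i) (snd i)))\<^sup>2) * real (card (U \<times> T))" by (rule sum_squared_le_sum_of_squares)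
  also have "(\<Sum>i\<in>U\<times>T. (norm (Z (fst i) (snd i)))\<^sup>2) = (\<Sum>m\<in>U. \<Sum>k\<in>T. (norm (Z m k))\<^sup>2)" by (simp add: sum.cartesian_product split_def)
  also have "\<dots> \<le> (\<Sum>(p, p')\<in>?SS. norm (\<Sum>m\<in>U. E m p * cnj (E m p')))"
  proof -
    have sq: "of_real ((norm (Z m k))\<^sup>2) = (\<Sum>p\<in>{p\<in>S. \<kappa> p = k}. \<Sum>p'\<in>{p\<in>S. \<kappa> p = k}. (c p * cnj (c p')) * (E m p * cnj (E m p')))" for m k
      unfolding complex_norm_square Z_def cnj_sum sum_product complex_cnj_mult by (simp only: mult_ac)
    have S2: "(\<Sum>k\<in>T. \<Sum>p\<in>{p\<in>S. \<kappa> p = k}. \<Sum>p'\<in>{p\<in>S. \<kappa> p = k}. G p p')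
       = (\<Sum>(p, p')\<in>?SS. G p p')" for G :: "'p \<Rightarrow> 'p \<Rightarrow> complex"
    proof -
      have "(\<Sum>k\<in>T. \<Sum>p\<in>{p\<in>S. \<kappa> p = k}. \<Sum>p'\<in>{p\<in>S. \<kappa> p = k}. G p p')
        = (\<Sum>k\<in>T. \<Sum>p\<in>{p\<in>S. \<kappa> p = k}. \<Sum>p'\<in>{p'\<in>S. \<kappa> p = \<kappa> p'}. G p p')" by (intro sum.cong refl) auto
      also have "\<dots> = (\<Sum>p\<in>S. \<Sum>p'\<in>{p'\<in>S. \<kappa> p = \<kappa> p'}. G p p')" by (rule sum.group[OF fin(2,3) \<kappa>])
      also have "\<dots> = (\<Sum>(p, p')\<in>(SIGMA p:S. {p'\<in>S. \<kappa> p = \<kappa> p'}). G p p')" using fin by (intro sum.Sigma) auto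
      also have "(SIGMA p:S. {p'\<in>S. \<kappa> p = \<kappa> p'}) = ?SS" by auto
      finally show ?thesis .
    qed
    have "of_real (\<Sum>m\<in>U. \<Sum>k\<in>T. (norm (Z m k))\<^sup>2)
      = (\<Sum>m\<in>U. \<Sum>(p, p')\<in>?SS. (c p * cnj (c p')) * (E m p * cnj (E m p')))" unfolding of_real_sum sq S2 ..
    also have "\<dots> = (\<Sum>(p, p')\<in>?SS. (c p * cnj (c p')) * (\<Sum>m\<in>U. E m p * cnj (E m p')))" unfolding split_def by (subst sum.swap) (simp only: sum_distrib_left)
    finally have eq: "complex_of_real (\<Sum>m\<in>U. \<Sum>k\<in>T. (norm (Z m k))\<^sup>2) = \<dots>" .
    have "(\<Sum>m\<in>U. \<Sum>k\<in>T. (norm (Z m k))\<^sup>2) = norm (complex_of_real (\<Sum>m\<in>U. \<Sum>k\<in>T. (norm (Z m k))\<^sup>2))"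
      unfolding norm_of_real by (intro abs_of_nonneg[symmetric] sum_nonneg) auto
    also have "\<dots> \<le> (\<Sum>(p, p')\<in>?SS. norm (\<Sum>m\<in>U. E m p * cnj (E m p')))" unfolding eq
    proof (rule sum_norm_le)
      fix i assume i: "i \<in> ?SS"
      obtain p p' where [simp]: "i = (p, p')" by (cases i)
      have "norm (c p) * norm (c p') \<le> 1 * 1" using i c by (intro mult_mono) auto
      then have "norm (c p * cnj (c p')) * norm (\<Sum>m\<in>U. E m p * cnj (E m p')) \<le> 1 * norm (\<Sum>m\<in>U. E m p * cnj (E m p'))"
        by (intro mult_right_mono) (auto simp: norm_mult)
      then show "norm (case i of (p, p') \<Rightarrow> c p * cnj (c p') * (\<Sum>m\<in>U. E m p * cnj (E m p')))
          \<le> (case i of (p, p') \<Rightarrow> norm (\<Sum>m\<in>U. E m p * cnj (E m p')))" by (simp only: \<open>i = (p, p')\<close> split norm_mult mult_1_left)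
    qed
    finally show ?thesis .
  qed
  finally show ?thesis by (simp add: mult_ac card_cartesian_product mult_right_mono mult_left_mono)
qed

definition twisted_phase :: "real \<Rightarrow> real \<Rightarrow> real \<Rightarrow> nat \<Rightarrow> nat \<Rightarrow> real" where
  "twisted_phase \<gamma> u \<alpha> h n = \<alpha> * n + h * (n + u) powr \<gamma>"

text \<open>Pulling n out of the power shows the phase, as a function of m, as a linear term plus a
  multiple of a power with shift u/n: the form treated by
  \<open>two_powers_sum_bound\<close>.\<close>

lemma twisted_phase_mult:
  assumes "0 < n" "0 \<le> u"
  shows "twisted_phase \<gamma> u \<alpha> h (m * n) = \<alpha> * n * m + (h * n powr \<gamma>) * (m + u / n) powr \<gamma>"
proof -
  have "real (m * n) + u = n * (m + u / n)" using assms by (simp add: field_simps)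
  then have "(real (m * n) + u) powr \<gamma> = n powr \<gamma> * (m + u / n) powr \<gamma>" using assms by (simp add: powr_mult)
  then show ?thesis by (simp add: twisted_phase_def mult_ac)
qed

lemma abs_ln_diff_le:
  fixes x y :: real
  assumes "0 < L" "L \<le> x" "L \<le> y"
  shows "\<bar>ln x - ln y\<bar> \<le> \<bar>x - y\<bar> / L"
proof -
  have *: "ln x - ln y \<le> \<bar>x - y\<bar> / L" if "L \<le> x" "L \<le> y" for x y
  proof -
    have "ln x - ln y = ln (x / y)" using that assms by (simp add: ln_div)
    also have "\<dots> \<le> x / y - 1" using that assms by (intro ln_le_minus_one) auto
    also have "\<dots> = (x - y) / y" using that assms by (simp add: field_simps)
    also have "\<dots> \<le> \<bar>x - y\<bar> / y" using that assms by (intro divide_right_mono) auto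
    also have "\<dots> \<le> \<bar>x - y\<bar> / L" using that assms by (intro divide_left_mono) auto
    finally show ?thesis .
  qed
  from *[of x y] *[of y x] assms show ?thesis by (auto simp: abs_le_iff abs_minus_commute)
qed

text \<open>Taking logarithms turns closeness of h n^\<gamma> and h' n'^\<gamma>, relative to their
  least possible value, into closeness of log ratios. The ranges up to 2H and 2N replace P * Q by 4
  H N, which explains 4 and 32 = 2 * 16.\<close>

lemma card_close_values:
  fixes H \<gamma> \<theta> :: real and N :: nat
  assumes "0 < \<gamma>" "\<gamma> < 1" "1 \<le> H" "1 \<le> N" "0 \<le> \<theta>" and hs: "\<And>h. h \<in> hs \<Longrightarrow> H \<le> real h \<and> real h \<le> 2 * H"
  shows "real (card {(p, p') \<in> (hs \<times> {N..<2*N}) \<times> (hs \<times> {N..<2*N}).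
      \<bar>real (fst p) * real (snd p) powr \<gamma> - real (fst p') * real (snd p') powr \<gamma>\<bar> \<le> \<theta> * (H * N powr \<gamma>)})
    \<le> (4 * H * N + 32 / \<gamma> * \<theta> * (H * N)\<^sup>2) * ((1 + ln (2 * H)) * (1 + ln (2 * real N)))"
proof -
  define P where "P = nat \<lfloor>2 * H\<rfloor>"
  have P: "0 < P" "real P \<le> 2 * H" "real P \<ge> 1" using assms by (auto simp: P_def le_nat_floor)
  have hsP: "h \<in> {1..P}" if "h \<in> hs" for h using hs[OF that] assms(3) by (auto simp: P_def le_nat_floor)
  let ?B = "{((h, h'), (n, n')). h \<in> {1..P} \<and> h' \<in> {1..P} \<and> n \<in> {1..2*N} \<and> n' \<in> {1..2*N} \<and>
       \<bar>\<gamma> * log_ratio (n, n') + log_ratio (h, h')\<bar> \<le> \<theta>}"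
  let ?A = "{(p, p') \<in> (hs \<times> {N..<2*N}) \<times> (hs \<times> {N..<2*N}).
      \<bar>real (fst p) * real (snd p) powr \<gamma> - real (fst p') * real (snd p') powr \<gamma>\<bar> \<le> \<theta> * (H * N powr \<gamma>)}"
  define r where "r = (\<lambda>((h, n), (h', n')). ((h, h'), (n, n')) :: (nat \<times> nat) \<times> (nat \<times> nat))"
  have "card ?A \<le> card ?B"
  proof (rule card_inj_on_le[of r])
    show "inj_on r ?A" by (auto simp: inj_on_def r_def)
    show "finite ?B" by (rule finite_subset[of _ "({1..P} \<times> {1..P}) \<times> ({1..2*N} \<times> {1..2*N})"]) auto
    show "r ` ?A \<subseteq> ?B"
    proof
      fix z assume "z \<in> r ` ?A"
      then obtain h n h' n' where z: "z = ((h, h'), (n, n'))" and *: "h \<in> hs" "h' \<in> hs" "n \<in> {N..<2*N}" "n' \<in> {N..<2*N}"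
        and le: "\<bar>h * n powr \<gamma> - h' * n' powr \<gamma>\<bar> \<le> \<theta> * (H * N powr \<gamma>)" by (auto simp: r_def)
      have big: "H * N powr \<gamma> \<le> k * m powr \<gamma>" if "k \<in> hs" "m \<in> {N..<2*N}" for k m :: nat
        using hs[OF that(1)] that(2) assms by (intro mult_mono powr_mono2) auto
      have HN: "0 < H * N powr \<gamma>" using assms by simp
      have "\<bar>ln (h * n powr \<gamma>) - ln (h' * n' powr \<gamma>)\<bar> \<le> \<bar>h * n powr \<gamma> - h' * n' powr \<gamma>\<bar> / (H * N powr \<gamma>)"
        using HN big * by (intro abs_ln_diff_le) auto
      also have "\<dots> \<le> \<theta>" using le HN by (simp add: divide_le_eq)
      also have "ln (h * n powr \<gamma>) - ln (h' * n' powr \<gamma>) = \<gamma> * log_ratio (n, n') + log_ratio (h, h')"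
        using hsP[OF *(1)] hsP[OF *(2)] * assms by (simp add: ln_mult ln_powr log_ratio_def algebra_simps)
      finally show "z \<in> ?B" using hsP[OF *(1)] hsP[OF *(2)] * assms unfolding z by simp
    qed
  qed
  then have "real (card ?A) \<le> real (card ?B)" by simp
  also have "\<dots> \<le> (real P * real (2 * N) + 2 / \<gamma> * \<theta> * (real P * real (2 * N))\<^sup>2) * ((1 + ln P) * (1 + ln (real (2 * N))))"
    using assms P by (intro card_close_quadruples) auto
  also have "\<dots> \<le> ((2 * H) * (2 * N) + 2 / \<gamma> * \<theta> * ((2 * H) * (2 * N))\<^sup>2) * ((1 + ln (2 * H)) * (1 + ln (2 * real N)))"
    using assms P by (intro mult_mono add_mono mult_left_mono power_mono) (auto intro!: add_nonneg_nonneg mult_nonneg_nonneg)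
  finally show ?thesis by (simp add: power2_eq_square mult_ac)
qed

text \<open>The saving is \<open>s\<close>. Cauchy's inequality groups the pairs p = (h, n) into
  about H N / s^2 classes of nearly equal values h n^\<gamma>. In a class, the very close pairs are
  few enough for the trivial bound M, and for the others the second derivative test in m saves s^2.
  Of the conditions, c1 makes the number of classes at least one; c2 bounds the first term of the
  test by M / s^2; c3 bounds the number of very close pairs by a multiple of H N, up to logarithms;
  c4 makes the shifts u/n harmless.\<close>

theorem bilinear_bound:
  fixes H s \<gamma> u \<alpha> :: real and M N :: nat
  assumes \<gamma>: "0 < \<gamma>" "\<gamma> < 1" and "1 \<le> H" "1 \<le> N" "1 \<le> M" "1 \<le> s" "0 \<le> u" "u \<le> 1"
    and fin: "finite hs" and hs: "\<And>h. h \<in> hs \<Longrightarrow> H \<le> real h \<and> real h \<le> 2 * H"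
    and a: "\<And>m. norm (a m) \<le> 1" and b: "\<And>n. norm (b n) \<le> 1"
    and F: "F = H * (real M * N) powr \<gamma>"
    and c1: "s\<^sup>2 \<le> H * N" and c2: "s ^ 6 * F \<le> H * N * (real M)\<^sup>2"
    and c3: "s ^ 4 * H * N \<le> F" and c4: "F \<le> s ^ 4 * M * N"
  shows "(\<Sum>h\<in>hs. norm (\<Sum>m\<in>{M..<2*M}. \<Sum>n\<in>{N..<2*N}. a m * b n * expi (twisted_phase \<gamma> u \<alpha> h (m * n))))\<^sup>2
    \<le> 9000 / \<gamma> * two_powers_const \<gamma> * ((1 + ln (2 * H)) * (1 + ln (2 * real N))) * (H * M * N / s)\<^sup>2"
proof -
  define S where "S = hs \<times> {N..<2*N}"
  have finS: "finite S" using fin by (simp add: S_def)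
  define y where "y = H * N powr \<gamma>"
  have y: "0 < y" using assms by (simp add: y_def)
  have Fy: "F = y * M powr \<gamma>" using assms by (simp add: F y_def powr_mult)
  have F0: "0 < F" using assms by (simp add: F)
  define A where "A p = fst p * snd p powr \<gamma>" for p :: "nat \<times> nat"
  have A: "y \<le> A p" "A p \<le> 4 * y" if pS: "p \<in> S" for p
  proof -
    obtain h n where p: "p = (h, n)" "h \<in> hs" "n \<in> {N..<2*N}" using pS by (cases p) (auto simp: S_def)
    show "y \<le> A p" unfolding y_def A_def p using hs[OF p(2)] p(3) assms by (auto intro!: mult_mono powr_mono2)
    have "real n powr \<gamma> \<le> (2 * N) powr \<gamma>" using p assms by (intro powr_mono2) auto
    also have "\<dots> \<le> 2 * N powr \<gamma>" using assms powr_mono[of \<gamma> 1 2] by (simp add: powr_mult)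
    finally have "real n powr \<gamma> \<le> 2 * N powr \<gamma>" .
    then have "real h * n powr \<gamma> \<le> (2 * H) * (2 * N powr \<gamma>)" using hs[OF p(2)] assms by (intro mult_mono) auto
    then show "A p \<le> 4 * y" by (simp add: A_def y_def p)
  qed
  \<comment> \<open>Up to a constant this is the number of classes; rounding up costs at most a
    factor 2 because c1 makes the quotient at least 1.\<close>
  define K where "K = nat \<lceil>H * N / s\<^sup>2\<rceil>"
  have HNs: "1 \<le> H * N / s\<^sup>2" using c1 assms by simp
  have K: "H * N / s\<^sup>2 \<le> real K" "real K \<le> 2 * (H * N / s\<^sup>2)" "1 \<le> K" using HNs by (auto simp: K_def of_nat_ceiling) linarith+
  define \<kappa> where "\<kappa> p = \<lfloor>K * (A p / y)\<rfloor>" for p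
  \<comment> \<open>Relative to y, \<theta>0 bounds the width of a class and \<theta>1 separates
    very close pairs from the rest. The power s^4 makes the second term of the derivative test at
    most M / s^2, and 16 is what the separation condition of \<open>two_powers_sum_bound\<close>
    asks for with shifts up to 1/N and values up to 4y.\<close>
  define \<theta>0 where "\<theta>0 = s\<^sup>2 / (H * N)"
  define \<theta>1 where "\<theta>1 = 16 * s ^ 4 / F"
  have \<theta>: "0 \<le> \<theta>0" "0 < \<theta>1" using assms F0 by (auto simp: \<theta>0_def \<theta>1_def)
  define LL where "LL = (1 + ln (2 * H)) * (1 + ln (2 * real N))"
  have LL: "0 \<le> LL" using assms unfolding LL_def by (intro mult_nonneg_nonneg add_nonneg_nonneg) auto
  define E where "E m p = expi (twisted_phase \<gamma> u \<alpha> (fst p) (m * snd p))" for m :: nat and p :: "nat \<times> nat"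
  define K2 where "K2 = two_powers_const \<gamma>"
  have "0 \<le> 26 / sqrt (\<gamma> * (1 - \<gamma>) / 18)" using assms by simp
  then have K2: "1 \<le> K2" by (simp add: K2_def two_powers_const_def)
  define W where "W p p' = norm (\<Sum>m\<in>{M..<2*M}. E m p * cnj (E m p'))" for p p'
  have near: "\<bar>A p - A p'\<bar> \<le> \<theta>0 * y" if "p \<in> S" "p' \<in> S" "\<kappa> p = \<kappa> p'" for p p'
  proof -
    have "\<bar>K * (A p / y) - K * (A p' / y)\<bar> \<le> 1" using that(3) unfolding \<kappa>_def by linarith
    moreover have "K * (A p / y) - K * (A p' / y) = K / y * (A p - A p')" by (simp add: algebra_simps)
    ultimately have "K / y * \<bar>A p - A p'\<bar> \<le> 1" using y by (simp add: abs_mult)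
    then have "\<bar>A p - A p'\<bar> \<le> y / K" using y K by (simp add: field_simps)
    also have "\<dots> \<le> y / (H * N / s\<^sup>2)"
    proof (intro divide_left_mono)
      show "0 < real K * (H * N / s\<^sup>2)" using K HNs by (intro mult_pos_pos) linarith+
    qed (use K y in auto)
    finally show ?thesis by (simp add: \<theta>0_def mult_ac)
  qed
  have Wle: "W p p' \<le> M" for p p'
  proof -
    have "W p p' \<le> (\<Sum>m\<in>{M..<2*M}. 1)" unfolding W_def by (rule sum_norm_le) (simp add: E_def norm_mult)
    then show ?thesis by simp
  qed
  have Wfar: "W p p' \<le> K2 * (2 * M / s\<^sup>2)" if pp: "p \<in> S" "p' \<in> S" "\<kappa> p = \<kappa> p'" "\<theta>1 * y < \<bar>A p - A p'\<bar>" for p p'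
  proof -
    obtain h n h' n' where p: "p = (h, n)" "p' = (h', n')" by (cases p, cases p')
    have n: "N \<le> n" "N \<le> n'" using pp assms by (auto simp: p S_def)
    then have n0: "0 < n" "0 < n'" using assms by auto
    have "E m p * cnj (E m p') = expi ((\<alpha> * n - \<alpha> * n') * m + A p * (m + u / n) powr \<gamma> - A p' * (m + u / n') powr \<gamma>)" for m
    proof -
      have "E m p * cnj (E m p') = expi (twisted_phase \<gamma> u \<alpha> h (m * n) - twisted_phase \<gamma> u \<alpha> h' (m * n'))" by (simp add: E_def p expi_diff)
      also have "twisted_phase \<gamma> u \<alpha> h (m * n) - twisted_phase \<gamma> u \<alpha> h' (m * n')
        = (\<alpha> * n - \<alpha> * n') * m + A p * (m + u / n) powr \<gamma> - A p' * (m + u / n') powr \<gamma>"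
        unfolding twisted_phase_mult[OF n0(1) \<open>0 \<le> u\<close>] twisted_phase_mult[OF n0(2) \<open>0 \<le> u\<close>] by (simp add: A_def p algebra_simps)
      finally show ?thesis .
    qed
    then have W: "W p p' = norm (\<Sum>m\<in>{M..<2*M}. expi ((\<alpha> * n - \<alpha> * n') * m + A p * (m + u / n) powr \<gamma> - A p' * (m + u / n') powr \<gamma>))"
      by (simp add: W_def)
    define D where "D = \<bar>A p - A p'\<bar>"
    have D: "\<theta>1 * y < D" "D \<le> \<theta>0 * y" using near[OF pp(1-3)] pp(4) by (auto simp: D_def)
    have "0 < \<theta>1 * y" using \<theta> y by simp
    then have D0: "0 < D" using D(1) by linarith
    then have DM: "0 < D * M powr \<gamma>" using \<open>1 \<le> M\<close> by simp
    have "4 * (1 / N) * (4 * y) \<le> M * (\<theta>1 * y)"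
    proof -
      have "16 / N * F \<le> 16 / N * (s ^ 4 * M * N)" using c4 assms by (intro mult_left_mono) auto
      also have "\<dots> = M * (16 * s ^ 4)" using assms by simp
      finally have "16 / N \<le> M * (16 * s ^ 4) / F" using F0 by (simp add: pos_le_divide_eq)
      then have "16 / N * y \<le> M * (16 * s ^ 4) / F * y" using y by (intro mult_right_mono) auto
      then show ?thesis by (simp add: \<theta>1_def)
    qed
    also have "\<dots> \<le> M * D" using D by (intro mult_left_mono) auto
    finally have sep: "4 * (1 / N) * (4 * y) \<le> M * D" .
    have sepA: "4 * (1 / N) * A q \<le> M * D" if "q \<in> S" for q using A[OF that] sep assms mult_left_mono[OF A(2)[OF that], of "4 * (1 / N)"] by (auto intro: order_trans)
    have un: "u / n \<le> 1 / N" "u / n' \<le> 1 / N" using n assms by (auto intro!: frac_le)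
    have "W p p' \<le> K2 * (sqrt (D * M powr \<gamma>) + M / sqrt (D * M powr \<gamma>))" unfolding W K2_def D_def
    proof (rule two_powers_sum_bound[where \<sigma> = "1 / N"])
      show "4 * (1 / real N) * A p \<le> real M * \<bar>A p - A p'\<bar>" "4 * (1 / real N) * A p' \<le> real M * \<bar>A p - A p'\<bar>" using sepA pp D_def by auto
      show "0 \<le> A p'" "0 \<le> A p" by (auto simp: A_def)
      show "A p \<noteq> A p'" using D0 by (auto simp: D_def)
    qed (use assms un in auto)
    also have "\<dots> \<le> K2 * (M / s\<^sup>2 + M / s\<^sup>2)"
    proof (intro mult_left_mono add_mono)
      have "D * M powr \<gamma> \<le> \<theta>0 * y * M powr \<gamma>" using D by (intro mult_right_mono) auto
      also have "\<dots> = s\<^sup>2 * F / (H * N)" by (simp add: \<theta>0_def Fy)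
      also have "\<dots> \<le> (M / s\<^sup>2)\<^sup>2"
      proof -
        have "s ^ 4 * (s\<^sup>2 * F) \<le> H * N * (real M)\<^sup>2" using c2 by (simp add: mult.assoc[symmetric] power_add[symmetric])
        then show ?thesis using assms by (simp add: field_simps power_divide power_mult[symmetric])
      qed
      finally show "sqrt (D * M powr \<gamma>) \<le> M / s\<^sup>2" by (intro real_le_lsqrt) auto
      have "(s\<^sup>2)\<^sup>2 \<le> \<theta>1 * F" using F0 assms by (simp add: \<theta>1_def power_mult[symmetric])
      also have "\<dots> = \<theta>1 * y * M powr \<gamma>" by (simp add: Fy)
      also have "\<dots> \<le> D * M powr \<gamma>" using D by (intro mult_right_mono) auto
      finally have "s\<^sup>2 \<le> sqrt (D * M powr \<gamma>)" by (rule real_le_rsqrt)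
      then show "M / sqrt (D * M powr \<gamma>) \<le> M / s\<^sup>2" using assms DM by (intro divide_left_mono mult_pos_pos) auto
    qed (use K2 in auto)
    finally show ?thesis by simp
  qed
  define Q where "Q \<theta> = {(p, p') \<in> S \<times> S. \<bar>A p - A p'\<bar> \<le> \<theta> * y}" for \<theta>
  have finQ: "finite (Q \<theta>)" for \<theta> using finS by (rule_tac finite_subset[of _ "S \<times> S"]) (auto simp: Q_def)
  have cardQ: "real (card (Q \<theta>)) \<le> (4 * H * N + 32 / \<gamma> * \<theta> * (H * N)\<^sup>2) * LL" if "0 \<le> \<theta>" for \<theta>
    unfolding Q_def S_def A_def LL_def y_def using assms that by (intro card_close_values) auto
  have HN: "0 < H * N" using assms by simp
  have Q1: "real (card (Q \<theta>1)) \<le> 516 / \<gamma> * (H * N) * LL"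
  proof -
    have "\<theta>1 * (H * N) \<le> 16" using c3 F0 by (simp add: \<theta>1_def divide_le_eq mult_ac)
    then have "\<theta>1 * (H * N) * (H * N) \<le> 16 * (H * N)" using HN by (intro mult_right_mono) auto
    then have "32 / \<gamma> * (\<theta>1 * (H * N) * (H * N)) \<le> 32 / \<gamma> * (16 * (H * N))" using \<gamma> by (intro mult_left_mono) auto
    moreover have "4 * (H * N) \<le> 4 / \<gamma> * (H * N)" using \<gamma> HN by (intro mult_right_mono) (auto simp: field_simps)
    moreover have "4 * H * N + 32 / \<gamma> * \<theta>1 * (H * N)\<^sup>2 = 4 * (H * N) + 32 / \<gamma> * (\<theta>1 * (H * N) * (H * N))" by (simp add: power2_eq_square mult_ac)
    moreover have "516 / \<gamma> * (H * N) = 32 / \<gamma> * (16 * (H * N)) + 4 / \<gamma> * (H * N)" by (simp add: add_divide_distrib[symmetric])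
    ultimately have "4 * H * N + 32 / \<gamma> * \<theta>1 * (H * N)\<^sup>2 \<le> 516 / \<gamma> * (H * N)" by linarith
    then show ?thesis using \<theta> by (intro order_trans[OF cardQ mult_right_mono[OF _ LL]]) auto
  qed
  have Q0: "real (card (Q \<theta>0)) \<le> 36 / \<gamma> * s\<^sup>2 * (H * N) * LL"
  proof -
    have "1 \<le> s\<^sup>2" using assms by (simp add: one_le_power)
    have "4 * (H * N) \<le> 4 / \<gamma> * s\<^sup>2 * (H * N)"
    proof (intro mult_right_mono)
      have "4 * 1 \<le> (4 / \<gamma>) * s\<^sup>2" using \<gamma> \<open>1 \<le> s\<^sup>2\<close> by (intro mult_mono) (auto simp: field_simps)
      then show "4 \<le> 4 / \<gamma> * s\<^sup>2" by simp
    qed (use HN in auto)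
    moreover have "32 / \<gamma> * \<theta>0 * (H * N)\<^sup>2 = 32 / \<gamma> * s\<^sup>2 * (H * N)" using HN by (simp add: \<theta>0_def power2_eq_square)
    moreover have "36 / \<gamma> * s\<^sup>2 * (H * N) = 4 / \<gamma> * s\<^sup>2 * (H * N) + 32 / \<gamma> * s\<^sup>2 * (H * N)"
      by (simp add: distrib_right[symmetric] add_divide_distrib[symmetric])
    moreover have "4 * H * N = 4 * (H * N)" by simp
    ultimately have "4 * H * N + 32 / \<gamma> * \<theta>0 * (H * N)\<^sup>2 \<le> 36 / \<gamma> * s\<^sup>2 * (H * N)" by linarith
    then show ?thesis using \<theta> by (intro order_trans[OF cardQ mult_right_mono[OF _ LL]]) auto
  qed
  \<comment> \<open>Every pair in a class is counted in \<open>Q \<theta>0\<close> with the bound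
    from the derivative test, and the very close ones in \<open>Q \<theta>1\<close> with the trivial
    bound. The factor s^2 in the first count cancels the saving of the test, so both contributions
    have the same order.\<close>
  have sumW: "(\<Sum>(p, p')\<in>{(p, p') \<in> S \<times> S. \<kappa> p = \<kappa> p'}. W p p') \<le> 600 / \<gamma> * K2 * (H * N) * LL * M"
  proof -
    have "(\<Sum>(p, p')\<in>{(p, p') \<in> S \<times> S. \<kappa> p = \<kappa> p'}. W p p')
       \<le> (\<Sum>i\<in>{(p, p') \<in> S \<times> S. \<kappa> p = \<kappa> p'}. (if i \<in> Q \<theta>1 then real M else 0) + (if i \<in> Q \<theta>0 then K2 * (2 * M / s\<^sup>2) else 0))"
    proof (rule sum_mono)
      fix i assume i: "i \<in> {(p, p') \<in> S \<times> S. \<kappa> p = \<kappa> p'}"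
      obtain p p' where [simp]: "i = (p, p')" by (cases i)
      have i0: "i \<in> Q \<theta>0" using near i by (auto simp: Q_def)
      have pos: "0 \<le> K2 * (2 * M / s\<^sup>2)" using K2 by simp
      show "(case i of (p, p') \<Rightarrow> W p p') \<le> (if i \<in> Q \<theta>1 then real M else 0) + (if i \<in> Q \<theta>0 then K2 * (2 * M / s\<^sup>2) else 0)"
      proof (cases "i \<in> Q \<theta>1")
        case True
        then show ?thesis using Wle[of p p'] pos by simp
      next
        case False
        then show ?thesis using Wfar[of p p'] i i0 by (auto simp: Q_def)
      qed
    qed
    also have "\<dots> \<le> (\<Sum>i\<in>S \<times> S. (if i \<in> Q \<theta>1 then real M else 0) + (if i \<in> Q \<theta>0 then K2 * (2 * M / s\<^sup>2) else 0))"
      using finS K2 by (intro sum_mono2) auto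
    also have "\<dots> = real (card (Q \<theta>1)) * M + real (card (Q \<theta>0)) * (K2 * (2 * M / s\<^sup>2))"
    proof -
      have "S \<times> S \<inter> Q \<theta> = Q \<theta>" for \<theta> by (auto simp: Q_def)
      then show ?thesis using finS finQ by (simp add: sum.distrib sum.If_cases Int_def[symmetric])
    qed
    also have "\<dots> \<le> 516 / \<gamma> * (H * N) * LL * M + 36 / \<gamma> * s\<^sup>2 * (H * N) * LL * (K2 * (2 * M / s\<^sup>2))"
      using Q1 Q0 K2 by (intro add_mono mult_right_mono) auto
    also have "\<dots> = (516 + 72 * K2) * (1 / \<gamma> * (H * N) * LL * M)" using assms by (simp add: field_simps)
    also have "\<dots> \<le> (600 * K2) * (1 / \<gamma> * (H * N) * LL * M)" using K2 \<gamma> \<open>1 \<le> H\<close> LL by (intro mult_right_mono mult_nonneg_nonneg) auto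
    finally show ?thesis by (simp add: mult_ac)
  qed
  define T where "T = {int K..4 * int K}"
  have \<kappa>T: "\<kappa> ` S \<subseteq> T"
  proof
    fix k assume "k \<in> \<kappa> ` S"
    then obtain p where p: "p \<in> S" "k = \<kappa> p" by auto
    have "1 \<le> A p / y" "A p / y \<le> 4" using A[OF p(1)] y by (auto simp: field_simps)
    then have "K * 1 \<le> K * (A p / y)" "K * (A p / y) \<le> K * 4" using mult_left_mono[of 1 "A p / y" "real K"] mult_left_mono[of "A p / y" 4 "real K"] by auto
    then show "k \<in> T" unfolding p(2) T_def \<kappa>_def by (auto simp: le_floor_iff floor_le_iff)
  qed
  define Y where "Y h = (\<Sum>m\<in>{M..<2*M}. \<Sum>n\<in>{N..<2*N}. a m * b n * expi (twisted_phase \<gamma> u \<alpha> h (m * n)))" for h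
  \<comment> \<open>Absolute values become weights w h of modulus at most 1, so that h joins n in a
    pair with bounded coefficient w h * b n and the sum over m can be pulled outside.\<close>
  have "\<exists>w. norm w \<le> 1 \<and> of_real (norm (Y h)) = w * Y h" for h by (rule unimodular_weight[of "Y h"]) blast
  then obtain w where w: "\<And>h. norm (w h) \<le> 1" "\<And>h. of_real (norm (Y h)) = w h * Y h" by metis
  define c where "c p = w (fst p) * b (snd p)" for p
  have cle: "norm (c p) \<le> 1" for p unfolding c_def norm_mult using w(1) b by (intro mult_le_one) auto
  define X where "X = (\<Sum>h\<in>hs. norm (Y h))"
  have "complex_of_real X = (\<Sum>h\<in>hs. w h * Y h)" unfolding X_def of_real_sum w(2) ..
  also have "\<dots> = (\<Sum>h\<in>hs. \<Sum>m\<in>{M..<2*M}. a m * (\<Sum>n\<in>{N..<2*N}. c (h, n) * E m (h, n)))"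
    by (simp only: Y_def sum_distrib_left c_def E_def fst_conv snd_conv mult_ac)
  also have "\<dots> = (\<Sum>m\<in>{M..<2*M}. \<Sum>h\<in>hs. a m * (\<Sum>n\<in>{N..<2*N}. c (h, n) * E m (h, n)))" by (rule sum.swap)
  also have "\<dots> = (\<Sum>m\<in>{M..<2*M}. a m * (\<Sum>h\<in>hs. \<Sum>n\<in>{N..<2*N}. c (h, n) * E m (h, n)))" by (simp only: sum_distrib_left)
  also have "\<dots> = (\<Sum>m\<in>{M..<2*M}. a m * (\<Sum>p\<in>S. c p * E m p))" unfolding S_def sum.cartesian_product split_def by simp
  finally have Xeq: "complex_of_real X = (\<Sum>m\<in>{M..<2*M}. a m * (\<Sum>p\<in>S. c p * E m p))" .
  have X0: "0 \<le> X" by (auto simp: X_def intro: sum_nonneg)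
  have "X = norm (complex_of_real X)" using X0 by simp
  also have "\<dots> \<le> (\<Sum>m\<in>{M..<2*M}. norm (\<Sum>p\<in>S. c p * E m p))" unfolding Xeq
  proof (rule sum_norm_le)
    fix m
    show "norm (a m * (\<Sum>p\<in>S. c p * E m p)) \<le> norm (\<Sum>p\<in>S. c p * E m p)"
      using mult_right_mono[OF a[of m], of "norm (\<Sum>p\<in>S. c p * E m p)"] by (simp add: norm_mult)
  qed
  finally have "X\<^sup>2 \<le> (\<Sum>m\<in>{M..<2*M}. norm (\<Sum>p\<in>S. c p * E m p))\<^sup>2" using X0 by (intro power_mono) auto
  also have "\<dots> \<le> real (card {M..<2*M}) * real (card T) * (\<Sum>(p, p')\<in>{(p, p') \<in> S \<times> S. \<kappa> p = \<kappa> p'}. W p p')"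
    unfolding W_def using finS \<kappa>T cle by (intro sum_norm_sq_classes) (auto simp: T_def)
  also have "\<dots> \<le> real M * (4 * real K) * (600 / \<gamma> * K2 * (H * N) * LL * M)"
  proof (intro mult_mono sumW)
    have "card T = 3 * K + 1" by (simp add: T_def nat_add_distrib nat_mult_distrib)
    then show "real (card T) \<le> 4 * real K" using K by simp
    show "0 \<le> (\<Sum>(p, p')\<in>{(p, p') \<in> S \<times> S. \<kappa> p = \<kappa> p'}. W p p')" by (rule sum_nonneg) (auto simp: W_def)
  qed auto
  also have "\<dots> \<le> real M * (4 * (2 * (H * N / s\<^sup>2))) * (600 / \<gamma> * K2 * (H * N) * LL * M)"
    using K K2 \<gamma> \<open>1 \<le> H\<close> LL by (intro mult_right_mono mult_left_mono mult_nonneg_nonneg) auto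
  also have "\<dots> = 4800 / \<gamma> * K2 * LL * (H * M * N / s)\<^sup>2" by (simp add: power2_eq_square mult_ac)
  also have "\<dots> \<le> 9000 / \<gamma> * K2 * LL * (H * M * N / s)\<^sup>2" using K2 \<gamma> LL by (intro mult_right_mono divide_right_mono) auto
  finally show ?thesis unfolding X_def Y_def K2_def LL_def .
qed

section \<open>Exponent pairs for perturbed powers\<close>

text \<open>Normalised to tend to 1 at 0: it is the factor by which the difference (t + q)^\<gamma>
  - t^\<gamma> deviates from its leading term \<gamma> q t^(\<gamma> - 1), evaluated at x =
  q/t.\<close>

definition binom_quot :: "real \<Rightarrow> real \<Rightarrow> real" where
  "binom_quot \<gamma> x = ((1 + x) powr \<gamma> - 1) / (\<gamma> * x)"

definition cbinom_quot :: "real \<Rightarrow> complex \<Rightarrow> complex" where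
  "cbinom_quot \<gamma> z = (if z = 0 then 1 else ((1 + z) powr of_real \<gamma> - 1) / (of_real \<gamma> * z))"

text \<open>The singularity at 0 is removable: this is the difference quotient at 0 of (1 +
  z)^\<gamma> / \<gamma>, whose derivative there is 1.\<close>

lemma cbinom_quot_holomorphic:
  assumes "0 < \<gamma>"
  shows "cbinom_quot \<gamma> holomorphic_on ball 0 1"
proof -
  define f where "f z = (1 + z) powr of_real \<gamma> / of_real \<gamma>" for z :: complex
  have nz: "1 + z \<notin> \<real>\<^sub>\<le>\<^sub>0" if "z \<in> ball 0 1" for z :: complex
  proof
    assume "1 + z \<in> \<real>\<^sub>\<le>\<^sub>0"
    then have "Re z \<le> -1" by (auto simp: complex_nonpos_Reals_iff)
    then show False using that abs_Re_le_cmod[of z] by simp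
  qed
  have d: "(f has_field_derivative (1 + z) powr (of_real \<gamma> - 1)) (at z)" if "z \<in> ball 0 1" for z unfolding f_def using nz[OF that] assms
    by (auto intro!: derivative_eq_intros simp: field_simps)
  have hol: "f holomorphic_on ball 0 1" unfolding holomorphic_on_def field_differentiable_def using has_field_derivative_at_within[OF d] by blast
  have "deriv f 0 = 1" using DERIV_imp_deriv[OF d[of 0]] by simp
  moreover have "(\<lambda>z. if z = 0 then deriv f 0 else (f z - f 0) / (z - 0)) holomorphic_on ball 0 1" by (rule pole_lemma[OF hol]) simp
  moreover have "(\<lambda>z. if z = 0 then 1 else (f z - f 0) / (z - 0)) = cbinom_quot \<gamma>"
    by (rule ext) (use assms in \<open>simp add: cbinom_quot_def f_def field_simps\<close>)
  ultimately show ?thesis by (simp only:)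
qed

lemma cbinom_quot_of_real:
  assumes "0 < x" "0 < \<gamma>"
  shows "cbinom_quot \<gamma> (of_real x) = of_real (binom_quot \<gamma> x)"
proof -
  have "(1 + complex_of_real x) powr of_real \<gamma> = of_real ((1 + x) powr \<gamma>)" using powr_of_real[of "1 + x" \<gamma>] assms by simp
  then show ?thesis using assms by (simp add: cbinom_quot_def binom_quot_def)
qed

lemma binom_quot_pos:
  assumes "0 < x" "0 < \<gamma>"
  shows "0 < binom_quot \<gamma> x"
proof -
  have "1 powr \<gamma> < (1 + x) powr \<gamma>" using assms by (intro powr_less_mono2) auto
  then show ?thesis using assms by (simp add: binom_quot_def)
qed

text \<open>
  If \<open>f t = t\<^sup>-\<^sup>b A\<^sub>0 (q/t)\<close>, then the \<open>p\<close>-th derivative of \<open>f\<close> is \<open>t\<^sup>-\<^sup>b\<^sup>-\<^sup>p A\<^sub>p (q/t)\<close>.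
\<close>
fun power_coeff :: "(complex \<Rightarrow> complex) \<Rightarrow> real \<Rightarrow> nat \<Rightarrow> complex \<Rightarrow> complex" where
  "power_coeff A b 0 = A"
| "power_coeff A b (Suc p) = (\<lambda>z. - of_real (b + p) * power_coeff A b p z - z * deriv (power_coeff A b p) z)"

lemma power_coeff_holomorphic:
  assumes "A holomorphic_on S" "open S"
  shows "power_coeff A b p holomorphic_on S" by (induction p) (auto intro!: holomorphic_intros holomorphic_deriv assms)

lemma power_coeff_0: "A 0 = 1 \<Longrightarrow> power_coeff A b p 0 = (-1) ^ p * of_real (pochhammer b p)" by (induction p) (simp_all add: pochhammer_Suc algebra_simps)

text \<open>The p-th derivative of a perturbed power is t^(-b - p) times a continuous function of
  q/t whose value at 0 is that of the pure power. For small q/t this lies within relative error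
  \<open>\<epsilon>\<close> for the finitely many orders up to \<open>P\<close>, and the smallness
  \<open>z0\<close> depends neither on N and y nor on the interval. A separate function g appears
  because \<open>f\<close> is prescribed on the interval only.\<close>

lemma phase_class_near_power_aux:
  assumes hol: "A holomorphic_on ball 0 r" "0 < r" and A0: "A 0 = 1" and "0 < b" "0 < \<epsilon>"
  obtains z0 where "0 < z0" "z0 < r"
    "\<And>N q y a' b' f. \<lbrakk>0 < q; q \<le> z0 * N; N \<le> a'; a' < b'; b' \<le> 2 * N; 0 < y;
      (\<And>t. a' \<le> t \<Longrightarrow> t \<le> b' \<Longrightarrow> f t = - (y / b) * t powr (- b) * Re (A (of_real (q / t))))\<rbrakk> \<Longrightarrow>
      \<exists>g. phase_class N P (b + 1) y \<epsilon> a' b' g \<and> (\<forall>t\<in>{a'..b'}. g t = f t)"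
proof -
  define B where "B = power_coeff A b"
  define a where "a p x = Re (B p (of_real x))" for p x
  have holB: "B p holomorphic_on ball 0 r" for p unfolding B_def using hol by (intro power_coeff_holomorphic) auto
  have B0: "B p 0 = (-1) ^ p * of_real (pochhammer b p)" for p unfolding B_def using A0 by (rule power_coeff_0)
  have a0: "a p 0 = (-1) ^ p * pochhammer b p" for p
  proof -
    have "B p 0 = of_real ((-1) ^ p * pochhammer b p)" by (simp add: B0)
    then show ?thesis unfolding a_def by (simp only: of_real_0 Re_complex_of_real)
  qed
  have dB: "(B p has_field_derivative deriv (B p) z) (at z)" if "norm z < r" for p z using holB[of p] that by (intro holomorphic_derivI[of _ "ball 0 r"]) auto
  have da: "(a p has_real_derivative Re (deriv (B p) (of_real x))) (at x)" if "\<bar>x\<bar> < r" for p x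
  proof -
    have "((\<lambda>x. B p (of_real x)) has_vector_derivative deriv (B p) (of_real x)) (at x)" using dB[of "of_real x" p] that by (intro has_vector_derivative_real_field) auto
    then have "((\<lambda>x. Re (B p (of_real x))) has_vector_derivative Re (deriv (B p) (of_real x))) (at x)" by (rule bounded_linear.has_vector_derivative[OF bounded_linear_Re])
    then show ?thesis unfolding a_def[abs_def] by (simp add: has_real_derivative_iff_has_vector_derivative)
  qed
  have aSuc: "a (Suc p) x = - (b + p) * a p x - x * Re (deriv (B p) (of_real x))" for p x by (simp add: a_def B_def)
  have poch: "0 < pochhammer (b + 1) p" for p using assms by (intro pochhammer_pos) auto
  have cont: "((\<lambda>x. a p x) \<longlongrightarrow> a p 0) (nhds 0)" for p
  proof -
    have "isCont (a p) 0" using da[of 0 p] hol DERIV_isCont by fastforce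
    then show ?thesis by (simp add: continuous_at isCont_def tendsto_nhds_iff)
  qed
  have "\<forall>\<^sub>F x in nhds 0. \<forall>p\<in>{..<P}. dist (a (Suc p) x) (a (Suc p) 0) < \<epsilon> * (b * pochhammer (b + 1) p)"
    using assms poch by (intro eventually_ball_finite ballI tendstoD[OF cont] mult_pos_pos) auto
  then obtain d where d: "0 < d" "\<And>x p. dist x 0 < d \<Longrightarrow> p < P \<Longrightarrow>
      dist (a (Suc p) x) (a (Suc p) 0) < \<epsilon> * (b * pochhammer (b + 1) p)" unfolding eventually_nhds_metric by auto
  define z0 where "z0 = min (d / 2) (r / 2)"
  show ?thesis
  proof (rule that[of z0])
    show "0 < z0" "z0 < r" using d hol by (auto simp: z0_def)
    fix N q y a' b' :: real and f :: "real \<Rightarrow> real"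
    assume *: "0 < q" "q \<le> z0 * N" "N \<le> a'" "a' < b'" "b' \<le> 2 * N" "0 < y"
      and f: "\<And>t. a' \<le> t \<Longrightarrow> t \<le> b' \<Longrightarrow> f t = - (y / b) * t powr (- b) * Re (A (of_real (q / t)))"
    have N: "0 < N" using * by linarith
    define D where "D p t = - (y / b) * (t powr (- b - p) * a p (q / t))" for p :: nat and t
    have rng: "0 < q / t \<and> q / t < d \<and> q / t < r" if "a' \<le> t" for t
    proof -
      have "q / t \<le> q / N" using * N that by (intro divide_left_mono) auto
      also have "\<dots> \<le> z0" using * N by (simp add: divide_le_eq)
      finally have "q / t \<le> z0" .
      moreover have "z0 < d" "z0 < r" using d assms(2) by (auto simp: z0_def)
      moreover have "0 < q / t" using * N that by simp
      ultimately show ?thesis by linarith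
    qed
    have dD: "(D p has_real_derivative D (Suc p) t) (at t)" if "a' \<le> t" for p t
    proof -
      have t: "0 < t" using that N * by linarith
      have 1: "((\<lambda>t. t powr (- b - p)) has_real_derivative (- b - p) * t powr (- b - p - 1)) (at t)" using t has_real_derivative_powr_shift[of t 0 "- b - p"] by simp
      have "((\<lambda>t. q / t) has_real_derivative - q / t\<^sup>2) (at t)" using t by (auto intro!: derivative_eq_intros simp: power2_eq_square)
      then have 2: "((\<lambda>t. a p (q / t)) has_real_derivative Re (deriv (B p) (of_real (q / t))) * (- q / t\<^sup>2)) (at t)"
        using rng[OF that] by (intro DERIV_chain2[OF da]) auto
      have "(D p has_real_derivative - (y / b) * ((- b - p) * t powr (- b - p - 1) * a p (q / t)
          + Re (deriv (B p) (of_real (q / t))) * (- q / t\<^sup>2) * t powr (- b - p))) (at t)" unfolding D_def[abs_def] by (intro DERIV_cmult DERIV_mult 1 2)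
      also have "(- b - p) * t powr (- b - p - 1) * a p (q / t)
          + Re (deriv (B p) (of_real (q / t))) * (- q / t\<^sup>2) * t powr (- b - p)
        = t powr (- b - Suc p) * a (Suc p) (q / t)"
      proof -
        have e: "t powr (- b - p) = t powr (- b - Suc p) * t" using t powr_add[of t "- b - Suc p" 1] by simp
        have "- b - real p - 1 = - b - Suc p" by simp
        then show ?thesis unfolding e aSuc using t by (simp add: power2_eq_square field_simps)
      qed
      finally show ?thesis by (simp add: D_def[abs_def])
    qed
    have "phase_class N P (b + 1) y \<epsilon> a' b' (D 0)" unfolding phase_class_def
    proof (intro conjI exI[of _ D] allI impI ballI)
      show "N \<le> a'" "a' < b'" "b' \<le> 2 * N" "D 0 = D 0" using * by auto
      show "(D p has_real_derivative D (Suc p) t) (at t within {a'..b'})" if "t \<in> {a'..b'}" for p t by (rule has_field_derivative_at_within[OF dD]) (use that in auto)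
      show "continuous_on {a'..b'} (D P)"
      proof (rule continuous_at_imp_continuous_on, rule ballI)
        fix t assume "t \<in> {a'..b'}"
        then show "isCont (D P) t" using dD[of t P] by (intro DERIV_isCont) auto
      qed
      fix p t assume p: "p < P" and t: "t \<in> {a'..b'}"
      have t0: "0 < t" using t N * by auto
      define T where "T = t powr (- (b + 1) - p)"
      have T: "0 < T" using t0 by (simp add: T_def)
      have poc: "pochhammer b (Suc p) = b * pochhammer (b + 1) p" by (simp add: pochhammer_rec)
      have "- (b + 1) - real p = - b - real (Suc p)" by simp
      then have "T = t powr (- b - Suc p)" by (simp only: T_def)
      then have DT: "D (Suc p) t = - (y / b) * (T * a (Suc p) (q / t))" by (simp only: D_def)
      have "D (Suc p) t - (-1) ^ p * pochhammer (b + 1) p * y * T = - (y / b) * T * (a (Suc p) (q / t) - a (Suc p) 0)" using assms unfolding a0 poc DT by (simp add: algebra_simps)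
      then have "\<bar>D (Suc p) t - (-1) ^ p * pochhammer (b + 1) p * y * T\<bar> = (y / b) * T * \<bar>a (Suc p) (q / t) - a (Suc p) 0\<bar>"
        using assms T * by (simp add: abs_mult)
      also have "\<dots> < (y / b) * T * (\<epsilon> * (b * pochhammer (b + 1) p))"
      proof (rule mult_strict_left_mono)
        have "dist (q / t) 0 < d" using rng[of t] t by auto
        from d(2)[OF this p] show "\<bar>a (Suc p) (q / t) - a (Suc p) 0\<bar> < \<epsilon> * (b * pochhammer (b + 1) p)" by (simp add: dist_real_def)
      qed (use assms T * in auto)
      also have "\<dots> = \<epsilon> * pochhammer (b + 1) p * y * T" using assms by simp
      finally show "\<bar>D (Suc p) t - (-1) ^ p * pochhammer (b + 1) p * y * t powr (- (b + 1) - p)\<bar>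
           < \<epsilon> * pochhammer (b + 1) p * y * t powr (- (b + 1) - p)" unfolding T_def .
    qed
    moreover have "D 0 t = f t" if "t \<in> {a'..b'}" for t using f[of t] that by (simp add: D_def a_def B_def)
    ultimately show "\<exists>g. phase_class N P (b + 1) y \<epsilon> a' b' g \<and> (\<forall>t\<in>{a'..b'}. g t = f t)" by blast
  qed
qed

text \<open>The exponent pair is used with s = b + 1: up to sign the phase is a primitive of y t^(-b
  - 1), perturbed by a power of \<open>binom_quot\<close> that is holomorphic near 0. The final 1
  pays for the term n = n1, which the range a < n \<le> b in \<open>exponent_pair\<close> leaves
  out, and for sums of at most one term.\<close>

lemma exponent_pair_near_power:
  assumes ep: "exponent_pair k l" and \<gamma>: "0 < \<gamma>" "\<gamma> < 1" and b: "0 < b"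
  obtains C z0 where "0 \<le> C" "0 < z0"
    "\<And>N q y n1 n2. \<lbrakk>0 < N; 0 < q; q \<le> z0 * N; 0 < y; N \<le> real n1; real n2 \<le> 2 * N\<rbrakk> \<Longrightarrow>
      norm (\<Sum>n\<in>{n1..<n2}. expi (y / b * real n powr (- b) * binom_quot \<gamma> (q / real n) powr \<kappa>))
        \<le> C * ((y * N powr (- b - 1)) powr k * N powr l + N powr (b + 1) / y) + 1"
proof -
  have "\<exists>P \<epsilon> C. 0 < \<epsilon> \<and> \<epsilon> < 1/2 \<and>
       (\<forall>N>0. \<forall>y>0. \<forall>a b' f. phase_class N P (b + 1) y \<epsilon> a b' f \<longrightarrow>
         norm (\<Sum>n::nat | a < real n \<and> real n \<le> b'. expi (f (real n)))
           \<le> C * ((y * N powr (- (b + 1))) powr k * N powr l + N powr (b + 1) / y))"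
    by (rule ep[unfolded exponent_pair_def, THEN conjunct2, THEN conjunct2, THEN conjunct2, THEN conjunct2, THEN spec, THEN mp])
      (use b in simp)
  then obtain P \<epsilon> C where PC: "0 < \<epsilon>" "\<forall>N>0. \<forall>y>0. \<forall>a b' f. phase_class N P (b + 1) y \<epsilon> a b' f \<longrightarrow>
         norm (\<Sum>n::nat | a < real n \<and> real n \<le> b'. expi (f (real n)))
           \<le> C * ((y * N powr (- (b + 1))) powr k * N powr l + N powr (b + 1) / y)" by (elim exE conjE) (rule that)
  have "continuous_on (ball 0 1) (cbinom_quot \<gamma>)" using cbinom_quot_holomorphic[OF \<gamma>(1)] holomorphic_on_imp_continuous_on by blast
  then have "isCont (cbinom_quot \<gamma>) 0" by (simp add: continuous_on_eq_continuous_at)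
  then obtain r0 where r0: "0 < r0" "\<And>z. dist z 0 < r0 \<Longrightarrow> dist (cbinom_quot \<gamma> z) (cbinom_quot \<gamma> 0) < 1"
    unfolding continuous_at_eps_delta by (metis zero_less_one)
  define r where "r = min r0 1"
  define A where "A z = cbinom_quot \<gamma> z powr of_real \<kappa>" for z
  \<comment> \<open>Values within distance 1 of the point 1 have positive real part, hence stay off
    the branch cut, and the power with exponent \<kappa> is holomorphic.\<close>
  have "cbinom_quot \<gamma> z \<notin> \<real>\<^sub>\<le>\<^sub>0" if "z \<in> ball 0 r" for z
  proof
    assume "cbinom_quot \<gamma> z \<in> \<real>\<^sub>\<le>\<^sub>0"
    then have "Re (cbinom_quot \<gamma> z) \<le> 0" by (auto simp: complex_nonpos_Reals_iff)
    moreover have "norm (cbinom_quot \<gamma> z - 1) < 1" using r0(2)[of z] that by (simp add: dist_norm r_def cbinom_quot_def)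
    moreover have "\<bar>Re (cbinom_quot \<gamma> z - 1)\<bar> \<le> norm (cbinom_quot \<gamma> z - 1)" by (rule abs_Re_le_cmod)
    ultimately show False by simp
  qed
  moreover have "cbinom_quot \<gamma> holomorphic_on ball 0 r" by (rule holomorphic_on_subset[OF cbinom_quot_holomorphic[OF \<gamma>(1)]]) (auto simp: r_def)
  ultimately have hol: "A holomorphic_on ball 0 r" unfolding A_def[abs_def] by (intro holomorphic_on_powr holomorphic_intros) auto
  have r: "0 < r" using r0 by (simp add: r_def)
  have A0: "A 0 = 1" by (simp add: A_def cbinom_quot_def)
  define C' where "C' = max C 0"
  show ?thesis
  proof (rule phase_class_near_power_aux[OF hol r A0 b PC(1), where P = P], goal_cases)
    case (1 z0)
    note z0 = 1(1,2) and pc = 1(3)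
  show ?thesis
  proof (rule that[of C' z0])
    show "0 \<le> C'" "0 < z0" using z0 by (auto simp: C'_def)
    fix N q y :: real and n1 n2 :: nat
    assume *: "0 < N" "0 < q" "q \<le> z0 * N" "0 < y" "N \<le> real n1" "real n2 \<le> 2 * N"
    define f where "f t = y / b * t powr (- b) * binom_quot \<gamma> (q / t) powr \<kappa>" for t
    define R where "R = (y * N powr (- b - 1)) powr k * N powr l + N powr (b + 1) / y"
    have R0: "0 \<le> R" using * by (simp add: R_def)
    show "norm (\<Sum>n\<in>{n1..<n2}. expi (y / b * real n powr (- b) * binom_quot \<gamma> (q / real n) powr \<kappa>))
        \<le> C' * ((y * N powr (- b - 1)) powr k * N powr l + N powr (b + 1) / y) + 1" unfolding f_def[symmetric] R_def[symmetric]
    proof (cases "n1 + 1 < n2")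
      case False
      then have "card {n1..<n2} \<le> 1" by simp
      then have "norm (\<Sum>n\<in>{n1..<n2}. expi (f (real n))) \<le> 1" using norm_sum_expi_le[of "\<lambda>n. f (real n)" "{n1..<n2}"] by linarith
      then show "norm (\<Sum>n\<in>{n1..<n2}. expi (f (real n))) \<le> C' * R + 1" using R0 by (simp add: C'_def add_increasing)
    next
      case True
      have ReA: "Re (A (of_real (q / t))) = binom_quot \<gamma> (q / t) powr \<kappa>" if "real n1 \<le> t" for t
      proof -
        have "0 < t" using that * by linarith
        then have x: "0 < q / t" using * by simp
        have "A (of_real (q / t)) = of_real (binom_quot \<gamma> (q / t)) powr of_real \<kappa>" unfolding A_def using cbinom_quot_of_real[OF x \<gamma>(1)] by simp
        also have "\<dots> = of_real (binom_quot \<gamma> (q / t) powr \<kappa>)" using binom_quot_pos[OF x \<gamma>(1)] by (intro powr_of_real) auto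
        finally show ?thesis by (simp only: Re_complex_of_real)
      qed
      have n2: "real (n2 - 1) = real n2 - 1" using True by simp
      then have n2': "real (n2 - 1) \<le> 2 * N" using * by linarith
      \<comment> \<open>Members of the phase class have positive derivative, so it is -f that
        belongs to it; conjugation leaves the norm of the sum unchanged. The right end point is n2 -
        1, the last index summed.\<close>
      have "\<exists>g. phase_class N P (b + 1) y \<epsilon> (real n1) (real (n2 - 1)) g \<and> (\<forall>t\<in>{real n1..real (n2 - 1)}. g t = - f t)"
      proof (rule pc[of q N "real n1" "real (n2 - 1)" y "\<lambda>t. - f t"])
        show "real n1 < real (n2 - 1)" using True by simp
        fix t assume "real n1 \<le> t"
        from ReA[OF this] show "- f t = - (y / b) * t powr (- b) * Re (A (of_real (q / t)))" by (simp only:) (simp add: f_def)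
      qed (fact *(2) *(3) *(5) *(4) n2')+
      then obtain g where g: "phase_class N P (b + 1) y \<epsilon> (real n1) (real (n2 - 1)) g"
        "\<And>t. t\<in>{real n1..real (n2 - 1)} \<Longrightarrow> g t = - f t" by blast
      have set: "{n::nat. real n1 < real n \<and> real n \<le> real (n2 - 1)} = {Suc n1..<n2}" using True by auto
      have "norm (\<Sum>n::nat | real n1 < real n \<and> real n \<le> real (n2 - 1). expi (g (real n)))
          \<le> C * ((y * N powr (- (b + 1))) powr k * N powr l + N powr (b + 1) / y)" using PC(2)[rule_format, OF *(1) *(4) g(1)] .
      also have "(\<Sum>n::nat | real n1 < real n \<and> real n \<le> real (n2 - 1). expi (g (real n))) = (\<Sum>n\<in>{Suc n1..<n2}. expi (- f (real n)))"
        unfolding set using True by (intro sum.cong) (auto simp: g(2) n2)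
      also have "norm \<dots> = norm (\<Sum>n\<in>{Suc n1..<n2}. expi (f (real n)))" by (rule norm_sum_expi_minus)
      also have "- (b + 1) = - b - 1" by simp
      finally have 1: "norm (\<Sum>n\<in>{Suc n1..<n2}. expi (f (real n))) \<le> C * R" unfolding R_def .
      have "(\<Sum>n\<in>{n1..<n2}. expi (f (real n))) = expi (f (real n1)) + (\<Sum>n\<in>{Suc n1..<n2}. expi (f (real n)))" using True by (intro sum.atLeast_Suc_lessThan) auto
      then have "norm (\<Sum>n\<in>{n1..<n2}. expi (f (real n))) \<le> 1 + norm (\<Sum>n\<in>{Suc n1..<n2}. expi (f (real n)))" by (metis norm_expi norm_triangle_ineq)
      also have "\<dots> \<le> 1 + C * R" using 1 by simp
      also have "\<dots> \<le> 1 + C' * R" using R0 by (intro add_left_mono mult_right_mono) (auto simp: C'_def)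
      finally show "norm (\<Sum>n\<in>{n1..<n2}. expi (f (real n))) \<le> C' * R + 1" by simp
    qed
  qed
qed
qed

section \<open>Oscillatory integrals and a smoothed Poisson formula\<close>

lemma expi_has_vector_derivative:
  assumes "(f has_real_derivative f') (at t within S)"
  shows "((\<lambda>t. expi (f t)) has_vector_derivative (2 * pi * \<i> * of_real f') * expi (f t)) (at t within S)"
proof -
  have "((\<lambda>t. of_real (f t) :: complex) has_vector_derivative of_real f') (at t within S)"
    using assms has_real_derivative_iff_has_vector_derivative has_vector_derivative_of_real by blast
  moreover have "((\<lambda>z. exp (2 * of_real pi * \<i> * z)) has_field_derivative
      (2 * of_real pi * \<i>) * exp (2 * of_real pi * \<i> * of_real (f t))) (at (of_real (f t)))" by (auto intro!: derivative_eq_intros)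
  ultimately have "((\<lambda>z. exp (2 * of_real pi * \<i> * z)) \<circ> (\<lambda>t. of_real (f t)) has_vector_derivative
      of_real f' * ((2 * of_real pi * \<i>) * exp (2 * of_real pi * \<i> * of_real (f t)))) (at t within S)"
    by (rule field_vector_diff_chain_within[OF _ has_field_derivative_at_within])
  then show ?thesis by (simp add: o_def expi_def mult_ac)
qed

lemma continuous_on_expi [continuous_intros]: "continuous_on S f \<Longrightarrow> continuous_on S (\<lambda>t. expi (f t))" unfolding expi_def by (intro continuous_intros)

text \<open>Write expi f as the derivative of expi f divided by 2 pi \<i> f', and integrate by
  parts.\<close>

lemma expi_integral_by_parts:
  fixes f f' f'' :: "real \<Rightarrow> real"
  assumes "p \<le> q"
    and 1: "\<And>t. t \<in> {p..q} \<Longrightarrow> (f has_real_derivative f' t) (at t within {p..q})"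
    and 2: "\<And>t. t \<in> {p..q} \<Longrightarrow> (f' has_real_derivative f'' t) (at t within {p..q})"
    and 3: "continuous_on {p..q} f''" and nz: "\<And>t. t \<in> {p..q} \<Longrightarrow> f' t \<noteq> 0"
  shows "integral {p..q} (\<lambda>t. expi (f t)) =
    1 / (2 * pi * \<i>) * (expi (f q) / f' q - expi (f p) / f' p
      + integral {p..q} (\<lambda>t. of_real (f'' t / (f' t)\<^sup>2) * expi (f t)))"
proof -
  define h where "h t = of_real (1 / f' t) * expi (f t)" for t
  define K where "K t = of_real (f'' t / (f' t)\<^sup>2) * expi (f t)" for t
  have c: "continuous_on {p..q} f" "continuous_on {p..q} f'" by (rule DERIV_continuous_on[OF 1], assumption) (rule DERIV_continuous_on[OF 2])
  have dh: "(h has_vector_derivative (2 * pi * \<i>) * expi (f t) - K t) (at t within {p..q})" if t: "t \<in> {p..q}" for t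
  proof -
    have "((\<lambda>t. 1 / f' t) has_real_derivative - (f'' t / (f' t)\<^sup>2)) (at t within {p..q})"
      using 2[OF t] nz[OF t] by (auto intro!: derivative_eq_intros simp: power2_eq_square)
    then have "((\<lambda>t. of_real (1 / f' t) :: complex) has_vector_derivative of_real (- (f'' t / (f' t)\<^sup>2))) (at t within {p..q})"
      using has_real_derivative_iff_has_vector_derivative has_vector_derivative_of_real by blast
    from has_vector_derivative_mult[OF this expi_has_vector_derivative[OF 1[OF t]]]
    have "(h has_vector_derivative of_real (1 / f' t) * ((2 * pi * \<i> * of_real (f' t)) * expi (f t))
        + of_real (- (f'' t / (f' t)\<^sup>2)) * expi (f t)) (at t within {p..q})" unfolding h_def[abs_def] .
    also have "of_real (1 / f' t) * ((2 * pi * \<i> * of_real (f' t)) * expi (f t))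
        + of_real (- (f'' t / (f' t)\<^sup>2)) * expi (f t) = (2 * pi * \<i>) * expi (f t) - K t" using nz[OF t] by (simp add: K_def)
    finally show ?thesis .
  qed
  have int: "((\<lambda>t. (2 * pi * \<i>) * expi (f t) - K t) has_integral h q - h p) {p..q}" by (rule fundamental_theorem_of_calculus[OF assms(1) dh])
  have K: "K integrable_on {p..q}" unfolding K_def using c 3 nz by (intro integrable_continuous_real continuous_intros) auto
  have E: "(\<lambda>t. expi (f t)) integrable_on {p..q}" using c by (intro integrable_continuous_real continuous_intros)
  have "h q - h p = (2 * pi * \<i>) * integral {p..q} (\<lambda>t. expi (f t)) - integral {p..q} K"
    using integral_unique[OF int] E K by (simp add: integral_diff integrable_on_mult_right)
  then show ?thesis unfolding K_def[symmetric] by (simp add: h_def field_simps)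
qed

text \<open>After integration by parts the remaining integrand is dominated by the derivative of
  1/f'. As f'' has constant sign, its integral is a difference of two values of 1/f' and does not
  grow with the length. Three terms of size 1/\<eta> against the factor 1/(2 pi) leave at most
  1/\<eta>.\<close>

lemma first_derivative_test:
  fixes f f' f'' :: "real \<Rightarrow> real"
  assumes "p \<le> q" "0 < \<eta>"
    and 1: "\<And>t. t \<in> {p..q} \<Longrightarrow> (f has_real_derivative f' t) (at t within {p..q})"
    and 2: "\<And>t. t \<in> {p..q} \<Longrightarrow> (f' has_real_derivative f'' t) (at t within {p..q})"
    and 3: "continuous_on {p..q} f''" and neg: "\<And>t. t \<in> {p..q} \<Longrightarrow> f'' t \<le> 0"
    and big: "(\<forall>t\<in>{p..q}. \<eta> \<le> f' t) \<or> (\<forall>t\<in>{p..q}. f' t \<le> - \<eta>)"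
  shows "norm (integral {p..q} (\<lambda>t. expi (f t))) \<le> 1 / \<eta>"
proof -
  have ab: "\<eta> \<le> \<bar>f' t\<bar>" if "t \<in> {p..q}" for t using big
  proof
    assume "\<forall>t\<in>{p..q}. \<eta> \<le> f' t"
    then have "\<eta> \<le> f' t" using that by blast
    then show ?thesis by linarith
  next
    assume "\<forall>t\<in>{p..q}. f' t \<le> - \<eta>"
    then have "f' t \<le> - \<eta>" using that by blast
    then show ?thesis by linarith
  qed
  have nz: "f' t \<noteq> 0" "1 / \<bar>f' t\<bar> \<le> 1 / \<eta>" if "t \<in> {p..q}" for t
  proof -
    show "f' t \<noteq> 0" using ab[OF that] assms(2) by auto
    then show "1 / \<bar>f' t\<bar> \<le> 1 / \<eta>" using ab[OF that] assms(2) by (intro divide_left_mono) auto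
  qed
  have c: "continuous_on {p..q} f" "continuous_on {p..q} f'" by (rule DERIV_continuous_on[OF 1], assumption) (rule DERIV_continuous_on[OF 2])
  have "((\<lambda>t. - (f'' t / (f' t)\<^sup>2)) has_integral 1 / f' q - 1 / f' p) {p..q}"
  proof (rule fundamental_theorem_of_calculus[OF assms(1)])
    fix t assume t: "t \<in> {p..q}"
    have "((\<lambda>t. 1 / f' t) has_real_derivative - (f'' t / (f' t)\<^sup>2)) (at t within {p..q})"
      using 2[OF t] nz[OF t] by (auto intro!: derivative_eq_intros simp: power2_eq_square)
    then show "((\<lambda>t. 1 / f' t) has_vector_derivative - (f'' t / (f' t)\<^sup>2)) (at t within {p..q})" by (simp add: has_real_derivative_iff_has_vector_derivative)
  qed
  then have int: "integral {p..q} (\<lambda>t. - (f'' t / (f' t)\<^sup>2)) = 1 / f' q - 1 / f' p" by (rule integral_unique)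
  have "norm (integral {p..q} (\<lambda>t. of_real (f'' t / (f' t)\<^sup>2) * expi (f t))) \<le> integral {p..q} (\<lambda>t. - (f'' t / (f' t)\<^sup>2))"
  proof (rule integral_norm_bound_integral)
    show "(\<lambda>t. of_real (f'' t / (f' t)\<^sup>2) * expi (f t)) integrable_on {p..q}" using c 3 nz by (intro integrable_continuous_real continuous_intros) auto
    show "(\<lambda>t. - (f'' t / (f' t)\<^sup>2)) integrable_on {p..q}" using c 3 nz by (intro integrable_continuous_real continuous_intros) auto
    show "norm (of_real (f'' t / (f' t)\<^sup>2) * expi (f t)) \<le> - (f'' t / (f' t)\<^sup>2)" if "t \<in> {p..q}" for t
      using neg[OF that] by (simp only: norm_mult norm_expi norm_of_real) (simp add: abs_if divide_le_0_iff not_less)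
  qed
  also have "\<dots> \<le> 1 / \<eta>" using big
  proof
    assume "\<forall>t\<in>{p..q}. \<eta> \<le> f' t"
    then have "\<eta> \<le> f' p" "\<eta> \<le> f' q" using assms(1) by auto
    then have "0 \<le> 1 / f' p" "1 / f' q = 1 / \<bar>f' q\<bar>" using assms(2) by auto
    moreover have "1 / \<bar>f' q\<bar> \<le> 1 / \<eta>" using nz(2)[of q] assms(1) by simp
    ultimately show ?thesis unfolding int by linarith
  next
    assume "\<forall>t\<in>{p..q}. f' t \<le> - \<eta>"
    then have *: "f' p \<le> - \<eta>" "f' q \<le> - \<eta>" using assms(1) by auto
    then have "f' q \<le> 0" "\<bar>f' p\<bar> = - f' p" using assms(2) by auto
    then have "1 / f' q \<le> 0" "- (1 / f' p) = 1 / \<bar>f' p\<bar>" by (auto simp: divide_le_0_iff)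
    moreover have "1 / \<bar>f' p\<bar> \<le> 1 / \<eta>" using nz(2)[of p] assms(1) by simp
    ultimately show ?thesis unfolding int by linarith
  qed
  finally have I: "norm (integral {p..q} (\<lambda>t. of_real (f'' t / (f' t)\<^sup>2) * expi (f t))) \<le> 1 / \<eta>" .
  have "norm (integral {p..q} (\<lambda>t. expi (f t))) = 1 / (2 * pi) * norm (expi (f q) / f' q - expi (f p) / f' p
      + integral {p..q} (\<lambda>t. of_real (f'' t / (f' t)\<^sup>2) * expi (f t)))"
    by (subst expi_integral_by_parts[of p q f f' f'']) (use assms nz in \<open>auto simp: norm_mult norm_divide\<close>)
  also have "\<dots> \<le> 1 / (2 * pi) * (norm (expi (f q) / f' q) + norm (expi (f p) / f' p)
     + norm (integral {p..q} (\<lambda>t. of_real (f'' t / (f' t)\<^sup>2) * expi (f t))))" by (intro mult_left_mono norm_triangle_le add_right_mono norm_triangle_ineq4) auto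
  also have "\<dots> \<le> 1 / (2 * pi) * (1 / \<eta> + 1 / \<eta> + 1 / \<eta>)" using I nz[of p] nz[of q] assms(1) by (intro mult_left_mono add_mono) (auto simp: norm_divide)
  also have "\<dots> \<le> 1 * (1 / \<eta>)"
  proof -
    have "3 / (2 * pi) \<le> 1" using pi_gt3 by simp
    then have "3 / (2 * pi) * (1 / \<eta>) \<le> 1 * (1 / \<eta>)" using assms by (intro mult_right_mono) auto
    then show ?thesis by simp
  qed
  finally show ?thesis by simp
qed

section \<open>The Fejer kernel and truncated Poisson summation\<close>

definition fejer :: "nat \<Rightarrow> real \<Rightarrow> complex" where
  "fejer R t = 1 / R * (\<Sum>i<R. \<Sum>j<R. expi (- (real i - real j) * t))"

lemma fejer_eq: "fejer R t = of_real ((norm (\<Sum>i<R. expi (real i * t)))\<^sup>2 / R)"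
proof -
  have "of_real ((norm (\<Sum>i<R. expi (real i * t)))\<^sup>2) = (\<Sum>j<R. expi (real j * t)) * (\<Sum>i<R. expi (- (real i * t)))"
    unfolding complex_norm_square cnj_sum expi_minus ..
  also have "\<dots> = (\<Sum>j<R. \<Sum>i<R. expi (real j * t) * expi (- (real i * t)))" by (rule sum_product)
  also have "\<dots> = (\<Sum>i<R. \<Sum>j<R. expi (- (real i - real j) * t))" by (subst sum.swap) (simp add: expi_add[symmetric] algebra_simps)
  finally show ?thesis by (simp add: fejer_def)
qed

lemma continuous_on_fejer: "continuous_on S (fejer R)" unfolding fejer_def by (intro continuous_intros)

lemma has_integral_expi_period:
  fixes k m :: int
  shows "((\<lambda>t. expi (k * t)) has_integral (if k = 0 then 1 else 0)) {m - 1/2..m + 1/2}"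
proof (cases "k = 0")
  case True
  then show ?thesis using has_integral_const_real[of "1::complex" "m - 1/2" "m + 1/2"] by simp
next
  case False
  have "((\<lambda>t. expi (k * t)) has_integral expi (k * (m + 1/2)) / (2 * pi * \<i> * k) - expi (k * (m - 1/2)) / (2 * pi * \<i> * k)) {m - 1/2..m + 1/2}"
  proof (rule fundamental_theorem_of_calculus)
    fix t :: real
    have "((\<lambda>t. k * t) has_real_derivative k) (at t within {m - 1/2..m + 1/2})" by (auto intro!: derivative_eq_intros)
    from has_vector_derivative_divide[OF expi_has_vector_derivative[OF this], of "2 * pi * \<i> * k"]
    show "((\<lambda>t. expi (k * t) / (2 * pi * \<i> * k)) has_vector_derivative expi (k * t)) (at t within {m - 1/2..m + 1/2})" using False by simp
  qed auto
  also have "expi (k * (m + 1/2)) = expi (of_int k + k * (m - 1/2))" by (simp add: algebra_simps)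
  also have "\<dots> = expi (k * (m - 1/2))" by (simp only: expi_add expi_of_int mult_1)
  finally show ?thesis using False by simp
qed

lemma has_integral_fejer:
  assumes "0 < R"
  shows "(fejer R has_integral 1) {of_int m - 1/2..of_int m + 1/2}"
proof -
  have "(fejer R has_integral (1 / of_nat R) * (\<Sum>i<R. \<Sum>j<R. if int j - int i = 0 then 1 else 0 :: complex)) {of_int m - 1/2..of_int m + 1/2}" unfolding fejer_def
  proof (intro has_integral_mult_right has_integral_sum)
    fix i j :: nat
    show "((\<lambda>t. expi (- (real i - real j) * t)) has_integral (if int j - int i = 0 then 1 else 0)) {real_of_int m - 1/2..real_of_int m + 1/2}"
      using has_integral_expi_period[of "int j - int i" m] by simp
  qed auto
  also have "(\<Sum>i<R. \<Sum>j<R. if int j - int i = 0 then 1 else 0 :: complex) = (\<Sum>i<R. 1)" by (intro sum.cong) auto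
  finally show ?thesis using assms by simp
qed

text \<open>With r * r frequencies the kernel is concentrated at distance about 1/r from the
  integers, as measured by this weight: up to 1/r the weight itself is small, beyond it the
  geometric sum bounds the kernel by 1/(r x)^2 at distance x.\<close>

lemma fejer_weighted_le:
  assumes "0 < r" "t \<in> {of_int m - 1/2..of_int m + 1/2}"
  shows "\<bar>t - of_int m\<bar> * norm (fejer (r * r) t) \<le> 1 / r * (norm (fejer (r * r) t) + 1)"
proof (cases "\<bar>t - m\<bar> \<le> 1 / r")
  case True
  then have "\<bar>t - m\<bar> * norm (fejer (r * r) t) \<le> 1 / r * norm (fejer (r * r) t)" by (intro mult_right_mono) auto
  also have "\<dots> \<le> 1 / r * (norm (fejer (r * r) t) + 1)" using assms by (intro mult_left_mono) auto
  finally show ?thesis .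
next
  case False
  define x where "x = t - m"
  have "\<bar>x\<bar> \<le> 1/2" unfolding x_def abs_le_iff using assms(2) by simp
  then have x: "1 / r < \<bar>x\<bar>" "\<bar>x\<bar> \<le> 1/2" using False by (auto simp: x_def)
  have r: "0 < real r" "0 < 1 / real r" using assms by auto
  then have x0: "0 < \<bar>x\<bar>" using x(1) by linarith
  have ex: "expi (real i * t) = expi x ^ i" for i
  proof -
    have "expi (real i * t) = expi (of_int (int i * m) + real i * x)" by (simp add: x_def algebra_simps)
    also have "\<dots> = expi (real i * x)" by (simp only: expi_add expi_of_int mult_1)
    also have "\<dots> = expi x ^ i" by (simp add: expi_def exp_of_nat_mult[symmetric] mult_ac)
    finally show ?thesis .
  qed
  have "pi * \<bar>x\<bar> / 2 \<le> sin (pi * \<bar>x\<bar>)" using x by (intro sin_ge_half) auto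
  moreover have "\<bar>sin (pi * x)\<bar> = sin (pi * \<bar>x\<bar>)"
  proof -
    have "0 \<le> sin (pi * \<bar>x\<bar>)" using x by (intro sin_ge_zero) (auto intro: order_trans[of _ "pi * (1/2)"])
    then show ?thesis by (cases "0 \<le> x") auto
  qed
  moreover have "2 * \<bar>x\<bar> \<le> pi * \<bar>x\<bar>" using pi_gt3 by (intro mult_right_mono) auto
  ultimately have d: "2 * \<bar>x\<bar> \<le> norm (expi x - 1)" by (simp add: norm_expi_minus_1)
  then have ne: "expi x \<noteq> 1" using x0 by auto
  have "norm (\<Sum>i<r * r. expi (real i * t)) = norm (expi x ^ (r * r) - 1) / norm (expi x - 1)" unfolding ex using ne by (simp add: geometric_sum norm_divide norm_minus_commute)
  also have "\<dots> \<le> 2 / (2 * \<bar>x\<bar>)"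
  proof (rule frac_le)
    show "norm (expi x ^ (r * r) - 1) \<le> 2" using norm_triangle_ineq4[of "expi x ^ (r * r)" 1] by (simp add: norm_power)
  qed (use d x0 in auto)
  finally have "norm (\<Sum>i<r * r. expi (real i * t)) \<le> 1 / \<bar>x\<bar>" by simp
  then have "(norm (\<Sum>i<r * r. expi (real i * t)))\<^sup>2 \<le> (1 / \<bar>x\<bar>)\<^sup>2" by (intro power_mono) auto
  then have "norm (fejer (r * r) t) \<le> (1 / \<bar>x\<bar>)\<^sup>2 / (r * r)" unfolding fejer_eq norm_of_real using r by (simp add: divide_right_mono)
  then have "\<bar>x\<bar> * norm (fejer (r * r) t) \<le> \<bar>x\<bar> * ((1 / \<bar>x\<bar>)\<^sup>2 / (r * r))" by (intro mult_left_mono) auto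
  also have "\<dots> = 1 / (\<bar>x\<bar> * r) * (1 / r)"
  proof -
    have "y * ((1 / y)\<^sup>2 / (r * r)) = 1 / (y * r) * (1 / r)" if "0 < y" for y :: real using r that by (simp add: power2_eq_square field_simps)
    then show ?thesis using x0 by simp
  qed
  also have "\<dots> \<le> 1 * (1 / r)" using x r by (intro mult_right_mono) (auto simp: field_simps)
  also have "\<dots> \<le> 1 / r * (norm (fejer (r * r) t) + 1)" using r by (simp add: field_simps)
  finally show ?thesis by (simp add: x_def)
qed

lemma norm_fejer: "norm (fejer R t) = (norm (\<Sum>i<R. expi (real i * t)))\<^sup>2 / R" unfolding fejer_eq norm_of_real by simp

text \<open>A term at the integer m is replaced by an average over the unit interval centred at m.
  The kernel has mass 1 there, so the error is the Lipschitz bound integrated against the weighted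
  kernel, which \<open>fejer_weighted_le\<close> controls.\<close>

lemma expi_fejer_term:
  fixes f :: "real \<Rightarrow> real" and m :: int and \<Lambda> :: real
  assumes "0 < r" "0 \<le> \<Lambda>" and cont: "continuous_on {m - 1/2..m + 1/2} f"
    and lip: "\<And>t::real. t \<in> {m - 1/2..m + 1/2} \<Longrightarrow> \<bar>f m - f t\<bar> \<le> \<Lambda> * \<bar>t - m\<bar>"
  shows "norm (expi (f m) - integral {m - 1/2..m + 1/2} (\<lambda>t. expi (f t) * fejer (r * r) t)) \<le> 4 * pi * \<Lambda> / r"
proof -
  let ?S = "{m - 1/2..m + 1/2 :: real}"
  have R: "0 < r * r" using assms by simp
  note F = has_integral_fejer[OF R, of m]
  have Fi: "fejer (r * r) integrable_on ?S" by (intro integrable_continuous_real continuous_on_fejer)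
  have fr: "fejer (r * r) t = of_real (norm (fejer (r * r) t))" for t unfolding norm_fejer by (rule fejer_eq)
  have "((\<lambda>t. Re (fejer (r * r) t)) has_integral Re 1) ?S" by (rule has_integral_linear[OF F bounded_linear_Re, unfolded o_def])
  moreover have "Re (fejer (r * r) t) = norm (fejer (r * r) t)" for t by (subst fr) (rule Re_complex_of_real)
  ultimately have nF: "((\<lambda>t. norm (fejer (r * r) t)) has_integral 1) ?S" by simp
  have "((\<lambda>t. norm (fejer (r * r) t) + 1) has_integral 1 + 1) ?S" using has_integral_const_real[of "1::real" "m - 1/2" "m + 1/2"] by (intro has_integral_add[OF nF]) simp
  from has_integral_mult_right[OF this, of "2 * pi * \<Lambda> / r"]
  have w: "((\<lambda>t. 2 * pi * \<Lambda> / r * (norm (fejer (r * r) t) + 1)) has_integral 2 * pi * \<Lambda> / r * 2) ?S" by (simp only: one_add_one)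
  have "expi (f m) = integral ?S (\<lambda>t. expi (f m) * fejer (r * r) t)" using integral_unique[OF has_integral_mult_right[OF F, of "expi (f m)"]] by simp
  then have "expi (f m) - integral ?S (\<lambda>t. expi (f t) * fejer (r * r) t)
     = integral ?S (\<lambda>t. expi (f m) * fejer (r * r) t) - integral ?S (\<lambda>t. expi (f t) * fejer (r * r) t)" by simp
  also have "\<dots> = integral ?S (\<lambda>t. expi (f m) * fejer (r * r) t - expi (f t) * fejer (r * r) t)"
    by (rule integral_diff[symmetric]) (intro integrable_continuous_real continuous_intros continuous_on_fejer cont)+
  also have "norm \<dots> \<le> integral ?S (\<lambda>t. 2 * pi * \<Lambda> / r * (norm (fejer (r * r) t) + 1))"
  proof (rule integral_norm_bound_integral)
    show "(\<lambda>t. expi (f m) * fejer (r * r) t - expi (f t) * fejer (r * r) t) integrable_on ?S"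
      by (intro integrable_continuous_real continuous_intros continuous_on_fejer cont)
    show "(\<lambda>t. 2 * pi * \<Lambda> / r * (norm (fejer (r * r) t) + 1)) integrable_on ?S" using w by blast
    fix t assume t: "t \<in> ?S"
    have "norm (expi (f m) * fejer (r * r) t - expi (f t) * fejer (r * r) t) = norm (expi (f m) - expi (f t)) * norm (fejer (r * r) t)"
      by (simp only: left_diff_distrib[symmetric] norm_mult)
    also have "\<dots> \<le> (2 * pi * (\<Lambda> * \<bar>t - m\<bar>)) * norm (fejer (r * r) t)" using lip[OF t] by (intro mult_right_mono order_trans[OF norm_expi_diff_le]) auto
    also have "\<dots> = (2 * pi * \<Lambda>) * (\<bar>t - m\<bar> * norm (fejer (r * r) t))" by simp
    also have "\<dots> \<le> (2 * pi * \<Lambda>) * (1 / r * (norm (fejer (r * r) t) + 1))" using fejer_weighted_le[OF assms(1) t] assms(2) by (intro mult_left_mono) auto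
    finally show "norm (expi (f m) * fejer (r * r) t - expi (f t) * fejer (r * r) t) \<le> 2 * pi * \<Lambda> / r * (norm (fejer (r * r) t) + 1)" by simp
  qed
  also have "\<dots> = 4 * pi * \<Lambda> / r" using integral_unique[OF w] by simp
  finally show ?thesis .
qed

lemma sum_expi_fejer:
  fixes f :: "real \<Rightarrow> real" and p q :: nat and \<Lambda> :: real
  assumes "0 < r" "0 \<le> \<Lambda>" "p \<le> q" and cont: "continuous_on {p - 1/2..q - 1/2} f"
    and lip: "\<And>s t. s \<in> {p - 1/2..q - 1/2} \<Longrightarrow> t \<in> {p - 1/2..q - 1/2} \<Longrightarrow> \<bar>f s - f t\<bar> \<le> \<Lambda> * \<bar>s - t\<bar>"
  shows "norm ((\<Sum>n\<in>{p..<q}. expi (f n)) - integral {p - 1/2..q - 1/2} (\<lambda>t. expi (f t) * fejer (r * r) t))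
    \<le> (real q - real p) * (4 * pi * \<Lambda> / r)" using assms(3) cont lip
proof (induction q rule: dec_induct)
  case base
  then show ?case by simp
next
  case (step q)
  let ?g = "\<lambda>t. expi (f t) * fejer (r * r) t"
  have sub: "{real p - 1/2..real q - 1/2} \<subseteq> {real p - 1/2..real (Suc q) - 1/2}"
    "{real_of_int (int q) - 1/2..real_of_int (int q) + 1/2} \<subseteq> {real p - 1/2..real (Suc q) - 1/2}" using step(1) by auto
  have IH: "norm ((\<Sum>n\<in>{p..<q}. expi (f n)) - integral {p - 1/2..q - 1/2} ?g) \<le> (real q - real p) * (4 * pi * \<Lambda> / r)"
    using step.prems sub(1) by (intro step.IH continuous_on_subset[OF step.prems(1) sub(1)]) auto
  have t: "norm (expi (f (real_of_int (int q))) - integral {real_of_int (int q) - 1/2..real_of_int (int q) + 1/2} ?g) \<le> 4 * pi * \<Lambda> / r"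
  proof (rule expi_fejer_term[OF assms(1,2) continuous_on_subset[OF step.prems(1) sub(2)]])
    fix t assume "t \<in> {real_of_int (int q) - 1/2..real_of_int (int q) + 1/2}"
    then show "\<bar>f (real_of_int (int q)) - f t\<bar> \<le> \<Lambda> * \<bar>t - real_of_int (int q)\<bar>"
      using step.prems(2)[of "real q" t] step(1) sub(2) by (auto simp: abs_minus_commute)
  qed
  have "?g integrable_on {p - 1/2..Suc q - 1/2}" using step.prems by (intro integrable_continuous_real continuous_intros continuous_on_fejer)
  then have comb: "integral {p - 1/2..Suc q - 1/2} ?g = integral {p - 1/2..q - 1/2} ?g + integral {q - 1/2..Suc q - 1/2} ?g"
    using step(1) by (intro Henstock_Kurzweil_Integration.integral_combine[symmetric]) auto
  have "{real q - 1/2..real (Suc q) - 1/2} = {real_of_int (int q) - 1/2..real_of_int (int q) + 1/2}" by auto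
  then have last: "integral {q - 1/2..Suc q - 1/2} ?g = integral {real_of_int (int q) - 1/2..real_of_int (int q) + 1/2} ?g" by (simp only:)
  have "(\<Sum>n\<in>{p..<Suc q}. expi (f n)) = (\<Sum>n\<in>{p..<q}. expi (f n)) + expi (f (real_of_int (int q)))" using step(1) by simp
  then have "(\<Sum>n\<in>{p..<Suc q}. expi (f n)) - integral {p - 1/2..Suc q - 1/2} ?g
    = ((\<Sum>n\<in>{p..<q}. expi (f n)) - integral {p - 1/2..q - 1/2} ?g)
     + (expi (f (real_of_int (int q))) - integral {real_of_int (int q) - 1/2..real_of_int (int q) + 1/2} ?g)" unfolding comb last by (simp only: add_diff_add)
  then have "norm ((\<Sum>n\<in>{p..<Suc q}. expi (f n)) - integral {p - 1/2..Suc q - 1/2} ?g)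
    \<le> (real q - real p) * (4 * pi * \<Lambda> / r) + 4 * pi * \<Lambda> / r" using norm_triangle_mono[OF IH t] by (simp only:)
  also have "\<dots> = (real (Suc q) - real p) * (4 * pi * \<Lambda> / r)"
  proof -
    have "(real q - real p) * K + K = (real (Suc q) - real p) * K" for K by (simp add: algebra_simps)
    then show ?thesis .
  qed
  finally show ?case .
qed

text \<open>A truncated Poisson formula as an inequality: expanding the kernel gives frequencies i -
  j with weight 1/R, where R = r * r, and each frequency arises at most R times. The sum over n
  remains inside the norm, so cancellation in n is still available for every frequency.\<close>

theorem sum_le_fejer_integrals:
  fixes f :: "nat \<Rightarrow> real \<Rightarrow> real" and p q :: nat and \<Lambda> :: real
  assumes "0 < r" "0 \<le> \<Lambda>" "p \<le> q" "finite S" and cont: "\<And>n. n \<in> S \<Longrightarrow> continuous_on {p - 1/2..q - 1/2} (f n)"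
    and lip: "\<And>n s t. \<lbrakk>n \<in> S; s \<in> {p - 1/2..q - 1/2}; t \<in> {p - 1/2..q - 1/2}\<rbrakk> \<Longrightarrow> \<bar>f n s - f n t\<bar> \<le> \<Lambda> * \<bar>s - t\<bar>"
  shows "norm (\<Sum>n\<in>S. \<Sum>m\<in>{p..<q}. expi (f n m))
    \<le> (\<Sum>\<mu>\<in>{- int (r * r)<..<int (r * r)}. norm (\<Sum>n\<in>S. integral {p - 1/2..q - 1/2} (\<lambda>t. expi (f n t - \<mu> * t))))
      + real (card S) * ((real q - real p) * (4 * pi * \<Lambda> / r))"
proof -
  let ?I = "{real p - 1/2..real q - 1/2}"
  define R where "R = r * r"
  have R: "0 < R" using assms by (simp add: R_def)
  define J where "J \<mu> = (\<Sum>n\<in>S. integral ?I (\<lambda>t. expi (f n t - real_of_int \<mu> * t)))" for \<mu> :: int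
  have fe: "integral ?I (\<lambda>t. expi (f n t) * fejer R t)
     = 1 / R * (\<Sum>i<R. \<Sum>j<R. integral ?I (\<lambda>t. expi (f n t - real_of_int (int i - int j) * t)))" if n: "n \<in> S" for n
  proof -
    have "(\<lambda>t. expi (f n t) * fejer R t) = (\<lambda>t. 1 / R * (\<Sum>i<R. \<Sum>j<R. expi (f n t - real_of_int (int i - int j) * t)))"
    proof
      fix t
      have "expi (f n t - real_of_int (int i - int j) * t) = expi (f n t) * expi (- (real i - real j) * t)" for i j unfolding expi_add[symmetric] by (simp add: algebra_simps)
      then show "expi (f n t) * fejer R t = 1 / R * (\<Sum>i<R. \<Sum>j<R. expi (f n t - real_of_int (int i - int j) * t))" by (simp add: fejer_def sum_distrib_left mult_ac)
    qed
    then show ?thesis by (simp add: integral_sum integrable_continuous_real continuous_intros cont[OF n] integrable_sum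
          del: of_int_diff)
  qed
  define V where "V n = integral ?I (\<lambda>t. expi (f n t) * fejer R t)" for n
  have split: "(\<Sum>n\<in>S. \<Sum>m\<in>{p..<q}. expi (f n m)) = (\<Sum>n\<in>S. (\<Sum>m\<in>{p..<q}. expi (f n m)) - V n) + (\<Sum>n\<in>S. V n)" by (simp add: sum_subtractf)
  have "norm (\<Sum>n\<in>S. (\<Sum>m\<in>{p..<q}. expi (f n m)) - V n) \<le> (\<Sum>n\<in>S. (real q - real p) * (4 * pi * \<Lambda> / r))"
    unfolding R_def V_def using assms by (intro sum_norm_le sum_expi_fejer) auto
  then have n1: "norm (\<Sum>n\<in>S. (\<Sum>m\<in>{p..<q}. expi (f n m)) - V n)
      \<le> real (card S) * ((real q - real p) * (4 * pi * \<Lambda> / r))" by simp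
  have n2: "norm (\<Sum>n\<in>S. V n) \<le> (\<Sum>\<mu>\<in>{- int R<..<int R}. norm (J \<mu>))"
  proof -
    have "(\<Sum>n\<in>S. V n) = 1 / R * (\<Sum>i<R. \<Sum>j<R. J (int i - int j))"
    proof -
      have "(\<Sum>n\<in>S. V n)
        = (\<Sum>n\<in>S. 1 / R * (\<Sum>i<R. \<Sum>j<R. integral ?I (\<lambda>t. expi (f n t - real_of_int (int i - int j) * t))))" unfolding V_def by (intro sum.cong refl fe)
      also have "\<dots> = 1 / R * (\<Sum>n\<in>S. \<Sum>i<R. \<Sum>j<R. integral ?I (\<lambda>t. expi (f n t - real_of_int (int i - int j) * t)))"
        by (rule sum_distrib_left[symmetric])
      also have "(\<Sum>n\<in>S. \<Sum>i<R. \<Sum>j<R. integral ?I (\<lambda>t. expi (f n t - real_of_int (int i - int j) * t)))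
        = (\<Sum>i<R. \<Sum>n\<in>S. \<Sum>j<R. integral ?I (\<lambda>t. expi (f n t - real_of_int (int i - int j) * t)))" by (rule sum.swap)
      also have "\<dots> = (\<Sum>i<R. \<Sum>j<R. J (int i - int j))" unfolding J_def by (intro sum.cong refl sum.swap)
      finally show ?thesis .
    qed
    then have "norm (\<Sum>n\<in>S. V n) = 1 / R * norm (\<Sum>i<R. \<Sum>j<R. J (int i - int j))" by (simp add: norm_mult norm_divide)
    also have "\<dots> \<le> 1 / R * (\<Sum>i<R. \<Sum>j<R. norm (J (int i - int j)))" by (intro mult_left_mono order_trans[OF norm_sum] sum_mono norm_sum) auto
    also have "\<dots> \<le> 1 / R * (\<Sum>i<R. \<Sum>\<mu>\<in>{- int R<..<int R}. norm (J \<mu>))"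
    proof (intro mult_left_mono sum_mono)
      fix i assume i: "i \<in> {..<R}"
      have "(\<Sum>j<R. norm (J (int i - int j))) = (\<Sum>\<mu>\<in>(\<lambda>j. int i - int j) ` {..<R}. norm (J \<mu>))" by (subst sum.reindex) (auto simp: inj_on_def)
      also have "\<dots> \<le> (\<Sum>\<mu>\<in>{- int R<..<int R}. norm (J \<mu>))" using i by (intro sum_mono2) auto
      finally show "(\<Sum>j<R. norm (J (int i - int j))) \<le> (\<Sum>\<mu>\<in>{- int R<..<int R}. norm (J \<mu>))" .
    qed auto
    also have "\<dots> = (\<Sum>\<mu>\<in>{- int R<..<int R}. norm (J \<mu>))" using R by simp
    finally show ?thesis .
  qed
  have "norm (\<Sum>n\<in>S. \<Sum>m\<in>{p..<q}. expi (f n m))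
     \<le> (\<Sum>\<mu>\<in>{- int R<..<int R}. norm (J \<mu>)) + real (card S) * ((real q - real p) * (4 * pi * \<Lambda> / r))"
    unfolding split using norm_triangle_mono[OF n1 n2] by linarith
  then show ?thesis unfolding J_def R_def .
qed

section \<open>Exponential integrals summed against a slowly varying scale\<close>

lemma integral_restricted:
  fixes F :: "real \<Rightarrow> complex"
  assumes "continuous_on {p..q} F"
  shows "(\<lambda>w. if w \<in> {c..d} then F w else 0) integrable_on {p..q}"
    and "integral {p..q} (\<lambda>w. if w \<in> {c..d} then F w else 0) = integral {max p c..min q d} F"
proof -
  have eq: "{c..d} \<inter> {p..q} = {max p c..min q d}" by auto
  have "F integrable_on {max p c..min q d}" by (rule integrable_continuous_real[OF continuous_on_subset[OF assms]]) auto
  then show "(\<lambda>w. if w \<in> {c..d} then F w else 0) integrable_on {p..q}" unfolding integrable_restrict_Int eq .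
  show "integral {p..q} (\<lambda>w. if w \<in> {c..d} then F w else 0) = integral {max p c..min q d} F" unfolding Henstock_Kurzweil_Integration.integral_restrict_Int eq ..
qed

text \<open>The intermediate value theorem, with an end point as default where the level x is not
  crossed. The disjunctions leave out what would be claimed about a degenerate piece.\<close>

lemma antimono_cut:
  fixes \<theta> :: "real \<Rightarrow> real"
  assumes "p \<le> q" "continuous_on {p..q} \<theta>" and mono: "\<And>v w. \<lbrakk>p \<le> v; v \<le> w; w \<le> q\<rbrakk> \<Longrightarrow> \<theta> w \<le> \<theta> v"
  obtains w where "p \<le> w" "w \<le> q" "w = p \<or> (\<forall>v\<in>{p..w}. x \<le> \<theta> v)" "w = q \<or> (\<forall>v\<in>{w..q}. \<theta> v \<le> x)"
proof (cases "\<theta> p \<le> x")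
  case True
  have "\<theta> v \<le> x" if "v \<in> {p..q}" for v using mono[of p v] True that by auto
  then show ?thesis using assms(1) by (intro that[of p]) auto
next
  case False
  show ?thesis
  proof (cases "x \<le> \<theta> q")
    case True
    have "x \<le> \<theta> v" if "v \<in> {p..q}" for v using mono[of v q] True that by auto
    then show ?thesis using assms(1) by (intro that[of q]) auto
  next
    case f: False
    have "\<exists>w. p \<le> w \<and> w \<le> q \<and> \<theta> w = x" using False f assms by (intro IVT2') auto
    then obtain w where w: "p \<le> w" "w \<le> q" "\<theta> w = x" by blast
    show ?thesis using w mono by (intro that[of w]) auto
  qed
qed

text \<open>The phase at (n, t) is \<open>G n * \<phi> (t / G n)\<close>. With t = G n * w it
  becomes \<open>G n * \<phi> w\<close>, where n enters only through a factor, so that for fixed w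
  the sum over n is a single exponential sum, bounded in \<open>pair\<close>. The range of w now
  depends on n; \<open>pair_end\<close> bounds the sums along its moving end points. The assumption
  \<open>pair\<close> concerns only w near a stationary point; elsewhere the first derivative test
  treats each n separately.\<close>

locale scaled_phase =
  fixes \<phi> \<theta> \<theta>' :: "real \<Rightarrow> real" and G :: "nat \<Rightarrow> real" and W0 W1 A B D Gu \<eta> E :: real and n1 n2 :: nat
  assumes n12: "n1 \<le> n2"
    and W: "0 < W0" "W0 \<le> W1" and AB: "0 < A" "A \<le> B"
    and d1: "\<And>w. W0 \<le> w \<Longrightarrow> w \<le> W1 \<Longrightarrow> (\<phi> has_real_derivative \<theta> w) (at w)"
    and d2: "\<And>w. W0 \<le> w \<Longrightarrow> w \<le> W1 \<Longrightarrow> (\<theta> has_real_derivative \<theta>' w) (at w)"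
    and cont: "continuous_on {W0..W1} \<theta>'"
    and D: "0 < D" "\<And>w. W0 \<le> w \<Longrightarrow> w \<le> W1 \<Longrightarrow> \<theta>' w \<le> - D"
    and G: "\<And>n. n1 \<le> n \<Longrightarrow> n < n2 \<Longrightarrow> 0 < G n \<and> G n \<le> Gu \<and> W0 \<le> A / G n \<and> B / G n \<le> W1"
    and Gmono: "\<And>m n. \<lbrakk>n1 \<le> m; m \<le> n; n < n2\<rbrakk> \<Longrightarrow> G n \<le> G m"
    and \<eta>: "0 < \<eta>" and E: "0 \<le> E"
    and pair: "\<And>w r s. \<lbrakk>W0 \<le> w; w \<le> W1; \<bar>\<theta> w\<bar> \<le> \<eta>; n1 \<le> r; r \<le> s; s \<le> n2\<rbrakk> \<Longrightarrow>
        norm (\<Sum>n\<in>{r..<s}. expi (G n * \<phi> w)) \<le> E"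
    and pair_end: "\<And>T r s. \<lbrakk>T = A \<or> T = B; n1 \<le> r; r \<le> s; s \<le> n2\<rbrakk> \<Longrightarrow>
        norm (\<Sum>n\<in>{r..<s}. expi (G n * \<phi> (T / G n))) \<le> E"
begin

text \<open>The factor \<open>G n\<close> is the Jacobian of t = G n * w. Extension by 0 puts all n
  on the common interval [W0, W1], which permits exchanging the sum over n with the
  integral.\<close>

definition "kern n w = (if w \<in> {A / G n..B / G n} then of_real (G n) * expi (G n * \<phi> w) else 0)"

definition "zone p q = (\<Sum>n\<in>{n1..<n2}. integral {p..q} (kern n))"

lemma ratio_mono: "\<lbrakk>n1 \<le> m; m \<le> n; n < n2; 0 \<le> T\<rbrakk> \<Longrightarrow> T / G m \<le> T / G n"
  using G[of m] G[of n] Gmono[of m n] by (intro divide_left_mono) auto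

lemma Gu_nonneg: "n1 < n2 \<Longrightarrow> 0 \<le> Gu" using G[of n1] by auto

lemma contin: "W0 \<le> p \<Longrightarrow> q \<le> W1 \<Longrightarrow> continuous_on {p..q} \<phi>"
  "W0 \<le> p \<Longrightarrow> q \<le> W1 \<Longrightarrow> continuous_on {p..q} \<theta>"
  by (auto intro!: continuous_at_imp_continuous_on DERIV_isCont[OF d1] DERIV_isCont[OF d2])

lemma \<theta>_decr: "\<lbrakk>W0 \<le> v; v \<le> w; w \<le> W1\<rbrakk> \<Longrightarrow> D * (w - v) \<le> \<theta> v - \<theta> w"
proof (cases "v = w")
  case False
  assume a: "W0 \<le> v" "v \<le> w" "w \<le> W1"
  with False obtain z where "v < z" "z < w" "\<theta> w - \<theta> v = (w - v) * \<theta>' z" using MVT2[of v w \<theta> \<theta>'] d2 by auto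
  moreover from this have "(w - v) * \<theta>' z \<le> (w - v) * (- D)" using D(2)[of z] a by (intro mult_left_mono) auto
  ultimately show ?thesis by (simp add: algebra_simps)
qed simp

lemma \<theta>_antimono: "\<lbrakk>W0 \<le> v; v \<le> w; w \<le> W1\<rbrakk> \<Longrightarrow> \<theta> w \<le> \<theta> v"
  using \<theta>_decr[of v w] D(1) mult_nonneg_nonneg[of D "w - v"] by linarith

lemma kern_integral:
  assumes "W0 \<le> p" "q \<le> W1"
  shows "kern n integrable_on {p..q}"
    and "integral {p..q} (kern n) = integral {max p (A / G n)..min q (B / G n)} (\<lambda>w. of_real (G n) * expi (G n * \<phi> w))"
proof -
  have "continuous_on {p..q} (\<lambda>w. of_real (G n) * expi (G n * \<phi> w))" by (intro continuous_intros contin assms)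
  from integral_restricted[OF this, of "A / G n" "B / G n"] show "kern n integrable_on {p..q}"
    and "integral {p..q} (kern n) = integral {max p (A / G n)..min q (B / G n)} (\<lambda>w. of_real (G n) * expi (G n * \<phi> w))" unfolding kern_def[abs_def] by auto
qed

lemma zone_combine:
  assumes "W0 \<le> p" "p \<le> q" "q \<le> r" "r \<le> W1"
  shows "zone p r = zone p q + zone q r"
proof -
  have "integral {p..r} (kern n) = integral {p..q} (kern n) + integral {q..r} (kern n)" for n
    using assms by (intro Henstock_Kurzweil_Integration.integral_combine[symmetric] kern_integral) auto
  then show ?thesis by (simp add: zone_def sum.distrib)
qed

lemma zone_refl [simp]: "zone p p = 0" by (simp add: zone_def)

lemma phase_derivs:
  assumes "W0 \<le> p" "q \<le> W1" "t \<in> {p..q}"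
  shows "((\<lambda>w. G n * \<phi> w) has_real_derivative G n * \<theta> t) (at t within {p..q})"
    "((\<lambda>w. G n * \<theta> w) has_real_derivative G n * \<theta>' t) (at t within {p..q})"
  using d1[of t] d2[of t] assms by (auto intro!: DERIV_cmult intro: has_field_derivative_at_within)

text \<open>The Jacobian \<open>G n\<close> cancels against the slope \<open>G n * \<theta>\<close>,
  so each n contributes at most 1/\<eta>.\<close>

lemma zone_far:
  assumes "W0 \<le> p" "p \<le> q" "q \<le> W1" and far: "(\<forall>w\<in>{p..q}. \<eta> \<le> \<theta> w) \<or> (\<forall>w\<in>{p..q}. \<theta> w \<le> - \<eta>)"
  shows "norm (zone p q) \<le> (real n2 - real n1) / \<eta>"
proof -
  have "norm (zone p q) \<le> (\<Sum>n\<in>{n1..<n2}. 1 / \<eta>)" unfolding zone_def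
  proof (rule sum_norm_le)
    fix n assume n: "n \<in> {n1..<n2}"
    then have Gn: "0 < G n" using G[of n] by auto
    define a b where "a = max p (A / G n)" and "b = min q (B / G n)"
    have ab: "W0 \<le> a" "b \<le> W1" "p \<le> a" "b \<le> q" using assms by (auto simp: a_def b_def)
    have I: "integral {p..q} (kern n) = of_real (G n) * integral {a..b} (\<lambda>w. expi (G n * \<phi> w))" using kern_integral(2)[of p q n] assms by (simp add: a_def b_def)
    show "norm (integral {p..q} (kern n)) \<le> 1 / \<eta>"
    proof (cases "a \<le> b")
      case True
      have "norm (integral {a..b} (\<lambda>w. expi (G n * \<phi> w))) \<le> 1 / (G n * \<eta>)"
      proof (rule first_derivative_test[OF True _ phase_derivs(1)[OF ab(1,2)] phase_derivs(2)[OF ab(1,2)]])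
        show "continuous_on {a..b} (\<lambda>t. G n * \<theta>' t)" using ab by (intro continuous_intros continuous_on_subset[OF cont]) auto
        show "0 < G n * \<eta>" using Gn \<eta> by simp
        show "G n * \<theta>' t \<le> 0" if "t \<in> {a..b}" for t using D(2)[of t] D(1) ab that Gn by (intro mult_nonneg_nonpos) auto
        show "(\<forall>t\<in>{a..b}. G n * \<eta> \<le> G n * \<theta> t) \<or> (\<forall>t\<in>{a..b}. G n * \<theta> t \<le> - (G n * \<eta>))" using far
        proof
          assume "\<forall>w\<in>{p..q}. \<eta> \<le> \<theta> w"
          then have "\<forall>t\<in>{a..b}. G n * \<eta> \<le> G n * \<theta> t" using ab Gn by (auto intro!: mult_left_mono)
          then show ?thesis ..
        next
          assume *: "\<forall>w\<in>{p..q}. \<theta> w \<le> - \<eta>"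
          have "G n * \<theta> t \<le> - (G n * \<eta>)" if "t \<in> {a..b}" for t using mult_left_mono[of "\<theta> t" "- \<eta>" "G n"] * ab Gn that by auto
          then show ?thesis by blast
        qed
      qed
      then have "G n * norm (integral {a..b} (\<lambda>w. expi (G n * \<phi> w))) \<le> G n * (1 / (G n * \<eta>))" using Gn by (intro mult_left_mono) auto
      then show ?thesis unfolding I using Gn by (simp add: norm_mult)
    next
      case False
      then show ?thesis unfolding I using \<eta> by simp
    qed
  qed
  then show ?thesis using n12 by (simp add: of_nat_diff)
qed

text \<open>As \<open>G\<close> decreases, w lies in the range belonging to n for a contiguous set
  of n. The cut-off therefore only shortens the sum, and the decreasing weights are removed by
  partial summation.\<close>

lemma sum_kern_le:
  assumes w: "W0 \<le> w" "w \<le> W1" "\<bar>\<theta> w\<bar> \<le> \<eta>"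
    and c: "\<And>m n. \<lbrakk>n1 \<le> m; m \<le> n; n < n2\<rbrakk> \<Longrightarrow> c n \<le> c m" "\<And>n. n1 \<le> n \<Longrightarrow> n < n2 \<Longrightarrow> 0 \<le> c n \<and> c n \<le> V" "0 \<le> V"
  shows "norm (\<Sum>n\<in>{n1..<n2}. if w \<in> {A / G n..B / G n} then of_real (c n) * expi (G n * \<phi> w) else 0) \<le> V * E"
proof -
  define S where "S = {n\<in>{n1..<n2}. w \<in> {A / G n..B / G n}}"
  have "\<exists>r s. n1 \<le> r \<and> r \<le> s \<and> s \<le> max n1 n2 \<and> S = {r..<s}"
  proof (rule convex_nat_subset)
    fix a b c assume abc: "a \<in> S" "b \<in> S" "a \<le> c" "c \<le> b"
    then have "A / G c \<le> A / G b" "B / G a \<le> B / G c" using AB by (auto simp: S_def intro!: ratio_mono)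
    then show "c \<in> S" using abc by (auto simp: S_def)
  qed (auto simp: S_def)
  then obtain r s where rs: "n1 \<le> r" "r \<le> s" "s \<le> n2" "S = {r..<s}" using n12 by auto
  have "(\<Sum>n\<in>{n1..<n2}. if w \<in> {A / G n..B / G n} then of_real (c n) * expi (G n * \<phi> w) else 0)
    = (\<Sum>n\<in>S. of_real (c n) * expi (G n * \<phi> w))" unfolding S_def by (rule sum.inter_filter[symmetric]) simp
  also have "norm \<dots> \<le> V * E" unfolding rs(4)
  proof (rule abel_antimono)
    show "norm (\<Sum>n\<in>{r..<t}. expi (G n * \<phi> w)) \<le> E" if "r \<le> t" "t \<le> s" for t using that rs by (intro pair w) auto
  qed (use rs c E in auto)
  finally show ?thesis .
qed

text \<open>Since \<open>\<theta>\<close> falls at least at rate \<open>D\<close>, the zone has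
  length at most 2\<eta>'/D; on it the sum over n is bounded for each w.\<close>

lemma zone_near:
  assumes pq: "W0 \<le> p" "p \<le> q" "q \<le> W1" and near: "\<And>w. w \<in> {p..q} \<Longrightarrow> \<bar>\<theta> w\<bar> \<le> \<eta>'" and "\<eta>' \<le> \<eta>"
    and "n1 < n2"
  shows "norm (zone p q) \<le> 2 * \<eta>' / D * (Gu * E)"
proof -
  have int: "kern n integrable_on {p..q}" for n using pq by (intro kern_integral) auto
  have "zone p q = integral {p..q} (\<lambda>w. \<Sum>n\<in>{n1..<n2}. kern n w)" unfolding zone_def by (rule integral_sum[symmetric]) (auto intro: int)
  also have "norm \<dots> \<le> integral {p..q} (\<lambda>w. Gu * E)"
  proof (rule integral_norm_bound_integral)
    show "(\<lambda>w. \<Sum>n\<in>{n1..<n2}. kern n w) integrable_on {p..q}" by (intro integrable_sum int) auto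
    show "(\<lambda>w. Gu * E) integrable_on {p..q}" by (intro integrable_continuous_real continuous_intros)
    fix w assume "w \<in> {p..q}"
    then show "norm (\<Sum>n\<in>{n1..<n2}. kern n w) \<le> Gu * E" unfolding kern_def using near[of w] pq assms(5) Gu_nonneg[OF assms(6)] Gmono G
      by (intro sum_kern_le) (auto simp: less_imp_le)
  qed
  also have "\<dots> = (q - p) * (Gu * E)" using pq by simp
  also have "\<dots> \<le> 2 * \<eta>' / D * (Gu * E)"
  proof (rule mult_right_mono)
    have "D * (q - p) \<le> 2 * \<eta>'" using \<theta>_decr[of p q] pq near[of p] near[of q] by auto
    then show "q - p \<le> 2 * \<eta>' / D" using D(1) by (simp add: pos_le_divide_eq mult.commute)
    show "0 \<le> Gu * E" using Gu_nonneg[OF assms(6)] E by simp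
  qed
  finally show ?thesis .
qed

text \<open>Treats the end point terms of the integration by parts in \<open>zone_middle\<close>.
  The weights 1/\<theta> (x n) are monotone in n, because x n is and \<theta> keeps its sign, so
  partial summation removes them. What remains is covered by \<open>pair\<close> at a fixed end
  point and by \<open>pair_end\<close> at a moving one.\<close>

lemma boundary_sum:
  assumes pq: "W0 \<le> p" "p \<le> q" "q \<le> W1" and T: "T = A \<or> T = B"
    and near: "\<And>w. w \<in> {p..q} \<Longrightarrow> \<eta>' \<le> \<bar>\<theta> w\<bar> \<and> \<bar>\<theta> w\<bar> \<le> \<eta>" and "0 < \<eta>'"
    and sgn: "(\<forall>w\<in>{p..q}. 0 < \<theta> w) \<or> (\<forall>w\<in>{p..q}. \<theta> w < 0)"
    and S: "S \<subseteq> {n1..<n2}" and conv: "\<And>a b c. \<lbrakk>a \<in> S; b \<in> S; a \<le> c; c \<le> b\<rbrakk> \<Longrightarrow> c \<in> S"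
    and x: "(\<forall>n\<in>S. x n = w0) \<and> w0 \<in> {p..q} \<or> (\<forall>n\<in>S. x n = T / G n \<and> T / G n \<in> {p..q})"
  shows "norm (\<Sum>n\<in>S. of_real (1 / \<theta> (x n)) * expi (G n * \<phi> (x n))) \<le> 3 * (1 / \<eta>') * E"
proof -
  have "\<exists>r s. n1 \<le> r \<and> r \<le> s \<and> s \<le> max n1 n2 \<and> S = {r..<s}" by (rule convex_nat_subset[OF S conv])
  then obtain r s where rs: "n1 \<le> r" "r \<le> s" "s \<le> n2" "S = {r..<s}" using n12 by auto
  have inv: "\<bar>1 / \<theta> w\<bar> \<le> 1 / \<eta>'" if "w \<in> {p..q}" for w using near[OF that] assms(6) by (auto simp: abs_divide intro!: divide_left_mono mult_pos_pos)
  have xin: "x n \<in> {p..q}" if "n \<in> S" for n using x that by auto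
  have xmono: "x m \<le> x n" if "m \<in> S" "n \<in> S" "m \<le> n" for m n
  proof -
    have "T / G m \<le> T / G n" using that S T AB by (intro ratio_mono) auto
    then show ?thesis using x that by auto
  qed
  have inc: "1 / \<theta> v \<le> 1 / \<theta> w" if "v \<in> {p..q}" "w \<in> {p..q}" "v \<le> w" for v w
  proof -
    have "\<theta> w \<le> \<theta> v" using that pq by (intro \<theta>_antimono) auto
    moreover have "0 < \<theta> v * \<theta> w" using sgn that by (auto intro: mult_pos_pos mult_neg_neg)
    ultimately show ?thesis by (intro divide_left_mono) auto
  qed
  show ?thesis unfolding rs(4)
  proof (rule abel_bound)
    have "1 / \<theta> (x m) \<le> 1 / \<theta> (x n)" if "r \<le> m" "m \<le> n" "n < s" for m n using that rs by (intro inc xin xmono) auto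
    then show "(\<forall>m n. r \<le> m \<longrightarrow> m \<le> n \<longrightarrow> n < s \<longrightarrow> 1 / \<theta> (x n) \<le> 1 / \<theta> (x m)) \<or>
      (\<forall>m n. r \<le> m \<longrightarrow> m \<le> n \<longrightarrow> n < s \<longrightarrow> 1 / \<theta> (x m) \<le> 1 / \<theta> (x n))" by blast
    show "\<bar>1 / \<theta> (x n)\<bar> \<le> 1 / \<eta>'" if "r \<le> n" "n < s" for n using that rs by (intro inv xin) auto
    fix t assume t: "r \<le> t" "t \<le> s"
    show "norm (\<Sum>n\<in>{r..<t}. expi (G n * \<phi> (x n))) \<le> E" using x
    proof
      assume "(\<forall>n\<in>S. x n = w0) \<and> w0 \<in> {p..q}"
      moreover from this have "(\<Sum>n\<in>{r..<t}. expi (G n * \<phi> (x n))) = (\<Sum>n\<in>{r..<t}. expi (G n * \<phi> w0))" using t rs by (intro sum.cong) auto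
      ultimately show ?thesis using near[of w0] pq t rs by (auto intro!: pair)
    next
      assume "\<forall>n\<in>S. x n = T / G n \<and> T / G n \<in> {p..q}"
      then have "(\<Sum>n\<in>{r..<t}. expi (G n * \<phi> (x n))) = (\<Sum>n\<in>{r..<t}. expi (G n * \<phi> (T / G n)))" using t rs by (intro sum.cong) auto
      then show ?thesis using pair_end[OF T, of r t] t rs by auto
    qed
  qed (use assms(6) E in auto)
qed

text \<open>Integrating by parts for each n first and summing over n afterwards keeps the bound
  \<open>E\<close> for the sum over n and divides it by the slope, which the derivative test applied
  term by term would not do. The Jacobian cancels the factor \<open>G n\<close> of the derivative,
  so no weights depending on n remain except 1/\<theta> at the end points.\<close>

lemma zone_middle:
  assumes pq: "W0 \<le> p" "p \<le> q" "q \<le> W1"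
    and near: "\<And>w. w \<in> {p..q} \<Longrightarrow> \<eta>' \<le> \<bar>\<theta> w\<bar> \<and> \<bar>\<theta> w\<bar> \<le> \<eta>" and "0 < \<eta>'"
    and sgn: "(\<forall>w\<in>{p..q}. 0 < \<theta> w) \<or> (\<forall>w\<in>{p..q}. \<theta> w < 0)"
  shows "norm (zone p q) \<le> 3 * E / \<eta>'"
proof -
  define P where "P n = max p (A / G n)" for n
  define Q where "Q n = min q (B / G n)" for n
  define S where "S = {n\<in>{n1..<n2}. P n \<le> Q n}"
  let ?e = "\<lambda>X n. of_real (1 / \<theta> (X n)) * expi (G n * \<phi> (X n))"
  define K where "K n w = of_real (\<theta>' w / (\<theta> w)\<^sup>2) * expi (G n * \<phi> w)" for n w
  have nz: "\<theta> w \<noteq> 0" if "w \<in> {p..q}" for w using near[OF that] assms(5) by auto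
  have Gn: "0 < G n" if "n \<in> {n1..<n2}" for n using G[of n] that by auto
  have "A / G n \<le> B / G n" if "n \<in> {n1..<n2}" for n using Gn[OF that] AB by (simp add: divide_right_mono)
  then have Seq: "S = {n\<in>{n1..<n2}. p \<le> B / G n \<and> A / G n \<le> q}" using pq by (auto simp: S_def P_def Q_def)
  have convS: "c \<in> S" if "a \<in> S" "b \<in> S" "a \<le> c" "c \<le> b" for a b c
  proof -
    have "A / G c \<le> A / G b" "B / G a \<le> B / G c" using AB that by (auto simp: Seq intro!: ratio_mono)
    then show ?thesis using that by (auto simp: Seq)
  qed
  have contK: "continuous_on {p..q} (K n)" for n unfolding K_def[abs_def] using pq nz by (intro continuous_intros contin continuous_on_subset[OF cont]) auto
  have main: "integral {p..q} (kern n) = 1 / (2 * pi * \<i>) * (?e Q n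
      - ?e P n + integral {P n..Q n} (K n))" if n: "n \<in> S" for n
  proof -
    have PQ: "P n \<le> Q n" "p \<le> P n" "Q n \<le> q" "W0 \<le> P n" "Q n \<le> W1" using n pq by (auto simp: S_def P_def Q_def)
    have g: "G n \<noteq> 0" using n Gn[of n] by (auto simp: S_def)
    have "integral {p..q} (kern n) = of_real (G n) * integral {P n..Q n} (\<lambda>w. expi (G n * \<phi> w))" using kern_integral(2)[of p q n] pq by (simp add: P_def Q_def)
    also have "integral {P n..Q n} (\<lambda>w. expi (G n * \<phi> w)) = 1 / (2 * pi * \<i>) *
      (expi (G n * \<phi> (Q n)) / of_real (G n * \<theta> (Q n)) - expi (G n * \<phi> (P n)) / of_real (G n * \<theta> (P n))
      + integral {P n..Q n} (\<lambda>t. of_real (G n * \<theta>' t / (G n * \<theta> t)\<^sup>2) * expi (G n * \<phi> t)))" using PQ nz g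
      by (intro expi_integral_by_parts phase_derivs continuous_intros continuous_on_subset[OF cont]) auto
    also have "(\<lambda>t. of_real (G n * \<theta>' t / (G n * \<theta> t)\<^sup>2) * expi (G n * \<phi> t)) = (\<lambda>t. 1 / of_real (G n) * K n t)"
      using g by (auto simp: K_def power2_eq_square)
    also have "integral {P n..Q n} (\<lambda>t. 1 / of_real (G n) * K n t) = 1 / of_real (G n) * integral {P n..Q n} (K n)" by (rule integral_mult_right)
    finally have eq: "integral {p..q} (kern n) = of_real (G n) * (1 / (2 * pi * \<i>) *
      (expi (G n * \<phi> (Q n)) / (of_real (G n) * of_real (\<theta> (Q n))) - expi (G n * \<phi> (P n)) / (of_real (G n) * of_real (\<theta> (P n)))
      + 1 / of_real (G n) * integral {P n..Q n} (K n)))" by (simp only: of_real_mult)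
    have "x * (c * (X / (x * a) - Y / (x * b) + 1 / x * J)) = c * (1 / a * X - 1 / b * Y + J)"
      if "x \<noteq> 0" for x c X Y a b J :: complex using that by (simp add: algebra_simps)
    from this[of "of_real (G n)"] show ?thesis unfolding eq using g by (simp only: of_real_divide of_real_1 of_real_eq_0_iff not_False_eq_True)
  qed
  have "zone p q = (\<Sum>n\<in>S. integral {p..q} (kern n))" unfolding zone_def
  proof (rule sum.mono_neutral_right)
    show "\<forall>n\<in>{n1..<n2} - S. integral {p..q} (kern n) = 0" using kern_integral(2)[of p q] pq by (auto simp: S_def P_def Q_def)
  qed (auto simp: S_def)
  also have "\<dots> = (\<Sum>n\<in>S. 1 / (2 * pi * \<i>) * (?e Q n
      - ?e P n + integral {P n..Q n} (K n)))" by (rule sum.cong[OF refl main])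
  also have "\<dots> = 1 / (2 * pi * \<i>) * ((\<Sum>n\<in>S. ?e Q n)
      - (\<Sum>n\<in>S. ?e P n) + (\<Sum>n\<in>S. integral {P n..Q n} (K n)))" by (simp only: sum_distrib_left[symmetric] sum.distrib sum_subtractf)
  finally have eq: "zone p q = \<dots>" .
  have b: "norm (\<Sum>n\<in>S'. of_real (1 / \<theta> (x n)) * expi (G n * \<phi> (x n))) \<le> 3 * (1 / \<eta>') * E"
    if "S' \<subseteq> S" "\<And>a b c. \<lbrakk>a \<in> S'; b \<in> S'; a \<le> c; c \<le> b\<rbrakk> \<Longrightarrow> c \<in> S'" "T = A \<or> T = B"
      "(\<forall>n\<in>S'. x n = v) \<and> v \<in> {p..q} \<or> (\<forall>n\<in>S'. x n = T / G n \<and> T / G n \<in> {p..q})" for S' x T v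
  proof -
    have "S' \<subseteq> {n1..<n2}" using that(1) by (auto simp: S_def)
    from boundary_sum[OF pq that(3) near assms(5) sgn this that(2,4)] show ?thesis .
  qed
  have finS: "finite S" by (simp add: S_def)
  have bP: "norm (\<Sum>n\<in>S. ?e P n) \<le> 6 * (1 / \<eta>') * E"
  proof -
    \<comment> \<open>The lower end point is the fixed p for n in S1 and the moving A / G n
      otherwise; both index sets are order-convex, as \<open>boundary_sum\<close> requires.\<close>
    define S1 where "S1 = {n\<in>S. A / G n \<le> p}"
    have "norm (\<Sum>n\<in>S1. ?e P n) \<le> 3 * (1 / \<eta>') * E"
    proof (rule b[where T = A and v = p])
      fix a b c assume abc: "a \<in> S1" "b \<in> S1" "a \<le> c" "c \<le> b"
      then have "A / G c \<le> A / G b" using AB by (auto simp: S1_def S_def intro!: ratio_mono)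
      then show "c \<in> S1" using abc convS[of a b c] by (auto simp: S1_def)
    qed (use pq in \<open>auto simp: S1_def P_def\<close>)
    moreover have "norm (\<Sum>n\<in>S - S1. ?e P n) \<le> 3 * (1 / \<eta>') * E"
    proof (rule b[where T = A and v = p])
      fix a b c assume abc: "a \<in> S - S1" "b \<in> S - S1" "a \<le> c" "c \<le> b"
      then have "A / G a \<le> A / G c" using AB by (auto simp: S1_def S_def intro!: ratio_mono)
      then show "c \<in> S - S1" using abc convS[of a b c] by (auto simp: S1_def)
    qed (auto simp: S1_def P_def Seq)
    moreover have "(\<Sum>n\<in>S. ?e P n) =
      (\<Sum>n\<in>S - S1. ?e P n) + (\<Sum>n\<in>S1. ?e P n)" using finS by (intro sum.subset_diff) (auto simp: S1_def)
    ultimately show ?thesis using norm_triangle_mono by fastforce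
  qed
  have bQ: "norm (\<Sum>n\<in>S. ?e Q n) \<le> 6 * (1 / \<eta>') * E"
  proof -
    define S1 where "S1 = {n\<in>S. q \<le> B / G n}"
    have "norm (\<Sum>n\<in>S1. ?e Q n) \<le> 3 * (1 / \<eta>') * E"
    proof (rule b[where T = B and v = q])
      fix a b c assume abc: "a \<in> S1" "b \<in> S1" "a \<le> c" "c \<le> b"
      then have "B / G a \<le> B / G c" using AB by (auto simp: S1_def S_def intro!: ratio_mono)
      then show "c \<in> S1" using abc convS[of a b c] by (auto simp: S1_def)
    qed (use pq in \<open>auto simp: S1_def Q_def\<close>)
    moreover have "norm (\<Sum>n\<in>S - S1. ?e Q n) \<le> 3 * (1 / \<eta>') * E"
    proof (rule b[where T = B and v = q])
      fix a b c assume abc: "a \<in> S - S1" "b \<in> S - S1" "a \<le> c" "c \<le> b"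
      then have "B / G c \<le> B / G b" using AB by (auto simp: S1_def S_def intro!: ratio_mono)
      then show "c \<in> S - S1" using abc convS[of a b c] by (auto simp: S1_def)
    qed (auto simp: S1_def Q_def Seq)
    moreover have "(\<Sum>n\<in>S. ?e Q n) =
      (\<Sum>n\<in>S - S1. ?e Q n) + (\<Sum>n\<in>S1. ?e Q n)" using finS by (intro sum.subset_diff) (auto simp: S1_def)
    ultimately show ?thesis using norm_triangle_mono by fastforce
  qed
  have bK: "norm (\<Sum>n\<in>S. integral {P n..Q n} (K n)) \<le> 2 * (1 / \<eta>') * E"
  proof -
    have "(\<Sum>n\<in>S. integral {P n..Q n} (K n)) = (\<Sum>n\<in>{n1..<n2}. integral {P n..Q n} (K n))" by (rule sum.mono_neutral_left) (auto simp: S_def)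
    also have "\<dots> = (\<Sum>n\<in>{n1..<n2}. integral {p..q} (\<lambda>w. if w \<in> {A / G n..B / G n} then K n w else 0))"
      unfolding P_def Q_def using integral_restricted(2)[OF contK] by simp
    \<comment> \<open>Exchanging sum and integral lets the sum over n be bounded by E for each w;
      the remaining weight -\<theta>'/\<theta>^2 is the derivative of 1/\<theta> and integrates to
      at most 2/\<eta>'.\<close>
    also have "\<dots> = integral {p..q} (\<lambda>w. \<Sum>n\<in>{n1..<n2}. if w \<in> {A / G n..B / G n} then K n w else 0)"
      by (rule integral_sum[symmetric]) (rule finite_atLeastLessThan, rule integral_restricted(1)[OF contK])
    also have "norm \<dots> \<le> integral {p..q} (\<lambda>w. - (\<theta>' w / (\<theta> w)\<^sup>2) * E)"
    proof (rule integral_norm_bound_integral)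
      show "(\<lambda>w. \<Sum>n\<in>{n1..<n2}. if w \<in> {A / G n..B / G n} then K n w else 0) integrable_on {p..q}"
        by (intro integrable_sum integral_restricted(1)[OF contK]) auto
      show "(\<lambda>w. - (\<theta>' w / (\<theta> w)\<^sup>2) * E) integrable_on {p..q}"
        using pq nz by (intro integrable_continuous_real continuous_intros contin continuous_on_subset[OF cont]) auto
      fix w assume w: "w \<in> {p..q}"
      have "(\<Sum>n\<in>{n1..<n2}. if w \<in> {A / G n..B / G n} then K n w else 0)
         = of_real (\<theta>' w / (\<theta> w)\<^sup>2) * (\<Sum>n\<in>{n1..<n2}. if w \<in> {A / G n..B / G n} then of_real 1 * expi (G n * \<phi> w) else 0)"
        unfolding sum_distrib_left K_def by (intro sum.cong) auto
      also have "norm \<dots> = \<bar>\<theta>' w / (\<theta> w)\<^sup>2\<bar> * norm (\<Sum>n\<in>{n1..<n2}. if w \<in> {A / G n..B / G n} then of_real 1 * expi (G n * \<phi> w) else 0)"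
        by (simp only: norm_mult norm_of_real)
      also have "\<dots> \<le> \<bar>\<theta>' w / (\<theta> w)\<^sup>2\<bar> * (1 * E)" using w pq near[OF w] by (intro mult_left_mono sum_kern_le) auto
      also have "\<bar>\<theta>' w / (\<theta> w)\<^sup>2\<bar> = - (\<theta>' w / (\<theta> w)\<^sup>2)"
        using D(2)[of w] D(1) w pq by (intro abs_of_nonpos divide_nonpos_nonneg) auto
      finally show "norm (\<Sum>n\<in>{n1..<n2}. if w \<in> {A / G n..B / G n} then K n w else 0) \<le> - (\<theta>' w / (\<theta> w)\<^sup>2) * E" by simp
    qed
    also have "\<dots> = (1 / \<theta> q - 1 / \<theta> p) * E"
    proof -
      have "((\<lambda>t. - (\<theta>' t / (\<theta> t)\<^sup>2)) has_integral 1 / \<theta> q - 1 / \<theta> p) {p..q}"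
      proof (rule fundamental_theorem_of_calculus[OF pq(2)])
        fix t assume t: "t \<in> {p..q}"
        have "(\<theta> has_real_derivative \<theta>' t) (at t within {p..q})" using d2[of t] t pq by (auto intro: has_field_derivative_at_within)
        then have "((\<lambda>t. 1 / \<theta> t) has_real_derivative - (\<theta>' t / (\<theta> t)\<^sup>2)) (at t within {p..q})"
          using nz[OF t] by (auto intro!: derivative_eq_intros simp: power2_eq_square)
        then show "((\<lambda>t. 1 / \<theta> t) has_vector_derivative - (\<theta>' t / (\<theta> t)\<^sup>2)) (at t within {p..q})"
          by (simp add: has_real_derivative_iff_has_vector_derivative)
      qed
      from has_integral_mult_left[OF this, of E] show ?thesis by (rule integral_unique)
    qed
    also have "\<dots> \<le> (1 / \<eta>' + 1 / \<eta>') * E"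
    proof (rule mult_right_mono[OF _ E])
      have inv: "\<bar>1 / \<theta> w\<bar> \<le> 1 / \<eta>'" if "w \<in> {p..q}" for w
        using near[OF that] assms(5) by (auto simp: abs_divide intro!: divide_left_mono mult_pos_pos)
      have "\<bar>1 / \<theta> p\<bar> \<le> 1 / \<eta>'" by (rule inv) (use pq in simp)
      moreover have "\<bar>1 / \<theta> q\<bar> \<le> 1 / \<eta>'" by (rule inv) (use pq in simp)
      ultimately show "1 / \<theta> q - 1 / \<theta> p \<le> 1 / \<eta>' + 1 / \<eta>'" by linarith
    qed
    finally show ?thesis by simp
  qed
  have "norm (zone p q) = 1 / (2 * pi) * norm ((\<Sum>n\<in>S. ?e Q n)
      - (\<Sum>n\<in>S. ?e P n) + (\<Sum>n\<in>S. integral {P n..Q n} (K n)))" unfolding eq norm_mult by (simp add: norm_divide norm_mult)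
  also have "\<dots> \<le> 1 / (2 * pi) * (6 * (1 / \<eta>') * E + 6 * (1 / \<eta>') * E + 2 * (1 / \<eta>') * E)"
    by (intro mult_left_mono norm_triangle_mono order_trans[OF norm_triangle_ineq4 add_mono[OF bQ bP]] bK) auto
  also have "\<dots> \<le> 1 / (2 * 3) * (6 * (1 / \<eta>') * E + 6 * (1 / \<eta>') * E + 2 * (1 / \<eta>') * E)"
    using pi_gt3 E assms(5) by (intro mult_right_mono divide_left_mono add_nonneg_nonneg mult_nonneg_nonneg) auto
  also have "\<dots> \<le> 3 * E / \<eta>'" using E assms(5) by (simp add: field_simps)
  finally show ?thesis .
qed

lemma sum_integral_eq_zone:
  "(\<Sum>n\<in>{n1..<n2}. integral {A..B} (\<lambda>t. expi (G n * \<phi> (t / G n)))) = zone W0 W1" unfolding zone_def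
proof (rule sum.cong[OF refl])
  fix n assume "n \<in> {n1..<n2}"
  then have Gn: "0 < G n" "W0 \<le> A / G n" "B / G n \<le> W1" using G[of n] by auto
  let ?a = "A / G n" and ?b = "B / G n"
  have ab: "?a \<le> ?b" using AB Gn by (simp add: divide_right_mono)
  have "continuous_on {A..B} (\<lambda>t. \<phi> (t / G n))" using Gn by (intro continuous_on_compose2[OF contin(1)[of W0 W1]] continuous_intros)
      (auto intro: order_trans divide_right_mono)
  then have "((\<lambda>w. G n *\<^sub>R expi (G n * \<phi> (G n * w / G n))) has_integral
      (integral {G n * ?a..G n * ?b} (\<lambda>t. expi (G n * \<phi> (t / G n))))) {?a..?b}" using Gn ab AB
    by (intro has_integral_substitution[where c = A and d = B] continuous_intros)
      (auto intro!: derivative_eq_intros simp: field_simps)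
  then have "((\<lambda>w. of_real (G n) * expi (G n * \<phi> w)) has_integral
      (integral {A..B} (\<lambda>t. expi (G n * \<phi> (t / G n))))) {?a..?b}" using Gn by (simp add: scaleR_conv_of_real)
  moreover have "max W0 ?a = ?a" "min W1 ?b = ?b" using Gn by auto
  ultimately show "integral {A..B} (\<lambda>t. expi (G n * \<phi> (t / G n))) = integral {W0..W1} (kern n)"
    unfolding kern_integral(2)[OF order_refl order_refl] by (simp only: integral_unique)
qed

text \<open>As \<open>\<theta>\<close> decreases, its levels \<eta>, \<eta>', -\<eta>' and -\<eta>
  cut [W0, W1] into at most five zones: far, middle, near, middle, far. The level \<eta>' is left
  free so that the last two terms can be balanced.\<close>

theorem near_bound:
  assumes "0 < \<eta>'" "\<eta>' \<le> \<eta>" "n1 < n2"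
  shows "norm (\<Sum>n\<in>{n1..<n2}. integral {A..B} (\<lambda>t. expi (G n * \<phi> (t / G n))))
    \<le> 2 * (real n2 - real n1) / \<eta> + 6 * E / \<eta>' + 2 * \<eta>' / D * (Gu * E)"
proof -
  have mono: "\<theta> w \<le> \<theta> v" if "W0 \<le> p" "p \<le> v" "v \<le> w" "w \<le> W1" for p v w using that by (intro \<theta>_antimono) auto
  obtain w1 where w1: "W0 \<le> w1" "w1 \<le> W1" "w1 = W0 \<or> (\<forall>v\<in>{W0..w1}. \<eta> \<le> \<theta> v)" "w1 = W1 \<or> (\<forall>v\<in>{w1..W1}. \<theta> v \<le> \<eta>)"
    by (rule antimono_cut[OF W(2) contin(2)[OF order_refl order_refl] mono[OF order_refl]])
  obtain w2 where w2: "w1 \<le> w2" "w2 \<le> W1" "w2 = w1 \<or> (\<forall>v\<in>{w1..w2}. \<eta>' \<le> \<theta> v)" "w2 = W1 \<or> (\<forall>v\<in>{w2..W1}. \<theta> v \<le> \<eta>')"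
    by (rule antimono_cut[OF w1(2) contin(2)[OF w1(1) order_refl] mono[OF w1(1)]])
  have W2: "W0 \<le> w2" using w1 w2 by linarith
  obtain w3 where w3: "w2 \<le> w3" "w3 \<le> W1" "w3 = w2 \<or> (\<forall>v\<in>{w2..w3}. - \<eta>' \<le> \<theta> v)" "w3 = W1 \<or> (\<forall>v\<in>{w3..W1}. \<theta> v \<le> - \<eta>')"
    by (rule antimono_cut[OF w2(2) contin(2)[OF W2 order_refl] mono[OF W2]])
  have W3: "W0 \<le> w3" using W2 w3 by linarith
  obtain w4 where w4: "w3 \<le> w4" "w4 \<le> W1" "w4 = w3 \<or> (\<forall>v\<in>{w3..w4}. - \<eta> \<le> \<theta> v)" "w4 = W1 \<or> (\<forall>v\<in>{w4..W1}. \<theta> v \<le> - \<eta>)"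
    by (rule antimono_cut[OF w3(2) contin(2)[OF W3 order_refl] mono[OF W3]])
  have ord: "W0 \<le> w1" "w1 \<le> w2" "w2 \<le> w3" "w3 \<le> w4" "w4 \<le> W1" using w1 w2 w3 w4 by auto
  have N: "0 \<le> real n2 - real n1" using n12 by simp
  have Gu: "0 \<le> Gu" by (rule Gu_nonneg[OF assms(3)])
  have z1: "norm (zone W0 w1) \<le> (real n2 - real n1) / \<eta>"
  proof (cases "w1 = W0")
    case False
    then show ?thesis using w1 ord by (intro zone_far) auto
  qed (use N \<eta> in auto)
  have z2: "norm (zone w1 w2) \<le> 3 * E / \<eta>'"
  proof (cases "w1 = w2")
    case False
    then have lo: "\<forall>v\<in>{w1..w2}. \<eta>' \<le> \<theta> v" using w2(3) by auto
    have hi: "\<forall>v\<in>{w1..w2}. \<theta> v \<le> \<eta>" using w1(4) False ord by auto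
    have "\<eta>' \<le> \<bar>\<theta> w\<bar> \<and> \<bar>\<theta> w\<bar> \<le> \<eta>" if "w \<in> {w1..w2}" for w
      using lo[rule_format, OF that] hi[rule_format, OF that] assms by linarith
    moreover have "\<forall>w\<in>{w1..w2}. 0 < \<theta> w" using lo assms by fastforce
    ultimately show ?thesis using ord assms by (intro zone_middle) auto
  qed (use E assms in auto)
  have z3: "norm (zone w2 w3) \<le> 2 * \<eta>' / D * (Gu * E)"
  proof (cases "w2 = w3")
    case False
    then have lo: "\<forall>v\<in>{w2..w3}. - \<eta>' \<le> \<theta> v" using w3(3) by auto
    have hi: "\<forall>v\<in>{w2..w3}. \<theta> v \<le> \<eta>'" using w2(4) False ord by auto
    have "\<bar>\<theta> w\<bar> \<le> \<eta>'" if "w \<in> {w2..w3}" for w using lo[rule_format, OF that] hi[rule_format, OF that] by linarith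
    then show ?thesis using ord assms by (intro zone_near) auto
  qed (use E Gu D assms in auto)
  have z4: "norm (zone w3 w4) \<le> 3 * E / \<eta>'"
  proof (cases "w3 = w4")
    case False
    then have lo: "\<forall>v\<in>{w3..w4}. - \<eta> \<le> \<theta> v" using w4(3) by auto
    have hi: "\<forall>v\<in>{w3..w4}. \<theta> v \<le> - \<eta>'" using w3(4) False ord by auto
    have "\<eta>' \<le> \<bar>\<theta> w\<bar> \<and> \<bar>\<theta> w\<bar> \<le> \<eta>" if "w \<in> {w3..w4}" for w
      using lo[rule_format, OF that] hi[rule_format, OF that] assms by linarith
    moreover have "\<forall>w\<in>{w3..w4}. \<theta> w < 0" using hi assms by fastforce
    ultimately show ?thesis using ord assms by (intro zone_middle) auto
  qed (use E assms in auto)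
  have z5: "norm (zone w4 W1) \<le> (real n2 - real n1) / \<eta>"
  proof (cases "w4 = W1")
    case False
    then show ?thesis using w4 ord by (intro zone_far) auto
  qed (use N \<eta> in auto)
  have "zone W0 W1 = zone W0 w1 + zone w1 w2 + zone w2 w3 + zone w3 w4 + zone w4 W1"
    using ord zone_combine[of W0 w1 W1] zone_combine[of w1 w2 W1] zone_combine[of w2 w3 W1] zone_combine[of w3 w4 W1] by simp
  then have "norm (zone W0 W1) \<le> (real n2 - real n1) / \<eta> + 3 * E / \<eta>' + 2 * \<eta>' / D * (Gu * E) + 3 * E / \<eta>' + (real n2 - real n1) / \<eta>"
    by (simp only:) (intro norm_triangle_mono z1 z2 z3 z4 z5)
  then show ?thesis unfolding sum_integral_eq_zone by simp
qed

end

section \<open>The double sum after differencing\<close>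

definition pow_diff :: "real \<Rightarrow> real \<Rightarrow> real \<Rightarrow> real" where
  "pow_diff \<gamma> q t = (t + q) powr \<gamma> - t powr \<gamma>"

lemma pow_diff_eq:
  assumes "0 < \<gamma>" "0 < q" "0 < t"
  shows "pow_diff \<gamma> q t = \<gamma> * q * t powr (\<gamma> - 1) * binom_quot \<gamma> (q / t)"
proof -
  have "t + q = t * (1 + q / t)" using assms by (simp add: field_simps)
  then have "(t + q) powr \<gamma> = t powr \<gamma> * (1 + q / t) powr \<gamma>" using assms by (simp add: powr_mult)
  moreover have "t powr \<gamma> = t powr (\<gamma> - 1) * t" using assms powr_add[of t "\<gamma> - 1" 1] by simp
  ultimately show ?thesis using assms by (simp add: pow_diff_def binom_quot_def field_simps)
qed

lemma pow_diff_mvt: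
  assumes "0 < \<gamma>" "0 < q" "0 < t"
  obtains \<xi> where "t < \<xi>" "\<xi> < t + q" "pow_diff \<gamma> q t = \<gamma> * q * \<xi> powr (\<gamma> - 1)"
proof -
  obtain z where "t < z" "z < t + q" "(t + q) powr \<gamma> - t powr \<gamma> = (t + q - t) * (\<gamma> * z powr (\<gamma> - 1))"
    using MVT2[of t "t + q" "\<lambda>t. t powr \<gamma>" "\<lambda>t. \<gamma> * t powr (\<gamma> - 1)"] assms has_real_derivative_powr_shift[of _ 0 \<gamma>] by auto
  then show ?thesis using that by (simp add: pow_diff_def mult_ac)
qed

lemma pow_diff_bounds:
  assumes "0 < \<gamma>" "\<gamma> < 1" "0 < q" "q \<le> N" "0 < N" "N \<le> t" "t \<le> 2 * N"
  shows "\<gamma> * q * (3 * N) powr (\<gamma> - 1) \<le> pow_diff \<gamma> q t" "pow_diff \<gamma> q t \<le> \<gamma> * q * N powr (\<gamma> - 1)"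
    "0 < pow_diff \<gamma> q t"
proof -
  obtain z where z: "t < z" "z < t + q" "pow_diff \<gamma> q t = \<gamma> * q * z powr (\<gamma> - 1)" using pow_diff_mvt[of \<gamma> q t] assms by auto
  show "\<gamma> * q * (3 * N) powr (\<gamma> - 1) \<le> pow_diff \<gamma> q t" unfolding z(3) using z assms by (intro mult_left_mono powr_mono2') auto
  show "pow_diff \<gamma> q t \<le> \<gamma> * q * N powr (\<gamma> - 1)" unfolding z(3) using z assms by (intro mult_left_mono powr_mono2') auto
  show "0 < pow_diff \<gamma> q t" unfolding z(3) using z assms by simp
qed

lemma pow_diff_antimono:
  assumes "0 < \<gamma>" "\<gamma> < 1" "0 < q" "0 < s" "s \<le> t"
  shows "pow_diff \<gamma> q t \<le> pow_diff \<gamma> q s"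
proof (rule DERIV_nonpos_imp_nonincreasing[OF assms(5)])
  fix x assume x: "s \<le> x" "x \<le> t"
  have "(pow_diff \<gamma> q has_real_derivative \<gamma> * (x + q) powr (\<gamma> - 1) - \<gamma> * (x + 0) powr (\<gamma> - 1)) (at x)"
    unfolding pow_diff_def[abs_def] using x assms has_real_derivative_powr_shift[of x q \<gamma>] has_real_derivative_powr_shift[of x 0 \<gamma>] by (auto intro!: DERIV_diff)
  moreover have "\<gamma> * (x + q) powr (\<gamma> - 1) \<le> \<gamma> * (x + 0) powr (\<gamma> - 1)" using x assms by (intro mult_left_mono powr_mono2') auto
  ultimately show "\<exists>y. (pow_diff \<gamma> q has_real_derivative y) (at x) \<and> y \<le> 0" by force
qed

text \<open>Choosing G n as the power 1/(1 - \<gamma>) of \<open>pow_diff \<gamma> q n\<close> gives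
  G n * (t / G n)^\<gamma> = t^\<gamma> * \<open>pow_diff \<gamma> q n\<close>, so the phase has the
  scaled form with \<phi> w = \<beta> w + h w^\<gamma>. For fixed w the phase behaves like 1/n, for
  fixed t like n^(\<gamma> - 1); this is why the exponent pair is invoked both with b = 1 and with b
  = 1 - \<gamma>. The parameter \<open>\<rho>\<close> is the size of the slope in t apart from
  \<beta>.\<close>

theorem near_integrals_bound:
  assumes ep: "exponent_pair k l" and \<gamma>: "0 < \<gamma>" "\<gamma> < 1"
  obtains C z0 where "0 < C" "0 < z0" "z0 \<le> 1"
    "\<And>h q N M A B \<beta> n1 n2 \<rho>. \<lbrakk>0 < h; 0 < q; 1 \<le> N; 1 \<le> M; q \<le> z0 * N; M / 2 \<le> A; A \<le> B; B \<le> 2 * M;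
      N \<le> real n1; n1 < n2; real n2 \<le> 2 * N; \<rho> = h * q * (M * N) powr (\<gamma> - 1)\<rbrakk> \<Longrightarrow>
      norm (\<Sum>n\<in>{n1..<n2}. integral {A..B} (\<lambda>t. expi (\<beta> * t + h * t powr \<gamma> * pow_diff \<gamma> q (real n))))
        \<le> C * (N / \<rho> + sqrt (M / \<rho>) * ((\<rho> * M) powr k * N powr (l - k)))"
proof -
  define a where "a = 1 - \<gamma>"
  have a: "0 < a" "a < 1" using \<gamma> by (auto simp: a_def)
  have exa: "(\<gamma> - 1) * (1 / a) = -1" using a by (simp add: a_def field_simps)
  have k: "0 \<le> k" "k \<le> 1" "k \<le> l" using ep by (auto simp: exponent_pair_def)
  show ?thesis
  proof (rule exponent_pair_near_power[OF ep \<gamma> zero_less_one, where \<kappa> = "1 / a"],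
      rule exponent_pair_near_power[OF ep \<gamma> a(1), where \<kappa> = 1], goal_cases)
  case (1 C1 z1 C2 z2)
  note 2 = 1(4-6)
  define C0 where "C0 = max C1 C2"
  have C0: "C1 \<le> C0" "C2 \<le> C0" "0 \<le> C0" using 1 2 by (auto simp: C0_def)
  define z0 where "z0 = min 1 (min z1 z2)"
  \<comment> \<open>The constant is chosen so that the lower bound a \<gamma> \<rho> / 12, which
    also serves as \<eta>, equals 2 \<rho> / c.\<close>
  define c where "c = 24 / (a * \<gamma>)"
  have c24: "24 \<le> c"
  proof -
    have "a * \<gamma> \<le> 1" using a \<gamma> by (intro mult_le_one) auto
    then show ?thesis unfolding c_def using a \<gamma> by (simp add: pos_le_divide_eq)
  qed
  define C where "C = 2 * c + (3 * c + 6 / \<gamma>) * ((18 * C0 + 1) + C0 * c)"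
  have cc: "0 \<le> 3 * c + 6 / \<gamma>" "0 \<le> 18 * C0 + 1" "0 \<le> C0 * c" using c24 \<gamma> C0 by auto
  have C48: "48 \<le> C" unfolding C_def using c24 cc mult_nonneg_nonneg[OF cc(1) add_nonneg_nonneg[OF cc(2,3)]] by linarith
  show ?thesis
  proof (rule that[of C z0])
    show "0 < C" using C48 by simp
    show "0 < z0" "z0 \<le> 1" using 1 2 by (auto simp: z0_def)
    fix h q N M A B \<beta> \<rho> :: real and n1 n2 :: nat
    assume *: "0 < h" "0 < q" "1 \<le> N" "1 \<le> M" "q \<le> z0 * N" "M / 2 \<le> A" "A \<le> B" "B \<le> 2 * M"
      "N \<le> real n1" "n1 < n2" "real n2 \<le> 2 * N" and rho: "\<rho> = h * q * (M * N) powr (\<gamma> - 1)"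
    have \<rho>: "0 < \<rho>" using * by (simp add: rho)
    have zN: "z0 * N \<le> z1 * N" "z0 * N \<le> z2 * N" "z0 * N \<le> 1 * N" using * by (auto intro!: mult_right_mono simp: z0_def)
    then have q: "q \<le> z1 * N" "q \<le> z2 * N" "q \<le> N" using *(5) by linarith+
    define Y where "Y = (\<rho> * M) powr k * N powr (l - k)"
    have Y0: "0 \<le> Y" by (simp add: Y_def)
    have nN: "real n2 - real n1 \<le> 2 * N" using * by linarith
    let ?I = "\<lambda>n. integral {A..B} (\<lambda>t. expi (\<beta> * t + h * t powr \<gamma> * pow_diff \<gamma> q (real n)))"
    show "norm (\<Sum>n\<in>{n1..<n2}. ?I n) \<le> C * (N / \<rho> + sqrt (M / \<rho>) * ((\<rho> * M) powr k * N powr (l - k)))" unfolding Y_def[symmetric]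
    proof (cases "\<rho> * M \<le> 1")
      case True
      \<comment> \<open>When \<rho> * M is at most 1, the term N / \<rho> already dominates N * M,
        and the trivial bound suffices.\<close>
      have "norm (\<Sum>n\<in>{n1..<n2}. ?I n) \<le> (\<Sum>n\<in>{n1..<n2}. 2 * M)"
      proof (rule sum_norm_le)
        fix n
        have "norm (?I n) \<le> 1 * (B - A)"
        proof (rule integral_bound)
          show "continuous_on {A..B} (\<lambda>t. expi (\<beta> * t + h * t powr \<gamma> * pow_diff \<gamma> q (real n)))" using * by (intro continuous_intros) auto
        qed (use * in auto)
        then show "norm (?I n) \<le> 2 * M" using * by simp
      qed
      also have "\<dots> = (real n2 - real n1) * (2 * M)" using * by (simp add: of_nat_diff)
      also have "\<dots> \<le> (2 * N) * (2 * (1 / \<rho>))" using nN * True \<rho> by (intro mult_mono) (auto simp: field_simps)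
      also have "\<dots> \<le> C * (N / \<rho>)"
      proof -
        have "4 * (N / \<rho>) \<le> C * (N / \<rho>)" using C48 * \<rho> by (intro mult_right_mono) auto
        then show ?thesis by simp
      qed
      also have "\<dots> \<le> C * (N / \<rho> + sqrt (M / \<rho>) * Y)" using C48 Y0 * \<rho> by (intro mult_left_mono) auto
      finally show "norm (\<Sum>n\<in>{n1..<n2}. ?I n) \<le> C * (N / \<rho> + sqrt (M / \<rho>) * Y)" .
    next
      case False
      then have \<rho>M: "1 \<le> \<rho> * M" by simp
      define g where "g n = pow_diff \<gamma> q (real n)" for n :: nat
      let ?v = "\<lambda>w. h * w powr (\<gamma> - 1)"
      define Gu where "Gu = (\<gamma> * q * N powr (\<gamma> - 1)) powr (1 / a)"
      define G where "G n = g n powr (1 / a)" for n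
      define \<phi> where "\<phi> w = \<beta> * w + h * w powr \<gamma>" for w
      define \<theta> where "\<theta> w = \<beta> + h * (\<gamma> * w powr (\<gamma> - 1))" for w
      define \<theta>' where "\<theta>' w = h * (\<gamma> * ((\<gamma> - 1) * w powr (\<gamma> - 2)))" for w
      \<comment> \<open>All \<open>G n\<close> lie between Gu / 3 and Gu; together with M/2 \<le> A
        and B \<le> 2M this confines t / G n to [W0, W1].\<close>
      define W0 where "W0 = M / (2 * Gu)"
      define W1 where "W1 = 6 * M / Gu"
      \<comment> \<open>In the identity \<phi> w = w * (\<theta> w + a * h w^(\<gamma> - 1)) the
        second summand is at least 2\<eta>, so a value of \<theta> w up to \<eta> in size cannot
        cancel it: near the stationary point \<phi> w keeps its full size. The choice of \<eta>'
        gives the last two terms of \<open>near_bound\<close> the same order.\<close>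
      define \<eta> where "\<eta> = a * \<gamma> * \<rho> / 12"
      define \<eta>' where "\<eta>' = \<eta> / sqrt (\<rho> * M)"
      \<comment> \<open>The lower bound for -\<theta>' w = a \<gamma> h w^(\<gamma> - 1) / w that
        results from h w^(\<gamma> - 1) \<ge> \<gamma> \<rho> / 6 and w \<le> W1.\<close>
      define D where "D = a * \<gamma>\<^sup>2 * \<rho> * Gu / (36 * M)"
      define E where "E = C0 * (18 * Y + c * N / (\<rho> * M)) + 1"
      have Gu: "0 < Gu" unfolding Gu_def using * \<gamma> by simp
      have Gua: "Gu powr (\<gamma> - 1) = 1 / (\<gamma> * q * N powr (\<gamma> - 1))"
      proof -
        have "Gu powr (\<gamma> - 1) = (\<gamma> * q * N powr (\<gamma> - 1)) powr (1 / a * (\<gamma> - 1))" unfolding Gu_def by (simp add: powr_powr)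
        also have "1 / a * (\<gamma> - 1) = -1" using a by (simp add: a_def field_simps)
        finally show ?thesis using * \<gamma> by (simp add: powr_minus_divide)
      qed
      have GuN: "Gu = (\<gamma> * q) powr (1 / a) / N"
      proof -
        have "Gu = (\<gamma> * q) powr (1 / a) * (N powr (\<gamma> - 1)) powr (1 / a)" unfolding Gu_def using * \<gamma> by (simp add: powr_mult)
        also have "(N powr (\<gamma> - 1)) powr (1 / a) = N powr (-1)" by (simp only: powr_powr exa)
        finally show ?thesis using * by (simp add: powr_minus_divide)
      qed
      have n: "N \<le> real n" "real n \<le> 2 * N" "0 < real n" if "n1 \<le> n" "n < n2" for n using that * by linarith+
      have g: "0 < g n" "g n \<le> \<gamma> * q * N powr (\<gamma> - 1)" "\<gamma> * q * (3 * N) powr (\<gamma> - 1) \<le> g n" if "n1 \<le> n" "n < n2" for n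
        unfolding g_def using pow_diff_bounds[of \<gamma> q N "real n"] n[OF that] q * \<gamma> by auto
      have G: "0 < G n" "G n \<le> Gu" "Gu / 3 \<le> G n" if "n1 \<le> n" "n < n2" for n
      proof -
        show "0 < G n" using g[OF that] by (simp add: G_def)
        show "G n \<le> Gu" unfolding G_def Gu_def using g[OF that] a by (intro powr_mono2) auto
        have "(\<gamma> * q * (3 * N) powr (\<gamma> - 1)) powr (1 / a) \<le> G n" unfolding G_def using g[OF that] a * \<gamma> by (intro powr_mono2) auto
        moreover have "(\<gamma> * q * (3 * N) powr (\<gamma> - 1)) powr (1 / a) = Gu * (3 powr (\<gamma> - 1)) powr (1 / a)"
          unfolding Gu_def using * \<gamma> by (simp add: powr_mult mult_ac)
        moreover have "(3 powr (\<gamma> - 1)) powr (1 / a) = (1/3 :: real)"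
        proof -          have "(3 powr (\<gamma> - 1)) powr (1 / a) = (3::real) powr (-1)" by (simp only: powr_powr exa)
          then show ?thesis by (simp add: powr_minus_divide)
        qed
        ultimately show "Gu / 3 \<le> G n" by simp
      qed
      have W: "0 < W0" "W0 \<le> W1" using Gu * by (auto simp: W0_def W1_def field_simps)
      have wG: "M / 2 \<le> w * Gu" "w * Gu \<le> 6 * M" "0 < w" if "W0 \<le> w" "w \<le> W1" for w
      proof -
        have "W0 * Gu \<le> w * Gu" "w * Gu \<le> W1 * Gu" using that Gu by (auto intro!: mult_right_mono)
        then show "M / 2 \<le> w * Gu" "w * Gu \<le> 6 * M" using Gu by (auto simp: W0_def W1_def)
        show "0 < w" using W that by linarith
      qed
      \<comment> \<open>On [W0, W1] the product w * Gu is comparable with M, so h w^(\<gamma> - 1)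
        is of size \<gamma> \<rho> throughout.\<close>
      have hw: "\<gamma> * \<rho> / 6 \<le> ?v w" "?v w \<le> 2 * (\<gamma> * \<rho>)" if "W0 \<le> w" "w \<le> W1" for w
      proof -
        have "?v w = h * (w * Gu) powr (\<gamma> - 1) / Gu powr (\<gamma> - 1)" using Gu wG[OF that] by (simp add: powr_mult)
        also have "\<dots> = h * (w * Gu) powr (\<gamma> - 1) * (\<gamma> * q * N powr (\<gamma> - 1))" unfolding Gua by simp
        finally have eq: "?v w = h * (\<gamma> * q * N powr (\<gamma> - 1)) * (w * Gu) powr (\<gamma> - 1)" by (simp add: mult_ac)
        have gr: "\<gamma> * \<rho> = h * (\<gamma> * q * N powr (\<gamma> - 1)) * M powr (\<gamma> - 1)" using * by (simp add: rho powr_mult)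
        have p0: "0 \<le> h * (\<gamma> * q * N powr (\<gamma> - 1))" using * \<gamma> by simp
        have "M powr (\<gamma> - 1) * (1 / 6) \<le> M powr (\<gamma> - 1) * 6 powr (\<gamma> - 1)"
          using powr_mono[of "-1" "\<gamma> - 1" "6::real"] \<gamma> by (intro mult_left_mono) (auto simp: powr_minus_divide)
        also have "\<dots> = (6 * M) powr (\<gamma> - 1)" using * by (simp add: powr_mult)
        also have "\<dots> \<le> (w * Gu) powr (\<gamma> - 1)" using wG[OF that] * \<gamma> Gu by (intro powr_mono2') auto
        finally have "M powr (\<gamma> - 1) * (1 / 6) \<le> (w * Gu) powr (\<gamma> - 1)" .
        from mult_left_mono[OF this p0] show "\<gamma> * \<rho> / 6 \<le> ?v w" unfolding eq gr by simp
        have "(w * Gu) powr (\<gamma> - 1) \<le> (M / 2) powr (\<gamma> - 1)" using wG[OF that] * \<gamma> by (intro powr_mono2') auto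
        also have "\<dots> = M powr (\<gamma> - 1) * 2 powr (1 - \<gamma>)" using * by (simp add: powr_divide powr_diff)
        also have "\<dots> \<le> M powr (\<gamma> - 1) * 2" using powr_mono[of "1 - \<gamma>" 1 "2::real"] \<gamma> by (intro mult_left_mono) auto
        finally have "(w * Gu) powr (\<gamma> - 1) \<le> M powr (\<gamma> - 1) * 2" .
        from mult_left_mono[OF this p0] show "?v w \<le> 2 * (\<gamma> * \<rho>)" unfolding eq gr by simp
      qed
      have phase: "G n * \<phi> (t / G n) = \<beta> * t + h * t powr \<gamma> * g n" if "n1 \<le> n" "n < n2" "0 < t" for n t
      proof -
        have "G n powr (1 - \<gamma>) = g n" using g[OF that(1,2)] a by (simp add: G_def powr_powr a_def)
        moreover have "G n * (t / G n) powr \<gamma> = t powr \<gamma> * G n powr (1 - \<gamma>)" using G[OF that(1,2)] that(3) by (simp add: powr_divide powr_diff)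
        ultimately have "G n * (t / G n) powr \<gamma> = t powr \<gamma> * g n" by simp
        then show ?thesis unfolding \<phi>_def using G[OF that(1,2)] by (simp add: algebra_simps)
      qed
      \<comment> \<open>In both uses of the exponent pair the quantity y N^(-b - 1) has size \<rho>
        M / N, so the two bounds take the common shape of a multiple of Y plus N / (\<rho>
        M).\<close>
      have Ebound: "C' * ((y * N powr (- b - 1)) powr k * N powr l + N powr (b + 1) / y) + 1 \<le> E"
        if "0 \<le> C'" "C' \<le> C0" "0 < y" "y * N powr (- b - 1) \<le> 18 * (\<rho> * M / N)" "\<rho> * M / N / c \<le> y * N powr (- b - 1)" for C' y b
      proof -
        have N0: "0 < N" "0 < \<rho> * M / N" using * \<rho> by auto
        have "(y * N powr (- b - 1)) powr k \<le> (18 * (\<rho> * M / N)) powr k" using that k N0 by (intro powr_mono2) auto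
        also have "\<dots> = 18 powr k * ((\<rho> * M) powr k / N powr k)" using N0 \<rho> * by (simp add: powr_mult powr_divide)
        also have "\<dots> \<le> 18 powr 1 * ((\<rho> * M) powr k / N powr k)" using k by (intro mult_right_mono powr_mono) auto
        finally have "(y * N powr (- b - 1)) powr k * N powr l \<le> 18 * ((\<rho> * M) powr k / N powr k) * N powr l" by (intro mult_right_mono) auto
        also have "\<dots> = 18 * Y" using N0 by (simp add: Y_def powr_diff)
        finally have a1: "(y * N powr (- b - 1)) powr k * N powr l \<le> 18 * Y" .
        have "N powr (b + 1) / y = 1 / (y * N powr (- b - 1))"
        proof -
          have "- b - 1 = - (b + 1)" by simp
          then have "N powr (- b - 1) = 1 / N powr (b + 1)" by (simp only: powr_minus_divide)
          then show ?thesis by simp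
        qed
        also have "\<dots> \<le> 1 / (\<rho> * M / N / c)"
        proof (intro divide_left_mono mult_pos_pos)
          show "0 < \<rho> * M / N / c" by (rule divide_pos_pos[OF N0(2)]) (use c24 in simp)
        qed (use that N0 in auto)
        also have "\<dots> = c * N / (\<rho> * M)" by simp
        finally have "(y * N powr (- b - 1)) powr k * N powr l + N powr (b + 1) / y \<le> 18 * Y + c * N / (\<rho> * M)" using a1 by linarith
        moreover have "0 \<le> 18 * Y + c * N / (\<rho> * M)" using Y0 c24 * \<rho> by simp
        ultimately have "C' * ((y * N powr (- b - 1)) powr k * N powr l + N powr (b + 1) / y) \<le> C0 * (18 * Y + c * N / (\<rho> * M))" using that C0 by (intro mult_mono) auto
        then show ?thesis by (simp add: E_def)
      qed
      have E0: "0 \<le> E" unfolding E_def using C0 Y0 c24 * \<rho> by (intro add_nonneg_nonneg mult_nonneg_nonneg) auto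
      interpret scaled_phase \<phi> \<theta> \<theta>' G W0 W1 A B D Gu \<eta> E n1 n2
      proof
        show "n1 \<le> n2" "0 < W0" "W0 \<le> W1" "0 < A" "A \<le> B" "0 \<le> E" using * W E0 by auto
        show "0 < D" "0 < \<eta>" using a \<gamma> \<rho> Gu * by (auto simp: D_def \<eta>_def)
        show "(\<phi> has_real_derivative \<theta> w) (at w)" if "W0 \<le> w" "w \<le> W1" for w
          unfolding \<phi>_def \<theta>_def using wG[OF that] has_real_derivative_powr_shift[of w 0 \<gamma>] by (intro DERIV_add DERIV_cmult_Id DERIV_cmult) auto
        show "(\<theta> has_real_derivative \<theta>' w) (at w)" if "W0 \<le> w" "w \<le> W1" for w
        proof -
          have "(\<theta> has_real_derivative 0 + h * (\<gamma> * ((\<gamma> - 1) * (w + 0) powr (\<gamma> - 1 - 1)))) (at w)"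
            unfolding \<theta>_def using wG[OF that] has_real_derivative_powr_shift[of w 0 "\<gamma> - 1"] by (intro DERIV_add DERIV_const DERIV_cmult) auto
          then show ?thesis by (simp add: \<theta>'_def)
        qed
        show "continuous_on {W0..W1} \<theta>'" unfolding \<theta>'_def using W by (intro continuous_intros) auto
        show "\<theta>' w \<le> - D" if "W0 \<le> w" "w \<le> W1" for w
        proof -
          have w0: "0 < w" using wG[OF that] by simp
          have "w powr (\<gamma> - 2) = w powr (\<gamma> - 1) / w" using w0 powr_diff[of w "\<gamma> - 1" 1] by simp
          then have "- \<theta>' w = a * \<gamma> * ?v w / w" using w0 by (simp add: \<theta>'_def a_def field_simps)
          also have "\<dots> \<ge> a * \<gamma> * (\<gamma> * \<rho> / 6) / (6 * M / Gu)" using hw[OF that] a \<gamma> w0 that \<rho> Gu *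
            by (intro frac_le mult_left_mono mult_nonneg_nonneg) (auto simp: W1_def)
          also have "a * \<gamma> * (\<gamma> * \<rho> / 6) / (6 * M / Gu) = D" using Gu by (simp add: D_def power2_eq_square)
          finally show ?thesis by simp
        qed
        show "0 < G n \<and> G n \<le> Gu \<and> W0 \<le> A / G n \<and> B / G n \<le> W1" if "n1 \<le> n" "n < n2" for n
        proof (intro conjI)
          show "0 < G n" "G n \<le> Gu" using G[OF that] by auto
          have "W0 = (M / 2) / Gu" by (simp add: W0_def)
          also have "\<dots> \<le> A / G n" using G[OF that] * by (intro frac_le) auto
          finally show "W0 \<le> A / G n" .
          have "B / G n \<le> (2 * M) / (Gu / 3)" using G[OF that] * Gu by (intro frac_le) auto
          also have "\<dots> = W1" by (simp add: W1_def)
          finally show "B / G n \<le> W1" .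
        qed
        show "G n' \<le> G n" if "n1 \<le> n" "n \<le> n'" "n' < n2" for n n' unfolding G_def g_def using that * \<gamma> a n[of n] g[of n']
          by (intro powr_mono2 pow_diff_antimono) (auto simp: g_def)
        show "norm (\<Sum>n\<in>{r..<s}. expi (G n * \<phi> w)) \<le> E"
          if w: "W0 \<le> w" "w \<le> W1" "\<bar>\<theta> w\<bar> \<le> \<eta>" and rs: "n1 \<le> r" "r \<le> s" "s \<le> n2" for w r s
        proof -
          define y where "y = \<phi> w * (\<gamma> * q) powr (1 / a)"
          have w0: "0 < w" using wG[OF w(1,2)] by simp
          have "w powr \<gamma> = w powr (\<gamma> - 1) * w" using w0 powr_add[of w "\<gamma> - 1" 1] by simp
          then have \<phi>w: "\<phi> w = w * (\<theta> w + a * ?v w)" by (simp add: \<phi>_def \<theta>_def a_def algebra_simps)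
          have "a * (\<gamma> * \<rho> / 6) \<le> a * ?v w" "a * ?v w \<le> a * (2 * (\<gamma> * \<rho>))" using hw[OF w(1,2)] a by (auto intro!: mult_left_mono)
          then have b1: "a * \<gamma> * \<rho> / 12 \<le> \<theta> w + a * ?v w" "\<theta> w + a * ?v w \<le> 3 * (a * \<gamma> * \<rho>)"
            using w(3) mult_pos_pos[OF mult_pos_pos[OF a(1) \<gamma>(1)] \<rho>] unfolding \<eta>_def abs_le_iff by (simp_all add: mult_ac)
          have "a * \<gamma> \<le> 1" using a \<gamma> by (intro mult_le_one) auto
          then have "a * \<gamma> * \<rho> \<le> 1 * \<rho>" using \<rho> by (intro mult_right_mono) auto
          moreover have "2 * \<rho> / c = a * \<gamma> * \<rho> / 12" unfolding c_def by simp
          ultimately have b: "2 * \<rho> / c \<le> \<theta> w + a * ?v w" "\<theta> w + a * ?v w \<le> 3 * \<rho>" using b1 by linarith+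
          have "0 \<le> 2 * \<rho> / c" using \<rho> c24 by simp
          with b(1) have pos: "0 \<le> \<theta> w + a * ?v w" by linarith
          have yeq: "y = (w * Gu) * (\<theta> w + a * ?v w) * N" unfolding y_def \<phi>w GuN using * by simp
          have lo: "M / 2 * (2 * \<rho> / c) * N \<le> y" unfolding yeq using wG[OF w(1,2)] b * \<rho> c24 by (intro mult_right_mono mult_mono) auto
          have hi: "y \<le> (6 * M) * (3 * \<rho>) * N" unfolding yeq by (intro mult_right_mono[OF mult_mono[OF wG(2)[OF w(1,2)] b(2)]] pos) (use * in auto)
          have "0 < M / 2 * (2 * \<rho> / c) * N" using * \<rho> c24 by simp
          with lo have y0: "0 < y" by linarith
          have N2: "N powr (- 1 - 1) = 1 / (N * N)" using * by (simp add: powr_minus_divide powr_numeral power2_eq_square)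
          have "norm (\<Sum>n\<in>{r..<s}. expi (y / 1 * real n powr (- 1) * binom_quot \<gamma> (q / real n) powr (1 / a)))
            \<le> C1 * ((y * N powr (- 1 - 1)) powr k * N powr l + N powr (1 + 1) / y) + 1" using * q rs y0 by (intro 1(3)) auto
          also have "\<dots> \<le> E"
          proof (rule Ebound[OF 1(1) C0(1) y0])
            have "y * (1 / (N * N)) \<le> (6 * M) * (3 * \<rho>) * N * (1 / (N * N))" using hi * by (intro mult_right_mono) auto
            then show "y * N powr (- 1 - 1) \<le> 18 * (\<rho> * M / N)" unfolding N2 using * by (simp add: mult_ac)
            have "M / 2 * (2 * \<rho> / c) * N * (1 / (N * N)) \<le> y * (1 / (N * N))" using lo * by (intro mult_right_mono) auto
            then show "\<rho> * M / N / c \<le> y * N powr (- 1 - 1)" unfolding N2 using * by (simp add: mult_ac)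
          qed
          also have "(\<Sum>n\<in>{r..<s}. expi (y / 1 * real n powr (- 1) * binom_quot \<gamma> (q / real n) powr (1 / a))) = (\<Sum>n\<in>{r..<s}. expi (G n * \<phi> w))"
          proof (intro sum.cong refl arg_cong[where f = expi])
            fix m assume m: "m \<in> {r..<s}"
            then have m0: "0 < real m" using n[of m] rs by auto
            have bq: "0 < binom_quot \<gamma> (q / m)" using m0 * \<gamma> by (intro binom_quot_pos) auto
            have "G m = (\<gamma> * q * real m powr (\<gamma> - 1) * binom_quot \<gamma> (q / m)) powr (1 / a)"
              unfolding G_def g_def using m0 * \<gamma> by (subst pow_diff_eq) auto
            also have "\<dots> = (\<gamma> * q) powr (1 / a) * (real m powr (\<gamma> - 1)) powr (1 / a) * binom_quot \<gamma> (q / m) powr (1 / a)"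
              using m0 * \<gamma> bq by (simp add: powr_mult)
            also have "(real m powr (\<gamma> - 1)) powr (1 / a) = real m powr (- 1)" by (simp only: powr_powr exa)
            finally show "y / 1 * real m powr (- 1) * binom_quot \<gamma> (q / real m) powr (1 / a) = G m * \<phi> w" by (simp add: y_def)
          qed
          finally show ?thesis .
        qed
        show "norm (\<Sum>n\<in>{r..<s}. expi (G n * \<phi> (T / G n))) \<le> E"
          if T: "T = A \<or> T = B" and rs: "n1 \<le> r" "r \<le> s" "s \<le> n2" for T r s
        proof -
          have TM: "M / 2 \<le> T" "T \<le> 2 * M" using T * by auto
          then have T0: "0 < T" using * by linarith
          \<comment> \<open>At a fixed end point t = T the term \<beta> T is the same for all n and
            contributes a factor of modulus one; the rest of the phase behaves like n^(-a).\<close>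
          define y where "y = a * (h * T powr \<gamma> * (\<gamma> * q))"
          have y0: "0 < y" using a \<gamma> * T0 by (simp add: y_def)
          have yN: "y * N powr (- a - 1) = a * \<gamma> * (T powr \<gamma> / M powr \<gamma>) * (\<rho> * M / N)"
          proof -
            have "N powr (- a - 1) = N powr (\<gamma> - 1) / N" using * powr_diff[of N "\<gamma> - 1" 1] by (simp add: a_def)
            moreover have "M powr \<gamma> = M powr (\<gamma> - 1) * M" using * powr_add[of M "\<gamma> - 1" 1] by simp
            ultimately show ?thesis using * by (simp add: y_def rho powr_mult)
          qed
          have t: "1 / 2 \<le> T powr \<gamma> / M powr \<gamma>" "T powr \<gamma> / M powr \<gamma> \<le> 2"
          proof -
            have "M powr \<gamma> / 2 \<le> M powr \<gamma> / 2 powr \<gamma>" using powr_mono[of \<gamma> 1 "2::real"] \<gamma> * by (intro divide_left_mono) auto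
            also have "\<dots> = (M / 2) powr \<gamma>" using * by (simp add: powr_divide)
            also have "\<dots> \<le> T powr \<gamma>" using TM * \<gamma> by (intro powr_mono2) auto
            finally show "1 / 2 \<le> T powr \<gamma> / M powr \<gamma>" using * by (simp add: field_simps)
            have "T powr \<gamma> \<le> (2 * M) powr \<gamma>" using TM * \<gamma> T0 by (intro powr_mono2) auto
            also have "\<dots> = 2 powr \<gamma> * M powr \<gamma>" using * by (simp add: powr_mult)
            also have "\<dots> \<le> 2 * M powr \<gamma>" using powr_mono[of \<gamma> 1 "2::real"] \<gamma> by (intro mult_right_mono) auto
            finally show "T powr \<gamma> / M powr \<gamma> \<le> 2" using * by (simp add: field_simps)
          qed
          have pos: "0 \<le> \<rho> * M / N" using * \<rho> by simp
          have "norm (\<Sum>n\<in>{r..<s}. expi (y / a * real n powr (- a) * binom_quot \<gamma> (q / real n) powr 1))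
            \<le> C2 * ((y * N powr (- a - 1)) powr k * N powr l + N powr (a + 1) / y) + 1" using * q rs y0 by (intro 2(3)) auto
          also have "\<dots> \<le> E"
          proof (rule Ebound[OF 2(1) C0(2) y0])
            have "a * \<gamma> \<le> 1" using a \<gamma> by (intro mult_le_one) auto
            then have "a * \<gamma> * (T powr \<gamma> / M powr \<gamma>) \<le> 1 * 2" using t a \<gamma> by (intro mult_mono) auto
            then have "a * \<gamma> * (T powr \<gamma> / M powr \<gamma>) * (\<rho> * M / N) \<le> 18 * (\<rho> * M / N)" using pos by (intro mult_right_mono) auto
            then show "y * N powr (- a - 1) \<le> 18 * (\<rho> * M / N)" unfolding yN .
            have "1 / c \<le> a * \<gamma> * (1 / 2)" using a \<gamma> by (simp add: c_def)
            also have "\<dots> \<le> a * \<gamma> * (T powr \<gamma> / M powr \<gamma>)" using t a \<gamma> by (intro mult_left_mono) auto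
            finally have "1 / c * (\<rho> * M / N) \<le> a * \<gamma> * (T powr \<gamma> / M powr \<gamma>) * (\<rho> * M / N)" using pos by (intro mult_right_mono) auto
            then show "\<rho> * M / N / c \<le> y * N powr (- a - 1)" unfolding yN by (simp add: mult_ac)
          qed
          also have "norm (\<Sum>n\<in>{r..<s}. expi (y / a * real n powr (- a) * binom_quot \<gamma> (q / real n) powr 1)) = norm (\<Sum>n\<in>{r..<s}. expi (G n * \<phi> (T / G n)))"
          proof -
            have "(\<Sum>n\<in>{r..<s}. expi (G n * \<phi> (T / G n))) = (\<Sum>n\<in>{r..<s}. expi (\<beta> * T) * expi (y / a * real n powr (- a) * binom_quot \<gamma> (q / real n) powr 1))"
            proof (intro sum.cong refl)
              fix m assume m: "m \<in> {r..<s}"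
              then have m': "n1 \<le> m" "m < n2" "0 < real m" using n[of m] rs by auto
              have bq: "0 < binom_quot \<gamma> (q / m)" using m' * \<gamma> by (intro binom_quot_pos) auto
              have "G m * \<phi> (T / G m) = \<beta> * T + h * T powr \<gamma> * (\<gamma> * q * real m powr (\<gamma> - 1) * binom_quot \<gamma> (q / m))"
                unfolding phase[OF m'(1,2) T0] g_def using m' * \<gamma> by (subst pow_diff_eq) auto
              also have "\<dots> = \<beta> * T + y / a * real m powr (- a) * binom_quot \<gamma> (q / real m) powr 1" using a bq by (simp add: y_def a_def)
              finally show "expi (G m * \<phi> (T / G m)) = expi (\<beta> * T) * expi (y / a * real m powr (- a) * binom_quot \<gamma> (q / real m) powr 1)"
                by (simp only: expi_add)
            qed
            then show ?thesis by (simp only: sum_distrib_left[symmetric] norm_mult norm_expi mult_1)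
          qed
          finally show ?thesis .
        qed
      qed
      have s0: "1 \<le> sqrt (\<rho> * M)" using \<rho>M by simp
      have \<eta>'0: "0 < \<eta>'" "\<eta>' \<le> \<eta>" using s0 \<eta> by (auto simp: \<eta>'_def divide_le_eq mult_le_cancel_left1)
      have eqI: "(\<Sum>n\<in>{n1..<n2}. ?I n) = (\<Sum>n\<in>{n1..<n2}. integral {A..B} (\<lambda>t. expi (G n * \<phi> (t / G n))))"
      proof (intro sum.cong refl integral_cong arg_cong[where f = expi])
        fix n t assume "n \<in> {n1..<n2}" "t \<in> {A..B}"
        then show "\<beta> * t + h * t powr \<gamma> * pow_diff \<gamma> q (real n) = G n * \<phi> (t / G n)" using phase[of n t] AB by (simp add: g_def)
      qed
      have near: "norm (\<Sum>n\<in>{n1..<n2}. ?I n) \<le> 2 * (real n2 - real n1) / \<eta> + 6 * E / \<eta>' + 2 * \<eta>' / D * (Gu * E)"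
        unfolding eqI by (rule near_bound[OF \<eta>'0 *(10)])
      define Q where "Q = sqrt (M / \<rho>)"
      have Q: "0 \<le> Q" using * \<rho> by (simp add: Q_def)
      have sq: "sqrt (\<rho> * M) / \<rho> = Q" "M / sqrt (\<rho> * M) = Q" using * \<rho> by (auto simp: Q_def real_sqrt_mult real_sqrt_divide field_simps)
      have i1: "2 * (real n2 - real n1) / \<eta> \<le> 2 * c * (N / \<rho>)"
      proof -
        have "2 * (real n2 - real n1) / \<eta> \<le> 2 * (2 * N) / \<eta>" using nN \<eta> by (intro divide_right_mono mult_left_mono) auto
        also have "\<dots> = 2 * c * (N / \<rho>)" by (simp add: \<eta>_def c_def)
        finally show ?thesis .
      qed
      have i2: "6 * E / \<eta>' = 3 * c * (Q * E)"
      proof -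
        have "6 * E / \<eta>' = 3 * c * (sqrt (\<rho> * M) / \<rho> * E)" using \<rho> by (simp add: \<eta>'_def \<eta>_def c_def)
        then show ?thesis unfolding sq .
      qed
      have i3: "2 * \<eta>' / D * (Gu * E) = 6 / \<gamma> * (Q * E)"
      proof -
        have "2 * \<eta>' / D * (Gu * E) = 6 / \<gamma> * (M / sqrt (\<rho> * M) * E)"
          using \<rho> Gu a \<gamma> * by (simp add: \<eta>'_def \<eta>_def D_def power2_eq_square field_simps)
        then show ?thesis unfolding sq .
      qed
      \<comment> \<open>Since Y is at least 1, it absorbs the isolated summand 1 in E.\<close>
      have Y1: "1 \<le> Y"
      proof -
        have "1 * 1 \<le> (\<rho> * M) powr k * N powr (l - k)" using \<rho>M k * by (intro mult_mono ge_one_powr_ge_zero) auto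
        then show ?thesis by (simp add: Y_def)
      qed
      have "Q * E = C0 * 18 * (Q * Y) + Q * 1 + C0 * c * (Q * (N / (\<rho> * M)))" by (simp add: E_def algebra_simps)
      also have "\<dots> \<le> C0 * 18 * (Q * Y) + Q * Y + C0 * c * (N / \<rho>)"
      proof (intro add_mono mult_left_mono order_refl Y1 Q)
        have "Q * (N / (\<rho> * M)) = N / \<rho> * (1 / sqrt (\<rho> * M))" unfolding sq(2)[symmetric] using * \<rho> by simp
        also have "\<dots> \<le> N / \<rho> * 1" using s0 * \<rho> by (intro mult_left_mono) auto
        finally show "Q * (N / (\<rho> * M)) \<le> N / \<rho>" by simp
      qed (use C0 c24 in auto)
      also have "\<dots> \<le> ((18 * C0 + 1) + C0 * c) * (N / \<rho> + Q * Y)"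
      proof -
        have "0 \<le> (18 * C0 + 1) * (N / \<rho>)" "0 \<le> C0 * c * (Q * Y)" using cc * \<rho> Q Y0 by auto
        then show ?thesis by (simp add: algebra_simps)
      qed
      finally have QE: "Q * E \<le> ((18 * C0 + 1) + C0 * c) * (N / \<rho> + Q * Y)" .
      have "norm (\<Sum>n\<in>{n1..<n2}. ?I n) \<le> 2 * c * (N / \<rho>) + (3 * c + 6 / \<gamma>) * (Q * E)" using near i1 unfolding i2 i3 by (simp add: algebra_simps)
      also have "\<dots> \<le> 2 * c * (N / \<rho> + Q * Y) + (3 * c + 6 / \<gamma>) * (((18 * C0 + 1) + C0 * c) * (N / \<rho> + Q * Y))"
        using QE cc Q Y0 c24 by (intro add_mono mult_left_mono) auto
      also have "\<dots> = C * (N / \<rho> + Q * Y)" by (simp only: C_def distrib_right mult.assoc)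
      finally show "norm (\<Sum>n\<in>{n1..<n2}. ?I n) \<le> C * (N / \<rho> + sqrt (M / \<rho>) * Y)" unfolding Q_def .
    qed
  qed
qed
qed

section \<open>Poisson summation in the double sum\<close>

lemma expi_frac: "expi (\<alpha> * real m + x) = expi (frac \<alpha> * real m + x)"
proof -
  have "\<alpha> * real m + x = of_int (\<lfloor>\<alpha>\<rfloor> * int m) + (frac \<alpha> * real m + x)" by (simp add: frac_def algebra_simps)
  then have "expi (\<alpha> * real m + x) = expi (of_int (\<lfloor>\<alpha>\<rfloor> * int m)) * expi (frac \<alpha> * real m + x)" by (simp only: expi_add)
  then show ?thesis by (simp only: expi_of_int mult_1)
qed

lemma sum_inverse_abs_int_le:
  assumes "0 < R"
  shows "(\<Sum>\<mu>\<in>{- int R<..<int R} - {0}. 1 / \<bar>real_of_int \<mu>\<bar>) \<le> 2 * (1 + ln (real R))"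
proof -
  have "{- int R<..<int R} - {0} \<subseteq> int ` {1..R} \<union> (\<lambda>j. - int j) ` {1..R}"
  proof
    fix \<mu> assume "\<mu> \<in> {- int R<..<int R} - {0}"
    then have "nat \<bar>\<mu>\<bar> \<in> {1..R}" "\<mu> = int (nat \<bar>\<mu>\<bar>) \<or> \<mu> = - int (nat \<bar>\<mu>\<bar>)" by auto
    then show "\<mu> \<in> int ` {1..R} \<union> (\<lambda>j. - int j) ` {1..R}" by blast
  qed
  then have "(\<Sum>\<mu>\<in>{- int R<..<int R} - {0}. 1 / \<bar>real_of_int \<mu>\<bar>)
     \<le> (\<Sum>\<mu>\<in>int ` {1..R} \<union> (\<lambda>j. - int j) ` {1..R}. 1 / \<bar>real_of_int \<mu>\<bar>)" by (intro sum_mono2) auto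
  also have "\<dots> \<le> (\<Sum>\<mu>\<in>int ` {1..R}. 1 / \<bar>real_of_int \<mu>\<bar>) + (\<Sum>\<mu>\<in>(\<lambda>j. - int j) ` {1..R}. 1 / \<bar>real_of_int \<mu>\<bar>)"
    by (subst sum.union_inter[symmetric]) (auto intro!: sum_nonneg)
  also have "\<dots> = (\<Sum>j\<in>{1..R}. 1 / real j) + (\<Sum>j\<in>{1..R}. 1 / real j)" by (simp add: sum.reindex inj_on_def)
  also have "\<dots> \<le> (1 + ln R) + (1 + ln R)" by (intro add_mono harmonic_sum_le assms)
  finally show ?thesis by simp
qed

text \<open>The first summand collects the frequencies without stationary point, whose contributions
  N/|\<mu>| add up to a logarithm, and the terms N/\<rho> of the roughly 1 + \<rho> remaining
  frequencies. The second summand is the exponent pair bound for the latter.\<close>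

definition type_one_term :: "real \<Rightarrow> real \<Rightarrow> real \<Rightarrow> real \<Rightarrow> real \<Rightarrow> real" where
  "type_one_term k l N M \<rho> = N * (1 + 1 / \<rho>) * (1 + ln (2 * (1 + \<rho>) * M)) + (1 + \<rho>) * sqrt (M / \<rho>) * ((\<rho> * M) powr k * N powr (l - k))"

text \<open>The smooth variable m runs over integers, so the sum over m becomes integrals with
  linear twists -\<mu> t. A stationary point can occur only for O(1 + \<rho>) frequencies, since the
  slope of h t^\<gamma> * \<open>pow_diff \<gamma> q n\<close> is O(\<rho>); these go to
  \<open>near_integrals_bound\<close>, the others to the first derivative test.\<close>

theorem double_sum_bound:
  assumes ep: "exponent_pair k l" and \<gamma>: "0 < \<gamma>" "\<gamma> < 1"
  obtains C z0 where "0 < C" "0 < z0" "z0 \<le> 1"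
    "\<And>h q N M \<alpha> \<rho> n1 n2 m1 m2. \<lbrakk>0 < h; 0 < q; 1 \<le> N; 1 \<le> M; q \<le> z0 * N;
      N \<le> real n1; real n2 \<le> 2 * N; M \<le> real m1; real m2 \<le> 2 * M; \<rho> = h * q * (M * N) powr (\<gamma> - 1)\<rbrakk> \<Longrightarrow>
      norm (\<Sum>n\<in>{n1..<n2}. \<Sum>m\<in>{m1..<m2}. expi (\<alpha> * real m + h * real m powr \<gamma> * pow_diff \<gamma> q (real n)))
        \<le> C * type_one_term k l N M \<rho>"
proof -
  show ?thesis
  proof (rule near_integrals_bound[OF ep \<gamma>], goal_cases)
  case (1 C1 z0)
  show ?thesis
  proof (rule that[of "8 * C1 + 42" z0])
    show "0 < 8 * C1 + 42" "0 < z0" "z0 \<le> 1" using 1 by auto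
    fix h q N M \<alpha> \<rho> :: real and n1 n2 m1 m2 :: nat
    assume *: "0 < h" "0 < q" "1 \<le> N" "1 \<le> M" "q \<le> z0 * N"
      "N \<le> real n1" "real n2 \<le> 2 * N" "M \<le> real m1" "real m2 \<le> 2 * M" and rho: "\<rho> = h * q * (M * N) powr (\<gamma> - 1)"
    have \<rho>: "0 < \<rho>" using * by (simp add: rho)
    have qN: "q \<le> N" using *(3,5) 1(3) mult_right_mono[of z0 1 N] by linarith
    define Y where "Y = (\<rho> * M) powr k * N powr (l - k)"
    define S where "S = sqrt (M / \<rho>)"
    have YS: "0 \<le> Y" "0 \<le> S" using * \<rho> by (auto simp: Y_def S_def)
    define L where "L = 1 + ln (2 * (1 + \<rho>) * M)"
    have arg: "1 * 1 \<le> (2 * (1 + \<rho>)) * M" using * \<rho> by (intro mult_mono) auto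
    have L: "1 \<le> L" using arg by (simp add: L_def)
    let ?T = "\<Sum>n\<in>{n1..<n2}. \<Sum>m\<in>{m1..<m2}. expi (\<alpha> * real m + h * real m powr \<gamma> * pow_diff \<gamma> q (real n))"
    have bound0: "0 \<le> (8 * C1 + 42) * (N * (1 + 1 / \<rho>) * L + (1 + \<rho>) * S * Y)" using 1 * \<rho> L YS by simp
    show "norm ?T \<le> (8 * C1 + 42) * type_one_term k l N M \<rho>" unfolding type_one_term_def Y_def[symmetric] S_def[symmetric] L_def[symmetric]
    proof (cases "n1 < n2 \<and> m1 < m2")
      case False
      then have "?T = 0" by auto
      then show "norm ?T \<le> (8 * C1 + 42) * (N * (1 + 1 / \<rho>) * L + (1 + \<rho>) * S * Y)" using bound0 by simp
    next
      case True
      \<comment> \<open>At integers m only \<alpha> modulo 1 matters. With \<alpha>' in [0, 1) the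
        frequencies that can meet the slope of the phase are those near 0, whatever \<alpha>
        is.\<close>
      define \<alpha>' where "\<alpha>' = frac \<alpha>"
      have \<alpha>': "0 \<le> \<alpha>'" "\<alpha>' < 1" by (auto simp: \<alpha>'_def frac_lt_1)
      define f where "f n t = \<alpha>' * t + h * t powr \<gamma> * pow_diff \<gamma> q (real n)" for n :: nat and t
      have T: "?T = (\<Sum>n\<in>{n1..<n2}. \<Sum>m\<in>{m1..<m2}. expi (f n (real m)))" unfolding f_def \<alpha>'_def by (intro sum.cong refl expi_frac)
      \<comment> \<open>The half-integers are the ends of the unit intervals centred at m1 and at m2
        - 1; M \<ge> 1 keeps A at least M / 2.\<close>
      define A B where "A = real m1 - 1/2" and "B = real m2 - 1/2"
      have AB: "M / 2 \<le> A" "A \<le> B" "B \<le> 2 * M" "0 < A" using * True by (auto simp: A_def B_def)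
      have nN: "real n2 - real n1 \<le> N" using * by linarith
      have g: "0 < pow_diff \<gamma> q (real n)" "pow_diff \<gamma> q (real n) \<le> \<gamma> * q * N powr (\<gamma> - 1)" if "n \<in> {n1..<n2}" for n
        using pow_diff_bounds[of \<gamma> q N "real n"] that * qN \<gamma> by auto
      define f' where "f' \<beta> n t = \<beta> + h * (\<gamma> * t powr (\<gamma> - 1)) * pow_diff \<gamma> q (real n)" for \<beta> and n :: nat and t
      define f'' where "f'' n t = h * (\<gamma> * ((\<gamma> - 1) * t powr (\<gamma> - 2))) * pow_diff \<gamma> q (real n)" for n :: nat and t
      have d1: "((\<lambda>t. \<beta> * t + h * t powr \<gamma> * pow_diff \<gamma> q (real n)) has_real_derivative f' \<beta> n t) (at t)" if "0 < t" for t n \<beta>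
        unfolding f'_def using that has_real_derivative_powr_shift[of t 0 \<gamma>] by (intro DERIV_add DERIV_cmult_right DERIV_cmult_Id DERIV_cmult) auto
      have d2: "(f' \<beta> n has_real_derivative f'' n t) (at t)" if "0 < t" for t n \<beta>
      proof -
        have "(f' \<beta> n has_real_derivative 0 + h * (\<gamma> * ((\<gamma> - 1) * (t + 0) powr (\<gamma> - 1 - 1))) * pow_diff \<gamma> q (real n)) (at t)"
          unfolding f'_def using that has_real_derivative_powr_shift[of t 0 "\<gamma> - 1"] by (intro DERIV_add DERIV_const DERIV_cmult_right DERIV_cmult) auto
        then show ?thesis by (simp add: f''_def)
      qed
      have slope: "0 \<le> f' 0 n t" "f' 0 n t \<le> 2 * \<rho>" if "n \<in> {n1..<n2}" "M / 2 \<le> t" for n t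
      proof -
        show "0 \<le> f' 0 n t" using g[OF that(1)] * \<gamma> by (simp add: f'_def)
        have "t powr (\<gamma> - 1) \<le> (M / 2) powr (\<gamma> - 1)" using that * \<gamma> by (intro powr_mono2') auto
        also have "\<dots> = M powr (\<gamma> - 1) * 2 powr (1 - \<gamma>)" using * by (simp add: powr_divide powr_diff)
        also have "\<dots> \<le> M powr (\<gamma> - 1) * 2" using powr_mono[of "1 - \<gamma>" 1 "2::real"] \<gamma> by (intro mult_left_mono) auto
        finally have "f' 0 n t \<le> h * (1 * (M powr (\<gamma> - 1) * 2)) * (1 * q * N powr (\<gamma> - 1))"
          unfolding f'_def using g[OF that(1)] * \<gamma> by (simp only: add_0) (intro mult_mono order_trans[OF g(2)[OF that(1)]] mult_right_mono, auto)
        also have "\<dots> = 2 * \<rho>" using * by (simp add: rho powr_mult)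
        finally show "f' 0 n t \<le> 2 * \<rho>" .
      qed
      have f'0: "f' \<beta> n t = \<beta> + f' 0 n t" for \<beta> n t by (simp add: f'_def)
      define \<Lambda> where "\<Lambda> = 1 + 2 * \<rho>"
      \<comment> \<open>With r at least (1 + \<rho>) M the smoothing error, a multiple of N M
        \<Lambda> / r, is a multiple of N; yet ln r remains logarithmic in (1 + \<rho>) M.\<close>
      define r where "r = nat \<lceil>(1 + \<rho>) * M\<rceil>"
      have "1 * 1 \<le> (1 + \<rho>) * M" using * \<rho> by (intro mult_mono) auto
      then have r: "(1 + \<rho>) * M \<le> r" "real r \<le> (1 + \<rho>) * M + 1" "0 < r" unfolding r_def by linarith+
      have lip: "\<bar>f n s - f n t\<bar> \<le> \<Lambda> * \<bar>s - t\<bar>" if n: "n \<in> {n1..<n2}" and st: "s \<in> {A..B}" "t \<in> {A..B}" for n s t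
      proof -
        have *: "\<bar>f n t - f n s\<bar> \<le> \<Lambda> * \<bar>t - s\<bar>" if ts: "s < t" "s \<in> {A..B}" "t \<in> {A..B}" for s t
        proof -
          obtain z where z: "s < z" "z < t" "f n t - f n s = (t - s) * f' \<alpha>' n z"
            using MVT2[of s t "f n" "f' \<alpha>' n"] d1[where \<beta> = \<alpha>'] ts AB unfolding f_def[abs_def] by auto
          have "\<bar>f' \<alpha>' n z\<bar> \<le> \<Lambda>" using slope[OF n, of z] z that AB \<alpha>' unfolding f'0[of \<alpha>'] \<Lambda>_def by auto
          then show ?thesis unfolding z(3) abs_mult using that by (simp add: mult.commute mult_left_mono)
        qed
        from *[of s t] *[of t s] st show ?thesis by (cases s t rule: linorder_cases) (auto simp: abs_minus_commute)
      qed
      define J where "J \<mu> = norm (\<Sum>n\<in>{n1..<n2}. integral {A..B} (\<lambda>t. expi (f n t - real_of_int \<mu> * t)))" for \<mu> :: int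
      have fej: "norm ?T \<le> (\<Sum>\<mu>\<in>{- int (r * r)<..<int (r * r)}. J \<mu>)
        + real (card {n1..<n2}) * ((real m2 - real m1) * (4 * pi * \<Lambda> / r))" unfolding T J_def A_def B_def
      proof (rule sum_le_fejer_integrals)
        show "continuous_on {real m1 - 1 / 2..real m2 - 1 / 2} (f n)" for n unfolding f_def using AB by (intro continuous_intros) (auto simp: A_def)
      qed (use r \<rho> True lip in \<open>auto simp: \<Lambda>_def A_def B_def\<close>)
      have err: "real (card {n1..<n2}) * ((real m2 - real m1) * (4 * pi * \<Lambda> / r)) \<le> 26 * N"
      proof -
        have "(real m2 - real m1) * (4 * pi * \<Lambda> / r) \<le> M * (4 * pi * \<Lambda> / r)" using * \<rho> by (intro mult_right_mono) (auto simp: \<Lambda>_def)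
        also have "\<dots> \<le> 8 * pi"
        proof -
          have "\<Lambda> * M \<le> 2 * ((1 + \<rho>) * M)" using * \<rho> by (simp add: \<Lambda>_def algebra_simps)
          then have "M * \<Lambda> \<le> 2 * r" using r by (simp add: mult.commute)
          then have "4 * pi * (M * \<Lambda>) \<le> 4 * pi * (2 * r)" by (intro mult_left_mono) auto
          then show ?thesis using r by (simp add: divide_le_eq mult_ac)
        qed
        also have "\<dots> \<le> 26" using pi_approx(2) by simp
        finally have "real (card {n1..<n2}) * ((real m2 - real m1) * (4 * pi * \<Lambda> / r)) \<le> N * 26"
          using nN True * \<rho> r by (intro mult_mono) (auto simp: of_nat_diff \<Lambda>_def)
        then show ?thesis by simp
      qed
      \<comment> \<open>Apart from \<beta> the slope lies in [0, 2\<rho>], so |\<beta>| \<ge> 1 +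
        4\<rho> leaves a slope of size at least |\<beta>|/2; moreover |\<mu>| is at most
        2|\<beta>|.\<close>
      have far: "J \<mu> \<le> 4 * N * (1 / \<bar>real_of_int \<mu>\<bar>)" "\<mu> \<noteq> 0" if "1 + 4 * \<rho> \<le> \<bar>\<alpha>' - \<mu>\<bar>" for \<mu>
      proof -
        define \<beta> where "\<beta> = \<alpha>' - \<mu>"
        have \<beta>: "1 + 4 * \<rho> \<le> \<bar>\<beta>\<bar>" using that by (simp add: \<beta>_def)
        show \<mu>0: "\<mu> \<noteq> 0" using that \<alpha>' \<rho> by auto
        have "J \<mu> \<le> (\<Sum>n\<in>{n1..<n2}. 1 / (\<bar>\<beta>\<bar> / 2))" unfolding J_def
        proof (rule sum_norm_le)
          fix n assume n: "n \<in> {n1..<n2}"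
          have "norm (integral {A..B} (\<lambda>t. expi (\<beta> * t + h * t powr \<gamma> * pow_diff \<gamma> q (real n)))) \<le> 1 / (\<bar>\<beta>\<bar> / 2)"
          proof (rule first_derivative_test)
            show "((\<lambda>t. \<beta> * t + h * t powr \<gamma> * pow_diff \<gamma> q (real n)) has_real_derivative f' \<beta> n t) (at t within {A..B})"
              if "t \<in> {A..B}" for t using that AB by (intro has_field_derivative_at_within[OF d1]) auto
            show "(f' \<beta> n has_real_derivative f'' n t) (at t within {A..B})" if "t \<in> {A..B}" for t using that AB by (intro has_field_derivative_at_within[OF d2]) auto
            show "continuous_on {A..B} (f'' n)" unfolding f''_def using AB by (intro continuous_intros) auto
            show "f'' n t \<le> 0" if "t \<in> {A..B}" for t
            proof -
              have "(\<gamma> - 1) * t powr (\<gamma> - 2) \<le> 0" using \<gamma> by (intro mult_nonpos_nonneg) auto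
              then have "h * (\<gamma> * ((\<gamma> - 1) * t powr (\<gamma> - 2))) \<le> 0" using * \<gamma> by (simp add: mult_nonneg_nonpos)
              then show ?thesis unfolding f''_def by (rule mult_nonpos_nonneg[OF _ less_imp_le[OF g(1)[OF n]]])
            qed
            show "(\<forall>t\<in>{A..B}. \<bar>\<beta>\<bar> / 2 \<le> f' \<beta> n t) \<or> (\<forall>t\<in>{A..B}. f' \<beta> n t \<le> - (\<bar>\<beta>\<bar> / 2))"
            proof (cases "0 \<le> \<beta>")
              case True
              then have "\<bar>\<beta>\<bar> / 2 \<le> f' \<beta> n t" if "t \<in> {A..B}" for t using slope[OF n, of t] that AB unfolding f'0[of \<beta>] by auto
              then show ?thesis by blast
            next
              case False
              then have "f' \<beta> n t \<le> - (\<bar>\<beta>\<bar> / 2)" if "t \<in> {A..B}" for t using slope[OF n, of t] that AB \<beta> unfolding f'0[of \<beta>] by auto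
              then show ?thesis by blast
            qed
          qed (use AB \<beta> \<rho> in auto)
          moreover have "(\<lambda>t. expi (f n t - real_of_int \<mu> * t)) = (\<lambda>t. expi (\<beta> * t + h * t powr \<gamma> * pow_diff \<gamma> q (real n)))"
            by (rule ext, rule arg_cong[where f = expi]) (simp add: f_def \<beta>_def algebra_simps)
          ultimately show "norm (integral {A..B} (\<lambda>t. expi (f n t - real_of_int \<mu> * t))) \<le> 1 / (\<bar>\<beta>\<bar> / 2)" by (simp only:)
        qed
        also have "\<dots> = (real n2 - real n1) * (2 / \<bar>\<beta>\<bar>)" using True by (simp add: of_nat_diff)
        also have "\<dots> \<le> N * (4 / \<bar>real_of_int \<mu>\<bar>)"
        proof (rule mult_mono[OF nN])
          have "\<bar>real_of_int \<mu>\<bar> \<le> 2 * \<bar>\<beta>\<bar>" using \<beta> \<alpha>' \<rho> abs_triangle_ineq4[of \<alpha>' "\<alpha>' - \<mu>"] unfolding \<beta>_def by simp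
          then show "2 / \<bar>\<beta>\<bar> \<le> 4 / \<bar>real_of_int \<mu>\<bar>" using \<mu>0 \<beta> \<rho> by (simp add: field_simps)
        qed (use * in auto)
        finally show "J \<mu> \<le> 4 * N * (1 / \<bar>real_of_int \<mu>\<bar>)" by (simp add: mult.commute)
      qed
      have near: "J \<mu> \<le> C1 * (N / \<rho> + S * Y)" for \<mu>
      proof -
        have "(\<lambda>t. expi (f n t - real_of_int \<mu> * t)) = (\<lambda>t. expi ((\<alpha>' - \<mu>) * t + h * t powr \<gamma> * pow_diff \<gamma> q (real n)))" for n
          by (rule ext, rule arg_cong[where f = expi]) (simp add: f_def algebra_simps)
        then show ?thesis unfolding J_def S_def Y_def using * AB True rho by (simp only:) (intro 1(4), auto)
      qed
      define Nr where "Nr = {\<mu>::int. \<bar>\<alpha>' - \<mu>\<bar> < 1 + 4 * \<rho>}"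
      have Nr_sub: "Nr \<subseteq> {\<lceil>\<alpha>' - (1 + 4 * \<rho>)\<rceil>..\<lfloor>\<alpha>' + (1 + 4 * \<rho>)\<rfloor>}"
        by (auto simp: Nr_def ceiling_le_iff le_floor_iff abs_less_iff)
      then have finNr: "finite Nr" using finite_subset by blast
      have cardNr: "real (card Nr) \<le> 8 * (1 + \<rho>)"
      proof -
        have "card Nr \<le> card {\<lceil>\<alpha>' - (1 + 4 * \<rho>)\<rceil>..\<lfloor>\<alpha>' + (1 + 4 * \<rho>)\<rfloor>}" by (rule card_mono[OF _ Nr_sub]) simp
        then have "real (card Nr) \<le> real_of_int (\<lfloor>\<alpha>' + (1 + 4 * \<rho>)\<rfloor> + 1 - \<lceil>\<alpha>' - (1 + 4 * \<rho>)\<rceil>) \<or> card Nr = 0"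
          by (simp add: nat_le_iff le_nat_iff) linarith
        moreover have "real_of_int (\<lfloor>\<alpha>' + (1 + 4 * \<rho>)\<rfloor> + 1 - \<lceil>\<alpha>' - (1 + 4 * \<rho>)\<rceil>) \<le> 3 + 8 * \<rho>"
          using of_int_floor_le[of "\<alpha>' + (1 + 4 * \<rho>)"] le_of_int_ceiling[of "\<alpha>' - (1 + 4 * \<rho>)"] by (simp only: of_int_diff of_int_add of_int_1)
        ultimately show ?thesis using \<rho> by auto
      qed
      define I where "I = {- int (r * r)<..<int (r * r)}"
      have "(\<Sum>\<mu>\<in>I. J \<mu>) = (\<Sum>\<mu>\<in>I \<inter> Nr. J \<mu>) + (\<Sum>\<mu>\<in>I - Nr. J \<mu>)" by (rule sum.Int_Diff) (simp add: I_def)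
      also have "(\<Sum>\<mu>\<in>I \<inter> Nr. J \<mu>) \<le> real (card Nr) * (C1 * (N / \<rho> + S * Y))"
      proof -
        have "(\<Sum>\<mu>\<in>I \<inter> Nr. J \<mu>) \<le> real (card (I \<inter> Nr)) * (C1 * (N / \<rho> + S * Y))" using near by (intro sum_bounded_above) auto
        also have "\<dots> \<le> real (card Nr) * (C1 * (N / \<rho> + S * Y))" using finNr 1 * \<rho> YS by (intro mult_right_mono) (auto intro!: card_mono)
        finally show ?thesis .
      qed
      also have "(\<Sum>\<mu>\<in>I - Nr. J \<mu>) \<le> (\<Sum>\<mu>\<in>I - {0}. 4 * N * (1 / \<bar>real_of_int \<mu>\<bar>))"
      proof -
        have "(\<Sum>\<mu>\<in>I - Nr. J \<mu>) \<le> (\<Sum>\<mu>\<in>I - Nr. 4 * N * (1 / \<bar>real_of_int \<mu>\<bar>))" by (intro sum_mono far(1)) (auto simp: Nr_def)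
        also have "\<dots> \<le> (\<Sum>\<mu>\<in>I - {0}. 4 * N * (1 / \<bar>real_of_int \<mu>\<bar>))"
        proof (intro sum_mono2)
          have "0 \<in> Nr" using \<alpha>' \<rho> by (auto simp: Nr_def)
          then show "I - Nr \<subseteq> I - {0}" by auto
        qed (use * in \<open>auto simp: I_def\<close>)
        finally show ?thesis .
      qed
      also have "\<dots> = 4 * N * (\<Sum>\<mu>\<in>I - {0}. 1 / \<bar>real_of_int \<mu>\<bar>)" by (simp only: sum_distrib_left)
      also have "\<dots> \<le> 4 * N * (2 * (1 + ln (real (r * r))))" unfolding I_def using r * by (intro mult_left_mono sum_inverse_abs_int_le) auto
      also have "\<dots> \<le> 16 * N * L"
      proof -
        have "2 * (1 + \<rho>) * M = (1 + \<rho>) * M + (1 + \<rho>) * M" by simp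
        then have "real r \<le> 2 * (1 + \<rho>) * M" using r \<open>1 * 1 \<le> (1 + \<rho>) * M\<close> by linarith
        then have "ln (real r) \<le> L - 1" using r by (simp add: L_def)
        moreover have "ln (real (r * r)) = 2 * ln (real r)" using r by (simp add: ln_mult)
        ultimately have "4 * N * (2 * (1 + ln (real (r * r)))) \<le> 4 * N * (2 * (2 * L))" using * L by (intro mult_left_mono) auto
        then show ?thesis by simp
      qed
      finally have main: "(\<Sum>\<mu>\<in>I. J \<mu>) \<le> real (card Nr) * (C1 * (N / \<rho> + S * Y)) + 16 * N * L" by simp
      have "real (card Nr) * (C1 * (N / \<rho> + S * Y)) \<le> 8 * (1 + \<rho>) * (C1 * (N / \<rho> + S * Y))" using cardNr 1 * \<rho> YS by (intro mult_right_mono) auto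
      also have "\<dots> = 8 * C1 * (N * (1 + 1 / \<rho>) * 1 + (1 + \<rho>) * S * Y)" using \<rho> by (simp add: field_simps)
      also have "\<dots> \<le> 8 * C1 * (N * (1 + 1 / \<rho>) * L + (1 + \<rho>) * S * Y)" using 1 * \<rho> L by (intro mult_left_mono add_right_mono) auto
      finally have n1: "real (card Nr) * (C1 * (N / \<rho> + S * Y)) \<le> 8 * C1 * (N * (1 + 1 / \<rho>) * L + (1 + \<rho>) * S * Y)" .
      have "1 * 1 \<le> (1 + 1 / \<rho>) * L" "1 * L \<le> (1 + 1 / \<rho>) * L" using \<rho> L by (intro mult_mono; simp)+
      then have "N * (1 * 1) \<le> N * ((1 + 1 / \<rho>) * L)" "N * (1 * L) \<le> N * ((1 + 1 / \<rho>) * L)" using * by (intro mult_left_mono; simp)+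
      then have "N \<le> N * (1 + 1 / \<rho>) * L" "N * L \<le> N * (1 + 1 / \<rho>) * L" by (simp_all only: mult_1 mult_1_right mult.assoc)
      have "0 \<le> (1 + \<rho>) * S * Y" using \<rho> YS by simp
      then have n2: "16 * N * L + 26 * N \<le> 42 * (N * (1 + 1 / \<rho>) * L + (1 + \<rho>) * S * Y)"
      proof -
        have "16 * x + 26 * y \<le> 42 * (z + w)" if "y \<le> z" "x \<le> z" "0 \<le> w" for x y z w :: real using that by (simp add: distrib_left)
        from this[of N "N * (1 + 1 / \<rho>) * L" "N * L" "(1 + \<rho>) * S * Y"] show ?thesis
          using \<open>N \<le> N * (1 + 1 / \<rho>) * L\<close> \<open>N * L \<le> N * (1 + 1 / \<rho>) * L\<close> \<open>0 \<le> (1 + \<rho>) * S * Y\<close>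
          by (simp only: mult.assoc)
      qed
      show "norm ?T \<le> (8 * C1 + 42) * (N * (1 + 1 / \<rho>) * L + (1 + \<rho>) * S * Y)" using fej err main n1 n2 unfolding I_def[symmetric] distrib_right by linarith
    qed
  qed
qed
qed

section \<open>Weyl differencing\<close>

text \<open>Partial summation in both variables, for which the bound S has to be available on all
  initial rectangles.\<close>

lemma double_abel:
  fixes F :: "nat \<Rightarrow> nat \<Rightarrow> complex" and X Y :: "nat \<Rightarrow> real"
  assumes X: "\<And>m m'. \<lbrakk>m1 \<le> m; m \<le> m'; m' < m2\<rbrakk> \<Longrightarrow> X m' \<le> X m" "\<And>m. m1 \<le> m \<Longrightarrow> m < m2 \<Longrightarrow> 0 \<le> X m \<and> X m \<le> Xm" "0 \<le> Xm"
    and Y: "\<And>n n'. \<lbrakk>n1 \<le> n; n \<le> n'; n' < n2\<rbrakk> \<Longrightarrow> Y n' \<le> Y n" "\<And>n. n1 \<le> n \<Longrightarrow> n < n2 \<Longrightarrow> 0 \<le> Y n \<and> Y n \<le> Ym" "0 \<le> Ym"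
    and S: "\<And>m' n'. m' \<le> m2 \<Longrightarrow> n' \<le> n2 \<Longrightarrow> norm (\<Sum>n\<in>{n1..<n'}. \<Sum>m\<in>{m1..<m'}. F n m) \<le> S" "0 \<le> S"
  shows "norm (\<Sum>n\<in>{n1..<n2}. \<Sum>m\<in>{m1..<m2}. F n m * (of_real (X m) * of_real (Y n))) \<le> S * (Xm * Ym)"
proof -
  have "(\<Sum>n\<in>{n1..<n2}. \<Sum>m\<in>{m1..<m2}. F n m * (of_real (X m) * of_real (Y n)))
     = (\<Sum>n\<in>{n1..<n2}. of_real (Y n) * (\<Sum>m\<in>{m1..<m2}. of_real (X m) * F n m))" by (simp add: sum_distrib_left mult_ac)
  also have "norm \<dots> \<le> Ym * (Xm * S)"
  proof (rule abel_antimono)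
    fix n' assume n': "n1 \<le> n'" "n' \<le> n2"
    have "(\<Sum>n\<in>{n1..<n'}. \<Sum>m\<in>{m1..<m2}. of_real (X m) * F n m) = (\<Sum>m\<in>{m1..<m2}. of_real (X m) * (\<Sum>n\<in>{n1..<n'}. F n m))"
      by (subst sum.swap) (simp add: sum_distrib_left)
    also have "norm \<dots> \<le> Xm * S"
    proof (rule abel_antimono)
      fix m' assume m': "m1 \<le> m'" "m' \<le> m2"
      have "(\<Sum>m\<in>{m1..<m'}. \<Sum>n\<in>{n1..<n'}. F n m) = (\<Sum>n\<in>{n1..<n'}. \<Sum>m\<in>{m1..<m'}. F n m)" by (rule sum.swap)
      then show "norm (\<Sum>m\<in>{m1..<m'}. \<Sum>n\<in>{n1..<n'}. F n m) \<le> S" using S(1)[of m' n'] m' n' by simp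
    qed (use X S in auto)
    finally show "norm (\<Sum>n\<in>{n1..<n'}. \<Sum>m\<in>{m1..<m2}. of_real (X m) * F n m) \<le> Xm * S" .
  qed (use X Y S in auto)
  finally show ?thesis by (simp add: mult_ac)
qed

text \<open>The power series of the exponential separates the variables: its j-th term carries X m^j
  * Y n^j with decreasing factors, which \<open>double_abel\<close> removes. Summing the series
  costs a constant as long as the total twist c * Xm * Ym is bounded.\<close>

lemma double_sum_twist:
  fixes F :: "nat \<Rightarrow> nat \<Rightarrow> complex" and X Y :: "nat \<Rightarrow> real"
  assumes X: "\<And>m m'. \<lbrakk>m1 \<le> m; m \<le> m'; m' < m2\<rbrakk> \<Longrightarrow> X m' \<le> X m" "\<And>m. m1 \<le> m \<Longrightarrow> m < m2 \<Longrightarrow> 0 \<le> X m \<and> X m \<le> Xm" "0 \<le> Xm"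
    and Y: "\<And>n n'. \<lbrakk>n1 \<le> n; n \<le> n'; n' < n2\<rbrakk> \<Longrightarrow> Y n' \<le> Y n" "\<And>n. n1 \<le> n \<Longrightarrow> n < n2 \<Longrightarrow> 0 \<le> Y n \<and> Y n \<le> Ym" "0 \<le> Ym"
    and S: "\<And>m' n'. m' \<le> m2 \<Longrightarrow> n' \<le> n2 \<Longrightarrow> norm (\<Sum>n\<in>{n1..<n'}. \<Sum>m\<in>{m1..<m'}. F n m) \<le> S" "0 \<le> S" and c: "0 \<le> c"
  shows "norm (\<Sum>n\<in>{n1..<n2}. \<Sum>m\<in>{m1..<m2}. F n m * expi (- (c * X m * Y n))) \<le> S * exp (2 * pi * c * Xm * Ym)"
proof -
  define K where "K = - (2 * pi * \<i> * c)"
  define V where "V j = (\<Sum>n\<in>{n1..<n2}. \<Sum>m\<in>{m1..<m2}. F n m * (of_real (X m ^ j) * of_real (Y n ^ j)))" for j :: nat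
  have ex: "(\<lambda>j. K ^ j / fact j * (of_real (X m ^ j) * of_real (Y n ^ j))) sums expi (- (c * X m * Y n))" for m n
  proof -
    have "(\<lambda>j. (K * (of_real (X m) * of_real (Y n))) ^ j /\<^sub>R fact j) sums exp (K * (of_real (X m) * of_real (Y n)))" by (rule exp_converges)
    moreover have "exp (K * (of_real (X m) * of_real (Y n))) = expi (- (c * X m * Y n))" by (simp add: K_def expi_def mult_ac)
    moreover have "(K * (of_real (X m) * of_real (Y n))) ^ j /\<^sub>R fact j = K ^ j / fact j * (of_real (X m ^ j) * of_real (Y n ^ j))" for j
      by (simp add: power_mult_distrib scaleR_conv_of_real divide_inverse mult_ac)
    ultimately show ?thesis by simp
  qed
  have "(\<lambda>j. \<Sum>n\<in>{n1..<n2}. \<Sum>m\<in>{m1..<m2}. F n m * (K ^ j / fact j * (of_real (X m ^ j) * of_real (Y n ^ j))))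
     sums (\<Sum>n\<in>{n1..<n2}. \<Sum>m\<in>{m1..<m2}. F n m * expi (- (c * X m * Y n)))" by (intro sums_sum sums_mult ex)
  also have "(\<lambda>j. \<Sum>n\<in>{n1..<n2}. \<Sum>m\<in>{m1..<m2}. F n m * (K ^ j / fact j * (of_real (X m ^ j) * of_real (Y n ^ j))))
     = (\<lambda>j. K ^ j / fact j * V j)" by (simp add: V_def sum_distrib_left mult_ac)
  finally have sums: "(\<lambda>j. K ^ j / fact j * V j) sums (\<Sum>n\<in>{n1..<n2}. \<Sum>m\<in>{m1..<m2}. F n m * expi (- (c * X m * Y n)))" .
  have V: "norm (V j) \<le> S * (Xm ^ j * Ym ^ j)" for j unfolding V_def
  proof (rule double_abel)
    show "X m' ^ j \<le> X m ^ j" if "m1 \<le> m" "m \<le> m'" "m' < m2" for m m' using X(1)[OF that] X(2)[of m'] that by (intro power_mono) auto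
    show "0 \<le> X m ^ j \<and> X m ^ j \<le> Xm ^ j" if "m1 \<le> m" "m < m2" for m using X(2)[OF that] by (auto intro: power_mono)
    show "Y n' ^ j \<le> Y n ^ j" if "n1 \<le> n" "n \<le> n'" "n' < n2" for n n' using Y(1)[OF that] Y(2)[of n'] that by (intro power_mono) auto
    show "0 \<le> Y n ^ j \<and> Y n ^ j \<le> Ym ^ j" if "n1 \<le> n" "n < n2" for n using Y(2)[OF that] by (auto intro: power_mono)
  qed (use X Y S in auto)
  have nK: "norm K = 2 * pi * c" using c by (simp add: K_def norm_mult)
  have le: "norm (K ^ j / fact j * V j) \<le> S * ((2 * pi * c * Xm * Ym) ^ j /\<^sub>R fact j)" for j
  proof -
    have "norm (K ^ j / fact j * V j) = (2 * pi * c) ^ j / fact j * norm (V j)" by (simp add: norm_mult norm_divide norm_power nK)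
    also have "\<dots> \<le> (2 * pi * c) ^ j / fact j * (S * (Xm ^ j * Ym ^ j))" using V c by (intro mult_left_mono) auto
    also have "\<dots> = S * ((2 * pi * c * Xm * Ym) ^ j /\<^sub>R fact j)" by (simp add: power_mult_distrib divide_inverse mult_ac)
    finally show ?thesis .
  qed
  have es: "(\<lambda>j. S * ((2 * pi * c * Xm * Ym) ^ j /\<^sub>R fact j)) sums (S * exp (2 * pi * c * Xm * Ym))" by (intro sums_mult exp_converges)
  have "norm (\<Sum>j. K ^ j / fact j * V j) \<le> (\<Sum>j. S * ((2 * pi * c * Xm * Ym) ^ j /\<^sub>R fact j))" by (rule norm_suminf_le[OF le sums_summable[OF es]])
  then show ?thesis using sums_unique[OF sums] sums_unique[OF es] by simp
qed

text \<open>The Weyl-van der Corput inequality. The support condition makes shifts free of end point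
  corrections: each shift by less than Q \<le> N sees the whole sum within a window of 2N starting
  points. Correlations at differences r and -r are conjugate, hence the factor 2.\<close>

lemma weyl_differencing:
  fixes z :: "'m \<Rightarrow> nat \<Rightarrow> complex"
  assumes "finite U" "0 < Q" "Q \<le> N" and supp: "\<And>m n. z m n \<noteq> 0 \<Longrightarrow> N \<le> n \<and> n < 2 * N" and z1: "\<And>m n. norm (z m n) \<le> 1"
  shows "(\<Sum>m\<in>U. (norm (\<Sum>n\<in>{N..<2*N}. z m n))\<^sup>2) \<le>
    3 * real N / real Q * (real (card U) * N + 2 * (\<Sum>r\<in>{1..<Q}. norm (\<Sum>m\<in>U. \<Sum>n\<in>{N..<2*N}. z m (n + r) * cnj (z m n))))"
proof -
  define W where "W = {0..<2 * N}"
  let ?N = "\<lambda>m i. (norm (\<Sum>q<Q. z m (i + q)))\<^sup>2"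
  let ?C = "\<lambda>m q q'. \<Sum>i\<in>W. z m (i + q) * cnj (z m (i + q'))"
  define R where "R r = (\<Sum>m\<in>U. \<Sum>n\<in>{N..<2*N}. z m (n + r) * cnj (z m n))" for r
  let ?R = "\<lambda>q q'. norm (R (nat \<bar>int q - int q'\<bar>))"
  have shift: "(\<Sum>i\<in>W. z m (i + q)) = (\<Sum>n\<in>{N..<2*N}. z m n)" if "q < Q" for m q
  proof -
    have "(\<Sum>i\<in>W. z m (i + q)) = (\<Sum>n\<in>{q..<2 * N + q}. z m n)" unfolding W_def using sum.shift_bounds_nat_ivl[of "z m" 0 q "2 * N"] by simp
    also have "\<dots> = (\<Sum>n\<in>{N..<2*N}. z m n)" using that assms(3) supp by (intro sum.mono_neutral_right) force+
    finally show ?thesis .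
  qed
  have c: "(\<Sum>m\<in>U. ?C m q q') = R (q - q')" if "q' \<le> q" "q < Q" for q q'
  proof -
    have "(?C m q q') = (\<Sum>n\<in>{N..<2*N}. z m (n + (q - q')) * cnj (z m n))" for m
    proof -
      have "(?C m q q') = (\<Sum>i\<in>{0..<2*N}. (\<lambda>n. z m (n + (q - q')) * cnj (z m n)) (i + q'))" unfolding W_def using that by (intro sum.cong) (auto simp: add.assoc)
      also have "\<dots> = (\<Sum>n\<in>{q'..<2 * N + q'}. z m (n + (q - q')) * cnj (z m n))"
        using sum.shift_bounds_nat_ivl[of "\<lambda>n. z m (n + (q - q')) * cnj (z m n)" 0 q' "2 * N"] by simp
      also have "\<dots> = (\<Sum>n\<in>{N..<2*N}. z m (n + (q - q')) * cnj (z m n))" using that assms(3) supp by (intro sum.mono_neutral_right) force+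
      finally show ?thesis .
    qed
    then show ?thesis by (simp add: R_def)
  qed
  have c': "norm (\<Sum>m\<in>U. ?C m q q') = ?R q q'" if "q < Q" "q' < Q" for q q'
  proof (cases "q' \<le> q")
    case True
    then show ?thesis using c[OF True that(1)] by (simp add: nat_diff_distrib)
  next
    case False
    then have "norm (\<Sum>m\<in>U. ?C m q q') = norm (cnj (\<Sum>m\<in>U. \<Sum>i\<in>W. z m (i + q') * cnj (z m (i + q))))" by (simp add: mult.commute)
    also have "\<dots> = norm (R (q' - q))" unfolding complex_mod_cnj using c[of q q'] False that by simp
    also have "q' - q = nat \<bar>int q - int q'\<bar>" using False by auto
    finally show ?thesis .
  qed
  have R0: "norm (R 0) \<le> real (card U) * N"
  proof -
    have "norm (R 0) \<le> (\<Sum>m\<in>U. \<Sum>n\<in>{N..<2*N}. 1)" unfolding R_def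
    proof (intro sum_norm_le)
      fix m n
      show "norm (z m (n + 0) * cnj (z m n)) \<le> 1" using z1[of m n] by (simp add: norm_mult mult_le_one)
    qed
    then show ?thesis by simp
  qed
  \<comment> \<open>Q copies of the sum, one for each shift, are rearranged by the starting point i;
    Cauchy's inequality over the 2N values of i brings in squares of sums of length Q.\<close>
  have "(real Q)\<^sup>2 * (\<Sum>m\<in>U. (norm (\<Sum>n\<in>{N..<2*N}. z m n))\<^sup>2) = (\<Sum>m\<in>U. (norm (of_nat Q * (\<Sum>n\<in>{N..<2*N}. z m n)))\<^sup>2)"
    by (subst sum_distrib_left) (simp only: norm_mult norm_of_nat power_mult_distrib)
  also have "\<dots> \<le> (\<Sum>m\<in>U. real (card W) * (\<Sum>i\<in>W. ?N m i))"
  proof (rule sum_mono)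
    fix m
    have "of_nat Q * (\<Sum>n\<in>{N..<2*N}. z m n) = (\<Sum>q<Q. \<Sum>i\<in>W. z m (i + q))" using shift by simp
    also have "\<dots> = (\<Sum>i\<in>W. \<Sum>q<Q. z m (i + q))" by (rule sum.swap)
    finally have "norm (of_nat Q * (\<Sum>n\<in>{N..<2*N}. z m n)) \<le> (\<Sum>i\<in>W. norm (\<Sum>q<Q. z m (i + q)))" by (simp only: norm_sum)
    then have "(norm (of_nat Q * (\<Sum>n\<in>{N..<2*N}. z m n)))\<^sup>2 \<le> (\<Sum>i\<in>W. norm (\<Sum>q<Q. z m (i + q)))\<^sup>2" by (intro power_mono) auto
    also have "\<dots> \<le> (\<Sum>i\<in>W. ?N m i) * real (card W)" by (rule sum_squared_le_sum_of_squares)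
    finally show "(norm (of_nat Q * (\<Sum>n\<in>{N..<2*N}. z m n)))\<^sup>2 \<le> real (card W) * (\<Sum>i\<in>W. ?N m i)" by (simp add: mult.commute)
  qed
  also have "\<dots> = 2 * N * (\<Sum>m\<in>U. \<Sum>i\<in>W. ?N m i)" by (simp add: W_def sum_distrib_left)
  also have "(\<Sum>m\<in>U. \<Sum>i\<in>W. ?N m i) \<le> (\<Sum>q<Q. \<Sum>q'<Q. ?R q q')"
  proof -
    have "complex_of_real (\<Sum>m\<in>U. \<Sum>i\<in>W. ?N m i)
       = (\<Sum>m\<in>U. \<Sum>i\<in>W. \<Sum>q<Q. \<Sum>q'<Q. z m (i + q) * cnj (z m (i + q')))" unfolding of_real_sum complex_norm_square cnj_sum sum_product ..
    also have "\<dots> = (\<Sum>m\<in>U. \<Sum>q<Q. \<Sum>i\<in>W. \<Sum>q'<Q. z m (i + q) * cnj (z m (i + q')))" by (intro sum.cong refl sum.swap)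
    also have "\<dots> = (\<Sum>m\<in>U. \<Sum>q<Q. \<Sum>q'<Q. ?C m q q')" by (intro sum.cong refl sum.swap)
    also have "\<dots> = (\<Sum>q<Q. \<Sum>m\<in>U. \<Sum>q'<Q. ?C m q q')" by (rule sum.swap)
    also have "\<dots> = (\<Sum>q<Q. \<Sum>q'<Q. \<Sum>m\<in>U. ?C m q q')" by (intro sum.cong refl sum.swap)
    finally have eq: "complex_of_real (\<Sum>m\<in>U. \<Sum>i\<in>W. ?N m i) = \<dots>" .
    have "(\<Sum>m\<in>U. \<Sum>i\<in>W. ?N m i) = norm (complex_of_real (\<Sum>m\<in>U. \<Sum>i\<in>W. ?N m i))"
      unfolding norm_of_real by (intro abs_of_nonneg[symmetric] sum_nonneg) auto
    also have "\<dots> \<le> (\<Sum>q<Q. \<Sum>q'<Q. norm (\<Sum>m\<in>U. ?C m q q'))" unfolding eq by (intro order_trans[OF norm_sum] sum_mono norm_sum)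
    also have "\<dots> = (\<Sum>q<Q. \<Sum>q'<Q. ?R q q')" by (intro sum.cong refl c') auto
    finally show ?thesis .
  qed
  also have "(\<Sum>q<Q. \<Sum>q'<Q. ?R q q') \<le> (\<Sum>q<Q. norm (R 0) + 2 * (\<Sum>r\<in>{1..<Q}. norm (R r)))"
  proof (rule sum_mono)
    fix q assume q: "q \<in> {..<Q}"
    have "(\<Sum>q'<Q. ?R q q') = (\<Sum>q'\<in>{..<q}. ?R q q')
        + (\<Sum>q'\<in>{q}. ?R q q') + (\<Sum>q'\<in>{q<..<Q}. ?R q q')"
    proof -
      have "{..<Q} = ({..<q} \<union> {q}) \<union> {q<..<Q}" using q by auto
      moreover have "sum f (({..<q} \<union> {q}) \<union> {q<..<Q}) = sum f {..<q} + sum f {q} + sum f {q<..<Q}" for f :: "nat \<Rightarrow> real"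
      proof -
        have "sum f (({..<q} \<union> {q}) \<union> {q<..<Q}) = sum f ({..<q} \<union> {q}) + sum f {q<..<Q}" by (rule sum.union_disjoint) auto
        also have "sum f ({..<q} \<union> {q}) = sum f {..<q} + sum f {q}" by (rule sum.union_disjoint) auto
        finally show ?thesis .
      qed
      ultimately show ?thesis by (simp only:)
    qed
    also have "(\<Sum>q'\<in>{..<q}. ?R q q') = (\<Sum>r\<in>(\<lambda>q'. nat \<bar>int q - int q'\<bar>) ` {..<q}. norm (R r))" by (subst sum.reindex) (auto simp: inj_on_def)
    also have "\<dots> \<le> (\<Sum>r\<in>{1..<Q}. norm (R r))" using q by (intro sum_mono2) auto
    also have "(\<Sum>q'\<in>{q<..<Q}. ?R q q') = (\<Sum>r\<in>(\<lambda>q'. nat \<bar>int q - int q'\<bar>) ` {q<..<Q}. norm (R r))" by (subst sum.reindex) (auto simp: inj_on_def)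
    also have "\<dots> \<le> (\<Sum>r\<in>{1..<Q}. norm (R r))" using q by (intro sum_mono2) auto
    finally show "(\<Sum>q'<Q. ?R q q') \<le> norm (R 0) + 2 * (\<Sum>r\<in>{1..<Q}. norm (R r))" by simp
  qed
  also have "\<dots> \<le> Q * (real (card U) * N + 2 * (\<Sum>r\<in>{1..<Q}. norm (R r)))" using R0 by (simp add: mult_left_mono)
  finally have fin: "(real Q)\<^sup>2 * (\<Sum>m\<in>U. (norm (\<Sum>n\<in>{N..<2*N}. z m n))\<^sup>2)
      \<le> 2 * N * (Q * (real (card U) * N + 2 * (\<Sum>r\<in>{1..<Q}. norm (R r))))" by (simp add: mult_left_mono)
  define V where "V = real (card U) * N + 2 * (\<Sum>r\<in>{1..<Q}. norm (R r))"
  define Z where "Z = (\<Sum>m\<in>U. (norm (\<Sum>n\<in>{N..<2*N}. z m n))\<^sup>2)"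
  have V0: "0 \<le> V" unfolding V_def by (intro add_nonneg_nonneg mult_nonneg_nonneg sum_nonneg) auto
  have "Z \<le> 2 * real N / real Q * V" using fin assms(2) unfolding V_def[symmetric] Z_def[symmetric] by (simp add: field_simps power2_eq_square)
  also have "\<dots> \<le> 3 * real N / real Q * V" using V0 by (intro mult_right_mono divide_right_mono) auto
  finally show ?thesis unfolding Z_def V_def R_def .
qed

section \<open>The shift u and the estimate with one smooth variable\<close>

lemma powr_remainder_bound:
  fixes X u \<gamma> :: real
  assumes "0 < \<gamma>" "\<gamma> < 1" "0 < X" "0 \<le> u" "u \<le> 1"
  shows "\<bar>(X + u) powr \<gamma> - X powr \<gamma> - \<gamma> * u * X powr (\<gamma> - 1)\<bar> \<le> X powr (\<gamma> - 2)"
proof (cases "u = 0")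
  case False
  then have u: "0 < u" using assms by simp
  obtain \<xi> where \<xi>: "X < \<xi>" "\<xi> < X + u" "(X + u) powr \<gamma> - X powr \<gamma> = (X + u - X) * (\<gamma> * \<xi> powr (\<gamma> - 1))"
    using MVT2[of X "X + u" "\<lambda>t. t powr \<gamma>" "\<lambda>t. \<gamma> * t powr (\<gamma> - 1)"] assms u has_real_derivative_powr_shift[of _ 0 \<gamma>] by auto
  obtain \<zeta> where \<zeta>: "X < \<zeta>" "\<zeta> < \<xi>" "\<xi> powr (\<gamma> - 1) - X powr (\<gamma> - 1) = (\<xi> - X) * ((\<gamma> - 1) * \<zeta> powr (\<gamma> - 1 - 1))"
    using MVT2[of X \<xi> "\<lambda>t. t powr (\<gamma> - 1)" "\<lambda>t. (\<gamma> - 1) * t powr (\<gamma> - 1 - 1)"] assms \<xi> has_real_derivative_powr_shift[of _ 0 "\<gamma> - 1"]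
    by auto
  have "(X + u) powr \<gamma> - X powr \<gamma> - \<gamma> * u * X powr (\<gamma> - 1) = \<gamma> * u * (\<xi> powr (\<gamma> - 1) - X powr (\<gamma> - 1))"
    unfolding \<xi>(3) by (simp add: algebra_simps)
  also have "\<dots> = (\<gamma> * u * (\<xi> - X) * (\<gamma> - 1)) * \<zeta> powr (\<gamma> - 2)" unfolding \<zeta>(3) by simp
  finally have "\<bar>(X + u) powr \<gamma> - X powr \<gamma> - \<gamma> * u * X powr (\<gamma> - 1)\<bar> = \<bar>\<gamma> * u * (\<xi> - X) * (\<gamma> - 1)\<bar> * \<zeta> powr (\<gamma> - 2)"
    by (simp add: abs_mult)
  also have "\<dots> \<le> 1 * X powr (\<gamma> - 2)"
  proof (rule mult_mono)
    have "\<gamma> * u * (\<xi> - X) * (1 - \<gamma>) \<le> 1 * 1 * 1 * 1" using assms \<xi> u by (intro mult_mono) auto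
    then show "\<bar>\<gamma> * u * (\<xi> - X) * (\<gamma> - 1)\<bar> \<le> 1" using assms \<xi> u by (simp add: abs_mult)
    show "\<zeta> powr (\<gamma> - 2) \<le> X powr (\<gamma> - 2)" using \<zeta> assms by (intro powr_mono2') auto
  qed auto
  finally show ?thesis by simp
qed (use assms in auto)

lemma neg_pow_diff:
  fixes \<gamma> r s t :: real
  assumes "0 < \<gamma>" "\<gamma> < 1" "0 < r" "0 < s"
  shows "0 \<le> s powr (\<gamma> - 1) - (s + r) powr (\<gamma> - 1)"
    and "s powr (\<gamma> - 1) - (s + r) powr (\<gamma> - 1) \<le> r * s powr (\<gamma> - 2)"
    and "s \<le> t \<Longrightarrow> t powr (\<gamma> - 1) - (t + r) powr (\<gamma> - 1) \<le> s powr (\<gamma> - 1) - (s + r) powr (\<gamma> - 1)"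
proof -
  show "0 \<le> s powr (\<gamma> - 1) - (s + r) powr (\<gamma> - 1)" using assms by (simp add: powr_mono2')
  obtain z where z: "s < z" "z < s + r" "(s + r) powr (\<gamma> - 1) - s powr (\<gamma> - 1) = (s + r - s) * ((\<gamma> - 1) * z powr (\<gamma> - 1 - 1))"
    using MVT2[of s "s + r" "\<lambda>t. t powr (\<gamma> - 1)" "\<lambda>t. (\<gamma> - 1) * t powr (\<gamma> - 1 - 1)"] assms has_real_derivative_powr_shift[of _ 0 "\<gamma> - 1"]
    by auto
  have "s powr (\<gamma> - 1) - (s + r) powr (\<gamma> - 1) = r * ((1 - \<gamma>) * z powr (\<gamma> - 2))" using z(3) by (simp add: algebra_simps)
  also have "\<dots> \<le> r * (1 * s powr (\<gamma> - 2))" using z assms by (intro mult_left_mono mult_mono powr_mono2') auto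
  finally show "s powr (\<gamma> - 1) - (s + r) powr (\<gamma> - 1) \<le> r * s powr (\<gamma> - 2)" by simp
  show "t powr (\<gamma> - 1) - (t + r) powr (\<gamma> - 1) \<le> s powr (\<gamma> - 1) - (s + r) powr (\<gamma> - 1)" if "s \<le> t"
  proof (rule DERIV_nonpos_imp_nonincreasing[OF that])
    fix x assume x: "s \<le> x" "x \<le> t"
    have "((\<lambda>t. (t + 0) powr (\<gamma> - 1) - (t + r) powr (\<gamma> - 1)) has_real_derivative
       (\<gamma> - 1) * (x + 0) powr (\<gamma> - 1 - 1) - (\<gamma> - 1) * (x + r) powr (\<gamma> - 1 - 1)) (at x)"
      using x assms by (intro DERIV_diff has_real_derivative_powr_shift) auto
    moreover have "(\<gamma> - 1) * (x + 0) powr (\<gamma> - 1 - 1) \<le> (\<gamma> - 1) * (x + r) powr (\<gamma> - 1 - 1)"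
      using x assms by (intro mult_left_mono_neg powr_mono2') auto
    ultimately show "\<exists>y. ((\<lambda>t. t powr (\<gamma> - 1) - (t + r) powr (\<gamma> - 1)) has_real_derivative y) (at x) \<and> y \<le> 0"
      by (intro exI[of _ "(\<gamma> - 1) * (x + 0) powr (\<gamma> - 1 - 1) - (\<gamma> - 1) * (x + r) powr (\<gamma> - 1 - 1)"]) simp
  qed
qed

lemma card_frequencies_le:
  assumes "1 \<le> H" "\<And>h. h \<in> hs \<Longrightarrow> H \<le> real h \<and> real h \<le> 2 * H"
  shows "real (card hs) \<le> 2 * H"
proof -
  have "hs \<subseteq> {1..nat \<lfloor>2 * H\<rfloor>}" using assms by (force simp: le_nat_floor)
  then have "card hs \<le> card {1..nat \<lfloor>2 * H\<rfloor>}" by (intro card_mono) auto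
  then have "real (card hs) \<le> real (nat \<lfloor>2 * H\<rfloor>)" by simp
  also have "\<dots> \<le> 2 * H" using assms by simp
  finally show ?thesis .
qed

text \<open>Cauchy's inequality and differencing lead to the phase h ((m (n + r) + u)^\<gamma> - (m
  n + u)^\<gamma>). Expansion in u gives three parts: the difference without u, for
  \<open>double_sum_bound\<close>; a first-order part that is a product of a function of m and one
  of n, for \<open>double_sum_twist\<close>; and a remainder of total cost O(N). \<open>B\<close>
  has to bound \<open>type_one_term\<close> for all \<open>\<rho>\<close> that arise from the
  frequencies h and the steps r < Q.\<close>

theorem type_one_bound:
  assumes ep: "exponent_pair k l" and \<gamma>: "0 < \<gamma>" "\<gamma> < 1"
  obtains C z0 where "0 < C" "0 < z0"
    "\<And>H B u \<alpha> hs N M Q n1 n2 a. \<lbrakk>1 \<le> H; 1 \<le> N; 1 \<le> M; 1 \<le> Q; real Q \<le> z0 * real N; 0 \<le> u; u \<le> 1;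
      finite hs; (\<And>h. h \<in> hs \<Longrightarrow> H \<le> real h \<and> real h \<le> 2 * H); (\<And>m. norm (a m :: complex) \<le> 1); N \<le> n1; n2 \<le> 2 * N;
      2 * H * Q * (real M * real N) powr (\<gamma> - 1) \<le> N;
      (\<And>\<rho>::real. H * (real M * real N) powr (\<gamma> - 1) \<le> \<rho> \<Longrightarrow> \<rho> \<le> 2 * H * Q * (real M * real N) powr (\<gamma> - 1) \<Longrightarrow>
         type_one_term k l N M \<rho> \<le> B)\<rbrakk> \<Longrightarrow>
      (\<Sum>h\<in>hs. norm (\<Sum>m\<in>{M..<2*M}. a m * (\<Sum>n\<in>{n1..<n2}. expi (twisted_phase \<gamma> u \<alpha> h (m * n)))))\<^sup>2
        \<le> C * ((H * M * N)\<^sup>2 / Q + H\<^sup>2 * M * N * B)"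
proof -
  show ?thesis
  proof (rule double_sum_bound[OF ep \<gamma>], goal_cases)
  case (1 C1 z0)
  \<comment> \<open>exp (2 pi) is the price of the twist, and 26 bounds 8 pi, which comes from the
    remainder.\<close>
  define C2 where "C2 = C1 * exp (2 * pi) + 26"
  have C2: "0 < C2" using 1 by (simp add: C2_def add_pos_pos)
  show ?thesis
  proof (rule that[of "12 + 24 * C2" z0])
    show "0 < 12 + 24 * C2" "0 < z0" using C2 1 by auto
    fix H B u \<alpha> :: real and hs :: "nat set" and N M Q n1 n2 :: nat and a :: "nat \<Rightarrow> complex"
    assume *: "1 \<le> H" "1 \<le> N" "1 \<le> M" "1 \<le> Q" "real Q \<le> z0 * real N" "0 \<le> u" "u \<le> 1" "finite hs"
      and hs: "\<And>h. h \<in> hs \<Longrightarrow> H \<le> real h \<and> real h \<le> 2 * H" and a: "\<And>m. norm (a m) \<le> 1"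
      and n12: "N \<le> n1" "n2 \<le> 2 * N" and tw: "2 * H * Q * (real M * real N) powr (\<gamma> - 1) \<le> N"
      and B: "\<And>\<rho>::real. H * (real M * real N) powr (\<gamma> - 1) \<le> \<rho> \<Longrightarrow> \<rho> \<le> 2 * H * Q * (real M * real N) powr (\<gamma> - 1) \<Longrightarrow>
         type_one_term k l N M \<rho> \<le> B"
    define P where "P = (real M * real N) powr (\<gamma> - 1)"
    have P: "0 < P" using * by (simp add: P_def)
    have QN: "Q \<le> N"
    proof -
      have "z0 * real N \<le> 1 * real N" using 1 by (intro mult_right_mono) auto
      then have "real Q \<le> real N" using *(5) by linarith
      then show ?thesis by simp
    qed
    have HP: "H * P \<le> 2 * H * Q * P"
    proof -
      have "1 * P * H \<le> (2 * real Q) * P * H" using * P by (intro mult_right_mono) auto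
      then show ?thesis by (simp add: mult_ac)
    qed
    \<comment> \<open>The first summand of \<open>type_one_term\<close> is at least N, so errors of
      size N fit into B.\<close>
    have NB: "real N \<le> B"
    proof -
      define \<rho> where "\<rho> = H * P"
      have \<rho>: "0 < \<rho>" using * P by (simp add: \<rho>_def)
      have "1 * 1 \<le> 2 * (1 + \<rho>) * M" using \<rho> * by (intro mult_mono) auto
      then have "1 \<le> 1 + ln (2 * (1 + \<rho>) * M)" by simp
      then have "real N * 1 * 1 \<le> N * (1 + 1 / \<rho>) * (1 + ln (2 * (1 + \<rho>) * M))" using \<rho> by (intro mult_mono) auto
      moreover have "0 \<le> (1 + \<rho>) * sqrt (M / \<rho>) * ((\<rho> * M) powr k * N powr (l - k))" using \<rho> by simp
      moreover have "type_one_term k l N M \<rho> \<le> B" using HP by (intro B) (auto simp: \<rho>_def P_def)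
      ultimately show ?thesis unfolding type_one_term_def by linarith
    qed
    have HPN: "H * P \<le> N" using tw HP by (simp add: P_def)
    define U where "U = {M..<2*M}"
    define z where "z h m n = (if n1 \<le> n \<and> n < n2 then expi (twisted_phase \<gamma> u \<alpha> h (m * n)) else 0)" for h m n
    let ?t = "\<lambda>h m. \<Sum>n\<in>{n1..<n2}. expi (twisted_phase \<gamma> u \<alpha> h (m * n))"
    have zsum: "(\<Sum>n\<in>{N..<2*N}. z h m n) = (?t h m)" for h m
    proof -
      have "(?t h m) = (\<Sum>n\<in>{n1..<n2}. z h m n)" by (intro sum.cong) (auto simp: z_def)
      also have "\<dots> = (\<Sum>n\<in>{N..<2*N}. z h m n)" using n12 by (intro sum.mono_neutral_left) (auto simp: z_def)
      finally show ?thesis ..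
    qed
    let ?corr = "\<lambda>h r. \<Sum>m\<in>U. \<Sum>n\<in>{N..<2*N}. z h m (n + r) * cnj (z h m n)" and ?V = "3 * real N / Q * (real M * N + 2 * (Q * (C2 * B)))"
    have D: "norm (?corr h r) \<le> C2 * B" if h: "h \<in> hs" and r: "r \<in> {1..<Q}" for h r
    proof -
      have h0: "H \<le> real h" "real h \<le> 2 * H" "0 < real h" using hs[OF h] * by auto
      define \<rho> where "\<rho> = real h * real r * P"
      have \<rho>: "H * P \<le> \<rho>" "\<rho> \<le> 2 * H * Q * P"
      proof -
        have "H * 1 * P \<le> real h * real r * P" using h0 r P * by (intro mult_right_mono mult_mono) auto
        then show "H * P \<le> \<rho>" by (simp add: \<rho>_def)
        show "\<rho> \<le> 2 * H * Q * P" unfolding \<rho>_def using h0 r P * by (intro mult_right_mono mult_mono) auto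
      qed
      \<comment> \<open>The first-order part in u is -c * X m * Y n. The sign in Y is chosen so that
        both factors are nonnegative and decreasing, as \<open>double_sum_twist\<close>
        requires.\<close>
      define X where "X m = real m powr (\<gamma> - 1)" for m :: nat
      define Y where "Y n = real n powr (\<gamma> - 1) - (real n + real r) powr (\<gamma> - 1)" for n :: nat
      define \<psi> where "\<psi> v = (v + u) powr \<gamma> - v powr \<gamma> - \<gamma> * u * v powr (\<gamma> - 1)" for v
      define c where "c = real h * \<gamma> * u"
      define F where "F n m = expi (\<alpha> * r * real m + real h * real m powr \<gamma> * pow_diff \<gamma> (real r) (real n))" for n m :: nat
      let ?F = "\<lambda>n m. F n m * expi (- (c * X m * Y n))"
      define R where "R n m = real h * (\<psi> (real m * (real n + r)) - \<psi> (real m * real n))" for n m :: nat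
      have r0: "0 < real r" using r by simp
      have phase: "twisted_phase \<gamma> u \<alpha> h (m * (n + r)) - twisted_phase \<gamma> u \<alpha> h (m * n)
        = (\<alpha> * r * real m + real h * real m powr \<gamma> * pow_diff \<gamma> (real r) (real n)) + - (c * X m * Y n) + R n m" if "0 < m" "0 < n" for m n
      proof -
        have "(real m * (real n + r)) powr \<gamma> = real m powr \<gamma> * (real n + r) powr \<gamma>" "(real m * real n) powr \<gamma> = real m powr \<gamma> * real n powr \<gamma>"
          "(real m * (real n + r)) powr (\<gamma> - 1) = real m powr (\<gamma> - 1) * (real n + r) powr (\<gamma> - 1)" "(real m * real n) powr (\<gamma> - 1) = real m powr (\<gamma> - 1) * real n powr (\<gamma> - 1)"
          using that by (simp_all add: powr_mult)
        then have "R n m = real h * (((real m * (real n + r)) + u) powr \<gamma> - real m powr \<gamma> * (real n + r) powr \<gamma> - \<gamma> * u * (real m powr (\<gamma> - 1) * (real n + r) powr (\<gamma> - 1))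
           - (((real m * real n) + u) powr \<gamma> - real m powr \<gamma> * real n powr \<gamma> - \<gamma> * u * (real m powr (\<gamma> - 1) * real n powr (\<gamma> - 1))))"
          by (simp only: R_def \<psi>_def)
        then show ?thesis by (simp add: twisted_phase_def pow_diff_def c_def X_def Y_def algebra_simps)
      qed
      have split: "(?corr h r) = (\<Sum>n\<in>{n1..<n2 - r}. \<Sum>m\<in>{M..<2*M}. ?F n m * expi (R n m))"
      proof -
        have "(\<Sum>n\<in>{N..<2*N}. z h m (n + r) * cnj (z h m n)) = (\<Sum>n\<in>{n1..<n2 - r}. ?F n m * expi (R n m))" if m: "m \<in> U" for m
        proof -
          have "(\<Sum>n\<in>{N..<2*N}. z h m (n + r) * cnj (z h m n)) = (\<Sum>n\<in>{n1..<n2 - r}. z h m (n + r) * cnj (z h m n))"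
            using n12 by (intro sum.mono_neutral_right) (auto simp: z_def)
          also have "\<dots> = (\<Sum>n\<in>{n1..<n2 - r}. ?F n m * expi (R n m))"
          proof (intro sum.cong refl)
            fix n assume n: "n \<in> {n1..<n2 - r}"
            then have "z h m (n + r) * cnj (z h m n) = expi (twisted_phase \<gamma> u \<alpha> h (m * (n + r)) - twisted_phase \<gamma> u \<alpha> h (m * n))"
              using n by (auto simp: z_def expi_diff less_diff_conv)
            also have "\<dots> = (?F n m) * expi (R n m)" unfolding F_def expi_add[symmetric] using n n12 * m by (subst phase) (auto simp: U_def)
            finally show "z h m (n + r) * cnj (z h m n) = (?F n m) * expi (R n m)" .
          qed
          finally show ?thesis .
        qed
        then have "(?corr h r) = (\<Sum>m\<in>U. \<Sum>n\<in>{n1..<n2 - r}. ?F n m * expi (R n m))" by (rule sum.cong[OF refl])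
        also have "\<dots> = (\<Sum>n\<in>{n1..<n2 - r}. \<Sum>m\<in>U. ?F n m * expi (R n m))" by (rule sum.swap)
        finally show ?thesis unfolding U_def .
      qed
      have "norm (\<Sum>n\<in>{n1..<n2 - r}. \<Sum>m\<in>{M..<2*M}. ?F n m) \<le> (C1 * B) * exp (2 * pi * c * M powr (\<gamma> - 1) * (r * N powr (\<gamma> - 2)))"
      proof (rule double_sum_twist)
        show "X m' \<le> X m" if "M \<le> m" "m \<le> m'" for m m' unfolding X_def using that * \<gamma> by (intro powr_mono2') auto
        show "0 \<le> X m \<and> X m \<le> M powr (\<gamma> - 1)" if "M \<le> m" for m unfolding X_def using that * \<gamma> by (auto intro!: powr_mono2')
        show "Y n' \<le> Y n" if "n1 \<le> n" "n \<le> n'" for n n' unfolding Y_def using that n12 * \<gamma> r0 by (intro neg_pow_diff(3)) auto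
        show "0 \<le> Y n \<and> Y n \<le> r * N powr (\<gamma> - 2)" if "n1 \<le> n" for n
        proof
          show "0 \<le> Y n" unfolding Y_def using that n12 * \<gamma> r0 by (intro neg_pow_diff(1)) auto
          have "Y n \<le> r * real n powr (\<gamma> - 2)" unfolding Y_def using that n12 * \<gamma> r0 by (intro neg_pow_diff(2)) auto
          also have "\<dots> \<le> r * N powr (\<gamma> - 2)" using that n12 * \<gamma> by (intro mult_left_mono powr_mono2') auto
          finally show "Y n \<le> r * N powr (\<gamma> - 2)" .
        qed
        show "norm (\<Sum>n\<in>{n1..<n'}. \<Sum>m\<in>{M..<m'}. F n m) \<le> C1 * B" if "m' \<le> 2 * M" "n' \<le> n2 - r" for m' n'
        proof -
          have "norm (\<Sum>n\<in>{n1..<n'}. \<Sum>m\<in>{M..<m'}. F n m) \<le> C1 * type_one_term k l N M \<rho>" unfolding F_def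
          proof (rule 1(4)[OF h0(3) r0])
            show "real r \<le> z0 * real N" using r *(5) by simp
            show "\<rho> = real h * real r * (real M * real N) powr (\<gamma> - 1)" by (simp add: \<rho>_def P_def)
          qed (use that n12 * in auto)
          also have "\<dots> \<le> C1 * B" using 1 \<rho> by (intro mult_left_mono B) (auto simp: P_def)
          finally show ?thesis .
        qed
      qed (use 1 NB * h0 \<gamma> in \<open>auto simp: c_def\<close>)
      also have "\<dots> \<le> (C1 * B) * exp (2 * pi)"
      proof -
        \<comment> \<open>The total twist is at most 2 H Q (M N)^(\<gamma> - 1) / N, which the
          hypothesis \<open>tw\<close> bounds by 1.\<close>
        have "c * M powr (\<gamma> - 1) * (r * N powr (\<gamma> - 2)) \<le> (2 * H * 1 * 1) * M powr (\<gamma> - 1) * (Q * N powr (\<gamma> - 2))"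
          unfolding c_def using h0 * \<gamma> r by (intro mult_mono) auto
        also have "\<dots> = 2 * H * Q * P / N"
        proof -
          have "real N powr (\<gamma> - 2) = N powr (\<gamma> - 1) / N" using * powr_diff[of "real N" "\<gamma> - 1" 1] by simp
          then show ?thesis using * by (simp add: P_def powr_mult)
        qed
        also have "\<dots> \<le> 1" using tw * by (simp add: P_def)
        finally have "2 * pi * (c * M powr (\<gamma> - 1) * (r * N powr (\<gamma> - 2))) \<le> 2 * pi * 1" by (intro mult_left_mono) auto
        then have "exp (2 * pi * c * M powr (\<gamma> - 1) * (r * N powr (\<gamma> - 2))) \<le> exp (2 * pi)" by (simp add: mult_ac)
        then show ?thesis using 1 NB by (intro mult_left_mono) auto
      qed
      finally have m1: "norm (\<Sum>n\<in>{n1..<n2 - r}. \<Sum>m\<in>{M..<2*M}. ?F n m) \<le> C1 * exp (2 * pi) * B" by (simp add: mult_ac)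
      have Rb: "norm (expi (R n m) - 1) \<le> 8 * pi * (H * (real M * real N) powr (\<gamma> - 2))" if "n \<in> {n1..<n2 - r}" "m \<in> {M..<2*M}" for n m
      proof -
        have nm: "real M * real N \<le> real m * real n" "real M * real N \<le> real m * (real n + r)" "0 < real M * real N" using that n12 * by (auto intro!: mult_mono)
        have ps: "\<bar>\<psi> v\<bar> \<le> (real M * real N) powr (\<gamma> - 2)" if "real M * real N \<le> v" for v
        proof -
          have "0 < v" using that nm(3) by linarith
          then have "\<bar>\<psi> v\<bar> \<le> v powr (\<gamma> - 2)" unfolding \<psi>_def using \<gamma> * by (intro powr_remainder_bound) auto
          also have "\<dots> \<le> (real M * real N) powr (\<gamma> - 2)" using that nm(3) \<gamma> by (intro powr_mono2') auto
          finally show ?thesis .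
        qed
        have "\<bar>\<psi> (real m * (real n + r)) - \<psi> (real m * real n)\<bar> \<le> 2 * (real M * real N) powr (\<gamma> - 2)" using ps[OF nm(1)] ps[OF nm(2)] by linarith
        then have "\<bar>R n m\<bar> \<le> (2 * H) * (2 * (real M * real N) powr (\<gamma> - 2))" unfolding R_def abs_mult using h0 * by (intro mult_mono) auto
        then have "2 * pi * \<bar>R n m - 0\<bar> \<le> 2 * pi * ((2 * H) * (2 * (real M * real N) powr (\<gamma> - 2)))" by (intro mult_left_mono) auto
        from order_trans[OF norm_expi_diff_le this] show ?thesis by (simp add: mult_ac)
      qed
      have m2: "norm (\<Sum>n\<in>{n1..<n2 - r}. \<Sum>m\<in>{M..<2*M}. ?F n m * (expi (R n m) - 1)) \<le> 26 * B"
      proof -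
        define K where "K = 8 * pi * (H * (real M * real N) powr (\<gamma> - 2))"
        have K0: "0 \<le> K" using * by (simp add: K_def)
        have "norm (\<Sum>n\<in>{n1..<n2 - r}. \<Sum>m\<in>{M..<2*M}. ?F n m * (expi (R n m) - 1)) \<le> (\<Sum>n\<in>{n1..<n2 - r}. \<Sum>m\<in>{M..<2*M}. K)"
          using Rb by (intro sum_norm_le) (auto simp: norm_mult F_def K_def)
        also have "\<dots> = real (n2 - r - n1) * (M * K)" by simp
        also have "\<dots> \<le> N * (M * K)" using n12 K0 by (intro mult_right_mono) auto
        also have "\<dots> = 8 * pi * (H * P)"
        proof -
          have "P = (real M * real N) powr (\<gamma> - 2) * (real M * real N)" using * powr_add[of "real M * real N" "\<gamma> - 2" 1] by (simp add: P_def)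
          then show ?thesis by (simp add: K_def)
        qed
        also have "\<dots> \<le> 26 * real N" using HPN pi_approx(2) P * by (intro mult_mono) auto
        also have "\<dots> \<le> 26 * B" using NB by simp
        finally show ?thesis .
      qed
      have "(\<Sum>n\<in>{n1..<n2 - r}. \<Sum>m\<in>{M..<2*M}. ?F n m * expi (R n m))
        = (\<Sum>n\<in>{n1..<n2 - r}. \<Sum>m\<in>{M..<2*M}. ?F n m) + (\<Sum>n\<in>{n1..<n2 - r}. \<Sum>m\<in>{M..<2*M}. ?F n m * (expi (R n m) - 1))"
        unfolding sum.distrib[symmetric] by (intro sum.cong refl) (simp add: algebra_simps)
      then have "norm (?corr h r) \<le> C1 * exp (2 * pi) * B + 26 * B" unfolding split by (simp only:) (rule norm_triangle_mono[OF m1 m2])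
      then show ?thesis by (simp add: C2_def algebra_simps)
    qed
    have weyl: "(\<Sum>m\<in>U. (norm (\<Sum>n\<in>{N..<2*N}. z h m n))\<^sup>2) \<le> ?V" if h: "h \<in> hs" for h
    proof -
      have "(\<Sum>m\<in>U. (norm (\<Sum>n\<in>{N..<2*N}. z h m n))\<^sup>2) \<le>
        3 * real N / real Q * (real (card U) * N + 2 * (\<Sum>r\<in>{1..<Q}. norm (?corr h r)))"
        using * QN n12 by (intro weyl_differencing) (auto simp: U_def z_def split: if_splits)
      also have "\<dots> \<le> ?V"
      proof (intro mult_left_mono add_mono)
        have "(\<Sum>r\<in>{1..<Q}. norm (?corr h r)) \<le> real (card {1..<Q}) * (C2 * B)" using D[OF h] by (intro sum_bounded_above) auto
        also have "\<dots> \<le> Q * (C2 * B)" using C2 NB by (intro mult_right_mono) auto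
        finally show "(\<Sum>r\<in>{1..<Q}. norm (?corr h r)) \<le> Q * (C2 * B)" .
      qed (auto simp: U_def)
      finally show ?thesis .
    qed
    define T where "T h m = norm (\<Sum>n\<in>{N..<2*N}. z h m n)" for h m
    define X where "X = (\<Sum>h\<in>hs. norm (\<Sum>m\<in>{M..<2*M}. a m * (?t h m)))"
    have X0: "0 \<le> X" unfolding X_def by (intro sum_nonneg) auto
    have "X \<le> (\<Sum>h\<in>hs. \<Sum>m\<in>U. T h m)" unfolding X_def T_def zsum U_def
    proof (intro sum_mono sum_norm_le)
      fix h m
      show "norm (a m * (?t h m)) \<le> norm (?t h m)" unfolding norm_mult using mult_right_mono[OF a[of m]] by (metis mult_1 norm_ge_zero)
    qed
    then have "X\<^sup>2 \<le> (\<Sum>h\<in>hs. \<Sum>m\<in>U. T h m)\<^sup>2" using X0 by (intro power_mono) auto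
    also have "\<dots> = (\<Sum>i\<in>hs \<times> U. T (fst i) (snd i))\<^sup>2" by (simp add: sum.cartesian_product split_def)
    also have "\<dots> \<le> (\<Sum>i\<in>hs \<times> U. (T (fst i) (snd i))\<^sup>2) * real (card (hs \<times> U))" by (rule sum_squared_le_sum_of_squares)
    also have "(\<Sum>i\<in>hs \<times> U. (T (fst i) (snd i))\<^sup>2) = (\<Sum>h\<in>hs. \<Sum>m\<in>U. (T h m)\<^sup>2)" by (simp add: sum.cartesian_product split_def)
    also have "(\<Sum>h\<in>hs. \<Sum>m\<in>U. (T h m)\<^sup>2) * real (card (hs \<times> U)) \<le> ((2 * H) * ?V) * ((2 * H) * M)"
    proof (rule mult_mono)
      have c: "real (card hs) \<le> 2 * H" by (rule card_frequencies_le[OF *(1) hs])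
      then show "real (card (hs \<times> U)) \<le> (2 * H) * M" by (simp add: card_cartesian_product U_def mult_right_mono)
      have "(\<Sum>h\<in>hs. \<Sum>m\<in>U. (T h m)\<^sup>2) \<le> real (card hs) * ?V" unfolding T_def using weyl by (intro sum_bounded_above) auto
      also have "\<dots> \<le> (2 * H) * ?V" using c C2 NB by (intro mult_right_mono) auto
      finally show "(\<Sum>h\<in>hs. \<Sum>m\<in>U. (T h m)\<^sup>2) \<le> (2 * H) * ?V" .
    qed (use C2 NB * in auto)
    also have "\<dots> = 12 * ((H * M * N)\<^sup>2 / Q) + 24 * C2 * (H\<^sup>2 * M * N * B)" using * by (simp add: power2_eq_square field_simps)
    also have "\<dots> \<le> (12 + 24 * C2) * ((H * M * N)\<^sup>2 / Q + H\<^sup>2 * M * N * B)"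
    proof -
      have "0 \<le> (H * M * N)\<^sup>2 / Q" "0 \<le> H\<^sup>2 * M * N * B" using NB * by auto
      then have "0 \<le> 24 * C2 * ((H * M * N)\<^sup>2 / Q)" "0 \<le> 12 * (H\<^sup>2 * M * N * B)" using C2 by auto
      then show ?thesis unfolding distrib_left distrib_right by linarith
    qed
    finally show "X\<^sup>2 \<le> (12 + 24 * C2) * ((H * M * N)\<^sup>2 / Q + H\<^sup>2 * M * N * B)" .
  qed
qed
qed

section \<open>The Heath-Brown identity\<close>

definition moebius_mu :: "nat \<Rightarrow> complex" where
  "moebius_mu n = (if squarefree n then (-1) ^ card (prime_factors n) else 0)"

lemma norm_moebius_le: "norm (moebius_mu n) \<le> 1" by (simp add: moebius_mu_def norm_power)

lemma moebius_prime_mult: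
  assumes "prime p" "\<not> p dvd d" "0 < d"
  shows "moebius_mu (p * d) = - moebius_mu d"
proof -
  have "coprime p d" using assms prime_imp_coprime by blast
  then have "squarefree (p * d) \<longleftrightarrow> squarefree d" using squarefree_mult_coprime[of p d] squarefree_prime[OF assms(1)] squarefree_multD[of p d] by blast
  moreover have "prime_factors (p * d) = insert p (prime_factors d)" using assms by (subst prime_factors_product) (auto simp: prime_prime_factors)
  moreover have "p \<notin> prime_factors d" using assms(2) by auto
  ultimately show ?thesis by (simp add: moebius_mu_def)
qed

text \<open>Divisors that are not squarefree contribute 0; for a prime p dividing n the others
  cancel in pairs d, p * d.\<close>

lemma sum_moebius:
  assumes "0 < n"
  shows "(\<Sum>d | d dvd n. moebius_mu d) = (if n = 1 then 1 else 0)"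
proof (cases "n = 1")
  case True
  then show ?thesis by (simp add: moebius_mu_def)
next
  case False
  then obtain p where p: "prime p" "p dvd n" using prime_factor_nat by blast
  define A where "A = {d. d dvd n \<and> squarefree d \<and> \<not> p dvd d}"
  define B where "B = {d. d dvd n \<and> squarefree d \<and> p dvd d}"
  have fin: "finite A" "finite B" using assms by (auto simp: A_def B_def)
  have pos: "0 < d" if "d dvd n" for d using that assms by (metis dvd_0_left gr0I)
  have "B = (*) p ` A"
  proof (intro equalityI subsetI)
    fix d assume d: "d \<in> B"
    then obtain c where c: "d = p * c" by (auto simp: B_def)
    have "\<not> p dvd c"
    proof
      assume "p dvd c"
      then have "p\<^sup>2 dvd d" unfolding c power2_eq_square by (simp add: mult_dvd_mono)
      then show False using d p by (auto simp: B_def dest: squarefreeD)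
    qed
    moreover have "c dvd n" "squarefree c" using d by (auto simp: B_def c intro: dvd_trans dest: squarefree_multD dvd_mult_right)
    ultimately show "d \<in> (*) p ` A" by (auto simp: A_def c)
  next
    fix d assume "d \<in> (*) p ` A"
    then obtain c where c: "d = p * c" "c dvd n" "squarefree c" "\<not> p dvd c" by (auto simp: A_def)
    have cop: "coprime p c" using p c prime_imp_coprime by blast
    then have "p * c dvd n" using p c by (simp add: divides_mult)
    moreover have "squarefree (p * c)" using cop c squarefree_prime[OF p(1)] by (simp add: squarefree_mult_coprime)
    ultimately show "d \<in> B" by (simp add: B_def c)
  qed
  then have "sum moebius_mu B = (\<Sum>d\<in>A. moebius_mu (p * d))"
    proof -
    have "inj_on ((*) p) A" using p by (auto simp: inj_on_def prime_gt_0_nat)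
    moreover assume "B = (*) p ` A"
    ultimately show ?thesis by (simp add: sum.reindex)
  qed
  also have "\<dots> = (\<Sum>d\<in>A. - moebius_mu d)" using p pos by (intro sum.cong moebius_prime_mult) (auto simp: A_def)
  finally have AB: "sum moebius_mu A + sum moebius_mu B = 0" by (simp add: sum_negf)
  have "(\<Sum>d | d dvd n. moebius_mu d) = sum moebius_mu (A \<union> B)" using assms by (intro sum.mono_neutral_right) (auto simp: A_def B_def moebius_mu_def)
  also have "\<dots> = sum moebius_mu A + sum moebius_mu B" using fin by (intro sum.union_disjoint) (auto simp: A_def B_def)
  finally show ?thesis using AB False by simp
qed

text \<open>Arithmetic functions act as operators on test functions. Their composition is Dirichlet
  convolution as long as the test function vanishes beyond X, so that Heath-Brown's identity becomes
  an algebraic identity between operators.\<close>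

definition dop :: "nat \<Rightarrow> (nat \<Rightarrow> complex) \<Rightarrow> (nat \<Rightarrow> complex) \<Rightarrow> nat \<Rightarrow> complex" where
  "dop X f F k = (\<Sum>n\<in>{1..X}. f n * F (n * k))"

definition lsum :: "nat \<Rightarrow> (nat \<Rightarrow> complex) list \<Rightarrow> (nat \<Rightarrow> complex) \<Rightarrow> complex" where
  "lsum X fs F = foldr (dop X) fs F 1"

lemma foldr_dop_scale: "foldr (dop X) fs (\<lambda>k. F (m * k)) k = foldr (dop X) fs F (m * k)"
proof (induction fs arbitrary: k)
  case (Cons f fs)
  then show ?case by (simp add: dop_def mult.left_commute)
qed simp

lemma lsum_Nil [simp]: "lsum X [] F = F 1" by (simp add: lsum_def)

lemma lsum_Cons: "lsum X (f # fs) F = (\<Sum>n\<in>{1..X}. f n * lsum X fs (\<lambda>k. F (n * k)))" by (simp add: lsum_def dop_def foldr_dop_scale)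

lemma dop_diff: "dop X f (\<lambda>k. F k - G k) = (\<lambda>k. dop X f F k - dop X f G k)" by (simp add: dop_def[abs_def] right_diff_distrib sum_subtractf)

lemma dop_supported: "(\<And>k. X < k \<Longrightarrow> F k = 0) \<Longrightarrow> X < k \<Longrightarrow> dop X f F k = 0" unfolding dop_def
proof (intro sum.neutral ballI)
  fix n assume F: "\<And>k. X < k \<Longrightarrow> F k = 0" and "X < k" and n: "n \<in> {1..X}"
  then have "1 * k \<le> n * k" by (intro mult_le_mono1) auto
  then have "X < n * k" using \<open>X < k\<close> by linarith
  then show "f n * F (n * k) = 0" by (simp add: F)
qed

lemma dop_dop:
  assumes F: "\<And>k. X < k \<Longrightarrow> F k = 0" and "0 < k"
  shows "dop X f (dop X g F) k = (\<Sum>N\<in>{1..X}. (\<Sum>d | d dvd N. f d * g (N div d)) * F (N * k))"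
proof -
  define P where "P = {p \<in> {1..X} \<times> {1..X}. fst p * snd p \<le> X}"
  define t where "t p = f (fst p) * g (snd p) * F (fst p * snd p * k)" for p
  have finP: "finite P" by (simp add: P_def)
  have "dop X f (dop X g F) k = (\<Sum>p\<in>{1..X} \<times> {1..X}. t p)" by (simp add: dop_def sum_distrib_left sum.cartesian_product t_def split_def mult_ac)
  also have "\<dots> = sum t P"
  proof (rule sum.mono_neutral_right)
    show "\<forall>p\<in>{1..X} \<times> {1..X} - P. t p = 0"
    proof
      fix p assume "p \<in> {1..X} \<times> {1..X} - P"
      then have "X < fst p * snd p" by (auto simp: P_def)
      then have "X < fst p * snd p * k" using assms(2) by (metis less_le_trans mult_le_mono2 mult.right_neutral Suc_leI One_nat_def)
      then show "t p = 0" by (simp add: t_def F)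
    qed
  qed (auto simp: P_def)
  also have "\<dots> = (\<Sum>N\<in>{1..X}. sum t {p\<in>P. fst p * snd p = N})" using finP by (intro sum.group[symmetric]) (auto simp: P_def Suc_le_eq)
  also have "\<dots> = (\<Sum>N\<in>{1..X}. (\<Sum>d | d dvd N. f d * g (N div d)) * F (N * k))"
  proof (rule sum.cong[OF refl])
    fix N assume N: "N \<in> {1..X}"
    have "sum t {p\<in>P. fst p * snd p = N} = (\<Sum>d | d dvd N. f d * g (N div d) * F (N * k))"
    proof (rule sum.reindex_bij_witness[of _ "\<lambda>d. (d, N div d)" fst])
      fix d assume "d \<in> {d. d dvd N}"
      then have d: "d dvd N" by simp
      have "0 < d" "d \<le> N" "0 < N div d" "N div d \<le> N" using d N by (auto intro: dvd_imp_le dvd_pos_nat simp: div_greater_zero_iff)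
      then show "(d, N div d) \<in> {p\<in>P. fst p * snd p = N}" using d N div_le_dividend[of N d] by (auto simp: P_def simp del: div_le_dividend)
    qed (auto simp: P_def t_def)
    then show "sum t {p\<in>P. fst p * snd p = N} = (\<Sum>d | d dvd N. f d * g (N div d)) * F (N * k)" by (simp add: sum_distrib_right)
  qed
  finally show ?thesis .
qed

lemma dop_mangoldt_1:
  assumes F: "\<And>k. X < k \<Longrightarrow> F k = 0"
  shows "dop X mangoldt (dop X (\<lambda>_. 1) F) 1 = dop X (\<lambda>n. of_real (ln (real n))) F 1"
proof -
  have "dop X mangoldt (dop X (\<lambda>_. 1) F) 1 = (\<Sum>N\<in>{1..X}. (\<Sum>d | d dvd N. mangoldt d * 1) * F (N * 1))" by (rule dop_dop[OF F]) auto
  also have "\<dots> = dop X (\<lambda>n. of_real (ln (real n))) F 1" unfolding dop_def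
  proof (rule sum.cong[OF refl])
    fix N assume "N \<in> {1..X}"
    then have "(\<Sum>d | d dvd N. mangoldt d * 1) = (of_real (ln (real N)) :: complex)" by (simp add: mangoldt_sum)
    then show "(\<Sum>d | d dvd N. mangoldt d * 1) * F (N * 1) = of_real (ln (real N)) * F (N * 1)" by (simp only:)
  qed
  finally show ?thesis .
qed

definition moebius_upto :: "nat \<Rightarrow> nat \<Rightarrow> complex" where
  "moebius_upto z n = (if n \<le> z then moebius_mu n else 0)"

text \<open>Truncated at \<open>z\<close>, the Moebius function still inverts the constant 1 at all
  N \<le> z, and for N > z the argument N * k lies beyond the support of F. So the support bound X /
  w shrinks to X / (w (z + 1)).\<close>

lemma dop_moebius_supported:
  assumes F: "\<And>k. 0 < k \<Longrightarrow> X < k * w \<Longrightarrow> F k = 0" and w: "0 < w" and z: "0 < z" and k: "0 < k" "X < k * (w * (z + 1))"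
  shows "F k - dop X (\<lambda>_. 1) (dop X (moebius_upto z) F) k = 0"
proof -
  have F0: "F k = 0" if "X < k" for k
  proof -
    have "k * 1 \<le> k * w" using w by (intro mult_le_mono2) auto
    then have "X < k * w" using that by linarith
    moreover have "0 < k" using that by simp
    ultimately show ?thesis by (rule F[rotated])
  qed
  have "dop X (\<lambda>_. 1) (dop X (moebius_upto z) F) k = (\<Sum>N\<in>{1..X}. (\<Sum>d | d dvd N. 1 * moebius_upto z (N div d)) * F (N * k))" by (rule dop_dop[OF F0 k(1)])
  also have "\<dots> = (\<Sum>N\<in>{1..X}. if N = 1 then F (N * k) else 0)"
  proof (rule sum.cong[OF refl])
    fix N assume N: "N \<in> {1..X}"
    show "(\<Sum>d | d dvd N. 1 * moebius_upto z (N div d)) * F (N * k) = (if N = 1 then F (N * k) else 0)"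
    proof (cases "N \<le> z")
      case True
      have "(\<Sum>d | d dvd N. 1 * moebius_upto z (N div d)) = (\<Sum>d | d dvd N. moebius_upto z d)"
        using N by (intro sum.reindex_bij_witness[of _ "\<lambda>d. N div d" "\<lambda>d. N div d"]) (auto elim!: dvdE)
      also have "\<dots> = (\<Sum>d | d dvd N. moebius_mu d)" using N True by (intro sum.cong) (auto simp: moebius_upto_def dest!: dvd_imp_le)
      finally show ?thesis using sum_moebius[of N] N by simp
    next
      case False
      then have "k * w * (z + 1) \<le> k * w * N" by (intro mult_le_mono2) auto
      moreover have "k * (w * (z + 1)) = k * w * (z + 1)" "k * w * N = N * k * w" by (simp_all only: mult_ac)
      ultimately have "X < N * k * w" using k(2) by linarith
      then have "F (N * k) = 0" using N k by (intro F) auto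
      then show ?thesis using False z by simp
    qed
  qed
  also have "\<dots> = F k"
  proof (cases "1 \<le> X")
    case True
    then show ?thesis by (simp add: sum.delta)
  next
    case False
    then show ?thesis using F0[of k] k by simp
  qed
  finally show ?thesis by simp
qed

text \<open>Let U be convolution with 1 and with the truncated Moebius function. Three applications
  of F \<mapsto> F - U F annihilate F, as the support shrinks by z + 1 each time and X < (z + 1)^3.
  Expanding the cube against the von Mangoldt function, whose convolution with 1 is the logarithm,
  gives the three terms.\<close>

theorem heath_brown:
  assumes F: "\<And>k. X < k \<Longrightarrow> F k = 0" and z: "0 < z" "X < (z + 1) ^ 3"
  defines "L \<equiv> (\<lambda>n. of_real (ln (real n)))" and "o' \<equiv> moebius_upto z" and "e \<equiv> (\<lambda>_. 1)"
  shows "(\<Sum>n\<in>{1..X}. mangoldt n * F n)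
    = 3 * lsum X [L, o'] F - 3 * lsum X [L, o', e, o'] F + lsum X [L, o', e, o', e, o'] F"
proof -
  define U where "U G = dop X e (dop X o' G)" for G
  define E where "E G k = G k - U G k" for G :: "nat \<Rightarrow> complex" and k
  have U: "U (\<lambda>k. G k - H k) = (\<lambda>k. U G k - U H k)" for G H by (simp add: U_def dop_diff)
  have s: "E G k = 0" if "\<And>k. 0 < k \<Longrightarrow> X < k * w \<Longrightarrow> G k = 0" "0 < w" "0 < k" "X < k * (w * (z + 1))" for G w k
    unfolding E_def U_def e_def o'_def using dop_moebius_supported[OF that(1,2) z(1) that(3,4)] .
  have E1: "E F k = 0" if "0 < k" "X < k * (1 * (z + 1))" for k using that F by (intro s[of 1]) auto
  have E2: "E (E F) k = 0" if "0 < k" "X < k * (1 * (z + 1) * (z + 1))" for k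
  proof (rule s[of "1 * (z + 1)"])
    show "X < k * (1 * (z + 1) * (z + 1))" by (rule that)
    show "E F j = 0" if "0 < j" "X < j * (1 * (z + 1))" for j using that by (rule E1)
  qed (use that in auto)
  have E3: "E (E (E F)) k = 0" if "0 < k" for k
  proof (rule s[of "1 * (z + 1) * (z + 1)"])
    have "(z + 1) ^ 3 * 1 \<le> (z + 1) ^ 3 * k" using that by (intro mult_le_mono2) auto
    then have "X < (z + 1) ^ 3 * k" using z(2) by linarith
    then show "X < k * (1 * (z + 1) * (z + 1) * (z + 1))" by (simp only: power3_eq_cube mult_1 mult_ac)
  qed (use that E2 in auto)
  have expand: "E (E (E F)) k = F k - 3 * U F k + 3 * U (U F) k - U (U (U F)) k" for k
  proof -
    have E: "E G = (\<lambda>k. G k - U G k)" for G by (rule ext) (rule E_def)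
    show ?thesis unfolding E U by simp
  qed
  have "(\<Sum>n\<in>{1..X}. mangoldt n * E (E (E F)) n) = 0" by (intro sum.neutral) (auto simp: E3)
  then have "(\<Sum>n\<in>{1..X}. mangoldt n * F n) - 3 * (\<Sum>n\<in>{1..X}. mangoldt n * U F n)
     + 3 * (\<Sum>n\<in>{1..X}. mangoldt n * U (U F) n) - (\<Sum>n\<in>{1..X}. mangoldt n * U (U (U F)) n) = 0"
    unfolding expand by (simp add: sum_distrib_left sum.distrib sum_subtractf algebra_simps)
  moreover have VU: "(\<Sum>n\<in>{1..X}. mangoldt n * U G n) = dop X L (dop X o' G) 1" if "\<And>k. X < k \<Longrightarrow> G k = 0" for G
    using dop_mangoldt_1[of X "dop X o' G"] dop_supported[of X G] that by (simp add: U_def L_def e_def dop_def[of X mangoldt])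
  moreover have "U F k = 0" if "X < k" for k unfolding U_def using F that by (intro dop_supported) auto
  moreover from this have "U (U F) k = 0" if "X < k" for k unfolding U_def[of "U F"] using that by (intro dop_supported) auto
  ultimately have "(\<Sum>n\<in>{1..X}. mangoldt n * F n) = 3 * dop X L (dop X o' F) 1
     - 3 * dop X L (dop X o' (U F)) 1 + dop X L (dop X o' (U (U F))) 1" using F by (simp add: algebra_simps)
  then show ?thesis by (simp add: lsum_def U_def)
qed

section \<open>The divisor bound\<close>

lemma card_divisors_prime_power_mult_le:
  fixes p m :: nat
  assumes "prime p" "0 < m"
  shows "card {d. d dvd p ^ i * m} \<le> (i + 1) * card {d. d dvd m}"
proof -
  have "{d. d dvd p ^ i * m} \<subseteq> (\<lambda>(j, d). p ^ j * d) ` ({0..i} \<times> {d. d dvd m})"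
  proof
    fix d assume "d \<in> {d. d dvd p ^ i * m}"
    then obtain a b where ab: "d = a * b" "a dvd p ^ i" "b dvd m" using dvd_productE[of d "p ^ i" m] by (metis mem_Collect_eq)
    then obtain j where "j \<le> i" "a = p ^ j" using divides_primepow_nat[OF assms(1)] by blast
    then show "d \<in> (\<lambda>(j, d). p ^ j * d) ` ({0..i} \<times> {d. d dvd m})" using ab by force
  qed
  then have "card {d. d dvd p ^ i * m} \<le> card ((\<lambda>(j, d). p ^ j * d) ` ({0..i} \<times> {d. d dvd m}))"
    using finite_divisors_nat[OF assms(2)] by (intro card_mono finite_imageI finite_cartesian_product) auto
  also have "\<dots> \<le> card ({0..i} \<times> {d. d dvd m})" using finite_divisors_nat[OF assms(2)] by (intro card_image_le finite_cartesian_product) auto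
  finally show ?thesis by (simp add: card_cartesian_product)
qed

text \<open>The divisor function is compared with n^\<epsilon> prime by prime: i + 1 \<le> p^(i
  \<epsilon>) once p^\<epsilon> \<ge> 2, and for each prime below Z a factor K repairs the
  inequality. There are at most Z such primes, so K^Z serves as the constant.\<close>

theorem divisor_bound:
  fixes \<epsilon> :: real
  assumes "0 < \<epsilon>"
  obtains C where "1 \<le> C" "\<And>n. 0 < n \<Longrightarrow> real (card {d. d dvd n}) \<le> C * real n powr \<epsilon>"
proof -
  \<comment> \<open>This value makes i + 1 \<le> K * 2^(i \<epsilon>) follow from t \<le> exp t at t
    = i \<epsilon> ln 2.\<close>
  define K where "K = 1 + 1 / (\<epsilon> * ln 2)"
  have K: "1 \<le> K" using assms by (simp add: K_def)
  define Z where "Z = nat \<lceil>2 powr (1 / \<epsilon>)\<rceil>"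
  have small: "real i + 1 \<le> K * real p powr (i * \<epsilon>)" if "prime p" for p i
  proof -
    have p: "2 \<le> real p" using prime_ge_2_nat[OF that] by simp
    have "i * \<epsilon> * ln 2 \<le> exp (i * \<epsilon> * ln 2)" using exp_ge_add_one_self[of "i * \<epsilon> * ln 2"] by linarith
    then have "real i \<le> 1 / (\<epsilon> * ln 2) * exp (i * \<epsilon> * ln 2)" using assms by (simp add: field_simps)
    moreover have "1 \<le> exp (i * \<epsilon> * ln 2)" using assms by simp
    ultimately have "real i + 1 \<le> K * exp (i * \<epsilon> * ln 2)" unfolding K_def distrib_right by linarith
    also have "exp (i * \<epsilon> * ln 2) = 2 powr (i * \<epsilon>)" by (simp add: powr_def)
    also have "\<dots> \<le> real p powr (i * \<epsilon>)" using p assms by (intro powr_mono2) auto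
    finally show ?thesis using K by simp
  qed
  have large: "real i + 1 \<le> real p powr (i * \<epsilon>)" if "Z \<le> p" for p i
  proof -
    have "2 powr (1 / \<epsilon>) \<le> real p" using that by (simp add: Z_def nat_le_iff ceiling_le_iff)
    then have "(2 powr (1 / \<epsilon>)) powr (i * \<epsilon>) \<le> real p powr (i * \<epsilon>)" using assms by (intro powr_mono2) auto
    moreover have "(2 powr (1 / \<epsilon>)) powr (i * \<epsilon>) = 2 ^ i" using assms by (simp add: powr_powr powr_realpow)
    moreover have "real i + 1 \<le> 2 ^ i" using Bernoulli_inequality[of "1::real" i] by simp
    ultimately show ?thesis by linarith
  qed
  have main: "real (card {d. d dvd n}) \<le> K ^ card {p\<in>prime_factors n. p < Z} * real n powr \<epsilon>" if "0 < n" for n using that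
  proof (induction n rule: less_induct)
    case (less n)
    show ?case
    proof (cases "n = 1")
      case False
      then obtain p where p: "prime p" "p dvd n" using prime_factor_nat by blast
      define i where "i = multiplicity p n"
      have "n \<noteq> 0" "\<not> is_unit p" using less.prems p by (auto simp: not_prime_unit)
      then obtain m where m: "n = p ^ i * m" "\<not> p dvd m" unfolding i_def by (rule multiplicity_decompose')
      have i: "0 < i" using p m by (intro gr0I) auto
      have m0: "0 < m" using m less.prems by (intro gr0I) auto
      have "1 < p ^ i" using one_less_power[OF prime_gt_1_nat[OF p(1)] i] .
      then have "m < n" using m m0 by simp
      have pf: "prime_factors n = insert p (prime_factors m)" unfolding m(1) using m0 p i prime_gt_0_nat[OF p(1)]
        by (subst prime_factors_product) (auto simp: prime_factorization_prime_power)
      have pnot: "p \<notin> prime_factors m" using m(2) by auto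
      have IH: "real (card {d. d dvd m}) \<le> K ^ card {p\<in>prime_factors m. p < Z} * real m powr \<epsilon>" by (rule less.IH[OF \<open>m < n\<close> m0])
      have "real (card {d. d dvd n}) \<le> real ((i + 1) * card {d. d dvd m})" unfolding m(1) using card_divisors_prime_power_mult_le[OF p(1) m0, of i] by (rule of_nat_mono)
      also have "\<dots> = (real i + 1) * real (card {d. d dvd m})" by (simp add: distrib_right)
      also have "\<dots> \<le> (real i + 1) * (K ^ card {p\<in>prime_factors m. p < Z} * real m powr \<epsilon>)" using IH by (intro mult_left_mono) auto
      also have "\<dots> \<le> K ^ card {p\<in>prime_factors n. p < Z} * real n powr \<epsilon>"
      proof -
        have np: "real n powr \<epsilon> = real p powr (i * \<epsilon>) * real m powr \<epsilon>"
          unfolding m(1) using prime_gt_0_nat[OF p(1)] by (simp add: powr_mult powr_realpow[symmetric] powr_powr)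
        show ?thesis
        proof (cases "p < Z")
          case True
          then have "{q\<in>prime_factors n. q < Z} = insert p {q\<in>prime_factors m. q < Z}" using pf by auto
          then have "K ^ card {q\<in>prime_factors n. q < Z} = K * K ^ card {q\<in>prime_factors m. q < Z}" using pnot by simp
          then show ?thesis unfolding np using mult_right_mono[OF small[OF p(1), of i], of "K ^ card {q\<in>prime_factors m. q < Z} * real m powr \<epsilon>"] K
            by (simp add: mult_ac)
        next
          case False
          then have "{q\<in>prime_factors n. q < Z} = {q\<in>prime_factors m. q < Z}" using pf by auto
          then show ?thesis unfolding np using mult_right_mono[OF large[of p i], of "K ^ card {q\<in>prime_factors m. q < Z} * real m powr \<epsilon>"] K False
            by (simp add: mult_ac)
        qed
      qed
      finally show ?thesis .
    qed simp
  qed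
  show ?thesis
  proof (rule that[of "K ^ Z"])
    show "1 \<le> K ^ Z" using K by (rule one_le_power)
    fix n :: nat assume n: "0 < n"
    have "card {p\<in>prime_factors n. p < Z} \<le> card {..<Z}" by (intro card_mono) auto
    then have "K ^ card {p\<in>prime_factors n. p < Z} \<le> K ^ Z" using K by (intro power_increasing) auto
    then show "real (card {d. d dvd n}) \<le> K ^ Z * real n powr \<epsilon>" using main[OF n] by (meson mult_right_mono order_trans powr_ge_zero)
  qed
qed

section \<open>Multilinear sums and dyadic pieces\<close>

lemma lsum_linear:
  assumes "finite A"
  shows "lsum X fs (\<lambda>k. \<Sum>i\<in>A. c i * F i k) = (\<Sum>i\<in>A. c i * lsum X fs (F i))"
proof (induction fs arbitrary: F)
  case (Cons f fs)
  have "lsum X (f # fs) (\<lambda>k. \<Sum>i\<in>A. c i * F i k) = (\<Sum>n\<in>{1..X}. \<Sum>i\<in>A. f n * (c i * lsum X fs (\<lambda>k. F i (n * k))))"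
    unfolding lsum_Cons Cons.IH[of "\<lambda>i k. F i (_ * k)"] sum_distrib_left ..
  also have "\<dots> = (\<Sum>i\<in>A. c i * (\<Sum>n\<in>{1..X}. f n * lsum X fs (\<lambda>k. F i (n * k))))" by (subst sum.swap) (simp add: sum_distrib_left mult_ac)
  finally show ?case by (simp add: lsum_Cons)
qed simp

text \<open>Grouping of variables: those at positions in T form one product k, the others a second
  product m. The freedom in T is what \<open>exponent_splitting\<close> exploits.\<close>

lemma lsum_split:
  "lsum X cs F = lsum X (nths cs T) (\<lambda>k. lsum X (nths cs (- T)) (\<lambda>m. F (k * m)))"
proof (induction cs arbitrary: T F)
  case (Cons c cs)
  define T' where "T' = {j. Suc j \<in> T}"
  have mT: "{j. Suc j \<in> - T} = - T'" "{j. Suc j \<notin> T} = - T'" by (auto simp: T'_def)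
  show ?case
  proof (cases "0 \<in> T")
    case True
    have "lsum X (c # cs) F = (\<Sum>n\<in>{1..X}. c n * lsum X (nths cs T') (\<lambda>k. lsum X (nths cs (- T')) (\<lambda>m. F (n * (k * m)))))"
      unfolding lsum_Cons Cons.IH[of "\<lambda>k. F (_ * k)" T'] ..
    then show ?thesis using True by (simp add: nths_Cons mT T'_def[symmetric] lsum_Cons mult.assoc)
  next
    case False
    have "lsum X (c # cs) F = (\<Sum>n\<in>{1..X}. c n * lsum X (nths cs T') (\<lambda>k. lsum X (nths cs (- T')) (\<lambda>m. F (n * (k * m)))))"
      unfolding lsum_Cons Cons.IH[of "\<lambda>k. F (_ * k)" T'] ..
    also have "\<dots> = lsum X (nths cs T') (\<lambda>k. \<Sum>n\<in>{1..X}. c n * lsum X (nths cs (- T')) (\<lambda>m. F (n * (k * m))))" by (rule lsum_linear[symmetric]) simp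
    finally show ?thesis using False by (simp add: nths_Cons mT T'_def[symmetric] lsum_Cons mult.left_commute)
  qed
qed (simp)

definition supported_at :: "nat \<Rightarrow> (nat \<Rightarrow> complex) \<Rightarrow> bool" where
  "supported_at j g \<longleftrightarrow> (\<forall>n. norm (g n) \<le> 1 \<and> (g n \<noteq> 0 \<longrightarrow> 2 ^ j \<le> n \<and> n < 2 ^ Suc j))"

text \<open>Testing with the indicator of n reads off the value at n of the Dirichlet convolution of
  the list, each factor restricted to 1, ..., X.\<close>

definition coef :: "nat \<Rightarrow> (nat \<Rightarrow> complex) list \<Rightarrow> nat \<Rightarrow> complex" where
  "coef X gs n = lsum X gs (\<lambda>k. if k = n then 1 else 0)"

text \<open>A product with one factor from each block lies in [2^S, 2^(S + r)), where S is the sum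
  of the r block exponents. The separate alternative is the empty product 1, which violates the
  strict upper bound 2^0.\<close>

lemma lsum_cong_supported:
  assumes "list_all2 supported_at js gs"
    and "\<And>k. 2 ^ sum_list js \<le> k \<Longrightarrow> k < 2 ^ (sum_list js + length js) \<or> js = [] \<and> k = 1 \<Longrightarrow> F k = G k"
  shows "lsum X gs F = lsum X gs G" using assms
proof (induction js gs arbitrary: F G rule: list_all2_induct)
  case (Cons j js g gs)
  have "lsum X gs (\<lambda>k. F (n * k)) = lsum X gs (\<lambda>k. G (n * k))" if n: "2 ^ j \<le> n" "n < 2 ^ Suc j" for n
  proof (rule Cons.IH)
    fix k :: nat assume k: "2 ^ sum_list js \<le> k" "k < 2 ^ (sum_list js + length js) \<or> js = [] \<and> k = 1"
    have "2 ^ j * 2 ^ sum_list js \<le> n * k" using n k by (intro mult_mono) auto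
    moreover have "n * k < 2 ^ Suc j * 2 ^ (sum_list js + length js)" using k(2)
    proof
      assume "k < 2 ^ (sum_list js + length js)"
      then show ?thesis using n by (intro mult_strict_mono) auto
    next
      assume "js = [] \<and> k = 1"
      then show ?thesis using n by simp
    qed
    ultimately show "F (n * k) = G (n * k)" by (intro Cons.prems) (auto simp: power_add mult_ac)
  qed
  then have "g n * lsum X gs (\<lambda>k. F (n * k)) = g n * lsum X gs (\<lambda>k. G (n * k))" for n using Cons.hyps(1) by (cases "g n = 0") (auto simp: supported_at_def)
  then show ?case by (simp only: lsum_Cons)
qed simp

text \<open>The additional 1 in the upper exponent makes room for the empty product, so that no case
  distinction is left.\<close>

lemma lsum_eq_coef:
  assumes "list_all2 supported_at js gs"
  shows "lsum X gs F = (\<Sum>n\<in>{2 ^ sum_list js..<2 ^ (sum_list js + length js + 1)}. coef X gs n * F n)"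
proof -
  let ?A = "{2 ^ sum_list js..<2 ^ (sum_list js + length js + 1)}"
  have "lsum X gs F = lsum X gs (\<lambda>k. \<Sum>n\<in>?A. F n * (if k = n then 1 else 0))"
  proof (rule lsum_cong_supported[OF assms])
    fix k :: nat assume k: "2 ^ sum_list js \<le> k" "k < 2 ^ (sum_list js + length js) \<or> js = [] \<and> k = 1"
    then have "k \<in> ?A" by auto
    then show "F k = (\<Sum>n\<in>?A. F n * (if k = n then 1 else 0))" by (simp add: sum.delta if_distrib cong: if_cong)
  qed
  also have "\<dots> = (\<Sum>n\<in>?A. F n * lsum X gs (\<lambda>k. if k = n then 1 else 0))" by (rule lsum_linear) simp
  finally show ?thesis by (simp add: coef_def mult.commute)
qed

text \<open>Every factor in a representation of n is a divisor of n, which leaves at most the number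
  of divisors as choices in each slot.\<close>

lemma norm_coef_le:
  assumes "list_all2 supported_at js gs" "0 < n"
  shows "norm (coef X gs n) \<le> real (card {d. d dvd n}) ^ length gs" using assms
proof (induction js gs arbitrary: n rule: list_all2_induct)
  case Nil
  then show ?case by (simp add: coef_def)
next
  case (Cons j js g gs)
  define D where "D = {d. d dvd n}"
  have D: "finite D" "1 \<in> D" using Cons.prems by (auto simp: D_def)
  have "coef X (g # gs) n = (\<Sum>m\<in>{1..X}. g m * lsum X gs (\<lambda>k. if m * k = n then 1 else 0))" by (simp add: coef_def lsum_Cons)
  also have "\<dots> = (\<Sum>m\<in>{1..X} \<inter> D. g m * coef X gs (n div m))"
  proof (rule sum.mono_neutral_cong_right)
    show "\<forall>i\<in>{1..X} - {1..X} \<inter> D. g i * lsum X gs (\<lambda>k. if i * k = n then 1 else 0) = 0"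
    proof
      fix i assume "i \<in> {1..X} - {1..X} \<inter> D"
      then have "(\<lambda>k. if i * k = n then 1 else 0 :: complex) = (\<lambda>k. \<Sum>i\<in>({}::nat set). 1 * 0)" by (force simp: D_def)
      then show "g i * lsum X gs (\<lambda>k. if i * k = n then 1 else 0) = 0" using lsum_linear[of "{}::nat set" X gs "\<lambda>_. 1" "\<lambda>_ _. 0"] by simp
    qed
    show "g x * lsum X gs (\<lambda>k. if x * k = n then 1 else 0) = g x * coef X gs (n div x)" if "x \<in> {1..X} \<inter> D" for x
    proof -
      have "x * k = n \<longleftrightarrow> k = n div x" for k using that by (auto simp: D_def elim!: dvdE)
      then show ?thesis by (simp add: coef_def)
    qed
  qed auto
  also have "norm \<dots> \<le> (\<Sum>m\<in>{1..X} \<inter> D. real (card D) ^ length gs)"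
  proof (rule sum_norm_le)
    fix m assume m: "m \<in> {1..X} \<inter> D"
    then have nm: "0 < n div m" "n div m dvd n" using Cons.prems by (auto simp: D_def div_greater_zero_iff dvd_imp_le)
    have "norm (g m) \<le> 1" using Cons.hyps(1) by (simp add: supported_at_def)
    then have "norm (g m * coef X gs (n div m)) \<le> 1 * real (card {d. d dvd n div m}) ^ length gs" unfolding norm_mult using Cons.IH[OF nm(1)] by (intro mult_mono) auto
    also have "card {d. d dvd n div m} \<le> card D" using nm D unfolding D_def by (intro card_mono) (auto intro: dvd_trans)
    then have "1 * real (card {d. d dvd n div m}) ^ length gs \<le> real (card D) ^ length gs" by (simp add: power_mono)
    finally show "norm (g m * coef X gs (n div m)) \<le> real (card D) ^ length gs" .
  qed
  also have "\<dots> = real (card ({1..X} \<inter> D)) * real (card D) ^ length gs" by simp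
  also have "\<dots> \<le> real (card D) * real (card D) ^ length gs" using D by (intro mult_right_mono) (auto intro: card_mono)
  finally show ?case by (simp add: D_def)
qed

section \<open>Sums over the frequencies h and dyadic decomposition\<close>

definition family_norm :: "nat \<Rightarrow> nat set \<Rightarrow> (nat \<Rightarrow> nat \<Rightarrow> complex) \<Rightarrow> (nat \<Rightarrow> complex) list \<Rightarrow> real" where
  "family_norm X hs \<Phi> cs = (\<Sum>h\<in>hs. norm (lsum X cs (\<Phi> h)))"

lemma lsum_slot:
  assumes "finite J" "\<And>n. n \<in> {1..X} \<Longrightarrow> c n = (\<Sum>j\<in>J. w j * d j n)"
  shows "lsum X (ps @ c # qs) F = (\<Sum>j\<in>J. w j * lsum X (ps @ d j # qs) F)"
proof (induction ps arbitrary: F)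
  case Nil
  have "lsum X (c # qs) F = (\<Sum>n\<in>{1..X}. \<Sum>j\<in>J. w j * (d j n * lsum X qs (\<lambda>k. F (n * k))))" unfolding lsum_Cons
  proof (rule sum.cong[OF refl])
    fix n assume "n \<in> {1..X}"
    then show "c n * lsum X qs (\<lambda>k. F (n * k)) = (\<Sum>j\<in>J. w j * (d j n * lsum X qs (\<lambda>k. F (n * k))))" by (simp only: assms(2) sum_distrib_right mult.assoc)
  qed
  then show ?case by (subst (asm) sum.swap) (simp add: lsum_Cons sum_distrib_left)
next
  case (Cons p ps)
  have "lsum X ((p # ps) @ c # qs) F = (\<Sum>n\<in>{1..X}. \<Sum>j\<in>J. p n * (w j * lsum X (ps @ d j # qs) (\<lambda>k. F (n * k))))"
    by (simp add: lsum_Cons Cons.IH sum_distrib_left)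
  then show ?case by (subst (asm) sum.swap) (simp add: lsum_Cons sum_distrib_left mult_ac)
qed

text \<open>Serves twice: with unit weights for the decomposition into dyadic blocks, and with the
  increments of the logarithm in \<open>family_norm_log_le\<close>.\<close>

lemma family_norm_slot:
  assumes "finite J" "\<And>n. n \<in> {1..X} \<Longrightarrow> c n = (\<Sum>j\<in>J. w j * d j n)"
    and B: "\<And>j. j \<in> J \<Longrightarrow> family_norm X hs \<Phi> (ps @ d j # qs) \<le> B"
  shows "family_norm X hs \<Phi> (ps @ c # qs) \<le> (\<Sum>j\<in>J. norm (w j)) * B"
proof -
  have "family_norm X hs \<Phi> (ps @ c # qs) \<le> (\<Sum>h\<in>hs. \<Sum>j\<in>J. norm (w j) * norm (lsum X (ps @ d j # qs) (\<Phi> h)))"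
    unfolding family_norm_def using lsum_slot[OF assms(1,2)] by (intro sum_mono) (auto intro!: sum_norm_le simp: norm_mult)
  also have "\<dots> = (\<Sum>j\<in>J. norm (w j) * family_norm X hs \<Phi> (ps @ d j # qs))" by (subst sum.swap) (simp add: family_norm_def sum_distrib_left)
  also have "\<dots> \<le> (\<Sum>j\<in>J. norm (w j) * B)" using B by (intro sum_mono mult_left_mono) auto
  finally show ?thesis by (simp add: sum_distrib_right)
qed

definition dyadic_block :: "(nat \<Rightarrow> complex) \<Rightarrow> nat \<Rightarrow> nat \<Rightarrow> complex" where
  "dyadic_block c j n = (if 2 ^ j \<le> n \<and> n < 2 ^ Suc j then c n else 0)"

lemma dyadic_block_sum:
  assumes "0 < n" "n < 2 ^ Suc L"
  shows "(\<Sum>j\<in>{..L}. dyadic_block c j n) = c n"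
proof -
  obtain i where i: "2 ^ i \<le> n" "n < 2 ^ Suc i" using assms(1) ex_power_ivl1[of 2 n] by auto
  have iL: "i \<le> L"
  proof (rule ccontr)
    assume "\<not> i \<le> L"
    then have "2 ^ Suc L \<le> (2::nat) ^ i" by (intro power_increasing) auto
    then show False using i assms by linarith
  qed
  have "j = i" if "2 ^ j \<le> n" "n < 2 ^ Suc j" for j
  proof -
    have "(2::nat) ^ j < 2 ^ Suc i" "(2::nat) ^ i < 2 ^ Suc j" using that i by linarith+
    then have "j < Suc i" "i < Suc j" by (simp_all only: power_strict_increasing_iff one_less_numeral_iff semiring_norm)
    then show ?thesis by simp
  qed
  then have "dyadic_block c j n = (if j = i then c n else 0)" for j using i unfolding dyadic_block_def by metis
  then show ?thesis using iL by simp
qed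

lemma family_norm_dyadic:
  assumes L: "X < 2 ^ Suc L"
    and B: "\<And>js. length js = length cs \<Longrightarrow> family_norm X hs \<Phi> (ps @ map2 dyadic_block cs js) \<le> B"
  shows "family_norm X hs \<Phi> (ps @ cs) \<le> (real L + 1) ^ length cs * B" using B
proof (induction cs arbitrary: ps)
  case (Cons c cs)
  have "family_norm X hs \<Phi> (ps @ c # cs) \<le> (\<Sum>j\<in>{..L}. norm (1::complex)) * ((real L + 1) ^ length cs * B)"
  proof (rule family_norm_slot[where d = "dyadic_block c"])
    show "c n = (\<Sum>j\<in>{..L}. 1 * dyadic_block c j n)" if "n \<in> {1..X}" for n using dyadic_block_sum[of n L c] that L by simp
    fix j
    have "family_norm X hs \<Phi> ((ps @ [dyadic_block c j]) @ cs) \<le> (real L + 1) ^ length cs * B"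
    proof (rule Cons.IH)
      fix js :: "nat list" assume "length js = length cs"
      then show "family_norm X hs \<Phi> ((ps @ [dyadic_block c j]) @ map2 dyadic_block cs js) \<le> B" using Cons.prems[of "j # js"] by simp
    qed
    then show "family_norm X hs \<Phi> (ps @ dyadic_block c j # cs) \<le> (real L + 1) ^ length cs * B" by simp
  qed simp
  then show ?case by (simp add: mult.assoc add.commute)
qed (use B[of "[]"] in simp)

section \<open>Finite Fourier expansion of an interval\<close>

text \<open>The discrete Fourier transform modulo Z of an interval is a geometric sum, so its
  coefficients are bounded by 1/j + 1/(Z - j) and their sum is only logarithmic in Z. An interval
  condition can thus be traded for additive characters.\<close>

lemma interval_fourier:
  fixes S :: "nat set" and Z :: nat
  assumes "2 \<le> Z" "S \<subseteq> {..<Z}" and conv: "\<And>a b c. \<lbrakk>a \<in> S; b \<in> S; a \<le> c; c \<le> b\<rbrakk> \<Longrightarrow> c \<in> S"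
  obtains c :: "nat \<Rightarrow> complex" where "(\<Sum>j<Z. norm (c j)) \<le> 3 + 2 * ln (real Z)"
    "\<And>n. n < Z \<Longrightarrow> (if n \<in> S then 1 else 0) = (\<Sum>j<Z. c j * expi (real j / Z * n))"
proof -
  have Z: "0 < real Z" using assms by simp
  have "S \<subseteq> {0..<Z}" using assms(2) by auto
  have "\<exists>p q. 0 \<le> p \<and> p \<le> q \<and> q \<le> max 0 Z \<and> S = {p..<q}" by (rule convex_nat_subset) (fact | rule conv)+
  then obtain p q where pq: "p \<le> q" "q \<le> max 0 Z" "S = {p..<q}" by blast
  then have pq: "S = {p..<q}" "p \<le> q" "q \<le> Z" by simp_all
  define c where "c j = (\<Sum>s\<in>S. expi (- (real j / Z * s))) / of_nat Z" for j
  have orth: "(\<Sum>j<Z. expi (real j / Z * n) * expi (- (real j / Z * s))) = (if n = s then of_nat Z else 0)" if "n < Z" "s < Z" for n s :: nat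
  proof -
    define t where "t = (real n - real s) / Z"
    have e: "expi (real j / Z * n) * expi (- (real j / Z * s)) = expi t ^ j" for j
    proof -
      have "expi (real j / Z * n) * expi (- (real j / Z * s)) = expi (real j * t)" unfolding expi_add[symmetric] t_def by (simp add: algebra_simps diff_divide_distrib)
      also have "\<dots> = expi t ^ j" by (simp add: expi_def exp_of_nat_mult[symmetric] mult_ac)
      finally show ?thesis .
    qed
    show ?thesis
    proof (cases "n = s")
      case True then show ?thesis unfolding e by (simp add: t_def)
    next
      case False
      have "expi t ^ Z = expi (real Z * t)" by (simp add: expi_def exp_of_nat_mult[symmetric] mult_ac)
      also have "real Z * t = of_int (int n - int s)" using Z by (simp add: t_def)
      finally have one: "expi t ^ Z = 1" by (simp only: expi_of_int)
      have "expi t \<noteq> 1"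
      proof
        assume "expi t = 1"
        then have "sin (pi * t) = 0" using norm_expi_minus_1[of t] by simp
        then obtain i :: int where "pi * t = of_int i * pi" by (auto simp: sin_zero_iff_int2)
        then have i: "t = of_int i" by simp
        have "\<bar>t\<bar> < 1" using that Z by (auto simp: t_def abs_less_iff field_simps)
        then have "i = 0" unfolding i by simp
        then show False using i False Z by (simp add: t_def)
      qed
      then show ?thesis unfolding e using False one by (simp add: geometric_sum)
    qed
  qed
  have "(if n \<in> S then 1 else 0) = (\<Sum>j<Z. c j * expi (real j / Z * n))" if "n < Z" for n
  proof -
    have "(\<Sum>j<Z. c j * expi (real j / Z * n)) = (\<Sum>j<Z. \<Sum>s\<in>S. expi (real j / Z * n) * expi (- (real j / Z * s)) / of_nat Z)"
      by (simp add: c_def sum_distrib_left sum_divide_distrib mult_ac)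
    also have "\<dots> = (\<Sum>s\<in>S. (\<Sum>j<Z. expi (real j / Z * n) * expi (- (real j / Z * s))) / of_nat Z)" by (subst sum.swap) (simp add: sum_divide_distrib)
    also have "\<dots> = (\<Sum>s\<in>S. if n = s then 1 else 0)"
      proof (rule sum.cong[OF refl])
      fix s assume "s \<in> S"
      then have "s < Z" using assms(2) by auto
      then show "(\<Sum>j<Z. expi (real j / Z * n) * expi (- (real j / Z * s))) / of_nat Z = (if n = s then 1 else 0)" unfolding orth[OF that \<open>s < Z\<close>] using Z by simp
    qed
    also have "\<dots> = (if n \<in> S then 1 else 0)" using pq by simp
    finally show ?thesis ..
  qed
  moreover have "(\<Sum>j<Z. norm (c j)) \<le> 3 + 2 * ln (real Z)"
  proof -
    have c0: "norm (c 0) \<le> 1"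
    proof -
      have "norm (\<Sum>s\<in>S. expi (- (real 0 / Z * s))) \<le> card S" by (rule norm_sum_expi_le)
      also have "\<dots> \<le> Z" using pq by simp
      finally show ?thesis using Z by (simp add: c_def norm_divide divide_le_eq)
    qed
    have cj: "norm (c j) \<le> 1 / j + 1 / (Z - j)" if "j \<in> {1..<Z}" for j
    proof -
      define t where "t = - (real j / Z)"
      \<comment> \<open>The distance of j/Z from the integers: it bounds the sine in the denominator
        of the geometric sum from below, and Z * \<theta> is j or Z - j.\<close>
      define \<theta> where "\<theta> = min (real j / Z) (1 - real j / Z)"
      have j: "0 < real j / Z" "real j / Z < 1" using that Z by auto
      have "\<theta> \<le> sin (pi * (real j / Z))" by (rule sin_pi_ge) (use j in \<open>auto simp: \<theta>_def\<close>)
      moreover have "\<bar>sin (pi * t)\<bar> = \<bar>sin (pi * (real j / Z))\<bar>" by (simp add: t_def)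
      moreover have "0 < \<theta>" using j by (simp add: \<theta>_def)
      ultimately have d: "2 * \<theta> \<le> norm (expi t - 1)" by (simp add: norm_expi_minus_1)
      then have ne: "expi t \<noteq> 1" using \<open>0 < \<theta>\<close> by auto
      have "(\<Sum>s\<in>S. expi (- (real j / Z * s))) = (\<Sum>s\<in>{p..<q}. expi t ^ s)"
        unfolding pq(1) t_def by (intro sum.cong refl) (simp add: expi_def exp_of_nat_mult[symmetric] mult_ac)
      also have "\<dots> = (expi t ^ p - expi t ^ q) / (1 - expi t)"
        using sum_gp[of "expi t" p "q - 1"] pq(2) ne by (cases "p = q") (auto simp: atLeastLessThanSuc_atLeastAtMost[symmetric])
      finally have "norm (\<Sum>s\<in>S. expi (- (real j / Z * s))) = norm (expi t ^ p - expi t ^ q) / norm (expi t - 1)" by (simp add: norm_divide norm_minus_commute)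
      also have "\<dots> \<le> 2 / (2 * \<theta>)"
      proof (rule frac_le)
        show "norm (expi t ^ p - expi t ^ q) \<le> 2" using norm_triangle_ineq4[of "expi t ^ p" "expi t ^ q"] by (simp add: norm_power)
      qed (use d \<open>0 < \<theta>\<close> in auto)
      also have "2 / (2 * \<theta>) = 1 / \<theta>" by simp
      finally have "norm (c j) \<le> 1 / \<theta> / Z" unfolding c_def norm_divide norm_of_nat by (rule divide_right_mono) simp
      also have "\<dots> = 1 / (Z * \<theta>)" by (simp add: mult.commute)
      also have "\<dots> \<le> 1 / j + 1 / (Z - j)"
      proof (cases "real j / Z \<le> 1 - real j / Z")
        case True
        then have "Z * \<theta> = j" using Z by (simp add: \<theta>_def)
        then show ?thesis using that by simp
      next
        case False
        then have "Z * \<theta> = Z - j" using Z that by (simp add: \<theta>_def of_nat_diff algebra_simps)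
        then show ?thesis by simp
      qed
      finally show ?thesis .
    qed
    have "(\<Sum>j<Z. norm (c j)) = norm (c 0) + (\<Sum>j\<in>{1..<Z}. norm (c j))" using assms(1) by (simp add: lessThan_atLeast0 sum.atLeast_Suc_lessThan)
    also have "\<dots> \<le> 1 + (\<Sum>j\<in>{1..<Z}. 1 / real j + 1 / real (Z - j))" using c0 cj by (intro add_mono sum_mono) auto
    also have "\<dots> = 1 + (\<Sum>j\<in>{1..<Z}. 1 / real j) + (\<Sum>j\<in>{1..<Z}. 1 / real (Z - j))" by (simp add: sum.distrib)
    also have "(\<Sum>j\<in>{1..<Z}. 1 / real (Z - j)) = (\<Sum>j\<in>{1..<Z}. 1 / real j)" by (rule sum.reindex_bij_witness[of _ "\<lambda>j. Z - j" "\<lambda>j. Z - j"]) auto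
    also have "(\<Sum>j\<in>{1..<Z}. 1 / real j) \<le> (\<Sum>j\<in>{1..Z}. 1 / real j)" by (intro sum_mono2) auto
    also have "\<dots> \<le> 1 + ln Z" using assms(1) by (intro harmonic_sum_le) auto
    finally show ?thesis by simp
  qed
  ultimately show ?thesis using that by blast
qed

section \<open>A combinatorial lemma on exponents\<close>

text \<open>Each added element is at most v - u, so the partial sums cannot jump over
  [u, v].\<close>

lemma greedy_subset_sum:
  fixes e :: "'i \<Rightarrow> real"
  assumes "finite A" "\<And>i. i \<in> A \<Longrightarrow> 0 \<le> e i \<and> e i \<le> v - u" "b < u" "u \<le> b + sum e A"
  shows "\<exists>T\<subseteq>A. u \<le> b + sum e T \<and> b + sum e T \<le> v" using assms
proof (induction A rule: finite_induct)
  case (insert x A)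
  show ?case
  proof (cases "u \<le> b + sum e A")
    case True
    then show ?thesis using insert by (metis insert_iff subset_insertI2)
  next
    case False
    moreover have "e x \<le> v - u" using insert.prems by simp
    ultimately have "b + sum e (insert x A) \<le> v" using insert.hyps by simp
    then show ?thesis using insert.prems by (intro exI[of _ "insert x A"]) auto
  qed
qed simp

text \<open>Suppose the conclusion fails. Each element is then small (at most v - u), medium
  (between v - u and u) or large (above v). Small ones cannot carry a sum from below u to above v,
  while two medium ones together exceed v. By \<open>rough\<close>, large ones lie in Sm and are
  below (1 - u - \<tau>)/2. No large element would force six medium ones, of sum above 3v; one would
  force four, again giving more than 3v; two leave a rest inside [u, v]; three exceed 3v > 1 +
  \<tau>.\<close>

lemma exponent_splitting:
  fixes e :: "'i \<Rightarrow> real"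
  assumes fin: "finite I" and e0: "\<And>i. i \<in> I \<Longrightarrow> 0 \<le> e i"
    and total: "1 - \<tau> \<le> sum e I" "sum e I \<le> 1 + \<tau>" and uv: "0 < u" "5 * u < 1 - \<tau>" "1 + \<tau> < 3 * v" "u < 1/5" "1/3 < v"
    and rough: "\<And>i. i \<in> I \<Longrightarrow> i \<notin> Sm \<Longrightarrow> e i \<le> v"
  shows "(\<exists>i\<in>I \<inter> Sm. (1 - u - \<tau>) / 2 \<le> e i) \<or> (\<exists>T\<subseteq>I. u \<le> sum e T \<and> sum e T \<le> v)"
proof (rule ccontr)
  assume neg: "\<not> ?thesis"
  then have nS: "\<And>T. T \<subseteq> I \<Longrightarrow> u \<le> sum e T \<Longrightarrow> v < sum e T" and sm: "\<And>i. i \<in> I \<Longrightarrow> i \<in> Sm \<Longrightarrow> e i < (1 - u - \<tau>) / 2"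
    by (auto simp: not_le)
  define A where "A = {i\<in>I. e i \<le> v - u}"
  define Bs where "Bs = {i\<in>I. v - u < e i \<and> e i < u}"
  define Ls where "Ls = {i\<in>I. v < e i}"
  have finA: "finite A" "finite Bs" "finite Ls" using fin by (auto simp: A_def Bs_def Ls_def)
  have trich: "e i < u \<or> v < e i" if "i \<in> I" for i using nS[of "{i}"] that by force
  have Ieq: "I = A \<union> Bs \<union> Ls" using trich by (force simp: A_def Bs_def Ls_def)
  have disj: "A \<inter> Bs = {}" "(A \<union> Bs) \<inter> Ls = {}" using uv by (auto simp: A_def Bs_def Ls_def)
  have "sum e I = sum e (A \<union> Bs) + sum e Ls" unfolding Ieq using finA disj by (intro sum.union_disjoint) auto
  also have "sum e (A \<union> Bs) = sum e A + sum e Bs" using finA disj by (intro sum.union_disjoint) auto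
  finally have tot: "sum e I = sum e A + sum e Bs + sum e Ls" .
  have greedy: "b + sum e A < u" if b: "b < u" and T: "b = sum e T" "T \<subseteq> I - A" for b T
  proof (rule ccontr)
    assume "\<not> b + sum e A < u"
    then obtain T' where T': "T' \<subseteq> A" "u \<le> b + sum e T'" "b + sum e T' \<le> v" using greedy_subset_sum[OF finA(1) _ b, of e v] e0 unfolding not_less A_def by blast
    have "sum e (T \<union> T') = sum e T + sum e T'" using T' T finA fin by (intro sum.union_disjoint) (auto intro: finite_subset)
    then show False using nS[of "T \<union> T'"] T' T by (auto simp: A_def)
  qed
  have A0: "sum e A < u" using greedy[of 0 "{}"] uv by simp
  have bA: "e i + sum e A < u" if "i \<in> Bs" for i using that disj by (intro greedy[of "e i" "{i}"]) (auto simp: Bs_def A_def)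
  have pair: "v < e i + e j" if "i \<in> Bs" "j \<in> Bs" "i \<noteq> j" for i j
  proof -
    \<comment> \<open>Medium elements exceed v - u, and 2(v - u) > u because u < 1/5 and v > 1/3; a
      subset sum of at least u must then exceed v.\<close>
    have "u \<le> e i + e j" using that uv by (auto simp: Bs_def)
    then show ?thesis using nS[of "{i, j}"] that by (auto simp: Bs_def)
  qed
  \<comment> \<open>One medium element together with all small ones stays below u, so the small
    elements do not enlarge the bound by the number of medium ones times u.\<close>
  have Bub: "sum e A + sum e Bs \<le> real (card Bs) * u \<or> card Bs = 0"
  proof (cases "Bs = {}")
    case False
    then obtain i where i: "i \<in> Bs" by blast
    have "sum e Bs = e i + sum e (Bs - {i})" using finA i by (simp add: sum.remove)
    also have "sum e (Bs - {i}) \<le> real (card (Bs - {i})) * u" by (intro sum_bounded_above) (auto simp: Bs_def)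
    also have "real (card (Bs - {i})) = real (card Bs) - 1"
    proof -
      have "card Bs \<noteq> 0" using i finA by auto
      then have "real (card Bs - 1) = real (card Bs) - 1" by (simp add: of_nat_diff Suc_le_eq)
      then show ?thesis using i finA by (simp add: card_Diff_singleton)
    qed
    finally have "sum e A + sum e Bs \<le> (e i + sum e A) + (real (card Bs) - 1) * u" by simp
    also have "\<dots> \<le> u + (real (card Bs) - 1) * u" using bA[OF i] by simp
    finally show ?thesis by (simp add: algebra_simps)
  qed simp
  have Bub0: "sum e A + sum e Bs \<le> u" if "card Bs = 0" using that A0 finA(2) by simp
  have four: "2 * v < sum e Q" if "Q \<subseteq> Bs" "card Q = 4" for Q
  proof -
    have "finite Q" using that(2) by (intro card_ge_0_finite) simp
    then obtain xs where xs: "set xs = Q" "distinct xs" using finite_distinct_list by blast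
    then have "length xs = 4" using that(2) distinct_card by fastforce
    then obtain a b c d where "xs = [a, b, c, d]" by (auto simp: numeral_eq_Suc length_Suc_conv)
    then have Q: "Q = {a, b, c, d}" "distinct [a, b, c, d]" using xs by (simp_all only: list.set)
    have "v < e a + e b" "v < e c + e d" using that Q by (auto intro!: pair)
    then show ?thesis using Q by simp
  qed
  have six: "3 * v < sum e Q" if "Q \<subseteq> Bs" "card Q = 6" for Q
  proof -
    have "finite Q" using that(2) by (intro card_ge_0_finite) simp
    then obtain xs where xs: "set xs = Q" "distinct xs" using finite_distinct_list by blast
    then have "length xs = 6" using that(2) distinct_card by fastforce
    then obtain a b c d f g where "xs = [a, b, c, d, f, g]" by (auto simp: numeral_eq_Suc length_Suc_conv)
    then have Q: "Q = {a, b, c, d, f, g}" "distinct [a, b, c, d, f, g]" using xs by (simp_all only: list.set)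
    have "v < e a + e b" "v < e c + e d" "v < e f + e g" using that Q by (auto intro!: pair)
    then show ?thesis using Q by simp
  qed
  have Bsub: "sum e Q \<le> sum e Bs" if "Q \<subseteq> Bs" for Q using that finA e0 by (intro sum_mono2) (auto simp: Bs_def)
  have A00: "0 \<le> sum e A" "0 \<le> sum e Bs" using e0 by (auto simp: A_def Bs_def intro!: sum_nonneg)
  have Lsm: "e i < (1 - u - \<tau>) / 2" "v < e i" if "i \<in> Ls" for i using that sm rough by (force simp: Ls_def)+
  consider "card Ls = 0" | "card Ls = 1" | "card Ls = 2" | "3 \<le> card Ls" by linarith
  then show False
  proof cases
    case 1
    then have L0: "sum e Ls = 0" using finA by simp
    have "6 \<le> card Bs"
    proof (rule ccontr)
      assume "\<not> 6 \<le> card Bs"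
      then have "real (card Bs) * u \<le> 5 * u" using uv by (intro mult_right_mono) auto
      then have "sum e A + sum e Bs \<le> 5 * u" using Bub Bub0 uv(1) by (elim disjE) linarith+
      then show False using total tot L0 uv by linarith
    qed
    then obtain Q where "Q \<subseteq> Bs" "card Q = 6" using obtain_subset_with_card_n by metis
    then show False using six[of Q] Bsub[of Q] total tot L0 uv A00 by auto
  next
    case 2
    then obtain a where a: "Ls = {a}" using card_1_singletonE by blast
    have ea: "e a < (1 - u - \<tau>) / 2" "v < e a" using Lsm a by auto
    have "4 \<le> card Bs"
    proof (rule ccontr)
      assume "\<not> 4 \<le> card Bs"
      then have "real (card Bs) * u \<le> 3 * u" using uv by (intro mult_right_mono) auto
      then have "sum e A + sum e Bs \<le> 3 * u" using Bub Bub0 uv(1) by (elim disjE) linarith+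
      moreover have "sum e Ls = e a" using a by simp
      ultimately show False using total tot ea uv by argo
    qed
    then obtain Q where "Q \<subseteq> Bs" "card Q = 4" using obtain_subset_with_card_n by metis
    then show False using four[of Q] Bsub[of Q] total tot a ea uv A00 by auto
  next
    case 3
    then obtain a b where ab: "Ls = {a, b}" "a \<noteq> b" by (auto simp: card_2_iff)
    have eab: "e a < (1 - u - \<tau>) / 2" "v < e a" "e b < (1 - u - \<tau>) / 2" "v < e b" using Lsm ab by auto
    have "sum e (A \<union> Bs) = sum e A + sum e Bs" using finA disj by (intro sum.union_disjoint) auto
    then have "u \<le> sum e (A \<union> Bs)" "sum e (A \<union> Bs) \<le> v" using total tot ab eab uv by auto
    then show False using nS[of "A \<union> Bs"] by (auto simp: A_def Bs_def)
  next
    case 4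
    then obtain Q where Q: "Q \<subseteq> Ls" "card Q = 3" using obtain_subset_with_card_n by metis
    then obtain a b c where abc: "Q = {a, b, c}" "distinct [a, b, c]" by (auto simp: numeral_eq_Suc card_Suc_eq)
    have "v < e a" "v < e b" "v < e c" using Lsm Q abc by auto
    moreover have "sum e Q \<le> sum e Ls" using Q finA e0 by (intro sum_mono2) (auto simp: Ls_def)
    ultimately show False using abc total tot uv A00 by auto
  qed
qed

section \<open>The three ranges of the parameters\<close>

text \<open>A single shape of logarithmic factor for all later uses; the constant 11 leaves room for
  terms such as 1 + ln 10.\<close>

lemma exists_powr_ge_log:
  fixes K c e :: real
  assumes "0 < c" "0 < e"
  shows "\<exists>x0>1. \<forall>x\<ge>x0. K * (11 + c * ln x)\<^sup>2 \<le> x powr e"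
proof -
  have "(\<lambda>x. (11 + c * ln x)\<^sup>2) \<in> o(\<lambda>x::real. x powr e)" using assms by real_asymp
  then have "\<forall>\<^sub>F x in at_top. norm ((11 + c * ln x)\<^sup>2) \<le> 1 / (\<bar>K\<bar> + 1) * norm (x powr e)" by (rule landau_o.smallD) simp
  then obtain x1 where x1: "\<And>x. x1 \<le> x \<Longrightarrow> norm ((11 + c * ln x)\<^sup>2) \<le> 1 / (\<bar>K\<bar> + 1) * norm (x powr e)"
    unfolding eventually_at_top_linorder by blast
  have "K * (11 + c * ln x)\<^sup>2 \<le> x powr e" if "x1 \<le> x" for x
  proof -
    have "K * (11 + c * ln x)\<^sup>2 \<le> (\<bar>K\<bar> + 1) * (11 + c * ln x)\<^sup>2" by (intro mult_right_mono) auto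
    also have "\<dots> \<le> x powr e" using x1[OF that] by (simp add: field_simps)
    finally show ?thesis .
  qed
  then show ?thesis by (intro exI[of _ "max 2 x1"]) auto
qed

lemma exists_powr_ge:
  fixes K e :: real
  assumes "0 < e"
  shows "\<exists>x0>1. \<forall>x\<ge>x0. K \<le> x powr e"
proof -
  have "filterlim (\<lambda>x::real. x powr e) at_top at_top" using assms by real_asymp
  then have "\<forall>\<^sub>F x in at_top. K \<le> x powr e" by (simp add: filterlim_at_top)
  then obtain x1 where "\<And>x. x1 \<le> x \<Longrightarrow> K \<le> x powr e" unfolding eventually_at_top_linorder by blast
  then show ?thesis by (intro exI[of _ "max 2 x1"]) auto
qed

text \<open>The weight for H = x^\<eta>, multiplied by the number of frequencies h, is min {H, x^a}:
  the amount by which the trivial bound exceeds the length of the sum over n.\<close>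

lemma min_powr_mult:
  fixes x :: real
  assumes "1 < x"
  shows "min 1 (x powr a / x powr \<eta>) * x powr \<eta> = x powr min \<eta> a" using assms by (cases "\<eta> \<le> a") (auto simp: min_def divide_le_eq le_divide_eq)

text \<open>Both strict hypotheses are kept with a margin of 100 e, the first one multiplied by 3 -
  2l, so that a bounded number of losses x^e is affordable. The parameter \<open>e\<close> stands
  for the \<epsilon> of the theorem.\<close>

locale twisted_sums =
  fixes k l \<gamma> \<delta> e d :: real
  assumes ep: "exponent_pair k l" and kl: "0 < 4 * k - 2 * l + 1"
    and \<gamma>: "0 < \<gamma>" "\<gamma> < 1" and d_def: "d = 1 - \<gamma>" and \<delta>: "0 \<le> \<delta>" "\<delta> \<le> d" and e: "0 < e"
    and hyp1: "(12 * k - 2 * l + 13) * d + (20 * k - 4 * l + 16) * \<delta> + 100 * e \<le> 3 - 2 * l"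
    and hyp: "15 / 2 * d + 9 * \<delta> + 100 * e \<le> 1"
begin

lemma d: "0 < d" "d < 1" using \<gamma> by (auto simp: d_def)

definition admissible :: "real \<Rightarrow> real \<Rightarrow> real \<Rightarrow> nat set \<Rightarrow> bool" where
  "admissible x H u hs \<longleftrightarrow> 1 \<le> H \<and> H \<le> x powr (d + \<delta> + e) \<and> 0 \<le> u \<and> u \<le> 1 \<and> finite hs
     \<and> (\<forall>h\<in>hs. H \<le> real h \<and> real h \<le> 2 * H)"

definition in_range :: "real \<Rightarrow> nat \<Rightarrow> nat \<Rightarrow> bool" where
  "in_range x M N \<longleftrightarrow> x powr (1 - e / 2) \<le> real M * real N \<and> real M * real N \<le> x powr (1 + e / 2)"

definition smooth_sum where
  "smooth_sum u \<alpha> hs a M n1 n2 = (\<Sum>h\<in>hs. norm (\<Sum>m\<in>{M..<2*M}. a m * (\<Sum>n\<in>{n1..<n2}. expi (twisted_phase \<gamma> u \<alpha> h (m * n)))))"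

definition bilinear_sum where
  "bilinear_sum u \<alpha> hs a b M N = (\<Sum>h\<in>hs. norm (\<Sum>m\<in>{M..<2*M}. \<Sum>n\<in>{N..<2*N}. a m * b n * expi (twisted_phase \<gamma> u \<alpha> h (m * n))))"

text \<open>Writing all sizes as powers of x turns conditions on sizes into linear inequalities
  between exponents. Here w is the exponent of (M N)^(1 - \<gamma>), within e/2 of d, and m is the
  exponent of min {H, x^d}.\<close>

lemma exponents:
  assumes adm: "admissible x H u hs" and x1: "1 < x" and MN: "in_range x M N"
  obtains \<eta> \<nu> \<mu> w m where "H = x powr \<eta>" "real N = x powr \<nu>" "real M = x powr \<mu>" "0 \<le> \<eta>" "\<eta> \<le> d + \<delta> + e"
    "1 - e / 2 \<le> \<mu> + \<nu>" "\<mu> + \<nu> \<le> 1 + e / 2" "w = d * (\<mu> + \<nu>)" "d - e / 2 \<le> w" "w \<le> d + e / 2"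
    "m = min \<eta> d" "m \<le> \<eta>" "m \<le> d" "0 \<le> m" "m = \<eta> \<or> m = d"
proof -
  define \<eta> \<nu> \<mu> where "\<eta> = log x H" and "\<nu> = log x N" and "\<mu> = log x M"
  have H: "1 \<le> H" "H \<le> x powr (d + \<delta> + e)" using adm by (auto simp: admissible_def)
  have "0 < real M * real N" using MN x1 less_le_trans[of 0 "x powr (1 - e / 2)"] by (simp add: in_range_def)
  then have eq: "H = x powr \<eta>" "real N = x powr \<nu>" "real M = x powr \<mu>" using x1 H by (auto simp: \<eta>_def \<nu>_def \<mu>_def zero_less_mult_iff)
  have \<eta>: "0 \<le> \<eta>" "\<eta> \<le> d + \<delta> + e" using H x1 by (simp_all add: \<eta>_def log_le_iff)
  have \<mu>\<nu>: "1 - e / 2 \<le> \<mu> + \<nu>" "\<mu> + \<nu> \<le> 1 + e / 2" using MN x1 by (auto simp: eq in_range_def powr_add[symmetric])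
  have "d * (1 - e / 2) \<le> d * (\<mu> + \<nu>)" "d * (\<mu> + \<nu>) \<le> d * (1 + e / 2)" using \<mu>\<nu> d by (auto intro!: mult_left_mono)
  moreover have "d * (e / 2) \<le> 1 * (e / 2)" using d e by (intro mult_right_mono) auto
  ultimately have "d - e / 2 \<le> d * (\<mu> + \<nu>)" "d * (\<mu> + \<nu>) \<le> d + e / 2" by (auto simp: algebra_simps)
  then show ?thesis using that[OF eq \<eta> \<mu>\<nu> refl _ _ refl] \<eta> d by (auto simp: min_def)
qed

lemma min_mult_le:
  assumes "1 < x" "S \<le> x powr (\<eta> + t)" "min \<eta> d + t \<le> r"
  shows "min 1 (x powr d / x powr \<eta>) * S \<le> x powr r"
proof -
  have "min 1 (x powr d / x powr \<eta>) * S \<le> min 1 (x powr d / x powr \<eta>) * x powr (\<eta> + t)" using assms(2) by (rule mult_left_mono) simp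
  also have "\<dots> = x powr (min \<eta> d + t)" unfolding powr_add min_powr_mult[OF assms(1), symmetric] by (simp only: mult_ac)
  also have "\<dots> \<le> x powr r" using assms by simp
  finally show ?thesis .
qed

text \<open>The saving is s = x^\<sigma> with \<sigma> = m + \<delta> + 4e: x^m makes up for the sum
  over h with its weight, x^\<delta> is the gain claimed, and the rest covers logarithms. The lower
  limit for N is condition c1 of \<open>bilinear_bound\<close>; that for M is c2, where 6\<sigma> -
  w is at most 5d + 6\<delta> + 25e.\<close>

lemma type_two_exponents:
  "\<exists>x0>1. \<forall>x\<ge>x0. \<forall>H u \<alpha> hs M N. \<forall>a b :: nat \<Rightarrow> complex. admissible x H u hs \<longrightarrow>
      (\<forall>m. norm (a m) \<le> 1) \<longrightarrow> (\<forall>n. norm (b n) \<le> 1) \<longrightarrow>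
      x powr (d + 2 * \<delta> + 8 * e) \<le> real N \<longrightarrow> x powr (5 * d + 6 * \<delta> + 25 * e) \<le> real M \<longrightarrow>
      in_range x M N \<longrightarrow>
      min 1 (x powr d / H) * bilinear_sum u \<alpha> hs a b M N
        \<le> x powr (1 - \<delta> - 2 * e)"
proof -
  define K where "K = 9000 / \<gamma> * two_powers_const \<gamma>"
  define c where "c = 4 + \<delta> + e"
  have c0: "0 < c" using \<delta> e by (simp add: c_def)
  obtain x0 where x0: "1 < x0" "\<And>x. x0 \<le> x \<Longrightarrow> K * (11 + c * ln x)\<^sup>2 \<le> x powr e" using exists_powr_ge_log[OF c0 e] by blast
  have K0: "0 \<le> K" using \<gamma> by (simp add: K_def two_powers_const_def)
  show ?thesis
  proof (intro exI[of _ x0] conjI allI impI)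
    show "1 < x0" by (rule x0)
    fix x H u \<alpha> :: real and hs :: "nat set" and M N :: nat and a b :: "nat \<Rightarrow> complex"
    assume x: "x0 \<le> x" and adm: "admissible x H u hs" and a: "\<forall>m. norm (a m) \<le> 1" and b: "\<forall>n. norm (b n) \<le> 1"
      and N: "x powr (d + 2 * \<delta> + 8 * e) \<le> real N" and M: "x powr (5 * d + 6 * \<delta> + 25 * e) \<le> real M"
      and MN: "in_range x M N"
    define S where "S = bilinear_sum u \<alpha> hs a b M N"
    have x1: "1 < x" using x x0 by simp
    obtain \<eta> \<nu> \<mu> w m where \<eta>: "H = x powr \<eta>" "0 \<le> \<eta>" "\<eta> \<le> d + \<delta> + e" and Neq: "real N = x powr \<nu>" and Meq: "real M = x powr \<mu>"
      and \<mu>\<nu>: "1 - e / 2 \<le> \<mu> + \<nu>" "\<mu> + \<nu> \<le> 1 + e / 2" and w_def: "w = d * (\<mu> + \<nu>)" and w: "d - e / 2 \<le> w" "w \<le> d + e / 2"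
      and m_def: "m = min \<eta> d" and m: "m \<le> \<eta>" "m \<le> d" "0 \<le> m" "m = \<eta> \<or> m = d" by (rule exponents[OF adm x1 MN])
    have Npos: "0 < real N" and Mpos: "0 < real M" using x1 by (simp_all add: Neq Meq)
    have \<nu>: "d + 2 * \<delta> + 8 * e \<le> \<nu>" using N x1 by (simp add: Neq)
    have \<mu>: "5 * d + 6 * \<delta> + 25 * e \<le> \<mu>" using M x1 by (simp add: Meq)
    have \<gamma>\<mu>\<nu>: "(\<mu> + \<nu>) * \<gamma> = \<mu> + \<nu> - w" by (simp add: w_def d_def algebra_simps)
    define \<sigma> where "\<sigma> = m + \<delta> + 4 * e"
    define s where "s = x powr \<sigma>"
    have sp: "s ^ i = x powr (\<sigma> * i)" for i using x1 by (simp add: s_def powr_power mult.commute)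
    have F: "H * (real M * real N) powr \<gamma> = x powr (\<eta> + (\<mu> + \<nu> - w))" using x1 by (simp add: \<eta>(1) Meq Neq powr_add[symmetric] powr_powr \<gamma>\<mu>\<nu>)
    have "S\<^sup>2 \<le> K * ((1 + ln (2 * H)) * (1 + ln (2 * real N))) * (H * M * N / s)\<^sup>2" unfolding S_def bilinear_sum_def K_def
    proof (rule bilinear_bound[OF \<gamma> _ _ _ _ _ _ _ _ _ _ refl])
      show "1 \<le> H" "0 \<le> u" "u \<le> 1" "finite hs" "\<And>h. h \<in> hs \<Longrightarrow> H \<le> real h \<and> real h \<le> 2 * H" using adm by (auto simp: admissible_def)
      show "1 \<le> N" "1 \<le> M" using Npos Mpos by auto
      show "1 \<le> s" unfolding s_def \<sigma>_def using x1 m(3) \<delta> e by (intro ge_one_powr_ge_zero) auto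
      show "s\<^sup>2 \<le> H * N" using x1 m \<nu> \<eta> by (simp add: sp \<eta>(1) Neq powr_add[symmetric] \<sigma>_def)
      show "s ^ 6 * (H * (real M * real N) powr \<gamma>) \<le> H * N * (real M)\<^sup>2"
        unfolding F using x1 m \<mu> \<eta> w \<delta> e by (simp add: sp \<eta>(1) Meq Neq powr_add[symmetric] powr_power \<sigma>_def)
      show "s ^ 4 * H * N \<le> H * (real M * real N) powr \<gamma>"
        unfolding F using x1 m \<mu> \<eta> w \<delta> e by (simp add: sp \<eta>(1) Meq Neq powr_add[symmetric] \<sigma>_def)
      show "H * (real M * real N) powr \<gamma> \<le> s ^ 4 * M * N"
        unfolding F using x1 m \<mu> \<eta> w \<delta> e by (auto simp add: sp \<eta>(1) Meq Neq powr_add[symmetric] \<sigma>_def)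
    qed (use a b in auto)
    also have "\<dots> \<le> (K * (11 + c * ln x)\<^sup>2) * (H * M * N / s)\<^sup>2"
    proof -
      have lx: "0 \<le> ln x" using x1 by simp
      have l2: "ln 2 \<le> (1::real)" using ln_le_minus_one[of "2::real"] by simp
      have "\<eta> * ln x \<le> c * ln x" "\<nu> * ln x \<le> c * ln x" using lx \<eta> \<nu> \<mu> \<mu>\<nu> d e \<delta> by (auto intro!: mult_right_mono simp: c_def)
      then have lns: "1 + ln (2 * H) \<le> 11 + c * ln x" "1 + ln (2 * real N) \<le> 11 + c * ln x"
      proof -
        have "ln (2 * H) = ln 2 + \<eta> * ln x" "ln (2 * real N) = ln 2 + \<nu> * ln x" using x1 by (simp_all add: \<eta>(1) Neq ln_mult ln_powr)
        then show "1 + ln (2 * H) \<le> 11 + c * ln x" "1 + ln (2 * real N) \<le> 11 + c * ln x"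
          using l2 \<open>\<eta> * ln x \<le> c * ln x\<close> \<open>\<nu> * ln x \<le> c * ln x\<close> by linarith+
      qed
      have "0 \<le> 1 + ln (2 * real N)" "0 \<le> 11 + c * ln x" using Npos lx \<delta> e by (auto intro!: add_nonneg_nonneg simp: c_def)
      with lns have "(1 + ln (2 * H)) * (1 + ln (2 * real N)) \<le> (11 + c * ln x)\<^sup>2" unfolding power2_eq_square by (intro mult_mono) auto
      then show ?thesis using K0 by (intro mult_right_mono mult_left_mono) auto
    qed
    also have "\<dots> \<le> x powr e * (H * M * N / s)\<^sup>2" by (intro mult_right_mono x0(2) x) simp
    also have "\<dots> = (x powr (\<eta> + (\<mu> + \<nu> - \<sigma> + e / 2)))\<^sup>2"
      using x1 by (simp add: \<eta>(1) Meq Neq s_def powr_add[symmetric] powr_diff[symmetric] powr_power algebra_simps)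
    finally have "S \<le> x powr (\<eta> + (\<mu> + \<nu> - \<sigma> + e / 2))" by (rule power2_le_imp_le) simp
    moreover have "min \<eta> d + (\<mu> + \<nu> - \<sigma> + e / 2) \<le> 1 - \<delta> - 2 * e" using \<mu>\<nu> e by (simp add: \<sigma>_def m_def)
    ultimately show "min 1 (x powr d / H) * bilinear_sum u \<alpha> hs a b M N \<le> x powr (1 - \<delta> - 2 * e)" unfolding \<eta>(1) S_def by (rule min_mult_le[OF x1])
  qed
qed

text \<open>The rough variable is so short that summing trivially over m and h is affordable; the
  second derivative test in n alone gives sqrt F + N / sqrt F with F = H (M N)^\<gamma>.\<close>

lemma short_rough_exponents:
  "\<exists>x0>1. \<forall>x\<ge>x0. \<forall>H u \<alpha> hs M N n1 n2. \<forall>a :: nat \<Rightarrow> complex. admissible x H u hs \<longrightarrow>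
      (\<forall>m. norm (a m) \<le> 1) \<longrightarrow> N \<le> n1 \<longrightarrow> n2 \<le> 2 * N \<longrightarrow> real M \<le> x powr (d + 2 * \<delta> + 8 * e) \<longrightarrow>
      in_range x M N \<longrightarrow>
      min 1 (x powr d / H) * smooth_sum u \<alpha> hs a M n1 n2
        \<le> x powr (1 - \<delta> - 2 * e)"
proof -
  define c where "c = two_powers_const \<gamma>"
  obtain x0 where x0: "1 < x0" "\<And>x. x0 \<le> x \<Longrightarrow> max 4 (6 * c) \<le> x powr e" using exists_powr_ge[OF e] by blast
  have c: "0 \<le> c" using \<gamma> by (simp add: c_def two_powers_const_def)
  show ?thesis
  proof (intro exI[of _ x0] conjI allI impI)
    show "1 < x0" by (rule x0)
    fix x H u \<alpha> :: real and hs :: "nat set" and M N n1 n2 :: nat and a :: "nat \<Rightarrow> complex"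
    assume x: "x0 \<le> x" and adm: "admissible x H u hs" and a: "\<forall>m. norm (a m) \<le> 1"
      and n12: "N \<le> n1" "n2 \<le> 2 * N" and M: "real M \<le> x powr (d + 2 * \<delta> + 8 * e)"
      and MN: "in_range x M N"
    define S where "S = smooth_sum u \<alpha> hs a M n1 n2"
    have x1: "1 < x" using x x0 by simp
    obtain \<eta> \<nu> \<mu> w m where \<eta>: "H = x powr \<eta>" "0 \<le> \<eta>" "\<eta> \<le> d + \<delta> + e" and Neq: "real N = x powr \<nu>" and Meq: "real M = x powr \<mu>"
      and \<mu>\<nu>: "1 - e / 2 \<le> \<mu> + \<nu>" "\<mu> + \<nu> \<le> 1 + e / 2" and w_def: "w = d * (\<mu> + \<nu>)" and w: "d - e / 2 \<le> w" "w \<le> d + e / 2"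
      and m_def: "m = min \<eta> d" and m: "m \<le> \<eta>" "m \<le> d" "0 \<le> m" "m = \<eta> \<or> m = d" by (rule exponents[OF adm x1 MN])
    have Npos: "0 < real N" and Mpos: "0 < real M" using x1 by (simp_all add: Neq Meq)
    have u: "0 \<le> u" "u \<le> 1" and H1: "1 \<le> H" and fin: "finite hs" and hs: "\<And>h. h \<in> hs \<Longrightarrow> H \<le> real h \<and> real h \<le> 2 * H"
      using adm by (auto simp: admissible_def)
    have \<mu>: "\<mu> \<le> d + 2 * \<delta> + 8 * e" using M x1 by (simp add: Meq)
    have \<gamma>\<mu>\<nu>: "(\<mu> + \<nu>) * \<gamma> = \<mu> + \<nu> - w" by (simp add: w_def d_def algebra_simps)
    define F where "F = H * (real M * real N) powr \<gamma>"
    have F: "F = x powr (\<eta> + (\<mu> + \<nu> - w))" using x1 by (simp add: F_def \<eta>(1) Meq Neq powr_add[symmetric] powr_powr \<gamma>\<mu>\<nu>)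
    have F0: "0 < F" using x1 by (simp add: F)
    \<comment> \<open>With one power only (B = 0) and shifts up to 1, the separation condition of
      \<open>two_powers_sum_bound\<close> reads 4 \<le> N.\<close>
    have N4: "4 \<le> real N"
    proof -
      have "4 \<le> x powr e" using x0(2)[OF x] by simp
      also have "\<dots> \<le> real N" using x1 \<mu> \<mu>\<nu> hyp \<delta> d by (simp add: Neq)
      finally show ?thesis .
    qed
    have inner: "norm (\<Sum>n\<in>{n1..<n2}. expi (twisted_phase \<gamma> u \<alpha> h (k * n))) \<le> c * (2 * sqrt F + N / sqrt F)"
      if h: "h \<in> hs" and k: "k \<in> {M..<2*M}" for h k
    proof (cases "n1 \<le> n2")
      case True
      have k0: "0 < k" using k Mpos by auto
      define A where "A = h * real k powr \<gamma>"
      have "1 \<le> real h" using hs[OF h] H1 by simp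
      then have A: "0 < A" using k0 by (simp add: A_def)
      have "H * real M powr \<gamma> \<le> A" unfolding A_def using hs[OF h] k \<gamma> H1 by (intro mult_mono powr_mono2) auto
      then have A1: "F \<le> A * real N powr \<gamma>" by (simp add: F_def powr_mult mult.assoc[symmetric] mult_right_mono)
      have "real k powr \<gamma> \<le> (2 * real M) powr \<gamma>" using k \<gamma> by (intro powr_mono2) auto
      also have "\<dots> = 2 powr \<gamma> * real M powr \<gamma>" by (simp add: powr_mult)
      also have "\<dots> \<le> 2 * real M powr \<gamma>" using \<gamma> powr_mono[of \<gamma> 1 "2::real"] by (intro mult_right_mono) auto
      finally have "A \<le> (2 * H) * (2 * real M powr \<gamma>)" unfolding A_def using hs[OF h] by (intro mult_mono) auto
      then have A2: "A * real N powr \<gamma> \<le> 4 * F" using mult_right_mono[of A "(2 * H) * (2 * real M powr \<gamma>)" "real N powr \<gamma>"] by (simp add: F_def powr_mult)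
      have "(\<Sum>n\<in>{n1..<n2}. expi (twisted_phase \<gamma> u \<alpha> h (k * n)))
         = (\<Sum>n\<in>{n1..<n2}. expi ((\<alpha> * k) * n + A * (n + u / k) powr \<gamma> - 0 * (real n + 0) powr \<gamma>))"
        using twisted_phase_mult[OF k0 u(1), of \<gamma> \<alpha> h] by (simp add: A_def mult.commute mult.left_commute)
      also have "norm \<dots> \<le> c * (sqrt (\<bar>A - 0\<bar> * real N powr \<gamma>) + real N / sqrt (\<bar>A - 0\<bar> * real N powr \<gamma>))" unfolding c_def
      proof (rule two_powers_sum_bound[OF \<gamma>, where \<sigma> = 1])
        show "u / real k \<le> 1" using u k0 by (simp add: divide_le_eq)
        show "4 * 1 * A \<le> real N * \<bar>A - 0\<bar>" using A N4 by simp
      qed (use u k0 A N4 n12 True in auto)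
      also have "\<dots> = c * (sqrt (A * real N powr \<gamma>) + real N / sqrt (A * real N powr \<gamma>))" using A by simp
      also have "\<dots> \<le> c * (2 * sqrt F + N / sqrt F)"
      proof (intro mult_left_mono add_mono divide_left_mono c)
        show "sqrt (A * real N powr \<gamma>) \<le> 2 * sqrt F" using real_sqrt_le_mono[OF A2] by (simp add: real_sqrt_mult)
        show "sqrt F \<le> sqrt (A * real N powr \<gamma>)" by (rule real_sqrt_le_mono[OF A1])
        show "0 < sqrt (A * real N powr \<gamma>) * sqrt F" using F0 A Npos by simp
      qed simp
      finally show ?thesis .
    next
      case False
      have "0 \<le> c * (2 * sqrt F + N / sqrt F)" using c F0 by simp
      then show ?thesis using False by simp
    qed
    have "S \<le> (\<Sum>h\<in>hs. \<Sum>k\<in>{M..<2*M}. 1 * (c * (2 * sqrt F + N / sqrt F)))" unfolding S_def smooth_sum_def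
    proof (intro sum_mono sum_norm_le)
      fix h k assume *: "h \<in> hs" "k \<in> {M..<2*M}"
      show "norm (a k * (\<Sum>n\<in>{n1..<n2}. expi (twisted_phase \<gamma> u \<alpha> h (k * n)))) \<le> 1 * (c * (2 * sqrt F + N / sqrt F))"
        unfolding norm_mult using a inner[OF *] by (intro mult_mono) auto
    qed
    also have "\<dots> = real (card hs) * (M * (c * (2 * sqrt F + N / sqrt F)))" by simp
    also have "\<dots> \<le> (2 * H) * (M * (c * (2 * sqrt F + N / sqrt F)))" using card_frequencies_le[OF H1 hs] c H1 by (intro mult_right_mono) (auto simp: F)
    finally have "min 1 (x powr d / H) * S \<le> min 1 (x powr d / H) * ((2 * H) * (M * (c * (2 * sqrt F + N / sqrt F))))" by (rule mult_left_mono) (simp add: \<eta>(1))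
    also have "\<dots> = min 1 (x powr d / x powr \<eta>) * x powr \<eta> * (2 * c * (2 * (M * sqrt F) + M * N / sqrt F))" by (simp add: \<eta>(1) algebra_simps)
    also have "\<dots> = x powr m * (2 * c * (2 * (M * sqrt F) + M * N / sqrt F))" unfolding min_powr_mult[OF x1] m_def ..
    also have "\<dots> = 2 * c * (2 * (x powr m * (M * sqrt F)) + x powr m * (M * N / sqrt F))" by (simp only: algebra_simps)
    also have "\<dots> \<le> 2 * c * (2 * x powr (1 - \<delta> - 3 * e) + x powr (1 - \<delta> - 3 * e))"
    proof -
      have sF: "sqrt F = x powr ((\<eta> + (\<mu> + \<nu> - w)) / 2)" unfolding F using x1 by (simp add: powr_half_sqrt[symmetric] powr_powr)
      have "m + (\<mu> + (\<eta> + (\<mu> + \<nu> - w)) / 2) \<le> 1 - \<delta> - 3 * e"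
        "m + (\<mu> + \<nu> - (\<eta> + (\<mu> + \<nu> - w)) / 2) \<le> 1 - \<delta> - 3 * e" using m(1,2) \<mu> \<mu>\<nu> w \<eta>(2,3) hyp \<delta> e d by argo+
      note ex = this
      have "x powr m * (M * sqrt F) \<le> x powr (1 - \<delta> - 3 * e)" using x1 ex(1) by (simp add: sF Meq powr_add[symmetric])
      moreover have "x powr m * (M * N / sqrt F) \<le> x powr (1 - \<delta> - 3 * e)" using x1 ex(2) by (simp add: sF Meq Neq powr_add[symmetric] powr_diff[symmetric])
      ultimately show ?thesis using c by (intro mult_left_mono add_mono) auto
    qed
    also have "\<dots> = 6 * c * x powr (1 - \<delta> - 3 * e)" by simp
    also have "\<dots> \<le> x powr e * x powr (1 - \<delta> - 3 * e)" using x0(2)[OF x] by (intro mult_right_mono) auto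
    also have "\<dots> = x powr (1 - \<delta> - 2 * e)" by (simp add: powr_add[symmetric])
    finally show "min 1 (x powr d / H) * smooth_sum u \<alpha> hs a M n1 n2
        \<le> x powr (1 - \<delta> - 2 * e)" unfolding S_def .
  qed
qed

text \<open>Differencing with about x^(2\<sigma>) steps saves x^\<sigma> in the diagonal term after
  the square root. It remains to bound \<open>type_one_term\<close> by x^(\<mu> + \<nu> - 2\<sigma>
  + e) for all \<rho> that occur, and this is where the hypotheses on k and l enter.\<close>

lemma long_smooth_exponents:
  "\<exists>x0>1. \<forall>x\<ge>x0. \<forall>H u \<alpha> hs M N n1 n2. \<forall>a :: nat \<Rightarrow> complex. admissible x H u hs \<longrightarrow>
      (\<forall>m. norm (a m) \<le> 1) \<longrightarrow> N \<le> n1 \<longrightarrow> n2 \<le> 2 * N \<longrightarrow> x powr (2 * d + 2 * \<delta> + 9 * e) \<le> real M \<longrightarrow>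
      x powr ((1 - d - 2 * \<delta> - 9 * e) / 2) \<le> real N \<longrightarrow>
      in_range x M N \<longrightarrow>
      min 1 (x powr d / H) * smooth_sum u \<alpha> hs a M n1 n2
        \<le> x powr (1 - \<delta> - 2 * e)"
proof -
  have k: "0 \<le> k" "k \<le> 1/2" and l: "1/2 \<le> l" "l \<le> 1" using ep by (auto simp: exponent_pair_def)
  show ?thesis
  proof (rule type_one_bound[OF ep \<gamma>], goal_cases)
  case (1 C z0)
  note C = 1(1,2) and type_one = 1(3)
  define c where "c = 10 + 4 * \<delta> + 20 * e"
  have c0: "0 < c" using \<delta> e by (simp add: c_def)
  obtain x0 where x0: "1 < x0" "\<And>x. x0 \<le> x \<Longrightarrow> 3 * (11 + c * ln x)\<^sup>2 \<le> x powr e" using exists_powr_ge_log[OF c0 e] by blast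
  obtain x2 where x2: "\<And>x. x2 \<le> x \<Longrightarrow> max 4 (max (2 * C) (2 / z0)) \<le> x powr e" using exists_powr_ge[OF e] by blast
  show ?thesis
  proof (intro exI[of _ "max x0 x2"] conjI allI impI)
    show "1 < max x0 x2" using x0(1) by simp
    fix x H u \<alpha> :: real and hs :: "nat set" and M N n1 n2 :: nat and a :: "nat \<Rightarrow> complex"
    assume x: "max x0 x2 \<le> x" and adm: "admissible x H u hs" and a: "\<forall>m. norm (a m) \<le> 1"
      and n12: "N \<le> n1" "n2 \<le> 2 * N" and M: "x powr (2 * d + 2 * \<delta> + 9 * e) \<le> real M"
      and N: "x powr ((1 - d - 2 * \<delta> - 9 * e) / 2) \<le> real N"
      and MN: "in_range x M N"
    define S where "S = smooth_sum u \<alpha> hs a M n1 n2"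
    have x1: "1 < x" using x x0 by simp
    have xe: "4 \<le> x powr e" "2 * C \<le> x powr e" "2 / z0 \<le> x powr e" "3 * (11 + c * ln x)\<^sup>2 \<le> x powr e" using x x0(2)[of x] x2[of x] by auto
    obtain \<eta> \<nu> \<mu> w m where \<eta>: "H = x powr \<eta>" "0 \<le> \<eta>" "\<eta> \<le> d + \<delta> + e" and Neq: "real N = x powr \<nu>" and Meq: "real M = x powr \<mu>"
      and \<mu>\<nu>: "1 - e / 2 \<le> \<mu> + \<nu>" "\<mu> + \<nu> \<le> 1 + e / 2" and w_def: "w = d * (\<mu> + \<nu>)" and w: "d - e / 2 \<le> w" "w \<le> d + e / 2"
      and m_def: "m = min \<eta> d" and m: "m \<le> \<eta>" "m \<le> d" "0 \<le> m" "m = \<eta> \<or> m = d" by (rule exponents[OF adm x1 MN])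
    have Npos: "0 < real N" and Mpos: "0 < real M" using x1 by (simp_all add: Neq Meq)
    have pos: "0 < x powr r" for r using x1 by simp
    have \<nu>: "(1 - d - 2 * \<delta> - 9 * e) / 2 \<le> \<nu>" using N x1 by (simp add: Neq)
    have \<mu>: "2 * d + 2 * \<delta> + 9 * e \<le> \<mu>" using M x1 by (simp add: Meq)
    have MN\<gamma>: "(real M * real N) powr (\<gamma> - 1) = x powr (- w)" using x1 by (simp add: Meq Neq powr_add[symmetric] powr_powr w_def d_def algebra_simps)
    define \<sigma> where "\<sigma> = m + \<delta> + 4 * e"
    let ?X = "x powr (2 * (\<eta> + \<mu> + \<nu> - \<sigma>) + e)" and ?E = "\<mu> * (k + 1/2) + \<nu> * (l - k)" and ?r = "\<eta> + 2 * \<sigma> - w"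
    have \<sigma>0: "0 \<le> \<sigma>" using m \<delta> e by (simp add: \<sigma>_def)
    define Q where "Q = nat \<lceil>x powr (2 * \<sigma>)\<rceil>"
    have one: "1 \<le> x powr (2 * \<sigma>)" using x1 \<sigma>0 by (intro ge_one_powr_ge_zero) auto
    have Q: "x powr (2 * \<sigma>) \<le> real Q" "real Q \<le> 2 * x powr (2 * \<sigma>)" using one unfolding Q_def by linarith+
    \<comment> \<open>The target for \<open>type_one_term\<close>, up to x^e: H^2 M N R is the
      square of H M N x^(-\<sigma>).\<close>
    define R where "R = x powr (\<mu> + \<nu> - 2 * \<sigma>)"
    have R0: "0 < R" using x1 by (simp add: R_def)
    define B where "B = x powr e * R"
    have "S\<^sup>2 \<le> C * ((H * M * N)\<^sup>2 / Q + H\<^sup>2 * M * N * B)" unfolding S_def smooth_sum_def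
    proof (rule type_one)
      show "1 \<le> H" "0 \<le> u" "u \<le> 1" "finite hs" "\<And>h. h \<in> hs \<Longrightarrow> H \<le> real h \<and> real h \<le> 2 * H" using adm by (auto simp: admissible_def)
      show "1 \<le> N" "1 \<le> M" using Npos Mpos by auto
      show "1 \<le> Q" using one Q by linarith
      show "real Q \<le> z0 * real N"
      proof -
        have "2 * x powr (2 * \<sigma>) \<le> (z0 * x powr e) * x powr (2 * \<sigma>)" using xe(3) C by (intro mult_right_mono) (auto simp: field_simps)
        also have "\<dots> = z0 * x powr (e + 2 * \<sigma>)" by (simp add: powr_add)
        also have "\<dots> \<le> z0 * x powr \<nu>" using C x1 m \<nu> hyp \<delta> d e by (intro mult_left_mono) (auto simp: \<sigma>_def)
        finally show ?thesis using Q(2) by (simp add: Neq)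
      qed
      have up: "2 * H * Q * (real M * real N) powr (\<gamma> - 1) \<le> 4 * x powr (?r)"
      proof -
        have "2 * H * Q * (real M * real N) powr (\<gamma> - 1) \<le> 2 * H * (2 * x powr (2 * \<sigma>)) * (real M * real N) powr (\<gamma> - 1)"
          using Q(2) \<eta> by (intro mult_right_mono mult_left_mono) auto
        also have "\<dots> = 4 * x powr (?r)" unfolding MN\<gamma> \<eta>(1) by (simp add: powr_add[symmetric] algebra_simps)
        finally show ?thesis .
      qed
      show "2 * H * Q * (real M * real N) powr (\<gamma> - 1) \<le> N"
      proof -
        have "4 * x powr (?r) \<le> x powr e * x powr (?r)" using xe by (intro mult_right_mono) auto
        also have "\<dots> = x powr (e + (?r))" by (simp only: powr_add)
        also have "\<dots> \<le> N" unfolding Neq using x1 m \<nu> \<eta> w hyp \<delta> d e by (simp add: \<sigma>_def)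
        finally show ?thesis using up by linarith
      qed
      fix \<rho> :: real
      assume \<rho>: "H * (real M * real N) powr (\<gamma> - 1) \<le> \<rho>" "\<rho> \<le> 2 * H * Q * (real M * real N) powr (\<gamma> - 1)"
      have \<rho>1: "x powr (\<eta> - w) \<le> \<rho>" using \<rho>(1) unfolding MN\<gamma> \<eta>(1) by (simp add: powr_add[symmetric])
      have \<rho>2: "\<rho> \<le> 4 * x powr (?r)" using \<rho>(2) up by linarith
      have \<rho>0: "0 < \<rho>" using less_le_trans[OF pos \<rho>1] .
      have lx: "0 \<le> ln x" using x1 by simp
      have "N * (1 + 1 / \<rho>) * (1 + ln (2 * (1 + \<rho>) * M)) \<le> (2 * R) * (11 + c * ln x)"
      proof (rule mult_mono)
        have "1 / \<rho> \<le> 1 / x powr (\<eta> - w)" using \<rho>1 \<rho>0 x1 by (intro divide_left_mono) auto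
        also have "\<dots> = x powr (w - \<eta>)" by (simp add: powr_minus_divide[symmetric])
        finally have "N * (1 + 1 / \<rho>) \<le> N * (1 + x powr (w - \<eta>))" by (intro mult_left_mono) auto
        also have "\<dots> = x powr \<nu> + x powr (\<nu> + (w - \<eta>))" unfolding Neq powr_add by (simp only: distrib_left mult_1_right)
        also have "\<dots> \<le> R + R" unfolding R_def using x1 m \<mu> w e hyp \<eta> by (intro add_mono) (auto simp: \<sigma>_def)
        finally show "N * (1 + 1 / \<rho>) \<le> 2 * R" by simp
        have "1 + \<rho> \<le> 5 * x powr (\<eta> + 2 * \<sigma>)"
        proof -
          have "x powr (?r) \<le> x powr (\<eta> + 2 * \<sigma>)" using x1 w d \<mu>\<nu> e hyp \<delta> by (simp add: w_def)
          moreover have "1 \<le> x powr (\<eta> + 2 * \<sigma>)" using x1 \<sigma>0 \<eta> by (intro ge_one_powr_ge_zero) auto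
          ultimately show ?thesis using \<rho>2 by linarith
        qed
        then have "2 * (1 + \<rho>) * M \<le> 2 * (5 * x powr (\<eta> + 2 * \<sigma>)) * M" by (intro mult_right_mono mult_left_mono) auto
        also have "\<dots> = 10 * x powr (\<eta> + 2 * \<sigma> + \<mu>)" by (simp add: Meq powr_add)
        finally have "ln (2 * (1 + \<rho>) * M) \<le> ln (10 * x powr (\<eta> + 2 * \<sigma> + \<mu>))" using \<rho>0 Mpos by (intro ln_mono) auto
        also have "\<dots> = ln 10 + (\<eta> + 2 * \<sigma> + \<mu>) * ln x" using x1 by (simp add: ln_mult ln_powr)
        also have "ln (10::real) \<le> 10" using ln_le_minus_one[of "10::real"] by simp
        also have "(\<eta> + 2 * \<sigma> + \<mu>) * ln x \<le> c * ln x"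
        proof (rule mult_right_mono[OF _ lx])
          have "0 \<le> \<nu>" using \<nu> hyp \<delta> d e by argo
          then show "\<eta> + 2 * \<sigma> + \<mu> \<le> c" using \<eta> m d \<mu>\<nu> \<delta> e by (simp add: \<sigma>_def c_def)
        qed
        finally show "1 + ln (2 * (1 + \<rho>) * M) \<le> 11 + c * ln x" by simp
        have "1 \<le> 2 * (1 + \<rho>) * M" using \<rho>0 Mpos mult_mono[of 1 "2 * (1 + \<rho>)" 1 "real M"] by simp
        then show "0 \<le> 1 + ln (2 * (1 + \<rho>) * M)" using ln_ge_zero[of "2 * (1 + \<rho>) * M"] by simp
      qed (use R0 in auto)
      moreover have "(1 + \<rho>) * sqrt (M / \<rho>) * ((\<rho> * M) powr k * N powr (l - k)) \<le> 5 * R"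
      proof -
        \<comment> \<open>The product is split into two powers of \<rho> because k - 1/2 \<le> 0 < k
          + 1/2: one is largest at the smallest \<rho>, the other at the largest, and the two are
          estimated separately.\<close>
        have eq: "(1 + \<rho>) * sqrt (M / \<rho>) * ((\<rho> * M) powr k * N powr (l - k))
            = (\<rho> powr (k - 1/2) + \<rho> powr (k + 1/2)) * x powr (?E)"
        proof -
          have "sqrt (M / \<rho>) = real M powr (1/2) * \<rho> powr (- (1/2))"
            unfolding real_sqrt_divide powr_minus powr_half_sqrt[OF less_imp_le[OF \<rho>0]] powr_half_sqrt[OF of_nat_0_le_iff] by (simp add: divide_inverse)
          then have "(1 + \<rho>) * sqrt (M / \<rho>) * ((\<rho> * M) powr k * N powr (l - k))
             = (1 + \<rho>) * \<rho> powr (k - 1/2) * (real M powr (k + 1/2) * real N powr (l - k))"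
            using powr_add[of \<rho> k "- (1/2)"] powr_add[of "real M" k "1/2"] powr_mult[of \<rho> "real M" k] by (simp only: mult_ac diff_conv_add_uminus)
          also have "(1 + \<rho>) * \<rho> powr (k - 1/2) = \<rho> powr (k - 1/2) + \<rho> powr (k + 1/2)"
            using \<rho>0 powr_add[of \<rho> 1 "k - 1/2"] by (simp add: distrib_right add.commute)
          finally show ?thesis by (simp only: Meq Neq powr_powr powr_add distrib_left)
        qed
        \<comment> \<open>2q = 4k - 2l + 1 > 0. For a given product M N the available exponent thus
          increases with \<nu>, and the worst case is the shortest smooth variable.\<close>
        define q where "q = 1/2 - l + 2 * k"
        have q: "0 < q" "q \<le> 1" using kl k l by (auto simp: q_def)
        have low: "q * (1 - d - 2 * \<delta>) / 2 - 9/2 * e + (1/2 - k) - e / 4 \<le> (1/2 - k) * \<mu> + (1 - l + k) * \<nu>"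
        proof -
          have "q * ((1 - d - 2 * \<delta> - 9 * e) / 2) \<le> q * \<nu>" using \<nu> q by (intro mult_left_mono) auto
          moreover have "q * (9 * e / 2) \<le> 1 * (9 * e / 2)" using q e by (intro mult_right_mono) auto
          moreover have "(1/2 - k) * (1 - e / 2) \<le> (1/2 - k) * (\<mu> + \<nu>)" using \<mu>\<nu> k by (intro mult_left_mono) auto
          moreover have "(1/2 - k) * (e / 2) \<le> 1/2 * (e / 2)" using k e by (intro mult_right_mono) auto
          moreover have "(1/2 - k) * \<mu> + (1 - l + k) * \<nu> = q * \<nu> + (1/2 - k) * (\<mu> + \<nu>)" by (simp add: q_def field_simps)
          moreover have "q * ((1 - d - 2 * \<delta> - 9 * e) / 2) = q * (1 - d - 2 * \<delta>) / 2 - q * (9 * e / 2)" by (simp add: field_simps)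
          moreover have "(1/2 - k) * (1 - e / 2) = (1/2 - k) - (1/2 - k) * (e / 2)" by (simp add: algebra_simps)
          ultimately show ?thesis by linarith
        qed
        \<comment> \<open>Four times this inequality is \<open>hyp1\<close>: the coefficients 12k -
          2l + 13 and 20k - 4l + 16 arise here, and the multiples of e add up to 99 e, within the
          margin of 100 e.\<close>
        have key: "(k + 1/2) * (2 * d + 3 * \<delta>) + 2 * d + 2 * \<delta> + 20 * e \<le> q * (1 - d - 2 * \<delta>) / 2 - 9/2 * e + (1/2 - k) - e / 4"
          using hyp1 e by (simp add: q_def field_simps)
        have t1: "\<rho> powr (k - 1/2) * x powr (?E) \<le> R"
        proof -
          have "\<rho> powr (k - 1/2) \<le> (x powr (\<eta> - w)) powr (k - 1/2)" using \<rho>1 pos k by (intro powr_mono2') auto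
          then have "\<rho> powr (k - 1/2) * x powr (?E)
              \<le> x powr ((\<eta> - w) * (k - 1/2)) * x powr (?E)" by (intro mult_right_mono) (auto simp: powr_powr)
          also have "\<dots> = x powr ((1/2 - k) * (w - \<eta>) + (?E))" unfolding powr_add[symmetric] by (rule arg_cong[where f = "\<lambda>t. x powr t"]) (simp add: field_simps)
          also have "\<dots> \<le> R" unfolding R_def
          proof (rule powr_mono)
            have "(1/2 - k) * (w - \<eta>) \<le> (1/2 - k) * (d + e / 2 - m)" using w m k by (intro mult_left_mono) auto
            also have "\<dots> \<le> 1/2 * (d + e / 2 - m)" using k m e by (intro mult_right_mono) auto
            finally have "2 * \<sigma> + (1/2 - k) * (w - \<eta>) \<le> 2 * d + 2 * \<delta> + 20 * e" using m e by (simp add: \<sigma>_def)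
            moreover have "0 \<le> (k + 1/2) * (2 * d + 3 * \<delta>)" using k d \<delta> by simp
            ultimately have "2 * \<sigma> + (1/2 - k) * (w - \<eta>) \<le> (1/2 - k) * \<mu> + (1 - l + k) * \<nu>" using key low by linarith
            then show "(1/2 - k) * (w - \<eta>) + (?E) \<le> \<mu> + \<nu> - 2 * \<sigma>" by (simp add: algebra_simps)
          qed (use x1 in simp)
          finally show ?thesis .
        qed
        have t2: "\<rho> powr (k + 1/2) * x powr (?E) \<le> 4 * R"
        proof -
          have "\<rho> powr (k + 1/2) \<le> (4 * x powr (?r)) powr (k + 1/2)" using \<rho>0 \<rho>2 k by (intro powr_mono2) auto
          also have "\<dots> = 4 powr (k + 1/2) * x powr ((?r) * (k + 1/2))" by (simp add: powr_mult powr_powr)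
          also have "\<dots> \<le> 4 * x powr ((?r) * (k + 1/2))" using powr_mono[of "k + 1/2" 1 "4::real"] k by (intro mult_right_mono) auto
          finally have "\<rho> powr (k + 1/2) * x powr (?E)
              \<le> 4 * x powr ((?r) * (k + 1/2)) * x powr (?E)" by (intro mult_right_mono) auto
          also have "\<dots> = 4 * x powr ((k + 1/2) * (?r) + (?E))" by (simp only: powr_add mult_ac)
          also have "\<dots> \<le> 4 * R" unfolding R_def
          proof (intro mult_left_mono powr_mono)
            have "(k + 1/2) * (?r) \<le> (k + 1/2) * (2 * d + 3 * \<delta> + 10 * e)" using w m k \<eta> e by (intro mult_left_mono) (auto simp: \<sigma>_def)
            also have "\<dots> = (k + 1/2) * (2 * d + 3 * \<delta>) + (k + 1/2) * (10 * e)" by (simp add: algebra_simps)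
            also have "(k + 1/2) * (10 * e) \<le> 1 * (10 * e)" using k e by (intro mult_right_mono) auto
            finally have "2 * \<sigma> + (k + 1/2) * (?r) \<le> (1/2 - k) * \<mu> + (1 - l + k) * \<nu>" using m e key low by (simp add: \<sigma>_def)
            then show "(k + 1/2) * (?r) + (?E) \<le> \<mu> + \<nu> - 2 * \<sigma>" by (simp add: algebra_simps)
          qed (use x1 in simp_all)
          finally show ?thesis .
        qed
        show ?thesis unfolding eq using t1 t2 by (simp add: distrib_right)
      qed
      moreover have "(2 * R) * (11 + c * ln x) + 5 * R \<le> B"
      proof -
        have "11 \<le> 11 + c * ln x" using lx c0 by simp
        then have "2 * (11 + c * ln x) + 5 \<le> 3 * (11 + c * ln x)\<^sup>2" using mult_right_mono[of 11 "11 + c * ln x" "11 + c * ln x"] by (simp add: power2_eq_square)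
        then have "2 * (11 + c * ln x) + 5 \<le> x powr e" using xe(4) by linarith
        then have "R * (2 * (11 + c * ln x) + 5) \<le> R * x powr e" using R0 by (intro mult_left_mono) auto
        then show ?thesis by (simp add: B_def algebra_simps)
      qed
      ultimately show "type_one_term k l N M \<rho> \<le> B" unfolding type_one_term_def by linarith
    qed (use a n12 in auto)
    also have "\<dots> \<le> C * (?X + ?X)"
    proof (intro mult_left_mono add_mono)
      have "(H * M * N)\<^sup>2 / Q \<le> (H * M * N)\<^sup>2 / x powr (2 * \<sigma>)" using Q one by (intro divide_left_mono mult_pos_pos) auto
      also have "\<dots> = x powr (2 * (\<eta> + \<mu> + \<nu> - \<sigma>))"
        using x1 by (simp add: \<eta>(1) Meq Neq powr_add[symmetric] powr_diff[symmetric] powr_power algebra_simps)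
      also have "\<dots> \<le> ?X" using x1 e by simp
      finally show "(H * M * N)\<^sup>2 / Q \<le> ?X" .
      have "H\<^sup>2 * M * N * B = ?X" using x1 by (simp add: \<eta>(1) Meq Neq B_def R_def powr_add[symmetric] powr_power algebra_simps)
      then show "H\<^sup>2 * M * N * B \<le> ?X" by simp
    qed (use C in simp)
    also have "\<dots> = 2 * C * ?X" by simp
    also have "\<dots> \<le> x powr e * ?X" using xe by (intro mult_right_mono) auto
    also have "\<dots> = (x powr (\<eta> + (\<mu> + \<nu> - \<sigma> + e)))\<^sup>2" using x1 by (simp add: powr_add[symmetric] powr_power algebra_simps)
    finally have "S \<le> x powr (\<eta> + (\<mu> + \<nu> - \<sigma> + e))" by (rule power2_le_imp_le) simp
    moreover have "min \<eta> d + (\<mu> + \<nu> - \<sigma> + e) \<le> 1 - \<delta> - 2 * e" using \<mu>\<nu> e by (simp add: \<sigma>_def m_def)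
    ultimately show "min 1 (x powr d / H) * smooth_sum u \<alpha> hs a M n1 n2 \<le> x powr (1 - \<delta> - 2 * e)" unfolding \<eta>(1) S_def by (rule min_mult_le[OF x1])
  qed
qed
qed

text \<open>The three ranges cover all M: if M is not short and N is below the limit of the bilinear
  estimate, then M \<ge> x^(1 - e/2) / N is long enough for differencing, because 7d + 8\<delta> is
  covered by \<open>hyp\<close>.\<close>

lemma smooth_exponents:
  "\<exists>x0>1. \<forall>x\<ge>x0. \<forall>H u \<alpha> hs M N n1 n2. \<forall>a :: nat \<Rightarrow> complex. admissible x H u hs \<longrightarrow>
      (\<forall>m. norm (a m) \<le> 1) \<longrightarrow> N \<le> n1 \<longrightarrow> n2 \<le> 2 * N \<longrightarrow>
      x powr ((1 - d - 2 * \<delta> - 9 * e) / 2) \<le> real N \<longrightarrow>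
      in_range x M N \<longrightarrow>
      min 1 (x powr d / H) * smooth_sum u \<alpha> hs a M n1 n2
        \<le> x powr (1 - \<delta> - 2 * e)" using short_rough_exponents type_two_exponents long_smooth_exponents
proof (elim exE conjE, goal_cases)
  case (1 x1 x2 x3)
  note short = 1(2) and two = 1(4) and long = 1(6)
  show ?case
  proof (intro exI[of _ "max x1 (max x2 x3)"] conjI allI impI)
    show "1 < max x1 (max x2 x3)" using 1(1) by simp
    fix x H u \<alpha> :: real and hs :: "nat set" and M N n1 n2 :: nat and a :: "nat \<Rightarrow> complex"
    assume x: "max x1 (max x2 x3) \<le> x" and adm: "admissible x H u hs" and a: "\<forall>m. norm (a m) \<le> 1"
      and n12: "N \<le> n1" "n2 \<le> 2 * N" and N: "x powr ((1 - d - 2 * \<delta> - 9 * e) / 2) \<le> real N"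
      and MN: "in_range x M N"
    have xx: "x1 \<le> x" "x2 \<le> x" "x3 \<le> x" "1 < x" using x 1(1) by auto
    consider "real M \<le> x powr (d + 2 * \<delta> + 8 * e)"
      | "x powr (d + 2 * \<delta> + 8 * e) \<le> real M" "x powr (5 * d + 6 * \<delta> + 25 * e) \<le> real N"
      | "real N \<le> x powr (5 * d + 6 * \<delta> + 25 * e)" by linarith
    then show "min 1 (x powr d / H) * smooth_sum u \<alpha> hs a M n1 n2
        \<le> x powr (1 - \<delta> - 2 * e)"
    proof cases
      case 1
      show ?thesis by (rule short[rule_format, OF xx(1) adm a[rule_format] n12 1 MN])
    next
      case 2
      \<comment> \<open>The interval for n is encoded in coefficients, and the two variables
        exchange roles: here n is the one with exponent at least 5d + 6\<delta> + 25e.\<close>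
      define b :: "nat \<Rightarrow> complex" where "b n = (if n \<in> {n1..<n2} then 1 else 0)" for n
      have b: "norm (b n) \<le> 1" for n by (simp add: b_def)
      have swap: "(\<Sum>m\<in>{M..<2*M}. a m * (\<Sum>n\<in>{n1..<n2}. expi (twisted_phase \<gamma> u \<alpha> h (m * n))))
         = (\<Sum>n\<in>{N..<2*N}. \<Sum>m\<in>{M..<2*M}. b n * a m * expi (twisted_phase \<gamma> u \<alpha> h (n * m)))" for h
      proof -
        have "(\<Sum>n\<in>{n1..<n2}. expi (twisted_phase \<gamma> u \<alpha> h (m * n))) = (\<Sum>n\<in>{N..<2*N}. b n * expi (twisted_phase \<gamma> u \<alpha> h (m * n)))" for m
          using n12 by (intro sum.mono_neutral_cong_left) (auto simp: b_def)
        then have "(\<Sum>m\<in>{M..<2*M}. a m * (\<Sum>n\<in>{n1..<n2}. expi (twisted_phase \<gamma> u \<alpha> h (m * n))))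
          = (\<Sum>m\<in>{M..<2*M}. \<Sum>n\<in>{N..<2*N}. b n * a m * expi (twisted_phase \<gamma> u \<alpha> h (n * m)))" by (simp add: sum_distrib_left mult_ac)
        then show ?thesis by (subst sum.swap)
      qed
      show ?thesis unfolding smooth_sum_def swap by (rule two[rule_format, OF xx(2) adm b a[rule_format] 2, unfolded bilinear_sum_def])
          (use MN in \<open>simp add: in_range_def mult.commute\<close>)
    next
      case 3
      have Npos: "0 < real N" using xx by (intro less_le_trans[OF _ N]) simp
      have "x powr (2 * d + 2 * \<delta> + 9 * e) * real N \<le> x powr (2 * d + 2 * \<delta> + 9 * e) * x powr (5 * d + 6 * \<delta> + 25 * e)"
        using 3 by (intro mult_left_mono) auto
      also have "\<dots> = x powr (2 * d + 2 * \<delta> + 9 * e + (5 * d + 6 * \<delta> + 25 * e))" by (simp only: powr_add)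
      also have "\<dots> \<le> x powr (1 - e / 2)"
      proof (rule powr_mono)
        show "2 * d + 2 * \<delta> + 9 * e + (5 * d + 6 * \<delta> + 25 * e) \<le> 1 - e / 2" using hyp e \<delta> d by argo
      qed (use xx in simp)
      also have "\<dots> \<le> real M * real N" using MN by (simp add: in_range_def)
      finally have "x powr (2 * d + 2 * \<delta> + 9 * e) \<le> real M" using Npos by simp
      then show ?thesis by (rule long[rule_format, OF xx(3) adm a[rule_format] n12 _ N MN])
    qed
  qed
qed

section \<open>Normalising coefficients and grouping variables\<close>

lemma scale_bilinear:
  fixes f g :: "nat \<Rightarrow> complex"
  assumes bound: "\<And>a b. (\<forall>m. norm (a m :: complex) \<le> 1) \<Longrightarrow> (\<forall>n. norm (b n :: complex) \<le> 1) \<Longrightarrow>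
      c * (\<Sum>h\<in>hs. norm (\<Sum>m\<in>A. \<Sum>n\<in>B. a m * b n * E h m n)) \<le> R"
    and D: "0 < D" and f: "\<And>m. m \<in> A \<Longrightarrow> norm (f m) \<le> D" and g: "\<And>n. n \<in> B \<Longrightarrow> norm (g n) \<le> D"
  shows "c * (\<Sum>h\<in>hs. norm (\<Sum>m\<in>A. \<Sum>n\<in>B. f m * g n * E h m n)) \<le> D\<^sup>2 * R"
proof -
  define a where "a m = (if m \<in> A then f m / of_real D else 0)" for m
  define b where "b n = (if n \<in> B then g n / of_real D else 0)" for n
  have ab: "\<forall>m. norm (a m) \<le> 1" "\<forall>n. norm (b n) \<le> 1" using f g D by (auto simp: a_def b_def norm_divide)
  have "norm (\<Sum>m\<in>A. \<Sum>n\<in>B. f m * g n * E h m n) = D\<^sup>2 * norm (\<Sum>m\<in>A. \<Sum>n\<in>B. a m * b n * E h m n)" for h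
  proof -
    have "(\<Sum>m\<in>A. \<Sum>n\<in>B. f m * g n * E h m n) = (\<Sum>m\<in>A. \<Sum>n\<in>B. (of_real D)\<^sup>2 * (a m * b n * E h m n))"
      using D by (intro sum.cong refl) (simp add: a_def b_def power2_eq_square)
    also have "\<dots> = (of_real D)\<^sup>2 * (\<Sum>m\<in>A. \<Sum>n\<in>B. a m * b n * E h m n)" by (simp only: sum_distrib_left)
    finally show ?thesis using D by (simp add: norm_mult norm_power)
  qed
  then have "c * (\<Sum>h\<in>hs. norm (\<Sum>m\<in>A. \<Sum>n\<in>B. f m * g n * E h m n)) = D\<^sup>2 * (c * (\<Sum>h\<in>hs. norm (\<Sum>m\<in>A. \<Sum>n\<in>B. a m * b n * E h m n)))"
    by (simp add: sum_distrib_left mult_ac)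
  also have "\<dots> \<le> D\<^sup>2 * R" using bound[OF ab] by (rule mult_left_mono) simp
  finally show ?thesis .
qed

lemma scale_linear:
  fixes f :: "nat \<Rightarrow> complex"
  assumes bound: "\<And>a. (\<forall>m. norm (a m :: complex) \<le> 1) \<Longrightarrow> c * (\<Sum>h\<in>hs. norm (\<Sum>m\<in>A. a m * G h m)) \<le> R"
    and D: "0 < D" and f: "\<And>m. m \<in> A \<Longrightarrow> norm (f m) \<le> D"
  shows "c * (\<Sum>h\<in>hs. norm (\<Sum>m\<in>A. f m * G h m)) \<le> D * R"
proof -
  define a where "a m = (if m \<in> A then f m / of_real D else 0)" for m
  have a: "\<forall>m. norm (a m) \<le> 1" using f D by (auto simp: a_def norm_divide)
  have "norm (\<Sum>m\<in>A. f m * G h m) = D * norm (\<Sum>m\<in>A. a m * G h m)" for h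
  proof -
    have "(\<Sum>m\<in>A. f m * G h m) = (\<Sum>m\<in>A. of_real D * (a m * G h m))" using D by (intro sum.cong refl) (simp add: a_def)
    also have "\<dots> = of_real D * (\<Sum>m\<in>A. a m * G h m)" by (simp only: sum_distrib_left)
    finally show ?thesis using D by (simp add: norm_mult)
  qed
  then have "c * (\<Sum>h\<in>hs. norm (\<Sum>m\<in>A. f m * G h m)) = D * (c * (\<Sum>h\<in>hs. norm (\<Sum>m\<in>A. a m * G h m)))" by (simp add: sum_distrib_left mult_ac)
  also have "\<dots> \<le> D * R" using bound[OF a] D by (intro mult_left_mono) auto
  finally show ?thesis .
qed

lemma list_all2_nths: "list_all2 P xs ys \<Longrightarrow> list_all2 P (nths xs T) (nths ys T)" by (induction xs ys arbitrary: T rule: list_all2_induct) (auto simp: nths_Cons)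

lemma sum_list_nths: "sum_list (nths js T) = (\<Sum>i<length js. if i \<in> T then js ! i else (0 :: nat))"
  by (induction js arbitrary: T) (simp_all add: nths_Cons sum.lessThan_Suc_shift del: sum.lessThan_Suc cong: if_cong)

lemma sum_dyadic_blocks:
  fixes f :: "nat \<Rightarrow> complex"
  shows "(\<Sum>n\<in>{2 ^ A..<2 ^ (A + c)}. f n) = (\<Sum>t<c. \<Sum>n\<in>{2 ^ (A + t)..<2 * 2 ^ (A + t)}. f n)"
proof (induction c)
  case (Suc c)
  have "(\<Sum>n\<in>{2 ^ A..<2 ^ (A + Suc c)}. f n) = (\<Sum>n\<in>{2 ^ A..<2 ^ (A + c)}. f n) + (\<Sum>n\<in>{2 ^ (A + c)..<2 ^ (A + Suc c)}. f n)"
    by (rule sum.atLeastLessThan_concat[symmetric]) (auto intro!: power_increasing)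
  then show ?case using Suc.IH by simp
qed simp

text \<open>An interval with q \<le> p is allowed and gives the zero function, which covers empty
  blocks.\<close>

definition smooth_at :: "nat \<Rightarrow> (nat \<Rightarrow> complex) \<Rightarrow> bool" where
  "smooth_at j g \<longleftrightarrow> (\<exists>p q. 2 ^ j \<le> p \<and> q \<le> 2 ^ Suc j \<and> g = (\<lambda>n. if n \<in> {p..<q} then 1 else 0))"

lemma sum_list_nths_Compl: "sum_list (nths js T) + sum_list (nths js (- T)) = sum_list (js :: nat list)"
proof -
  have "sum_list js = (\<Sum>i<length js. js ! i)" by (simp add: sum_list_sum_nth atLeast0LessThan)
  also have "\<dots> = (\<Sum>i<length js. (if i \<in> T then js ! i else 0) + (if i \<in> - T then js ! i else 0))" by (intro sum.cong) auto
  finally show ?thesis by (simp only: sum_list_nths sum.distrib)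
qed

lemma length_nths_le: "length (nths xs T) \<le> length xs" by (induction xs arbitrary: T) (auto simp: nths_Cons le_SucI)

lemma nths_nth_singleton: "i < length xs \<Longrightarrow> nths xs {i} = [xs ! i]"
proof (induction xs arbitrary: i)
  case (Cons a xs)
  show ?case
  proof (cases i)
    case 0
    then show ?thesis by (simp add: nths_Cons)
  next
    case (Suc j)
    then have "{m. Suc m \<in> {i}} = {j}" by auto
    then show ?thesis using Suc Cons by (simp add: nths_Cons)
  qed
qed simp

lemma lsum_eq_blocks:
  assumes "list_all2 supported_at js gs"
  shows "lsum X gs F = (\<Sum>t<length gs + 1. \<Sum>n\<in>{2 ^ (sum_list js + t)..<2 * 2 ^ (sum_list js + t)}. coef X gs n * F n)"
  using lsum_eq_coef[OF assms, of X F] list_all2_lengthD[OF assms] sum_dyadic_blocks[of _ "sum_list js" "length gs + 1"] by (simp only: add.assoc)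

text \<open>The product of r variables from dyadic blocks spreads over at most r + 1 dyadic blocks.
  Each of the two groups is cut accordingly, and the bilinear bound is used for every pair of
  blocks.\<close>

lemma family_norm_two_blocks:
  fixes T :: "nat set"
  assumes supp: "list_all2 supported_at js gs" and c: "0 \<le> c"
  defines "A \<equiv> sum_list (nths js T)" and "B \<equiv> sum_list (nths js (- T))"
  assumes bound: "\<And>t t'. t \<le> length gs \<Longrightarrow> t' \<le> length gs \<Longrightarrow>
      c * (\<Sum>h\<in>hs. norm (\<Sum>m\<in>{2 ^ (B + t')..<2 * 2 ^ (B + t')}. \<Sum>n\<in>{2 ^ (A + t)..<2 * 2 ^ (A + t)}.
        coef X (nths gs (- T)) m * coef X (nths gs T) n * F h (m * n))) \<le> R"
    and R: "0 \<le> R"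
  shows "c * family_norm X hs F gs \<le> (real (length gs) + 1)\<^sup>2 * R"
proof -
  define a b where "a = length (nths gs T) + 1" and "b = length (nths gs (- T)) + 1"
  define G where "G t t' h = (\<Sum>m\<in>{2 ^ (B + t')..<2 * 2 ^ (B + t')}. \<Sum>n\<in>{2 ^ (A + t)..<2 * 2 ^ (A + t)}.
        coef X (nths gs (- T)) m * coef X (nths gs T) n * F h (m * n))" for t t' h
  have ab: "a \<le> length gs + 1" "b \<le> length gs + 1" by (simp_all add: a_def b_def length_nths_le)
  have "lsum X gs (F h) = (\<Sum>t<a. \<Sum>t'<b. G t t' h)" for h
  proof -
    have "lsum X gs (F h) = (\<Sum>t<a. \<Sum>n\<in>{2 ^ (A + t)..<2 * 2 ^ (A + t)}. coef X (nths gs T) n *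
        (\<Sum>t'<b. \<Sum>m\<in>{2 ^ (B + t')..<2 * 2 ^ (B + t')}. coef X (nths gs (- T)) m * F h (n * m)))"
      unfolding lsum_split[of X gs _ T] lsum_eq_blocks[OF list_all2_nths[OF supp]] a_def b_def A_def B_def ..
    also have "\<dots> = (\<Sum>t<a. \<Sum>n\<in>{2 ^ (A + t)..<2 * 2 ^ (A + t)}. \<Sum>t'<b. \<Sum>m\<in>{2 ^ (B + t')..<2 * 2 ^ (B + t')}.
        coef X (nths gs (- T)) m * coef X (nths gs T) n * F h (m * n))" unfolding sum_distrib_left by (intro sum.cong refl) (simp only: mult_ac)
    also have "\<dots> = (\<Sum>t<a. \<Sum>t'<b. G t t' h)" unfolding G_def
    proof (rule sum.cong[OF refl], goal_cases)
      case (1 t)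
      show ?case by (subst sum.swap, rule sum.cong[OF refl], rule sum.swap)
    qed
    finally show ?thesis .
  qed
  then have "c * family_norm X hs F gs \<le> c * (\<Sum>h\<in>hs. \<Sum>t<a. \<Sum>t'<b. norm (G t t' h))"
    unfolding family_norm_def using c by (intro mult_left_mono sum_mono) (auto intro!: sum_norm_le)
  also have "(\<Sum>h\<in>hs. \<Sum>t<a. \<Sum>t'<b. norm (G t t' h)) = (\<Sum>t<a. \<Sum>t'<b. \<Sum>h\<in>hs. norm (G t t' h))"
  proof -
    have "(\<Sum>h\<in>hs. \<Sum>t<a. \<Sum>t'<b. norm (G t t' h)) = (\<Sum>t<a. \<Sum>h\<in>hs. \<Sum>t'<b. norm (G t t' h))" by (rule sum.swap)
    also have "\<dots> = (\<Sum>t<a. \<Sum>t'<b. \<Sum>h\<in>hs. norm (G t t' h))" by (intro sum.cong refl sum.swap)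
    finally show ?thesis .
  qed
  also have "c * \<dots> = (\<Sum>t<a. \<Sum>t'<b. c * (\<Sum>h\<in>hs. norm (G t t' h)))" by (simp only: sum_distrib_left)
  also have "\<dots> \<le> (\<Sum>t<a. \<Sum>t'<b. R)" unfolding G_def using ab by (intro sum_mono bound) auto
  also have "\<dots> = real a * real b * R" by simp
  also have "\<dots> \<le> (real (length gs) + 1) * (real (length gs) + 1) * R" using ab R by (intro mult_right_mono mult_mono) auto
  finally show ?thesis by (simp add: power2_eq_square)
qed

text \<open>The variable at position \<open>i\<close> keeps its interval, intersected with the range
  1, ..., X of \<open>lsum\<close>; only the product of the others is cut into blocks.\<close>

lemma family_norm_smooth_blocks:
  assumes supp: "list_all2 supported_at js gs" and c: "0 \<le> c" and i: "i < length gs"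
    and g: "gs ! i = (\<lambda>n. if n \<in> {p..<q} then 1 else 0)"
  defines "B \<equiv> sum_list (nths js (- {i}))"
  assumes bound: "\<And>t. t \<le> length gs \<Longrightarrow>
      c * (\<Sum>h\<in>hs. norm (\<Sum>m\<in>{2 ^ (B + t)..<2 * 2 ^ (B + t)}. coef X (nths gs (- {i})) m * (\<Sum>n\<in>{max 1 p..<min q (Suc X)}. F h (m * n)))) \<le> R"
    and R: "0 \<le> R"
  shows "c * family_norm X hs F gs \<le> (real (length gs) + 1) * R"
proof -
  define b where "b = length (nths gs (- {i})) + 1"
  define G where "G t h = (\<Sum>m\<in>{2 ^ (B + t)..<2 * 2 ^ (B + t)}. coef X (nths gs (- {i})) m * (\<Sum>n\<in>{max 1 p..<min q (Suc X)}. F h (m * n)))" for t h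
  have b: "b \<le> length gs + 1" by (simp add: b_def length_nths_le)
  have "lsum X gs (F h) = (\<Sum>t<b. G t h)" for h
  proof -
    have "lsum X (nths gs {i}) F' = (\<Sum>n\<in>{max 1 p..<min q (Suc X)}. F' n)" for F'
    proof -
      have "lsum X (nths gs {i}) F' = (\<Sum>n\<in>{1..X}. (if n \<in> {p..<q} then 1 else 0) * F' n)" by (simp add: nths_nth_singleton[OF i] g lsum_Cons)
      also have "\<dots> = (\<Sum>n\<in>{max 1 p..<min q (Suc X)}. F' n)" by (rule sum.mono_neutral_cong_right) auto
      finally show ?thesis .
    qed
    then show ?thesis unfolding lsum_split[of X gs _ "- {i}"] double_complement lsum_eq_blocks[OF list_all2_nths[OF supp]] b_def B_def G_def by simp
  qed
  then have "c * family_norm X hs F gs \<le> c * (\<Sum>h\<in>hs. \<Sum>t<b. norm (G t h))"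
    unfolding family_norm_def using c by (intro mult_left_mono sum_mono) (auto intro!: sum_norm_le)
  also have "(\<Sum>h\<in>hs. \<Sum>t<b. norm (G t h)) = (\<Sum>t<b. \<Sum>h\<in>hs. norm (G t h))" by (rule sum.swap)
  also have "c * \<dots> = (\<Sum>t<b. c * (\<Sum>h\<in>hs. norm (G t h)))" by (simp only: sum_distrib_left)
  also have "\<dots> \<le> (\<Sum>t<b. R)" unfolding G_def using b by (intro sum_mono bound) auto
  also have "\<dots> \<le> (real (length gs) + 1) * R" using b R by (simp add: mult_right_mono)
  finally show ?thesis .
qed

text \<open>\<open>exponent_splitting\<close> decides between a long smooth variable and a group of
  variables whose product lies in the window of the bilinear estimate. The convolution coefficients
  of the groups are normalised by the divisor bound at the cost of powers of x^(e/100).\<close>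

lemma unrestricted_piece_bound:
  "\<exists>x0>1. \<forall>x\<ge>x0. \<forall>H u \<alpha> hs X gs js. admissible x H u hs \<longrightarrow> length gs \<le> 6 \<longrightarrow> list_all2 supported_at js gs \<longrightarrow>
      (\<forall>i<length gs. smooth_at (js ! i) (gs ! i) \<or> 2 ^ (js ! i) \<le> x powr (1/3 + e)) \<longrightarrow>
      x \<le> 128 * 2 ^ sum_list js \<longrightarrow> 2 ^ sum_list js \<le> 2 * x \<longrightarrow>
      min 1 (x powr d / H) * family_norm X hs (\<lambda>h k. expi (twisted_phase \<gamma> u \<alpha> h k)) gs \<le> x powr (1 - \<delta> - 17 / 10 * e)"
proof -
  have e100: "0 < e / 100" using e by simp
  obtain C where C: "1 \<le> C" "\<And>n. 0 < n \<Longrightarrow> real (card {d. d dvd n}) \<le> C * real n powr (e / 100)" using divisor_bound[OF e100] by blast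
  show ?thesis using smooth_exponents type_two_exponents
      exists_powr_ge[OF e100, of "max (C ^ 6) 256"]
  proof (elim exE conjE, goal_cases)
  case (1 x1 x2 x3)
  note smooth = 1(2) and two = 1(4) and xlarge = 1(6)
  show ?case
  proof (intro exI[of _ "max x1 (max x2 x3)"] conjI allI impI)
    show "1 < max x1 (max x2 x3)" using 1(1) by simp
    fix x H u \<alpha> :: real and hs :: "nat set" and X and gs :: "(nat \<Rightarrow> complex) list" and js :: "nat list"
    assume x: "max x1 (max x2 x3) \<le> x" and adm: "admissible x H u hs" and len: "length gs \<le> 6"
      and supp: "list_all2 supported_at js gs"
      and cls: "\<forall>i<length gs. smooth_at (js ! i) (gs ! i) \<or> 2 ^ (js ! i) \<le> x powr (1/3 + e)"
      and S1: "x \<le> 128 * 2 ^ sum_list js" and S2: "2 ^ sum_list js \<le> 2 * x"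
    have xx: "x1 \<le> x" "x2 \<le> x" "1 < x" using x 1(1) by auto
    define S where "S = sum_list js"
    let ?lhs = "min 1 (x powr d / H) * family_norm X hs (\<lambda>h k. expi (twisted_phase \<gamma> u \<alpha> h k)) gs"
    define y where "y = x powr (e / 100)"
    have y: "C ^ 6 \<le> y" "256 \<le> y" using xlarge[rule_format, of x] x by (auto simp: y_def)
    have e1: "e \<le> 1 / 100" using hyp d \<delta> by argo
    have yx: "y \<le> x" using powr_mono[of "e / 100" 1 x] xx e1 by (simp add: y_def)
    have ypow: "y ^ i = x powr (real i * (e / 100))" for i using xx by (simp add: y_def powr_power mult.commute)
    \<comment> \<open>13 = 1 + 2 * 6: six divisor functions of numbers up to x^2, each at most C *
      y^2, and C^6 \<le> y.\<close>
    define D where "D = x powr (13 / 100 * e)"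
    have D: "1 \<le> D" unfolding D_def using xx e by (intro ge_one_powr_ge_zero) auto
    have D13: "D = y ^ 13" by (simp add: ypow D_def)
    have coefD: "norm (coef X (nths gs T) n) \<le> D" if n: "0 < n" "n < 2 ^ (S + 7)" for T n
    proof -
      let ?c = "real (card {d. d dvd n})"
      have "real n \<le> 2 ^ (S + 7)" using n(2) by (metis less_imp_le of_nat_le_iff of_nat_numeral of_nat_power)
      also have "\<dots> \<le> 256 * x" using S2 by (simp add: S_def power_add)
      also have "\<dots> \<le> x * x" using y yx xx by (intro mult_right_mono) auto
      finally have nx: "real n \<le> x powr 2" using xx by (simp add: power2_eq_square)
      have "finite {d. d dvd n}" "n \<in> {d. d dvd n}" using n by auto
      then have c1: "1 \<le> ?c" by (metis card_gt_0_iff empty_iff of_nat_1 of_nat_le_iff One_nat_def Suc_le_eq)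
      have "real n powr (e / 100) \<le> (x powr 2) powr (e / 100)" using nx e by (intro powr_mono2) auto
      also have "\<dots> = y ^ 2" by (simp add: ypow powr_powr)
      finally have n2: "real n powr (e / 100) \<le> y ^ 2" .
      have "norm (coef X (nths gs T) n) \<le> ?c ^ length (nths gs T)" by (rule norm_coef_le[OF list_all2_nths[OF supp] n(1)])
      also have "\<dots> \<le> ?c ^ 6" using c1 len length_nths_le[of gs T] by (intro power_increasing) auto
      also have "\<dots> \<le> (C * y ^ 2) ^ 6" using C(2)[OF n(1)] n2 C(1) by (intro power_mono order_trans[OF C(2)[OF n(1)]] mult_left_mono) auto
      also have "\<dots> = C ^ 6 * y ^ 12" by (simp add: power_mult_distrib power_mult[symmetric])
      also have "\<dots> \<le> y * y ^ 12" using y by (intro mult_right_mono) auto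
      also have "\<dots> = D" by (simp add: D13 power_Suc[symmetric])
      finally show ?thesis .
    qed
    \<comment> \<open>With this unit 2^A = x^(A * lam), so block exponents become exponents of x and
      can be fed into \<open>exponent_splitting\<close>.\<close>
    define lam where "lam = log x 2"
    have lam: "0 < lam" using xx by (simp add: lam_def)
    have pw: "2 ^ A = x powr (real A * lam)" for A
    proof -
      have "x powr (lam * real A) = (x powr lam) powr real A" by (simp add: powr_powr)
      also have "x powr lam = 2" using xx by (simp add: lam_def)
      finally show ?thesis by (simp add: powr_realpow mult.commute)
    qed
    have Slow: "1 - e / 100 \<le> real S * lam"
    proof -
      have "x powr 1 \<le> 128 * x powr (real S * lam)" using S1 xx by (simp add: S_def[symmetric] pw[symmetric])
      also have "\<dots> \<le> y * x powr (real S * lam)" using y by (intro mult_right_mono) auto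
      also have "\<dots> = x powr (e / 100 + real S * lam)" by (simp add: y_def powr_add)
      finally show ?thesis using xx by (simp only: powr_le_cancel_iff)
    qed
    have Supp: "real S * lam \<le> 1 + e / 100"
    proof -
      have "x powr (real S * lam) \<le> 2 * x" using S2 by (simp add: S_def[symmetric] pw[symmetric])
      also have "\<dots> \<le> y * x" using y xx by (intro mult_right_mono) auto
      also have "\<dots> = x powr (1 + e / 100)" using xx by (simp add: y_def powr_add)
      finally show ?thesis using xx by (simp only: powr_le_cancel_iff)
    qed
    have prod_bounds: "x powr (1 - e / 2) \<le> 2 ^ (S + t)" "2 ^ (S + t) \<le> x powr (1 + e / 2)" if t: "t \<le> 12" for t
    proof -
      have "x powr (1 - e / 2) \<le> x powr (real S * lam)" using xx Slow e by (intro powr_mono) auto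
      also have "\<dots> \<le> 2 ^ (S + t)" unfolding pw[symmetric] by (intro power_increasing) auto
      finally show "x powr (1 - e / 2) \<le> 2 ^ (S + t)" .
      have "(2::real) ^ (S + t) \<le> 2 ^ (S + 12)" using t by (intro power_increasing) auto
      also have "\<dots> = 4096 * 2 ^ S" by (simp add: power_add)
      also have "\<dots> \<le> y ^ 2 * 2 ^ S" using power_mono[OF y(2), of 2] by (intro mult_right_mono) auto
      also have "\<dots> = x powr (real S * lam + e / 50)" by (simp add: pw ypow powr_add)
      also have "\<dots> \<le> x powr (1 + e / 2)" using xx Supp e by (intro powr_mono) auto
      finally show "2 ^ (S + t) \<le> x powr (1 + e / 2)" .
    qed
    define E where "E i = real (js ! i) * lam" for i
    have ljs: "length js = length gs" using supp by (rule list_all2_lengthD)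
    have sumE: "sum E T = real (sum_list (nths js T)) * lam" if T: "T \<subseteq> {..<length gs}" for T
    proof -
      have "sum_list (nths js T) = (\<Sum>i\<in>T. js ! i)" unfolding sum_list_nths ljs using T by (simp add: sum.If_cases Int_absorb1)
      then show ?thesis by (simp add: E_def sum_distrib_right)
    qed
    have sumI: "sum E {..<length gs} = real S * lam" using sumE[of "{..<length gs}"] ljs by (simp add: nths_all S_def)
    \<comment> \<open>The requirement v' \<ge> 1/3 + e for the Moebius variables is where 15d/2 +
      9\<delta> < 1 enters: it is 5d + 6\<delta> < 2/3 multiplied by 3/2. A product of at most x^v'
      leaves the complementary group at least x^(5d + 6\<delta> + 25e).\<close>
    define u' v' where "u' = d + 2 * \<delta> + 8 * e" and "v' = 1 - 5 * d - 6 * \<delta> - 27 * e"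
    have split: "(\<exists>i\<in>{..<length gs} \<inter> {i. smooth_at (js ! i) (gs ! i)}. (1 - u' - e / 100) / 2 \<le> E i)
        \<or> (\<exists>T\<subseteq>{..<length gs}. u' \<le> sum E T \<and> sum E T \<le> v')"
    proof (rule exponent_splitting)
      show "0 \<le> E i" for i using lam by (simp add: E_def)
      show "1 - e / 100 \<le> sum E {..<length gs}" "sum E {..<length gs} \<le> 1 + e / 100" unfolding sumI by (rule Slow, rule Supp)
      show "0 < u'" "5 * u' < 1 - e / 100" "1 + e / 100 < 3 * v'" "u' < 1/5" "1/3 < v'" unfolding u'_def v'_def using hyp d \<delta> e by argo+
      fix i assume "i \<in> {..<length gs}" "i \<notin> {i. smooth_at (js ! i) (gs ! i)}"
      then have "x powr E i \<le> x powr (1/3 + e)" using cls by (auto simp: E_def pw[symmetric])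
      then have "E i \<le> 1/3 + e" using xx by (simp only: powr_le_cancel_iff)
      then show "E i \<le> v'" unfolding v'_def using hyp d \<delta> e by argo
    qed simp
    have c0: "0 \<le> min 1 (x powr d / H)" using adm by (auto simp: admissible_def)
    have len1: "real (length gs) + 1 \<le> 7" using len by simp
    define R where "R = D\<^sup>2 * x powr (1 - \<delta> - 2 * e)"
    have R: "0 \<le> R" by (simp add: R_def)
    have "?lhs \<le> 49 * R" using split
    proof (elim disjE bexE exE conjE)
      fix T assume T: "T \<subseteq> {..<length gs}" "u' \<le> sum E T" "sum E T \<le> v'"
      define A B where "A = sum_list (nths js T)" and "B = sum_list (nths js (- T))"
      have AB: "A + B = S" by (simp add: A_def B_def S_def sum_list_nths_Compl)
      have A1: "x powr u' \<le> 2 ^ A" "(2::real) ^ A \<le> x powr v'" using T xx by (auto simp: sumE[OF T(1)] pw A_def)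
      have B1: "x powr (1 - e / 100 - v') \<le> 2 ^ B"
      proof -
        have "real S * lam = real A * lam + real B * lam" by (simp add: AB[symmetric] distrib_right)
        moreover have "real A * lam \<le> v'" using T by (simp add: sumE[OF T(1)] A_def)
        ultimately show ?thesis unfolding pw using xx Slow by (intro powr_mono) auto
      qed
      have "?lhs \<le> (real (length gs) + 1)\<^sup>2 * R"
      proof (rule family_norm_two_blocks[where T = T, OF supp c0 _ R], fold A_def B_def)
        fix t t' assume t: "t \<le> length gs" "t' \<le> length gs"
        show "min 1 (x powr d / H) * (\<Sum>h\<in>hs. norm (\<Sum>m\<in>{2 ^ (B + t')..<2 * 2 ^ (B + t')}. \<Sum>n\<in>{2 ^ (A + t)..<2 * 2 ^ (A + t)}.
          coef X (nths gs (- T)) m * coef X (nths gs T) n * expi (twisted_phase \<gamma> u \<alpha> h (m * n)))) \<le> R" unfolding R_def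
        proof (rule scale_bilinear)
          fix a b :: "nat \<Rightarrow> complex" assume ab: "\<forall>m. norm (a m) \<le> 1" "\<forall>n. norm (b n) \<le> 1"
          have prod: "real (2 ^ (B + t')) * real (2 ^ (A + t)) = 2 ^ (S + (t + t'))" by (simp add: AB[symmetric] power_add)
          show "min 1 (x powr d / H) * (\<Sum>h\<in>hs. norm (\<Sum>m\<in>{2 ^ (B + t')..<2 * 2 ^ (B + t')}. \<Sum>n\<in>{2 ^ (A + t)..<2 * 2 ^ (A + t)}.
            a m * b n * expi (twisted_phase \<gamma> u \<alpha> h (m * n)))) \<le> x powr (1 - \<delta> - 2 * e)"
          proof (rule two[unfolded bilinear_sum_def, rule_format, OF xx(2) adm ab[rule_format]])
            have pw_mono: "(2::real) ^ A \<le> 2 ^ (A + t)" "(2::real) ^ B \<le> 2 ^ (B + t')" by (auto intro: power_increasing)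
            have "x powr (5 * d + 6 * \<delta> + 25 * e) \<le> x powr (1 - e / 100 - v')" using xx e by (intro powr_mono) (auto simp: v'_def)
            then show "x powr (d + 2 * \<delta> + 8 * e) \<le> real (2 ^ (A + t))" "x powr (5 * d + 6 * \<delta> + 25 * e) \<le> real (2 ^ (B + t'))"
              using order_trans[OF A1(1) pw_mono(1)] order_trans[OF B1 pw_mono(2)] by (simp_all only: u'_def of_nat_power of_nat_numeral)
          qed (use prod prod_bounds[of "t + t'"] t len in \<open>auto simp: in_range_def\<close>)
        next
          have SA: "A + t + 1 \<le> S + 7" "B + t' + 1 \<le> S + 7" using AB t len by auto
          show "norm (coef X (nths gs (- T)) m) \<le> D" if "m \<in> {2 ^ (B + t')..<2 * 2 ^ (B + t')}" for m
          proof (rule coefD)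
            show "0 < m" using that by (auto intro: less_le_trans[OF zero_less_power[of "2::nat"]])
            have "(2::nat) ^ (B + t' + 1) \<le> 2 ^ (S + 7)" using SA by (intro power_increasing) auto
            then show "m < 2 ^ (S + 7)" using that by (auto intro: less_le_trans)
          qed
          show "norm (coef X (nths gs T) n) \<le> D" if "n \<in> {2 ^ (A + t)..<2 * 2 ^ (A + t)}" for n
          proof (rule coefD)
            show "0 < n" using that by (auto intro: less_le_trans[OF zero_less_power[of "2::nat"]])
            have "(2::nat) ^ (A + t + 1) \<le> 2 ^ (S + 7)" using SA by (intro power_increasing) auto
            then show "n < 2 ^ (S + 7)" using that by (auto intro: less_le_trans)
          qed
        qed (use D in simp)
      qed
      also have "\<dots> \<le> 7\<^sup>2 * R" using len1 R by (intro mult_right_mono power_mono) auto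
      finally show ?thesis by simp
    next
      fix i assume i: "i \<in> {..<length gs} \<inter> {i. smooth_at (js ! i) (gs ! i)}" "(1 - u' - e / 100) / 2 \<le> E i"
      then have il: "i < length gs" by simp
      obtain p q where pq: "2 ^ (js ! i) \<le> p" "q \<le> 2 ^ Suc (js ! i)" "gs ! i = (\<lambda>n. if n \<in> {p..<q} then 1 else 0)" using i(1) unfolding smooth_at_def by auto
      define B where "B = sum_list (nths js (- {i}))"
      have AB: "js ! i + B = S" using sum_list_nths_Compl[of js "{i}"] nths_nth_singleton[of i js] il ljs by (simp add: B_def S_def)
      have "?lhs \<le> (real (length gs) + 1) * R"
      proof (rule family_norm_smooth_blocks[OF supp c0 il pq(3) _ R], fold B_def)
        fix t assume t: "t \<le> length gs"
        have "min 1 (x powr d / H) * (\<Sum>h\<in>hs. norm (\<Sum>m\<in>{2 ^ (B + t)..<2 * 2 ^ (B + t)}. coef X (nths gs (- {i})) m *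
            (\<Sum>n\<in>{max 1 p..<min q (Suc X)}. expi (twisted_phase \<gamma> u \<alpha> h (m * n))))) \<le> D * x powr (1 - \<delta> - 2 * e)"
        proof (rule scale_linear)
          fix a :: "nat \<Rightarrow> complex" assume a: "\<forall>m. norm (a m) \<le> 1"
          have prod: "real (2 ^ (B + t)) * real (2 ^ (js ! i)) = 2 ^ (S + t)" by (simp add: AB[symmetric] power_add)
          show "min 1 (x powr d / H) * (\<Sum>h\<in>hs. norm (\<Sum>m\<in>{2 ^ (B + t)..<2 * 2 ^ (B + t)}. a m *
            (\<Sum>n\<in>{max 1 p..<min q (Suc X)}. expi (twisted_phase \<gamma> u \<alpha> h (m * n))))) \<le> x powr (1 - \<delta> - 2 * e)"
          proof (rule smooth[unfolded smooth_sum_def, rule_format, OF xx(1) adm a[rule_format], where N = "2 ^ (js ! i)"])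
            show "x powr ((1 - d - 2 * \<delta> - 9 * e) / 2) \<le> real (2 ^ (js ! i))"
            proof -
              have "(1 - d - 2 * \<delta> - 9 * e) / 2 \<le> E i" using i(2) e unfolding u'_def by argo
              then have "x powr ((1 - d - 2 * \<delta> - 9 * e) / 2) \<le> x powr E i" using xx by (intro powr_mono) auto
              then show ?thesis by (simp add: E_def pw)
            qed
          qed (use prod prod_bounds[of t] t len pq in \<open>auto simp: in_range_def\<close>)
        next
          fix m :: nat assume m: "m \<in> {2 ^ (B + t)..<2 * 2 ^ (B + t)}"
          show "norm (coef X (nths gs (- {i})) m) \<le> D"
          proof (rule coefD)
            show "0 < m" using m by (auto intro: less_le_trans[OF zero_less_power[of "2::nat"]])
            have "(2::nat) ^ (B + t + 1) \<le> 2 ^ (S + 7)" using AB t len by (intro power_increasing) auto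
            then show "m < 2 ^ (S + 7)" using m by (auto intro: less_le_trans)
          qed
        qed (use D in simp)
        also have "\<dots> \<le> R" unfolding R_def using D by (intro mult_right_mono) (auto simp: power2_eq_square)
        finally show "min 1 (x powr d / H) * (\<Sum>h\<in>hs. norm (\<Sum>m\<in>{2 ^ (B + t)..<2 * 2 ^ (B + t)}. coef X (nths gs (- {i})) m *
            (\<Sum>n\<in>{max 1 p..<min q (Suc X)}. expi (twisted_phase \<gamma> u \<alpha> h (m * n))))) \<le> R" .
      qed
      also have "\<dots> \<le> 49 * R" using len1 R by (intro mult_right_mono) auto
      finally show ?thesis .
    qed
    also have "49 * R \<le> y * R" using y R by (intro mult_right_mono) auto
    \<comment> \<open>The exponents e/100 from y, 26e/100 from D^2 and -2e add up to
      -173e/100.\<close>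
    also have "\<dots> = x powr (e / 100 + 2 * (13 / 100 * e) + (1 - \<delta> - 2 * e))" using xx by (simp add: R_def D_def y_def powr_add[symmetric] powr_power)
    also have "\<dots> \<le> x powr (1 - \<delta> - 17 / 10 * e)" using xx e by (intro powr_mono) auto
    finally show "?lhs \<le> x powr (1 - \<delta> - 17 / 10 * e)" .
  qed
  qed
qed

section \<open>Removing the restriction to the interval I\<close>

definition restricted_phase :: "real \<Rightarrow> real \<Rightarrow> real set \<Rightarrow> nat \<Rightarrow> nat \<Rightarrow> complex" where
  "restricted_phase u \<alpha> I h n = (if real n \<in> I then expi (twisted_phase \<gamma> u \<alpha> h n) else 0)"

text \<open>The condition n in I couples all variables. Expanding its indicator into characters expi
  (j n / Z) decouples them, and each character merely replaces \<alpha> by \<alpha> + j / Z; the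
  unrestricted bound is uniform in \<alpha>, so the loss is logarithmic.\<close>

lemma piece_bound:
  "\<exists>x0>1. \<forall>x\<ge>x0. \<forall>H u \<alpha> hs I X gs js. admissible x H u hs \<longrightarrow> dyadic_subinterval x I \<longrightarrow>
      length gs \<le> 6 \<longrightarrow> list_all2 supported_at js gs \<longrightarrow>
      (\<forall>i<length gs. smooth_at (js ! i) (gs ! i) \<or> 2 ^ (js ! i) \<le> x powr (1/3 + e)) \<longrightarrow>
      min 1 (x powr d / H) * family_norm X hs (restricted_phase u \<alpha> I) gs \<le> x powr (1 - \<delta> - 8 / 5 * e)"
proof -
  have e10: "0 < e / 10" using e by simp
  show ?thesis using unrestricted_piece_bound
      exists_powr_ge_log[OF zero_less_numeral[of "num.Bit0 (num.Bit0 num.One)"] e10, of 1]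
  proof (elim exE conjE, goal_cases)
    case (1 x1 x2)
    note main = 1(2) and xlog = 1(4)
    show ?case
    proof (intro exI[of _ "max x1 (max x2 256)"] conjI allI impI)
      show "1 < max x1 (max x2 256)" by simp
      fix x H u \<alpha> :: real and hs :: "nat set" and I :: "real set" and X and gs :: "(nat \<Rightarrow> complex) list" and js :: "nat list"
      assume x: "max x1 (max x2 256) \<le> x" and adm: "admissible x H u hs" and I: "dyadic_subinterval x I"
        and len: "length gs \<le> 6" and supp: "list_all2 supported_at js gs"
        and cls: "\<forall>i<length gs. smooth_at (js ! i) (gs ! i) \<or> 2 ^ (js ! i) \<le> x powr (1/3 + e)"
      have xx: "x1 \<le> x" "256 \<le> x" "1 < x" using x by auto
      define S where "S = sum_list js"
      have Isub: "x < t" "t \<le> 2 * x" if "t \<in> I" for t using I that by (auto simp: dyadic_subinterval_def)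
      have ljs: "length js = length gs" using supp by (rule list_all2_lengthD)
      define c where "c = min 1 (x powr d / H)"
      have c0: "0 \<le> c" using adm by (auto simp: admissible_def c_def)
      show "min 1 (x powr d / H) * family_norm X hs (restricted_phase u \<alpha> I) gs \<le> x powr (1 - \<delta> - 8 / 5 * e)"
      \<comment> \<open>All products lie in [2^S, 2^(S + 7)); unless this range meets (x, 2x] the
        restricted sum is empty.\<close>
      proof (cases "x \<le> 128 * 2 ^ S \<and> 2 ^ S \<le> 2 * x")
        case False
        have "lsum X gs (restricted_phase u \<alpha> I h) = 0" for h
        proof -
          have "restricted_phase u \<alpha> I h n = 0" if n: "n \<in> {2 ^ S..<2 ^ (S + length gs + 1)}" for n
          proof -
            have "real n < 2 ^ (S + length gs + 1)" "2 ^ S \<le> real n"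
              using n by (simp_all add: of_nat_less_numeral_power_cancel_iff numeral_power_le_of_nat_cancel_iff del: power_Suc)
            moreover have "(2::real) ^ (S + length gs + 1) \<le> 2 ^ (S + 7)" using len by (intro power_increasing) auto
            moreover have "(2::real) ^ (S + 7) = 128 * 2 ^ S" by (simp add: power_add)
            ultimately have "real n \<notin> I" using False Isub[of "real n"] by linarith
            then show ?thesis by (simp add: restricted_phase_def)
          qed
          then show ?thesis unfolding lsum_eq_coef[OF supp] ljs S_def by (intro sum.neutral) auto
        qed
        then show ?thesis by (simp add: family_norm_def)
      next
        case True
        \<comment> \<open>The modulus exceeds every product of at most six variables from the
          blocks, so representing the indicator of I below Z suffices.\<close>
        define Z :: nat where "Z = 2 ^ (S + 7)"
        have Zx: "real Z \<le> x\<^sup>2"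
        proof -
          have "real Z = 128 * 2 ^ S" by (simp add: Z_def power_add)
          also have "\<dots> \<le> 256 * x" using True by simp
          also have "\<dots> \<le> x * x" using xx by (intro mult_right_mono) auto
          finally show ?thesis by (simp add: power2_eq_square)
        qed
        have Z2: "2 \<le> Z" using power_increasing[of 1 "S + 7" "2::nat"] by (simp add: Z_def)
        define A where "A = {n. n < Z \<and> real n \<in> I}"
        obtain w :: "nat \<Rightarrow> complex" where w: "(\<Sum>j<Z. norm (w j)) \<le> 3 + 2 * ln (real Z)"
          "\<And>n. n < Z \<Longrightarrow> (if n \<in> A then 1 else 0) = (\<Sum>j<Z. w j * expi (real j / Z * n))"
        proof (rule interval_fourier[OF Z2, of A])
          show "A \<subseteq> {..<Z}" by (auto simp: A_def)
          show "b \<in> A" if "a \<in> A" "c \<in> A" "a \<le> b" "b \<le> c" for a b c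
            using that I mem_is_interval_1_I[of I "real a" "real c" "real b"] by (auto simp: A_def dyadic_subinterval_def)
        qed blast
        define \<Psi> where "\<Psi> j h n = expi (twisted_phase \<gamma> u (\<alpha> + real j / Z) h n)" for j h n
        define R where "R = x powr (1 - \<delta> - 17 / 10 * e)"
        have R: "c * family_norm X hs (\<Psi> j) gs \<le> R" for j unfolding c_def R_def \<Psi>_def using main[rule_format, OF xx(1) adm len supp] cls True S_def by blast
        have "lsum X gs (restricted_phase u \<alpha> I h) = (\<Sum>j<Z. w j * lsum X gs (\<Psi> j h))" for h
        proof -
          have "lsum X gs (restricted_phase u \<alpha> I h) = lsum X gs (\<lambda>n. \<Sum>j<Z. w j * \<Psi> j h n)"
          proof (rule lsum_cong_supported[OF supp])
            fix n :: nat assume n: "2 ^ sum_list js \<le> n" "n < 2 ^ (sum_list js + length js) \<or> js = [] \<and> n = 1"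
            have "(2::nat) ^ (sum_list js + length js) \<le> Z" unfolding Z_def S_def ljs using len by (intro power_increasing) auto
            then have nZ: "n < Z" using n(2) Z2 by auto
            have "(\<Sum>j<Z. w j * \<Psi> j h n) = (\<Sum>j<Z. w j * expi (real j / Z * n)) * expi (twisted_phase \<gamma> u \<alpha> h n)"
              unfolding \<Psi>_def twisted_phase_def sum_distrib_right mult.assoc expi_add[symmetric] by (intro sum.cong refl) (simp add: algebra_simps)
            also have "\<dots> = restricted_phase u \<alpha> I h n" unfolding w(2)[OF nZ, symmetric] using nZ by (simp add: restricted_phase_def A_def)
            finally show "restricted_phase u \<alpha> I h n = (\<Sum>j<Z. w j * \<Psi> j h n)" ..
          qed
          then show ?thesis by (simp only: lsum_linear[OF finite_lessThan])
        qed
        then have "c * family_norm X hs (restricted_phase u \<alpha> I) gs \<le> c * (\<Sum>h\<in>hs. \<Sum>j<Z. norm (w j) * norm (lsum X gs (\<Psi> j h)))"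
          unfolding family_norm_def using c0 by (intro mult_left_mono sum_mono) (auto intro!: sum_norm_le simp: norm_mult)
        also have "\<dots> = (\<Sum>j<Z. norm (w j) * (c * family_norm X hs (\<Psi> j) gs))" by (subst sum.swap) (simp add: family_norm_def sum_distrib_left mult_ac)
        also have "\<dots> \<le> (\<Sum>j<Z. norm (w j) * R)" by (intro sum_mono mult_left_mono R) simp
        also have "\<dots> = (\<Sum>j<Z. norm (w j)) * R" by (simp add: sum_distrib_right)
        also have "\<dots> \<le> x powr (e / 10) * R"
        proof (rule mult_right_mono)
          have "ln (real Z) \<le> ln (x\<^sup>2)" using Zx Z2 by (intro ln_mono) auto
          also have "\<dots> = 2 * ln x" using xx by (simp add: ln_realpow)
          finally have "(\<Sum>j<Z. norm (w j)) \<le> 11 + 4 * ln x" using w(1) by linarith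
          also have "\<dots> \<le> (11 + 4 * ln x) * (11 + 4 * ln x)" using xx mult_right_mono[of 1 "11 + 4 * ln x" "11 + 4 * ln x"] by simp
          also have "\<dots> \<le> x powr (e / 10)" using xlog[rule_format, of x] x by (simp add: power2_eq_square)
          finally show "(\<Sum>j<Z. norm (w j)) \<le> x powr (e / 10)" .
        qed (simp add: R_def)
        also have "\<dots> = x powr (e / 10 + (1 - \<delta> - 17 / 10 * e))" by (simp only: R_def powr_add)
        also have "e / 10 + (1 - \<delta> - 17 / 10 * e) = 1 - \<delta> - 8 / 5 * e" by simp
        finally show ?thesis unfolding c_def .
      qed
    qed
  qed
qed

section \<open>Assembling the pieces of Heath-Brown's identity\<close>

lemma supported_at_dyadic_block:
  assumes "\<And>n. norm (c n) \<le> 1"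
  shows "supported_at j (dyadic_block c j)" using assms by (auto simp: supported_at_def dyadic_block_def)

lemma smooth_at_dyadic_block: "smooth_at j (dyadic_block (\<lambda>n. if i \<le> n then 1 else 0) j)"
proof -
  have "dyadic_block (\<lambda>n. if i \<le> n then 1 else 0) j = (\<lambda>n. if n \<in> {max (2 ^ j) i..<2 ^ Suc j} then 1 else 0)" by (rule ext) (simp add: dyadic_block_def)
  then show ?thesis unfolding smooth_at_def by (metis max.cobounded1 order_refl)
qed

text \<open>A block starting above \<open>z\<close> contains only zeros of the truncated Moebius
  function and counts as smooth with an empty interval.\<close>

lemma smooth_or_short_moebius_block:
  "smooth_at j (dyadic_block (moebius_upto z) j) \<or> 2 ^ j \<le> z"
proof (cases "2 ^ j \<le> z")
  case False
  then have "dyadic_block (moebius_upto z) j = (\<lambda>n. if n \<in> {2 ^ j..<2 ^ j} then 1 else 0)" by (auto simp: dyadic_block_def moebius_upto_def)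
  then show ?thesis unfolding smooth_at_def by (intro disjI1 exI[of _ "2 ^ j"]) auto
qed simp

text \<open>Summing the increments ln i - ln (i - 1) over i \<le> n replaces the logarithm by
  indicators with nonnegative weights of total ln X, and such indicators are smooth on dyadic
  blocks. The sum may start at i = 1 because ln 0 = 0 by convention.\<close>

lemma family_norm_log_le:
  assumes "\<And>i. i \<in> {1..X} \<Longrightarrow> family_norm X hs \<Phi> ((\<lambda>n. if i \<le> n then 1 else 0) # cs) \<le> B" and X: "1 \<le> X"
  shows "family_norm X hs \<Phi> ((\<lambda>n. of_real (ln (real n))) # cs) \<le> ln (real X) * B"
proof -
  define w where "w i = ln (real i) - ln (real (i - 1))" for i
  have tele: "(\<Sum>i\<in>{1..n}. w i) = ln (real n)" for n using sum_telescope''[of 0 n "\<lambda>i. ln (real i)"] by (simp add: w_def)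
  have w0: "0 \<le> w i" if "1 \<le> i" for i using that by (cases "i = 1") (auto simp: w_def)
  have "family_norm X hs \<Phi> ([] @ (\<lambda>n. of_real (ln (real n))) # cs) \<le> (\<Sum>i\<in>{1..X}. norm (of_real (w i) :: complex)) * B"
  proof (rule family_norm_slot[where d = "\<lambda>i n. if i \<le> n then 1 else 0"])
    show "of_real (ln (real n)) = (\<Sum>i\<in>{1..X}. of_real (w i) * (if i \<le> n then 1 else 0 :: complex))" if "n \<in> {1..X}" for n
    proof -
      have "(\<Sum>i\<in>{1..X}. of_real (w i) * (if i \<le> n then 1 else 0 :: complex)) = (\<Sum>i\<in>{1..n}. of_real (w i))"
        using that by (intro sum.mono_neutral_cong_right) auto
      then show ?thesis by (simp only: of_real_sum[symmetric] tele)
    qed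
  qed (use assms in auto)
  also have "(\<Sum>i\<in>{1..X}. norm (of_real (w i) :: complex)) = (\<Sum>i\<in>{1..X}. w i)" using w0 by (intro sum.cong) auto
  finally show ?thesis by (simp only: tele append_Nil)
qed

lemma main_bound:
  "\<exists>x0>1. \<forall>x\<ge>x0. \<forall>H u \<alpha> hs I. admissible x H u hs \<longrightarrow> dyadic_subinterval x I \<longrightarrow>
      min 1 (x powr d / H) * (\<Sum>h\<in>hs. norm (\<Sum>n | real n \<in> I. mangoldt n * expi (twisted_phase \<gamma> u \<alpha> h n))) \<le> x powr (1 - \<delta> - e)"
proof -
  have e16: "0 < e / 16" using e by simp
  show ?thesis using piece_bound
      exists_powr_ge_log[OF zero_less_numeral[of "num.Bit0 num.One"] e16, of 1] exists_powr_ge[OF e, of 4]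
  proof (elim exE conjE, goal_cases)
    case (1 x1 x2 x3)
    note main = 1(2) and xlog = 1(4) and x4 = 1(6)
    show ?case
    proof (intro exI[of _ "max x1 (max x2 x3)"] conjI allI impI)
      show "1 < max x1 (max x2 x3)" using 1(1) by simp
      fix x H u \<alpha> :: real and hs :: "nat set" and I :: "real set"
      assume x: "max x1 (max x2 x3) \<le> x" and adm: "admissible x H u hs" and I: "dyadic_subinterval x I"
      have xx: "x1 \<le> x" "1 < x" "4 \<le> x powr e" using x x4[rule_format, of x] 1(1) by auto
      have Isub: "x < t" "t \<le> 2 * x" if "t \<in> I" for t using I that by (auto simp: dyadic_subinterval_def)
      define c where "c = min 1 (x powr d / H)"
      let ?S = "\<lambda>h. \<Sum>n | real n \<in> I. mangoldt n * expi (twisted_phase \<gamma> u \<alpha> h n)"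
      have c0: "0 < c" using adm xx by (auto simp: admissible_def c_def)
      define X where "X = nat \<lfloor>2 * x\<rfloor>"
      have X: "1 \<le> X" "real X \<le> 2 * x" using xx by (auto simp: X_def le_nat_floor)
      \<comment> \<open>The truncation is as short as X < (z + 1)^3 permits, up to a constant, so
        that Moebius variables stay below x^(1/3 + e).\<close>
      define z where "z = nat \<lceil>(2 * x) powr (1/3)\<rceil>"
      define \<Phi> where "\<Phi> = restricted_phase u \<alpha> I"
      have one: "1 \<le> (2 * x) powr (1/3)" using xx by (intro ge_one_powr_ge_zero) auto
      then have z: "(2 * x) powr (1/3) \<le> real z" "real z \<le> 2 * (2 * x) powr (1/3)" "0 < z" unfolding z_def by linarith+
      have zx: "real z \<le> x powr (1/3 + e)"
      proof -
        have "2 powr (1/3) \<le> (2::real)" using powr_mono[of "1/3" 1 "2::real"] by simp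
        then have "(2 * x) powr (1/3) \<le> 2 * x powr (1/3)" using xx by (simp add: powr_mult mult_right_mono)
        then have "real z \<le> 4 * x powr (1/3)" using z(2) by linarith
        also have "\<dots> \<le> x powr e * x powr (1/3)" using xx by (intro mult_right_mono) auto
        finally show ?thesis by (simp add: powr_add mult.commute)
      qed
      have Xz: "X < (z + 1) ^ 3"
      proof -
        have "real X \<le> ((2 * x) powr (1/3)) ^ 3" using X xx by (simp add: powr_power)
        also have "\<dots> < (real z + 1) ^ 3" using z one by (intro power_strict_mono) auto
        also have "\<dots> = real ((z + 1) ^ 3)" by (simp add: add.commute)
        finally show ?thesis by (simp only: of_nat_less_iff)
      qed
      obtain Lc where Lc: "2 ^ Lc \<le> X" "X < 2 ^ Suc Lc" using X(1) ex_power_ivl1[of 2 X] by auto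
      \<comment> \<open>One quantity dominates ln X, the number Lc + 1 of dyadic blocks per variable
        and the constant 7, so all logarithmic losses become powers of g.\<close>
      define g where "g = 11 + 2 * ln x"
      have lnX: "ln (real X) \<le> 1 + ln x"
      proof -
        have "ln (real X) \<le> ln (2 * x)" using X by (intro ln_mono) auto
        also have "\<dots> = ln 2 + ln x" using xx by (simp add: ln_mult)
        also have "ln 2 \<le> (1::real)" using ln_le_minus_one[of "2::real"] by simp
        finally show ?thesis by simp
      qed
      have lx: "0 \<le> ln x" using xx by simp
      have gX: "ln (real X) \<le> g" "7 \<le> g" using lnX lx by (auto simp: g_def)
      have Lg: "real Lc + 1 \<le> g"
      proof -
        have "ln (2 ^ Lc) \<le> ln (real X)" using Lc X by (intro ln_mono) (auto simp: numeral_power_le_of_nat_cancel_iff)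
        then have "real Lc * ln 2 \<le> 1 + ln x" using lnX by (simp add: ln_realpow)
        moreover have "1/2 \<le> ln (2::real)" using ln_le_minus_one[of "1/2::real"] by (simp add: ln_div)
        then have "real Lc * (1/2) \<le> real Lc * ln 2" by (intro mult_left_mono) auto
        ultimately show ?thesis by (simp add: g_def)
      qed
      define R where "R = x powr (1 - \<delta> - 8 / 5 * e)"
      have R0: "0 \<le> R / c" using c0 by (simp add: R_def)
      \<comment> \<open>One power of g pays for replacing the logarithm by indicators, at most six
        for the dyadic decomposition of the variables.\<close>
      have FN: "family_norm X hs \<Phi> ((\<lambda>n. of_real (ln (real n))) # cs) \<le> g ^ 7 * (R / c)"
        if cs: "length cs \<le> 5" "set cs \<subseteq> {moebius_upto z, \<lambda>_. 1}" for cs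
      proof -
        have "family_norm X hs \<Phi> ((\<lambda>n. of_real (ln (real n))) # cs) \<le> ln (real X) * (g ^ 6 * (R / c))"
        proof (rule family_norm_log_le[OF _ X(1)])
          fix i
          define ds where "ds = (\<lambda>n. if i \<le> n then 1 else 0 :: complex) # cs"
          have dsc: "c' = moebius_upto z \<or> (\<exists>i. c' = (\<lambda>n. if i \<le> n then 1 else 0))" if c': "c' \<in> set ds" for c'
          proof -
            have "(\<lambda>_::nat. 1 :: complex) = (\<lambda>n. if 0 \<le> n then 1 else 0)" by simp
            moreover have "c' = (\<lambda>n. if i \<le> n then 1 else 0) \<or> c' = moebius_upto z \<or> c' = (\<lambda>_. 1)" using c' cs(2) unfolding ds_def by auto
            ultimately show ?thesis by blast
          qed
          have "family_norm X hs \<Phi> ([] @ ds) \<le> (real Lc + 1) ^ length ds * (R / c)"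
          proof (rule family_norm_dyadic[OF Lc(2)])
            fix js :: "nat list" assume js: "length js = length ds"
            define gs where "gs = map2 dyadic_block ds js"
            have gs: "length gs = length ds" "\<And>j. j < length ds \<Longrightarrow> gs ! j = dyadic_block (ds ! j) (js ! j)" using js by (simp_all add: gs_def)
            have "c * family_norm X hs \<Phi> gs \<le> R" unfolding c_def \<Phi>_def R_def
            proof (rule main[rule_format, OF xx(1) adm I])
              show "length gs \<le> 6" using cs by (simp add: gs ds_def)
              show "list_all2 supported_at js gs" unfolding list_all2_conv_all_nth
              proof (intro conjI allI impI)
                fix j assume "j < length js"
                then have j: "j < length ds" by (simp add: js)
                have "norm ((ds ! j) n) \<le> 1" for n using dsc[OF nth_mem[OF j]] norm_moebius_le by (auto simp: moebius_upto_def)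
                then show "supported_at (js ! j) (gs ! j)" unfolding gs(2)[OF j] by (rule supported_at_dyadic_block)
              qed (simp add: gs js)
              fix j assume "j < length gs"
              then have j: "j < length ds" by (simp add: gs)
              show "smooth_at (js ! j) (gs ! j) \<or> 2 ^ (js ! j) \<le> x powr (1/3 + e)" using dsc[OF nth_mem[OF j]]
              proof (elim disjE exE)
                assume m: "ds ! j = moebius_upto z"
                have "2 ^ (js ! j) \<le> z \<Longrightarrow> 2 ^ (js ! j) \<le> x powr (1/3 + e)" using zx by (metis of_nat_le_iff of_nat_numeral of_nat_power order_trans)
                then show ?thesis unfolding gs(2)[OF j] m using smooth_or_short_moebius_block by blast
              next
                fix i' assume m: "ds ! j = (\<lambda>n. if i' \<le> n then 1 else 0)"
                show ?thesis unfolding gs(2)[OF j] m using smooth_at_dyadic_block by blast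
              qed
            qed
            then show "family_norm X hs \<Phi> ([] @ map2 dyadic_block ds js) \<le> R / c" using c0 by (simp add: gs_def le_divide_eq mult.commute)
          qed
          also have "\<dots> \<le> (real Lc + 1) ^ 6 * (R / c)" using cs R0 by (intro mult_right_mono power_increasing) (auto simp: ds_def)
          also have "\<dots> \<le> g ^ 6 * (R / c)" using Lg R0 by (intro mult_right_mono power_mono) auto
          finally show "family_norm X hs \<Phi> ((\<lambda>n. if i \<le> n then 1 else 0) # cs) \<le> g ^ 6 * (R / c)" by (simp add: ds_def)
        qed
        also have "\<dots> \<le> g * (g ^ 6 * (R / c))" using gX R0 by (intro mult_right_mono mult_nonneg_nonneg) auto
        also have "\<dots> = g ^ 7 * (R / c)" by (simp add: power_Suc[symmetric] mult.assoc[symmetric] del: times_divide_eq_right)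
        finally show ?thesis .
      qed
      let ?L = "\<lambda>n. complex_of_real (ln (real n))" and ?o = "moebius_upto z" and ?i = "\<lambda>_::nat. 1 :: complex"
      have "(?S h)
         = 3 * lsum X [?L, ?o] (\<Phi> h) - 3 * lsum X [?L, ?o, ?i, ?o] (\<Phi> h) + lsum X [?L, ?o, ?i, ?o, ?i, ?o] (\<Phi> h)" for h
      proof -
        have IX: "n \<in> {1..X}" if "real n \<in> I" for n using Isub[OF that] xx by (auto simp: X_def le_nat_floor)
        have "(?S h) = (\<Sum>n\<in>{1..X}. mangoldt n * \<Phi> h n)" using IX by (intro sum.mono_neutral_cong_left) (auto simp: \<Phi>_def restricted_phase_def)
        also have "\<dots> = 3 * lsum X [?L, ?o] (\<Phi> h) - 3 * lsum X [?L, ?o, ?i, ?o] (\<Phi> h) + lsum X [?L, ?o, ?i, ?o, ?i, ?o] (\<Phi> h)"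
        proof (rule heath_brown[OF _ z(3) Xz])
          show "\<Phi> h n = 0" if "X < n" for n using IX[of n] that by (auto simp: \<Phi>_def restricted_phase_def)
        qed
        finally show ?thesis .
      qed
      then have "(\<Sum>h\<in>hs. norm (?S h))
        \<le> (\<Sum>h\<in>hs. 3 * norm (lsum X [?L, ?o] (\<Phi> h)) + 3 * norm (lsum X [?L, ?o, ?i, ?o] (\<Phi> h)) + norm (lsum X [?L, ?o, ?i, ?o, ?i, ?o] (\<Phi> h)))"
        by (auto intro!: sum_mono norm_triangle_le norm_triangle_le_diff simp: norm_mult)
      also have "\<dots> = 3 * family_norm X hs \<Phi> [?L, ?o] + 3 * family_norm X hs \<Phi> [?L, ?o, ?i, ?o] + family_norm X hs \<Phi> [?L, ?o, ?i, ?o, ?i, ?o]"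
        by (simp add: family_norm_def sum.distrib sum_distrib_left)
      also have "\<dots> \<le> 3 * (g ^ 7 * (R / c)) + 3 * (g ^ 7 * (R / c)) + g ^ 7 * (R / c)" by (intro add_mono mult_left_mono FN) auto
      also have "\<dots> = 7 * (g ^ 7 * (R / c))" by simp
      also have "\<dots> \<le> g * (g ^ 7 * (R / c))" using gX R0 by (intro mult_right_mono mult_nonneg_nonneg) auto
      also have "\<dots> = g ^ 8 * R / c" by (simp add: power_Suc[symmetric] mult.assoc[symmetric])
      finally have "c * (\<Sum>h\<in>hs. norm (?S h)) \<le> g ^ 8 * R" using c0 by (simp add: field_simps)
      \<comment> \<open>The eight powers of g cost x^(e/2), which the difference between 8e/5 and e
        covers.\<close>
      also have "\<dots> \<le> (x powr (e / 16)) ^ 8 * R"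
      proof (intro mult_right_mono power_mono)
        have "g \<le> g * g" using gX mult_right_mono[of 1 g g] by simp
        also have "\<dots> \<le> x powr (e / 16)" using xlog[rule_format, of x] x by (simp add: power2_eq_square g_def)
        finally show "g \<le> x powr (e / 16)" .
      qed (use gX R_def in auto)
      also have "\<dots> = x powr (e / 2 + (1 - \<delta> - 8 / 5 * e))" using xx by (simp add: R_def powr_add[symmetric] powr_power)
      also have "\<dots> \<le> x powr (1 - \<delta> - e)" using xx e by (intro powr_mono) auto
      finally show "min 1 (x powr d / H) * (\<Sum>h\<in>hs. norm (?S h)) \<le> x powr (1 - \<delta> - e)" unfolding c_def .
    qed
  qed
qed

end

theorem theorem8p1:
  fixes k l \<gamma> \<delta> :: real
  assumes "exponent_pair k l"
    and "4 * k - 2 * l + 1 > 0"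
    and "0 < \<gamma>" and "\<gamma> < 1"
    and "0 \<le> \<delta>" and "\<delta> \<le> 1 - \<gamma>"
    and "(12 * k - 2 * l + 13) / (- 2 * l + 3) * (1 - \<gamma>)
           + (20 * k - 4 * l + 16) / (- 2 * l + 3) * \<delta> < 1"
    and "15 / 2 * (1 - \<gamma>) + 9 * \<delta> < 1"
  shows "\<exists>\<epsilon>\<^sub>0>0. \<forall>\<epsilon>::real. 0 < \<epsilon> \<and> \<epsilon> < \<epsilon>\<^sub>0 \<longrightarrow>
    (\<exists>C x\<^sub>0::real. \<forall>x\<ge>x\<^sub>0. \<forall>H u \<alpha> :: real. \<forall>I J :: real set.
       1 \<le> H \<and> H \<le> x powr (1 - \<gamma> + \<delta> + \<epsilon>) \<and> 0 \<le> u \<and> u \<le> 1 \<and>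
       dyadic_subinterval H J \<and> dyadic_subinterval x I \<longrightarrow>
       min 1 (x powr (1 - \<gamma>) / H) *
         (\<Sum>h::nat | real h \<in> J.
            norm (\<Sum>n::nat | real n \<in> I.
              mangoldt n * expi (\<alpha> * real n + real h * (real n + u) powr \<gamma>)))
       \<le> C * x powr (1 - \<delta> - \<epsilon>))"
proof -
  \<comment> \<open>The slacks of the two strict hypotheses, the first one cleared of the
    denominator 3 - 2l, which is positive since l \<le> 1. A hundredth of the smaller slack is an
    admissible bound for \<epsilon>, because the locale asks for a margin of 100 \<epsilon>.\<close>
  define \<kappa>1 where "\<kappa>1 = 3 - 2 * l - ((12 * k - 2 * l + 13) * (1 - \<gamma>) + (20 * k - 4 * l + 16) * \<delta>)"
  define \<kappa>2 where "\<kappa>2 = 1 - (15 / 2 * (1 - \<gamma>) + 9 * \<delta>)"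
  have l: "l \<le> 1" using assms(1) by (simp add: exponent_pair_def)
  then have "0 < - 2 * l + 3" by simp
  then have "(12 * k - 2 * l + 13) * (1 - \<gamma>) + (20 * k - 4 * l + 16) * \<delta> < - 2 * l + 3"
    using assms(7) by (simp add: divide_less_eq add_divide_distrib[symmetric] del: distrib_left_numeral)
  then have \<kappa>: "0 < \<kappa>1" "0 < \<kappa>2" using assms(8) by (auto simp: \<kappa>1_def \<kappa>2_def)
  show ?thesis
  proof (rule exI[of _ "min \<kappa>1 \<kappa>2 / 100"], intro conjI allI impI, goal_cases)
    case 1
    show ?case using \<kappa> by simp
  next
    case (2 \<epsilon>)
    then have \<epsilon>: "0 < \<epsilon>" "100 * \<epsilon> \<le> \<kappa>1" "100 * \<epsilon> \<le> \<kappa>2" by auto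
    interpret twisted_sums k l \<gamma> \<delta> \<epsilon> "1 - \<gamma>" using assms \<epsilon> by unfold_locales (auto simp: \<kappa>1_def \<kappa>2_def)
    obtain x0 where x0: "\<forall>x\<ge>x0. \<forall>H u \<alpha> hs I. admissible x H u hs \<longrightarrow> dyadic_subinterval x I \<longrightarrow>
        min 1 (x powr (1 - \<gamma>) / H) * (\<Sum>h\<in>hs. norm (\<Sum>n | real n \<in> I. mangoldt n * expi (twisted_phase \<gamma> u \<alpha> h n))) \<le> x powr (1 - \<delta> - \<epsilon>)"
      using main_bound by blast
    show ?case
    proof (rule exI[of _ 1], rule exI[of _ x0], intro allI impI, elim conjE, goal_cases)
      case (1 x H u \<alpha> I J)
      note x = 1(1) and H = 1(2,3) and u = 1(4,5) and J = 1(6) and I = 1(7)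
      define hs where "hs = {h :: nat. real h \<in> J}"
      have hs: "H < real h \<and> real h \<le> 2 * H" if "h \<in> hs" for h using J that by (auto simp: hs_def dyadic_subinterval_def)
      have "hs \<subseteq> {..nat \<lfloor>2 * H\<rfloor>}" using hs by (auto intro: le_nat_floor)
      then have "finite hs" by (rule finite_subset) simp
      then have "admissible x H u hs" using H u hs by (auto simp: admissible_def less_imp_le)
      from x0[rule_format, OF x this I, of \<alpha>] show ?case by (simp add: hs_def twisted_phase_def)
    qed
  qed
qed

end
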